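(* Let $d\in\{2,3\}$, $T>0$, and let $\Omega$ be either $\mathbb T^d$ or a bounded domain in $\mathbb R^d$ with $C^2$ boundary. Let $(\varrho,\mathbf u,P)$ be a weak solution of (icNS) with initial data $(\varrho_0,\varrho_0\mathbf u_0)$ (and, if $\Omega$ is a bounded domain, with $\mathbf u\in L^2(0,T;H^1_0(\Omega))$, i.e. homogeneous Dirichlet boundary condition). Assume there are constants $0<c_1\le c_2<\infty$ with $c_1\le\varrho\le c_2$ a.e., $\mathbf u\in L^\infty(0,T;L^2(\Omega))\cap L^2(0,T;H^1(\Omega))$ and $P\in L^2(\Omega\times(0,T))$; if $d=3$ assume moreover $\mathbf u\in L^4(\Omega\times(0,T))$. Then for every $t\in(0,T)$, $$\frac12\int_\Omega\varrho(x,t)|\mathbf u(x,t)|^2\,dx+\int_0^t\!\!\int_\Omega\nu(\varrho)|\mathbb D\mathbf u|^2\,dx\,ds=\frac12\int_\Omega\varrho_0|\mathbf u_0|^2\,dx.$$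
   Context: Standing assumption: $\nu:(0,\infty)\to[0,\infty)$ is continuous. $\mathbb D\mathbf u=\frac12(\nabla\mathbf u+\nabla^\top\mathbf u)$; $A:B=\sum_{i,j}A_{ij}B_{ij}$, $(\nabla\psi)_{ij}=\partial_j\psi_i$. The system (icNS) is $\partial_t\varrho+\nabla\cdot(\varrho\mathbf u)=0$, $\partial_t(\varrho\mathbf u)+\nabla\cdot(\varrho\mathbf u\otimes\mathbf u)+\nabla P-\nabla\cdot(\nu(\varrho)\mathbb D\mathbf u)=0$, $\nabla\cdot\mathbf u=0$ in $\Omega\times(0,T)$. A weak solution with initial data $(\varrho_0,\varrho_0\mathbf u_0)$ is a triple of measurable functions $(\varrho,\mathbf u,P)$ on $\Omega\times(0,T)$ with $\varrho,\varrho\mathbf u,\varrho\mathbf u\otimes\mathbf u,P,\nu(\varrho)\mathbb D\mathbf u\in L^1_{loc}$ such that: $\int_0^T\!\int_\Omega(\varrho\partial_t\varphi+\varrho\mathbf u\cdot\nabla\varphi)=0$ for all $\varphi\in C_c^\infty(\Omega\times(0,T))$; $\int_0^T\!\int_\Omega(\varrho\mathbf u\cdot\partial_t\psi+\varrho\mathbf u\otimes\mathbf u:\nabla\psi+P\,\nabla\cdot\psi-\nu(\varrho)\mathbb D\mathbf u:\nabla\psi)=0$ for all $\psi\in C_c^\infty(\Omega\times(0,T))^d$; $\nabla\cdot\mathbf u=0$ a.e.; $\int_\Omega\varrho(x,t)\varphi(x)dx\to\int_\Omega\varrho_0\varphi$ and $\int_\Omega(\varrho\mathbf u)(x,t)\cdot\psi(x)dx\to\int_\Omega\varrho_0\mathbf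 u_0\cdot\psi$ as $t\to0$ for all $\varphi\in C_c^\infty(\Omega)$, $\psi\in C_c^\infty(\Omega)^d$.
   Formalization: The energy equality is stated for almost every t in (0,T) rather than every t: the hypotheses fix u only up to null sets in space-time, so changing u on a single time slice keeps every hypothesis but breaks the identity at that time. *)

theory Defs
  imports "HOL-Analysis.Analysis"
begin

definition dderiv :: "'a::euclidean_space \<Rightarrow> ('a \<Rightarrow> real) \<Rightarrow> 'a \<Rightarrow> real" where
  "dderiv e f x = frechet_derivative f (at x) e"

coinductive smooth_fun :: "('a::euclidean_space \<Rightarrow> real) \<Rightarrow> bool" where
  "\<lbrakk>\<forall>x. f differentiable (at x); \<forall>e\<in>Basis. smooth_fun (dderiv e f)\<rbrakk> \<Longrightarrow> smooth_fun f"

definition smooth_vfield :: "('a::euclidean_space \<Rightarrow> real^'n::finite) \<Rightarrow> bool" where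
  "smooth_vfield \<psi> \<longleftrightarrow> (\<forall>i. smooth_fun (\<lambda>z. \<psi> z $ i))"

definition supp_closure :: "('a::real_normed_vector \<Rightarrow> 'b::zero) \<Rightarrow> 'a set" where
  "supp_closure f = closure {x. f x \<noteq> 0}"

definition C2_fun :: "(real^'n::finite \<Rightarrow> real) \<Rightarrow> bool" where
  "C2_fun \<gamma> \<longleftrightarrow> (\<exists>g H. (\<forall>x. (\<gamma> has_derivative (\<lambda>h. g x \<bullet> h)) (at x)) \<and>
                        (\<forall>x. (g has_derivative (\<lambda>h. H x *v h)) (at x)) \<and>
                        continuous_on UNIV H)"

text \<open>Bounded domain (open, connected, bounded, nonempty) with C^2 boundary: near every
  boundary point, after an orthogonal change of coordinates, the domain is the subgraph
  of a C^2 function of the remaining d-1 coordinates.\<close>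
definition bounded_C2_domain :: "(real^'n::finite) set \<Rightarrow> bool" where
  "bounded_C2_domain \<Omega> \<longleftrightarrow> open \<Omega> \<and> connected \<Omega> \<and> bounded \<Omega> \<and> \<Omega> \<noteq> {} \<and>
     (\<forall>p\<in>frontier \<Omega>. \<exists>r>0. \<exists>Q k \<gamma>. orthogonal_matrix (Q::real^'n::finite^'n) \<and> C2_fun \<gamma> \<and>
        (\<forall>y y'. (\<forall>i. i \<noteq> k \<longrightarrow> y $ i = y' $ i) \<longrightarrow> \<gamma> y = \<gamma> y') \<and>
        (\<forall>x\<in>ball p r. x \<in> \<Omega> \<longleftrightarrow> (Q *v x) $ k < \<gamma> (Q *v x)))"

definition dx :: "'n::finite \<Rightarrow> ((real^'n::finite) \<times> real \<Rightarrow> real) \<Rightarrow> (real^'n) \<times> real \<Rightarrow> real" where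
  "dx j f = dderiv (axis j 1, 0) f"

definition dt :: "((real^'n::finite) \<times> real \<Rightarrow> real) \<Rightarrow> (real^'n) \<times> real \<Rightarrow> real" where
  "dt f = dderiv (0, 1) f"

definition grad_x :: "((real^'n::finite) \<times> real \<Rightarrow> real) \<Rightarrow> (real^'n) \<times> real \<Rightarrow> real^'n" where
  "grad_x f z = (\<chi> j. dx j f z)"

definition jac_x :: "((real^'n::finite) \<times> real \<Rightarrow> real^'n) \<Rightarrow> (real^'n) \<times> real \<Rightarrow> real^'n^'n" where
  "jac_x \<psi> z = (\<chi> i j. dx j (\<lambda>w. \<psi> w $ i) z)"

definition div_x :: "((real^'n::finite) \<times> real \<Rightarrow> real^'n) \<Rightarrow> (real^'n) \<times> real \<Rightarrow> real" where
  "div_x \<psi> z = (\<Sum>j\<in>UNIV. dx j (\<lambda>w. \<psi> w $ j) z)"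

definition dt_v :: "((real^'n::finite) \<times> real \<Rightarrow> real^'n) \<Rightarrow> (real^'n) \<times> real \<Rightarrow> real^'n" where
  "dt_v \<psi> z = (\<chi> i. dt (\<lambda>w. \<psi> w $ i) z)"

definition jac :: "(real^'n::finite \<Rightarrow> real^'n) \<Rightarrow> real^'n \<Rightarrow> real^'n^'n" where
  "jac v x = (\<chi> i j. dderiv (axis j 1) (\<lambda>y. v y $ i) x)"

definition frob :: "real^'n::finite^'n \<Rightarrow> real^'n^'n \<Rightarrow> real" (infixl ":::" 70) where
  "A ::: B = (\<Sum>i\<in>UNIV. \<Sum>j\<in>UNIV. A $ i $ j * B $ i $ j)"

definition otimes :: "real^'n::finite \<Rightarrow> real^'n \<Rightarrow> real^'n^'n" where
  "otimes a b = (\<chi> i j. a $ i * b $ j)"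

definition symgrad :: "real^'n::finite^'n \<Rightarrow> real^'n^'n" where
  "symgrad G = (1/2) *\<^sub>R (G + transpose G)"

datatype ('n::finite) setting = Torus | Domain "(real^'n::finite) set"

text \<open>The torus is modelled by Z^d-periodic functions on R^d; integrals over the torus
  are integrals over the unit cell.\<close>
definition periodic_x :: "(real^'n::finite \<Rightarrow> 'b) \<Rightarrow> bool" where
  "periodic_x f \<longleftrightarrow> (\<forall>x k. (\<forall>i. k $ i \<in> \<int>) \<longrightarrow> f (x + k) = f x)"

definition periodic_xt :: "((real^'n::finite) \<times> real \<Rightarrow> 'b) \<Rightarrow> bool" where
  "periodic_xt f \<longleftrightarrow> (\<forall>t. periodic_x (\<lambda>x. f (x, t)))"

fun region :: "'n setting \<Rightarrow> (real^'n::finite) set" where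
  "region Torus = cbox 0 One"
| "region (Domain \<Omega>) = \<Omega>"

fun test_ST :: "'n setting \<Rightarrow> real \<Rightarrow> ((real^'n::finite) \<times> real \<Rightarrow> real) \<Rightarrow> bool" where
  "test_ST Torus T \<phi> \<longleftrightarrow> smooth_fun \<phi> \<and> periodic_xt \<phi> \<and>
       (\<exists>a b. 0 < a \<and> b < T \<and> (\<forall>x t. t \<notin> {a..b} \<longrightarrow> \<phi> (x, t) = 0))"
| "test_ST (Domain \<Omega>) T \<phi> \<longleftrightarrow> smooth_fun \<phi> \<and> compact (supp_closure \<phi>) \<and>
       supp_closure \<phi> \<subseteq> \<Omega> \<times> {0<..<T}"

definition testv_ST :: "'n setting \<Rightarrow> real \<Rightarrow> ((real^'n::finite) \<times> real \<Rightarrow> real^'n) \<Rightarrow> bool" where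
  "testv_ST st T \<psi> \<longleftrightarrow> (\<forall>i. test_ST st T (\<lambda>z. \<psi> z $ i))"

fun test_S :: "'n setting \<Rightarrow> (real^'n::finite \<Rightarrow> real) \<Rightarrow> bool" where
  "test_S Torus \<phi> \<longleftrightarrow> smooth_fun \<phi> \<and> periodic_x \<phi>"
| "test_S (Domain \<Omega>) \<phi> \<longleftrightarrow> smooth_fun \<phi> \<and> compact (supp_closure \<phi>) \<and> supp_closure \<phi> \<subseteq> \<Omega>"

definition testv_S :: "'n setting \<Rightarrow> (real^'n::finite \<Rightarrow> real^'n) \<Rightarrow> bool" where
  "testv_S st \<psi> \<longleftrightarrow> (\<forall>i. test_S st (\<lambda>x. \<psi> x $ i))"

fun loc_int_ST :: "'n setting \<Rightarrow> real \<Rightarrow> ((real^'n::finite) \<times> real \<Rightarrow> 'b::{banach,second_countable_topology}) \<Rightarrow> bool" where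
  "loc_int_ST Torus T f \<longleftrightarrow> (\<forall>a b. 0 < a \<longrightarrow> b < T \<longrightarrow> set_integrable lebesgue (cbox 0 One \<times> {a..b}) f)"
| "loc_int_ST (Domain \<Omega>) T f \<longleftrightarrow> (\<forall>K. compact K \<longrightarrow> K \<subseteq> \<Omega> \<times> {0<..<T} \<longrightarrow> set_integrable lebesgue K f)"

fun loc_int_S :: "'n setting \<Rightarrow> (real^'n::finite \<Rightarrow> 'b::{banach,second_countable_topology}) \<Rightarrow> bool" where
  "loc_int_S Torus f \<longleftrightarrow> set_integrable lebesgue (cbox 0 One) f"
| "loc_int_S (Domain \<Omega>) f \<longleftrightarrow> (\<forall>K. compact K \<longrightarrow> K \<subseteq> \<Omega> \<longrightarrow> set_integrable lebesgue K f)"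

definition weak_grad_x :: "'n setting \<Rightarrow> real \<Rightarrow> ((real^'n::finite) \<times> real \<Rightarrow> real^'n) \<Rightarrow> ((real^'n) \<times> real \<Rightarrow> real^'n^'n) \<Rightarrow> bool" where
  "weak_grad_x st T u G \<longleftrightarrow>
     u \<in> borel_measurable lebesgue \<and> G \<in> borel_measurable lebesgue \<and>
     loc_int_ST st T u \<and> loc_int_ST st T G \<and>
     (\<forall>\<phi> i j. test_ST st T \<phi> \<longrightarrow>
        (LINT z:region st \<times> {0<..<T}|lebesgue. u z $ i * dx j \<phi> z)
          = - (LINT z:region st \<times> {0<..<T}|lebesgue. G z $ i $ j * \<phi> z))"

definition H10 :: "(real^'n::finite) set \<Rightarrow> (real^'n \<Rightarrow> real^'n) \<Rightarrow> (real^'n \<Rightarrow> real^'n^'n) \<Rightarrow> bool" where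
  "H10 \<Omega> v Gv \<longleftrightarrow> v \<in> borel_measurable lebesgue \<and> Gv \<in> borel_measurable lebesgue \<and>
     set_integrable lebesgue \<Omega> (\<lambda>x. (norm (v x))\<^sup>2) \<and>
     set_integrable lebesgue \<Omega> (\<lambda>x. (norm (Gv x))\<^sup>2) \<and>
     (\<exists>\<phi> :: nat \<Rightarrow> real^'n::finite \<Rightarrow> real^'n. (\<forall>k. testv_S (Domain \<Omega>) (\<phi> k)) \<and>
        (\<lambda>k. (LINT x:\<Omega>|lebesgue. (norm (\<phi> k x - v x))\<^sup>2 + (norm (jac (\<phi> k) x - Gv x))\<^sup>2))
          \<longlonglongrightarrow> 0)"

definition weak_solution ::
  "'n setting \<Rightarrow> real \<Rightarrow> (real \<Rightarrow> real) \<Rightarrow>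
   ((real^'n::finite) \<times> real \<Rightarrow> real) \<Rightarrow> ((real^'n) \<times> real \<Rightarrow> real^'n) \<Rightarrow>
   ((real^'n::finite) \<times> real \<Rightarrow> real^'n^'n) \<Rightarrow> ((real^'n) \<times> real \<Rightarrow> real) \<Rightarrow>
   (real^'n::finite \<Rightarrow> real) \<Rightarrow> (real^'n \<Rightarrow> real^'n) \<Rightarrow> bool" where
  "weak_solution st T \<nu> \<rho> u G P \<rho>0 u0 \<longleftrightarrow>
     (st = Torus \<longrightarrow> periodic_xt \<rho> \<and> periodic_xt u \<and> periodic_xt G \<and> periodic_xt P \<and>
                     periodic_x \<rho>0 \<and> periodic_x u0) \<and>
     \<rho> \<in> borel_measurable lebesgue \<and> u \<in> borel_measurable lebesgue \<and>
     P \<in> borel_measurable lebesgue \<and>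
     \<rho>0 \<in> borel_measurable lebesgue \<and> u0 \<in> borel_measurable lebesgue \<and>
     weak_grad_x st T u G \<and>
     loc_int_ST st T \<rho> \<and> loc_int_ST st T (\<lambda>z. \<rho> z *\<^sub>R u z) \<and>
     loc_int_ST st T (\<lambda>z. \<rho> z *\<^sub>R otimes (u z) (u z)) \<and> loc_int_ST st T P \<and>
     loc_int_ST st T (\<lambda>z. \<nu> (\<rho> z) *\<^sub>R symgrad (G z)) \<and>
     loc_int_S st \<rho>0 \<and> loc_int_S st (\<lambda>x. \<rho>0 x *\<^sub>R u0 x) \<and>
     (\<forall>\<phi>. test_ST st T \<phi> \<longrightarrow>
        (LINT z:region st \<times> {0<..<T}|lebesgue. \<rho> z * dt \<phi> z + \<rho> z * (u z \<bullet> grad_x \<phi> z)) = 0) \<and>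
     (\<forall>\<psi>. testv_ST st T \<psi> \<longrightarrow>
        (LINT z:region st \<times> {0<..<T}|lebesgue.
            (\<rho> z *\<^sub>R u z) \<bullet> dt_v \<psi> z + (\<rho> z *\<^sub>R otimes (u z) (u z)) ::: jac_x \<psi> z
            + P z * div_x \<psi> z - (\<nu> (\<rho> z) *\<^sub>R symgrad (G z)) ::: jac_x \<psi> z) = 0) \<and>
     (AE z in lebesgue. z \<in> region st \<times> {0<..<T} \<longrightarrow> (\<Sum>i\<in>UNIV. G z $ i $ i) = 0) \<and>
     (\<forall>\<phi>. test_S st \<phi> \<longrightarrow>
        ((\<lambda>t. LINT x:region st|lebesgue. \<rho> (x, t) * \<phi> x)
           \<longlongrightarrow> (LINT x:region st|lebesgue. \<rho>0 x * \<phi> x)) (at_right 0)) \<and>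
     (\<forall>\<psi>. testv_S st \<psi> \<longrightarrow>
        ((\<lambda>t. LINT x:region st|lebesgue. (\<rho> (x, t) *\<^sub>R u (x, t)) \<bullet> \<psi> x)
           \<longlongrightarrow> (LINT x:region st|lebesgue. (\<rho>0 x *\<^sub>R u0 x) \<bullet> \<psi> x)) (at_right 0))"

end

(*
  Let m = r u be the momentum density.  The energy increment between two times is controlled by the identity
    1/2 r2 |u2|^2 - 1/2 r1 |u1|^2 = 1/2 (m2 - m1) . (u1 + u2) - 1/2 (r2 - r1) u1 . u2,
  which involves only increments of the conserved quantities r and m.  These are time integrals of fluxes
  and may be tested against the slices u1, u2: a slice lies in H^1 and is a limit of test functions in H^1
  and, by the Sobolev inequality, in L^4.  Averaging over pairs of times at distance at most h and dividing
  by h, continuity of translations in L^2 and L^4 (in time) turns the right-hand side into the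
  dissipation; no regularisation of the nonlinear terms is needed.  Hence E(t) = L - int_0^t D for almost
  every t.  The constant L is the initial energy: testing the weak initial condition with bounded
  approximations of u0 gives one inequality, and comparing time 0 with small times t by the same
  increment identity gives the other.
*)
theory Submission
  imports Defs
begin

section \<open>Convergence in Lebesgue spaces\<close>

text \<open>The decisive integrability is that of r U_i U_j d_j U_i over space-time, a product L^4 *
  L^4 * L^2. This is why only the exponents 1, 2 and 4 occur, and why U must lie in L^4 of
  space-time: for d = 3 this is assumed, for d = 2 it comes from the Ladyzhenskaya inequality. In
  the limit the convective terms of the momentum and the mass balance cancel identically, because r
  U_i U_j is symmetric in i and j; the pressure drops out earlier, since each slice is divergence
  free. Two obstacles shape the rest. A slice used as a test function depends on the time at which
  the balance is used, so the balances must hold outside one null set of times for all test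
  functions at once. And at time 0 there is neither a slice in H^1 nor a finite energy to start
  with: the bounds of the initial density and the finiteness of the initial energy have to be
  extracted from the weak limit, and only the slice at t can be tested against the increment from 0
  to t, which gives an inequality instead of an identity.\<close>

lemmas integrable_add = Bochner_Integration.integrable_add
  and integrable_diff = Bochner_Integration.integrable_diff and integrable_sum = Bochner_Integration.integrable_sum
  and integrable_bound = Bochner_Integration.integrable_bound and integrable_cong = Bochner_Integration.integrable_cong
  and integral_add = Bochner_Integration.integral_add and integral_diff = Bochner_Integration.integral_diff
  and integral_sum = Bochner_Integration.integral_sum and integral_cong = Bochner_Integration.integral_cong
  and integral_nonneg = Bochner_Integration.integral_nonneg

text \<open>The exponent is a natural number, so \<open>power\<close> suffices and no p-th roots
  appear. Hoelder's inequality is always Cauchy-Schwarz, which doubles the exponent: 4, 4 to 2 and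
  2, 2 to 1.\<close>

definition Lp :: "nat \<Rightarrow> 'a measure \<Rightarrow> ('a \<Rightarrow> real) \<Rightarrow> bool" where
  "Lp p M f \<longleftrightarrow> f \<in> borel_measurable M \<and> integrable M (\<lambda>x. \<bar>f x\<bar> ^ p)"

text \<open>The filter is arbitrary because three kinds of limits occur: sequences of test
  functions, translations tending to zero, and pairs of a delay and a step tending to zero
  jointly.\<close>

definition Lpconv :: "nat \<Rightarrow> 'a measure \<Rightarrow> 'k filter \<Rightarrow> ('k \<Rightarrow> 'a \<Rightarrow> real) \<Rightarrow> ('a \<Rightarrow> real) \<Rightarrow> bool" where
  "Lpconv p M F f g \<longleftrightarrow> (\<forall>k. Lp p M (f k)) \<and> Lp p M g \<and>
     ((\<lambda>k. LINT x|M. \<bar>f k x - g x\<bar> ^ p) \<longlongrightarrow> 0) F"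

lemma Lp_measurable: "Lp p M f \<Longrightarrow> f \<in> borel_measurable M"
  by (simp add: Lp_def)

lemma Lp_integrable: "Lp p M f \<Longrightarrow> integrable M (\<lambda>x. \<bar>f x\<bar> ^ p)"
  by (simp add: Lp_def)

text \<open>Compare each term with the maximum. The crude constant is harmless, since it only ever
  multiplies quantities that tend to zero or can be chosen small.\<close>

lemma power_sum3_le:
  fixes a b c :: real
  assumes "0 \<le> a" "0 \<le> b" "0 \<le> c"
  shows "(a + b + c) ^ p \<le> 3 ^ p * (a ^ p + b ^ p + c ^ p)"
proof -
  define m where "m = max a (max b c)"
  have "a + b + c \<le> 3 * m" "0 \<le> m" using assms by (auto simp: m_def)
  then have "(a + b + c) ^ p \<le> (3 * m) ^ p" using assms by (intro power_mono) auto
  also have "\<dots> = 3 ^ p * m ^ p" by (simp add: power_mult_distrib)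
  also have "m ^ p \<le> a ^ p + b ^ p + c ^ p"
    using assms by (auto simp: m_def max_def)
  finally show ?thesis by (simp add: mult_left_mono)
qed

lemma abs_power_sum3_le:
  fixes a b c :: real
  shows "\<bar>a + b + c\<bar> ^ p \<le> 3 ^ p * (\<bar>a\<bar> ^ p + \<bar>b\<bar> ^ p + \<bar>c\<bar> ^ p)"
proof -
  have "\<bar>a + b + c\<bar> ^ p \<le> (\<bar>a\<bar> + \<bar>b\<bar> + \<bar>c\<bar>) ^ p" by (intro power_mono) auto
  also have "\<dots> \<le> 3 ^ p * (\<bar>a\<bar> ^ p + \<bar>b\<bar> ^ p + \<bar>c\<bar> ^ p)" by (rule power_sum3_le) auto
  finally show ?thesis .
qed

lemma integrable_bounded_mult:
  fixes f b :: "'a \<Rightarrow> real"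
  assumes "integrable M f" "b \<in> borel_measurable M" "\<And>x. f x \<noteq> 0 \<Longrightarrow> \<bar>b x\<bar> \<le> B"
  shows "integrable M (\<lambda>x. f x * b x)"
proof (rule integrable_bound[where f="\<lambda>x. B * f x"])
  show "AE x in M. norm (f x * b x) \<le> norm (B * f x)"
  proof (rule AE_I2)
    fix x show "norm (f x * b x) \<le> norm (B * f x)"
      using assms(3)[of x] by (cases "f x = 0") (auto simp: abs_mult mult.commute[of "\<bar>f x\<bar>"] intro!: mult_right_mono)
  qed
qed (use assms in auto)

lemma Lp_bound:
  assumes "Lp p M g" "f \<in> borel_measurable M" "AE x in M. \<bar>f x\<bar> \<le> \<bar>g x\<bar>"
  shows "Lp p M f"
  unfolding Lp_def
proof (intro conjI assms integrable_bound[OF Lp_integrable[OF assms(1)]])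
  show "(\<lambda>x. \<bar>f x\<bar> ^ p) \<in> borel_measurable M" using assms by measurable
  show "AE x in M. norm (\<bar>f x\<bar> ^ p) \<le> norm (\<bar>g x\<bar> ^ p)"
    using assms(3) by eventually_elim (auto intro!: power_mono)
qed

lemma Lp_add3:
  assumes "Lp p M f" "Lp p M g" "Lp p M h"
  shows "Lp p M (\<lambda>x. f x + g x + h x)"
  unfolding Lp_def
proof
  have [measurable]: "f \<in> borel_measurable M" "g \<in> borel_measurable M" "h \<in> borel_measurable M"
    using assms by (auto simp: Lp_def)
  show "(\<lambda>x. f x + g x + h x) \<in> borel_measurable M" by measurable
  show "integrable M (\<lambda>x. \<bar>f x + g x + h x\<bar> ^ p)"
  proof (rule integrable_bound)
    show "integrable M (\<lambda>x. 3 ^ p * (\<bar>f x\<bar> ^ p + \<bar>g x\<bar> ^ p + \<bar>h x\<bar> ^ p))"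
      using assms by (auto simp: Lp_def)
    show "AE x in M. norm (\<bar>f x + g x + h x\<bar> ^ p) \<le> norm (3 ^ p * (\<bar>f x\<bar> ^ p + \<bar>g x\<bar> ^ p + \<bar>h x\<bar> ^ p))"
      using abs_power_sum3_le[of "f _" "g _" "h _" p] by (auto intro!: AE_I2 simp: abs_mult)
  qed measurable
qed

lemma Lp_zero: "0 < p \<Longrightarrow> Lp p M (\<lambda>x. 0)"
  by (simp add: Lp_def zero_power)

lemma Lp_add: "0 < p \<Longrightarrow> Lp p M f \<Longrightarrow> Lp p M g \<Longrightarrow> Lp p M (\<lambda>x. f x + g x)"
  using Lp_add3[of p M f g "\<lambda>x. 0"] Lp_zero by auto

lemma Lp_cmult: "Lp p M f \<Longrightarrow> Lp p M (\<lambda>x. c * f x)"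
  by (auto simp: Lp_def abs_mult power_mult_distrib)

lemma Lp_minus: "Lp p M f \<Longrightarrow> Lp p M (\<lambda>x. - f x)"
  by (auto simp: Lp_def)

lemma Lp_diff: "0 < p \<Longrightarrow> Lp p M f \<Longrightarrow> Lp p M g \<Longrightarrow> Lp p M (\<lambda>x. f x - g x)"
  using Lp_add[of p M f "\<lambda>x. - g x"] Lp_minus[of p M g] by auto

lemma Lp_bounded_mult:
  assumes "Lp p M f" "b \<in> borel_measurable M" "AE x in M. \<bar>b x\<bar> \<le> B"
  shows "Lp p M (\<lambda>x. b x * f x)"
proof (rule Lp_bound[OF Lp_cmult[OF assms(1), of B]])
  show "(\<lambda>x. b x * f x) \<in> borel_measurable M" using assms by (auto simp: Lp_def)
  show "AE x in M. \<bar>b x * f x\<bar> \<le> \<bar>B * f x\<bar>"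
    using assms(3) by eventually_elim (auto simp: abs_mult intro!: mult_right_mono)
qed

lemma Lp_mult:
  assumes "Lp (2 * p) M f" "Lp (2 * p) M g"
  shows "Lp p M (\<lambda>x. f x * g x)"
  unfolding Lp_def
proof
  have [measurable]: "f \<in> borel_measurable M" "g \<in> borel_measurable M"
    using assms by (auto simp: Lp_def)
  show "(\<lambda>x. f x * g x) \<in> borel_measurable M" by measurable
  show "integrable M (\<lambda>x. \<bar>f x * g x\<bar> ^ p)"
  proof (rule integrable_bound)
    show "integrable M (\<lambda>x. \<bar>f x\<bar> ^ (2 * p) + \<bar>g x\<bar> ^ (2 * p))"
      using assms by (auto simp: Lp_def)
    have "\<bar>a * b\<bar> ^ p \<le> \<bar>a\<bar> ^ (2 * p) + \<bar>b\<bar> ^ (2 * p)" for a b :: real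
    proof -
      have "\<bar>a * b\<bar> ^ p \<le> max \<bar>a\<bar> \<bar>b\<bar> ^ (2 * p)"
        by (auto simp: abs_mult power_mult power2_eq_square intro!: power_mono mult_mono)
      also have "\<dots> \<le> \<bar>a\<bar> ^ (2 * p) + \<bar>b\<bar> ^ (2 * p)" by (auto simp: max_def)
      finally show ?thesis .
    qed
    then show "AE x in M. norm (\<bar>f x * g x\<bar> ^ p) \<le> norm (\<bar>f x\<bar> ^ (2 * p) + \<bar>g x\<bar> ^ (2 * p))"
      by (auto intro!: AE_I2)
  qed measurable
qed

lemma Cauchy_Schwarz_integral:
  fixes f g :: "'a \<Rightarrow> real"
  assumes "Lp 2 M f" "Lp 2 M g"
  shows "\<bar>LINT x|M. f x * g x\<bar> \<le> sqrt (LINT x|M. \<bar>f x\<bar>^2) * sqrt (LINT x|M. \<bar>g x\<bar>^2)"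
proof -
  have [measurable]: "f \<in> borel_measurable M" "g \<in> borel_measurable M"
    using assms by (auto simp: Lp_def)
  have "Lp 1 M (\<lambda>x. f x * g x)" using assms Lp_mult[of 1] by (simp add: numeral_2_eq_2)
  then have i: "integrable M (\<lambda>x. \<bar>f x * g x\<bar>)" by (simp add: Lp_def)
  have i2: "integrable M (\<lambda>x. \<bar>f x\<bar>^2)" "integrable M (\<lambda>x. \<bar>g x\<bar>^2)"
    using assms by (auto simp: Lp_def)
  let ?n = "\<lambda>h. \<integral>\<^sup>+x. ennreal (h x) \<partial>M"
  have "(?n (\<lambda>x. \<bar>f x * g x\<bar>))^2 \<le> ?n (\<lambda>x. \<bar>f x\<bar>^2) * ?n (\<lambda>x. \<bar>g x\<bar>^2)"
    using Cauchy_Schwarz_nn_integral[of "\<lambda>x. ennreal \<bar>f x\<bar>" M "\<lambda>x. ennreal \<bar>g x\<bar>"]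
    by (simp add: ennreal_mult' ennreal_power abs_mult)
  then have "ennreal ((LINT x|M. \<bar>f x * g x\<bar>)^2) \<le> ennreal ((LINT x|M. \<bar>f x\<bar>^2) * (LINT x|M. \<bar>g x\<bar>^2))"
    using i i2 by (simp add: nn_integral_eq_integral ennreal_power ennreal_mult)
  then have "(LINT x|M. \<bar>f x * g x\<bar>)^2 \<le> (LINT x|M. \<bar>f x\<bar>^2) * (LINT x|M. \<bar>g x\<bar>^2)"
    by (subst (asm) ennreal_le_iff) auto
  then have "(LINT x|M. \<bar>f x * g x\<bar>) \<le> sqrt ((LINT x|M. \<bar>f x\<bar>^2) * (LINT x|M. \<bar>g x\<bar>^2))"
    by (rule real_le_rsqrt)
  moreover have "\<bar>LINT x|M. f x * g x\<bar> \<le> (LINT x|M. \<bar>f x * g x\<bar>)"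
    using integral_abs_bound by blast
  ultimately show ?thesis unfolding real_sqrt_mult by linarith
qed

lemma integral_abs_mult_power_le:
  fixes f g :: "'a \<Rightarrow> real"
  assumes "Lp (2 * p) M f" "Lp (2 * p) M g"
  shows "(LINT x|M. \<bar>f x * g x\<bar> ^ p) \<le> sqrt (LINT x|M. \<bar>f x\<bar> ^ (2 * p)) * sqrt (LINT x|M. \<bar>g x\<bar> ^ (2 * p))"
proof -
  have "Lp 2 M (\<lambda>x. \<bar>h x\<bar> ^ p)" if "Lp (2 * p) M h" for h
    using that by (auto simp: Lp_def power_mult mult.commute simp flip: power_mult)
  from Cauchy_Schwarz_integral[OF this[OF assms(1)] this[OF assms(2)]]
  show ?thesis
    by (simp add: abs_mult power_mult_distrib power_mult[symmetric] mult.commute)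
qed

lemma LpconvD: assumes "Lpconv p M F f g"
  shows "Lp p M (f k)" "Lp p M g" "((\<lambda>k. LINT x|M. \<bar>f k x - g x\<bar> ^ p) \<longlongrightarrow> 0) F"
  using assms by (auto simp: Lpconv_def)

lemma Lpconv_const: "0 < p \<Longrightarrow> Lp p M f \<Longrightarrow> Lpconv p M F (\<lambda>k. f) f"
  by (auto simp: Lpconv_def zero_power)

lemma Lpconv_compose:
  "Lpconv p M F f g \<Longrightarrow> filterlim h F F' \<Longrightarrow> Lpconv p M F' (\<lambda>k. f (h k)) g"
  unfolding Lpconv_def by (auto intro: filterlim_compose)

lemma Lpconv_sandwich:
  assumes "\<And>k. Lp p M (f k)" "Lp p M g"
    and "\<And>k. (LINT x|M. \<bar>f k x - g x\<bar> ^ p) \<le> e k" "(e \<longlongrightarrow> 0) F"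
  shows "Lpconv p M F f g"
  unfolding Lpconv_def
  using assms by (auto intro!: tendsto_sandwich[OF _ _ tendsto_const assms(4)])

lemma Lp_dist_triangle:
  assumes p: "0 < p" and L: "Lp p M f" "Lp p M g" "Lp p M h" "Lp p M k"
  shows "(LINT x|M. \<bar>f x - k x\<bar> ^ p) \<le>
    3 ^ p * ((LINT x|M. \<bar>f x - g x\<bar> ^ p) + (LINT x|M. \<bar>g x - h x\<bar> ^ p) + (LINT x|M. \<bar>h x - k x\<bar> ^ p))"
proof -
  have i: "integrable M (\<lambda>x. \<bar>f x - g x\<bar> ^ p)" "integrable M (\<lambda>x. \<bar>g x - h x\<bar> ^ p)" "integrable M (\<lambda>x. \<bar>h x - k x\<bar> ^ p)"
    "integrable M (\<lambda>x. \<bar>f x - k x\<bar> ^ p)"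
    by (intro Lp_integrable Lp_diff p L)+
  have "(LINT x|M. \<bar>f x - k x\<bar> ^ p) \<le> (LINT x|M. 3 ^ p * (\<bar>f x - g x\<bar> ^ p + \<bar>g x - h x\<bar> ^ p + \<bar>h x - k x\<bar> ^ p))"
  proof (rule integral_mono)
    show "\<bar>f x - k x\<bar> ^ p \<le> 3 ^ p * (\<bar>f x - g x\<bar> ^ p + \<bar>g x - h x\<bar> ^ p + \<bar>h x - k x\<bar> ^ p)" for x
      using abs_power_sum3_le[of "f x - g x" "g x - h x" "h x - k x" p] by simp
  qed (use i in auto)
  then show ?thesis using i by simp
qed

text \<open>The three-epsilon argument. The approximation of \<open>f k\<close> has to be uniform in
  \<open>k\<close>: for translations this is translation invariance of the measure, for mollifiers
  it is their contraction property.\<close>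

lemma Lpconv_approx:
  assumes p: "0 < p" and L: "\<And>k. Lp p M (f k)" "Lp p M g"
    and approx: "\<And>d. 0 < d \<Longrightarrow> \<exists>f' g'. Lpconv p M F f' g' \<and> (LINT x|M. \<bar>g' x - g x\<bar> ^ p) < d \<and> (\<forall>k. (LINT x|M. \<bar>f k x - f' k x\<bar> ^ p) < d)"
  shows "Lpconv p M F f g"
  unfolding Lpconv_def
proof (intro conjI allI L tendstoI)
  fix e :: real assume e: "0 < e"
  define d where "d = e / (3 * 3 ^ p)"
  have d: "0 < d" using e by (simp add: d_def)
  obtain f' g' where c: "Lpconv p M F f' g'" and near: "(LINT x|M. \<bar>g' x - g x\<bar> ^ p) < d" "\<And>k. (LINT x|M. \<bar>f k x - f' k x\<bar> ^ p) < d"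
    using approx[OF d] by blast
  have "\<forall>\<^sub>F k in F. (LINT x|M. \<bar>f' k x - g' x\<bar> ^ p) < d" by (rule order_tendstoD(2)[OF LpconvD(3)[OF c] d])
  then show "\<forall>\<^sub>F k in F. dist (LINT x|M. \<bar>f k x - g x\<bar> ^ p) 0 < e"
  proof eventually_elim
    case (elim k)
    have "(LINT x|M. \<bar>f k x - g x\<bar> ^ p) \<le> 3 ^ p * ((LINT x|M. \<bar>f k x - f' k x\<bar> ^ p) + (LINT x|M. \<bar>f' k x - g' x\<bar> ^ p) + (LINT x|M. \<bar>g' x - g x\<bar> ^ p))"
      by (rule Lp_dist_triangle[OF p L(1) LpconvD(1,2)[OF c] L(2)])
    also have "\<dots> < 3 ^ p * (d + d + d)" using near elim by (intro mult_strict_left_mono add_strict_mono) auto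
    finally show ?case by (simp add: d_def field_simps)
  qed
qed

lemma Lpconv_add:
  assumes p: "0 < p" and f: "Lpconv p M F f f'" and g: "Lpconv p M F g g'"
  shows "Lpconv p M F (\<lambda>k x. f k x + g k x) (\<lambda>x. f' x + g' x)"
proof (rule Lpconv_sandwich[where e="\<lambda>k. 3 ^ p * ((LINT x|M. \<bar>f k x - f' x\<bar> ^ p) + (LINT x|M. \<bar>g k x - g' x\<bar> ^ p))"])
  note L = LpconvD(1,2)[OF f] LpconvD(1,2)[OF g]
  show "Lp p M (\<lambda>x. f k x + g k x)" "Lp p M (\<lambda>x. f' x + g' x)" for k using L p by (auto intro!: Lp_add)
  show "(LINT x|M. \<bar>f k x + g k x - (f' x + g' x)\<bar> ^ p) \<le>
      3 ^ p * ((LINT x|M. \<bar>f k x - f' x\<bar> ^ p) + (LINT x|M. \<bar>g k x - g' x\<bar> ^ p))" for k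
    using Lp_dist_triangle[OF p Lp_add[OF p L(1,3)] Lp_add[OF p L(2,3)] Lp_add[OF p L(2,4)] Lp_add[OF p L(2,4)], of k k k] p
    by (simp add: zero_power)
next
  show "((\<lambda>k. 3 ^ p * ((LINT x|M. \<bar>f k x - f' x\<bar> ^ p) + (LINT x|M. \<bar>g k x - g' x\<bar> ^ p))) \<longlongrightarrow> 0) F"
    using tendsto_mult[OF tendsto_const tendsto_add[OF LpconvD(3)[OF f] LpconvD(3)[OF g]]] by simp
qed

lemma Lpconv_sum:
  "0 < p \<Longrightarrow> (\<And>i. i \<in> I \<Longrightarrow> Lpconv p M F (f i) (g i)) \<Longrightarrow>
   Lpconv p M F (\<lambda>k x. \<Sum>i\<in>I. f i k x) (\<lambda>x. \<Sum>i\<in>I. g i x)"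
  by (induction I rule: infinite_finite_induct) (auto simp: Lpconv_const Lp_zero Lpconv_add)

lemma Lpconv_bounded_mult:
  assumes p: "0 < p" and f: "Lpconv p M F f f'" and b: "b \<in> borel_measurable M" "AE x in M. \<bar>b x\<bar> \<le> B"
  shows "Lpconv p M F (\<lambda>k x. b x * f k x) (\<lambda>x. b x * f' x)"
proof (rule Lpconv_sandwich[where e="\<lambda>k. \<bar>B\<bar> ^ p * (LINT x|M. \<bar>f k x - f' x\<bar> ^ p)"])
  note L = LpconvD(1,2)[OF f]
  show L2: "Lp p M (\<lambda>x. b x * f k x)" "Lp p M (\<lambda>x. b x * f' x)" for k using L b by (auto intro!: Lp_bounded_mult)
  fix k
  have "(LINT x|M. \<bar>b x * f k x - b x * f' x\<bar> ^ p) \<le> (LINT x|M. \<bar>B\<bar> ^ p * \<bar>f k x - f' x\<bar> ^ p)"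
  proof (rule integral_mono_AE)
    show "AE x in M. \<bar>b x * f k x - b x * f' x\<bar> ^ p \<le> \<bar>B\<bar> ^ p * \<bar>f k x - f' x\<bar> ^ p"
      using b(2)
    proof eventually_elim
      case (elim x)
      have "\<bar>b x * f k x - b x * f' x\<bar> ^ p = \<bar>b x\<bar> ^ p * \<bar>f k x - f' x\<bar> ^ p"
        by (simp add: right_diff_distrib[symmetric] abs_mult power_mult_distrib)
      also have "\<dots> \<le> \<bar>B\<bar> ^ p * \<bar>f k x - f' x\<bar> ^ p"
        using elim by (intro mult_right_mono power_mono) auto
      finally show ?case .
    qed
  qed (auto intro!: Lp_integrable[OF Lp_diff] p L L2)
  then show "(LINT x|M. \<bar>b x * f k x - b x * f' x\<bar> ^ p) \<le> \<bar>B\<bar> ^ p * (LINT x|M. \<bar>f k x - f' x\<bar> ^ p)" by simp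
next
  show "((\<lambda>k. \<bar>B\<bar> ^ p * (LINT x|M. \<bar>f k x - f' x\<bar> ^ p)) \<longlongrightarrow> 0) F"
    using tendsto_mult[OF tendsto_const LpconvD(3)[OF f]] by simp
qed

lemma Lpconv_cmult: "0 < p \<Longrightarrow> Lpconv p M F f g \<Longrightarrow> Lpconv p M F (\<lambda>k z. x * f k z) (\<lambda>z. x * g z)"
  by (rule Lpconv_bounded_mult[where B="\<bar>x\<bar>"]) auto

lemma Lpconv_diff:
  "0 < p \<Longrightarrow> Lpconv p M F f f' \<Longrightarrow> Lpconv p M F g g' \<Longrightarrow> Lpconv p M F (\<lambda>k z. f k z - g k z) (\<lambda>z. f' z - g' z)"
  using Lpconv_add[of p M F f f', OF _ _ Lpconv_cmult[of p M F g g' "-1"]] by simp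

lemma Lpconv_mult:
  assumes p: "0 < p" and f: "Lpconv (2 * p) M F f f'" and g: "Lpconv (2 * p) M F g g'"
  shows "Lpconv p M F (\<lambda>k x. f k x * g k x) (\<lambda>x. f' x * g' x)"
proof -
  define N where "N = (\<lambda>h. sqrt (LINT x|M. \<bar>h x\<bar> ^ (2 * p)))"
  \<comment> \<open>Expanding the error as (f - f')(g - g') + (f - f') g' + f' (g - g') involves
    only norms of the limits, so no uniform bound on \<open>f k\<close> or \<open>g k\<close> has to
    be established.\<close>
  define e where "e = (\<lambda>k. 3 ^ p * (N (\<lambda>x. f k x - f' x) * N (\<lambda>x. g k x - g' x) + N (\<lambda>x. f k x - f' x) * N g' + N f' * N (\<lambda>x. g k x - g' x)))"
  note L = LpconvD(1,2)[OF f] LpconvD(1,2)[OF g]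
  have p2: "0 < 2 * p" using p by simp
  show ?thesis
  proof (rule Lpconv_sandwich[where e=e])
    show "Lp p M (\<lambda>x. f k x * g k x)" "Lp p M (\<lambda>x. f' x * g' x)" for k using L by (auto intro!: Lp_mult)
    fix k
    have D: "Lp (2 * p) M (\<lambda>x. f k x - f' x)" "Lp (2 * p) M (\<lambda>x. g k x - g' x)"
      by (intro Lp_diff L p2)+
    note ii = Lp_integrable[OF Lp_mult[OF D]] Lp_integrable[OF Lp_mult[OF D(1) L(4)]] Lp_integrable[OF Lp_mult[OF L(2) D(2)]]
    have "(LINT x|M. \<bar>f k x * g k x - f' x * g' x\<bar> ^ p) \<le>
       (LINT x|M. 3 ^ p * (\<bar>(f k x - f' x) * (g k x - g' x)\<bar> ^ p + \<bar>(f k x - f' x) * g' x\<bar> ^ p + \<bar>f' x * (g k x - g' x)\<bar> ^ p))"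
    proof (rule integral_mono)
      show "integrable M (\<lambda>x. \<bar>f k x * g k x - f' x * g' x\<bar> ^ p)"
        by (intro Lp_integrable Lp_diff Lp_mult L p)
      show "\<bar>f k x * g k x - f' x * g' x\<bar> ^ p \<le> 3 ^ p * (\<bar>(f k x - f' x) * (g k x - g' x)\<bar> ^ p + \<bar>(f k x - f' x) * g' x\<bar> ^ p + \<bar>f' x * (g k x - g' x)\<bar> ^ p)" for x
        using abs_power_sum3_le[of "(f k x - f' x) * (g k x - g' x)" "(f k x - f' x) * g' x" "f' x * (g k x - g' x)" p]
        by (simp add: algebra_simps)
    qed (use ii in auto)
    also have "\<dots> = 3 ^ p * ((LINT x|M. \<bar>(f k x - f' x) * (g k x - g' x)\<bar> ^ p) + (LINT x|M. \<bar>(f k x - f' x) * g' x\<bar> ^ p) + (LINT x|M. \<bar>f' x * (g k x - g' x)\<bar> ^ p))"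
      using ii by simp
    also have "\<dots> \<le> e k" unfolding e_def N_def
      by (intro mult_left_mono add_mono integral_abs_mult_power_le D L) auto
    finally show "(LINT x|M. \<bar>f k x * g k x - f' x * g' x\<bar> ^ p) \<le> e k" .
  next
    have "((\<lambda>k. N (\<lambda>x. f k x - f' x)) \<longlongrightarrow> 0) F" "((\<lambda>k. N (\<lambda>x. g k x - g' x)) \<longlongrightarrow> 0) F"
      unfolding N_def using tendsto_real_sqrt[OF LpconvD(3)[OF f]] tendsto_real_sqrt[OF LpconvD(3)[OF g]] by simp_all
    then show "(e \<longlongrightarrow> 0) F" unfolding e_def by (auto intro!: tendsto_eq_intros)
  qed
qed

lemma Lp1: "Lp 1 M f \<longleftrightarrow> integrable M f" "Lp (Suc 0) M f \<longleftrightarrow> integrable M f"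
  by (auto simp: Lp_def intro: integrable_abs_cancel)

lemma Lp2_mult: "Lp 2 M f \<Longrightarrow> Lp 2 M g \<Longrightarrow> integrable M (\<lambda>x. f x * g x)"
  using Lp_mult[of 1 M f g] by (simp add: Lp1 numeral_2_eq_2)

lemma Lp4_mult: "Lp 4 M f \<Longrightarrow> Lp 4 M g \<Longrightarrow> Lp 2 M (\<lambda>x. f x * g x)"
  using Lp_mult[of 2 M f g] by simp

text \<open>Cauchy-Schwarz against the indicator of a set of finite measure.\<close>

lemma Lp2_integrable:
  fixes f :: "'a::euclidean_space \<Rightarrow> real"
  assumes f: "Lp 2 lborel f" and A: "A \<in> sets borel" "emeasure lborel A < \<infinity>" and zero: "\<And>x. x \<notin> A \<Longrightarrow> f x = 0"
  shows "integrable lborel f"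
proof -
  have "(\<lambda>x. \<bar>indicator A x :: real\<bar>^2) = indicator A" by (auto simp: indicator_def)
  then have "Lp 2 lborel (indicator A :: 'a \<Rightarrow> real)"
    using A by (auto simp: Lp_def intro!: integrable_real_indicator)
  from Lp2_mult[OF this f] show ?thesis
    by (rule integrable_cong[OF refl, THEN iffD1, rotated]) (auto simp: indicator_def zero)
qed

lemma Lpconv2_mult: "Lpconv 2 M F f f' \<Longrightarrow> Lpconv 2 M F g g' \<Longrightarrow> Lpconv 1 M F (\<lambda>k x. f k x * g k x) (\<lambda>x. f' x * g' x)"
  using Lpconv_mult[of 1 M F f f' g g'] by (simp add: numeral_2_eq_2)

lemma Lpconv4_mult: "Lpconv 4 M F f f' \<Longrightarrow> Lpconv 4 M F g g' \<Longrightarrow> Lpconv 2 M F (\<lambda>k x. f k x * g k x) (\<lambda>x. f' x * g' x)"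
  using Lpconv_mult[of 2 M F f f' g g'] by simp

lemma Lpconv1_integral:
  assumes "Lpconv 1 M F f g"
  shows "((\<lambda>k. LINT x|M. f k x) \<longlongrightarrow> (LINT x|M. g x)) F"
proof -
  have i: "integrable M (f k)" "integrable M g" for k using LpconvD[OF assms] by (auto simp: Lp1)
  have "((\<lambda>k. (LINT x|M. f k x) - (LINT x|M. g x)) \<longlongrightarrow> 0) F"
  proof (rule Lim_null_comparison)
    show "\<forall>\<^sub>F k in F. norm ((LINT x|M. f k x) - (LINT x|M. g x)) \<le> (LINT x|M. \<bar>f k x - g x\<bar> ^ 1)"
    proof (intro always_eventually allI)
      fix k
      have "(LINT x|M. f k x) - (LINT x|M. g x) = (LINT x|M. f k x - g x)" using i by simp
      then show "norm ((LINT x|M. f k x) - (LINT x|M. g x)) \<le> (LINT x|M. \<bar>f k x - g x\<bar> ^ 1)"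
        using integral_abs_bound[of M "\<lambda>x. f k x - g x"] by simp
    qed
  qed (use LpconvD(3)[OF assms] in auto)
  then show ?thesis by (rule LIM_zero_cancel)
qed

section \<open>Translations and density of continuous functions in L^p\<close>

lemma
  fixes f :: "'a::euclidean_space \<Rightarrow> 'b::{banach, second_countable_topology}"
  shows lborel_integrable_shift: "integrable lborel f \<Longrightarrow> integrable lborel (\<lambda>x. f (x + a))"
    and lborel_integral_shift: "f \<in> borel_measurable borel \<Longrightarrow> (LBINT x. f (x + a)) = (LBINT x. f x)"
proof -
  show "integrable lborel f \<Longrightarrow> integrable lborel (\<lambda>x. f (x + a))"
  proof -
    assume "integrable lborel f"
    then have "integrable (distr lborel borel ((+) a)) f" by (simp add: lborel_distr_plus)
    then have "integrable lborel (\<lambda>x. f (a + x))" by (rule integrable_distr[rotated]) simp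
    then show ?thesis by (simp add: add.commute)
  qed
  show "f \<in> borel_measurable borel \<Longrightarrow> (LBINT x. f (x + a)) = (LBINT x. f x)"
    using integral_distr[of "(+) a" lborel borel f] by (simp add: lborel_distr_plus add.commute)
qed

lemma lborel_AE_shift:
  fixes P :: "'a::euclidean_space \<Rightarrow> bool"
  assumes "AE x in lborel. P x" shows "AE x in lborel. P (x + a)"
proof -
  obtain N where N: "{x \<in> space lborel. \<not> P x} \<subseteq> N" "emeasure lborel N = 0" "N \<in> sets lborel"
    using assms by (rule AE_E)
  then have "AE x in distr lborel borel ((+) a). x \<notin> N"
    by (simp add: lborel_distr_plus AE_iff_null null_setsI)
  then have "AE x in lborel. a + x \<notin> N" using N(3) by (subst (asm) AE_distr_iff) auto
  moreover have "a + x \<notin> N \<Longrightarrow> P (x + a)" for x using N(1) by (auto simp: add.commute)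
  ultimately show ?thesis by (auto elim: eventually_mono)
qed

definition clampr :: "real \<Rightarrow> real \<Rightarrow> real \<Rightarrow> real" where
  "clampr a b x = max a (min b x)"

lemma clampr_measurable[measurable]: "clampr a b \<in> borel_measurable borel"
  unfolding clampr_def[abs_def] by measurable

lemma clampr_id: "a \<le> x \<Longrightarrow> x \<le> b \<Longrightarrow> clampr a b x = x"
  by (auto simp: clampr_def)

lemma clampr_bounds: "a \<le> b \<Longrightarrow> a \<le> clampr a b x" "a \<le> b \<Longrightarrow> clampr a b x \<le> b"
  by (auto simp: clampr_def)

lemma abs_clampr_le: "0 \<le> B \<Longrightarrow> \<bar>clampr (- B) B x\<bar> \<le> B" "0 \<le> B \<Longrightarrow> \<bar>clampr (- B) B x\<bar> \<le> \<bar>x\<bar>"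
  by (auto simp: clampr_def)

lemma continuous_clampr: "continuous_on UNIV (clampr a b)"
  unfolding clampr_def[abs_def] by (intro continuous_intros)

lemma tendsto_clampr: "(f \<longlongrightarrow> l) F \<Longrightarrow> ((\<lambda>x. clampr a b (f x)) \<longlongrightarrow> clampr a b l) F"
  unfolding clampr_def by (intro tendsto_intros)

text \<open>A Lebesgue measurable function is an a.e. limit of continuous ones. Clamping the values
  and multiplying by a tent-shaped cutoff restores the bound and the bounded support without moving
  the limit.\<close>

lemma bounded_supp_continuous_approx:
  fixes f :: "'a::euclidean_space \<Rightarrow> real"
  assumes [measurable]: "f \<in> borel_measurable borel" and B: "\<And>x. \<bar>f x\<bar> \<le> B" and R: "\<And>x. R < norm x \<Longrightarrow> f x = 0"
  obtains g where "\<And>k. continuous_on UNIV (g k)" "\<And>k x. \<bar>g k x\<bar> \<le> B" "\<And>k x. R + 1 < norm x \<Longrightarrow> g k x = 0"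
    "AE x in lborel. (\<lambda>k. g k x) \<longlonglongrightarrow> f x"
proof -
  have B0: "0 \<le> B" using B[of 0] by simp
  have "f \<in> borel_measurable lebesgue" by (simp add: measurable_completion)
  then have "f measurable_on UNIV" by (intro lebesgue_measurable_imp_measurable_on) auto
  then obtain N g where N: "negligible N" and g: "\<And>n::nat. continuous_on UNIV (g n)"
    and lim: "\<And>x. x \<notin> N \<Longrightarrow> (\<lambda>n. g n x) \<longlonglongrightarrow> f x"
    unfolding measurable_on_def by auto
  \<comment> \<open>The second factor is 1 on the ball of radius \<open>R\<close>, where
    \<open>f\<close> lives, and 0 beyond radius \<open>R + 1\<close>.\<close>
  define h where "h = (\<lambda>k x. clampr (- B) B (g k x) * max 0 (min 1 (R + 1 - norm x)))"
  show thesis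
  proof (rule that[of h])
    show "continuous_on UNIV (h k)" for k unfolding h_def
      by (intro continuous_intros continuous_on_compose2[OF continuous_clampr g]) auto
    show "\<bar>h k x\<bar> \<le> B" for k x
    proof -
      have "\<bar>h k x\<bar> \<le> B * 1" unfolding h_def abs_mult
        by (intro mult_mono abs_clampr_le B0) auto
      then show ?thesis by simp
    qed
    show "R + 1 < norm x \<Longrightarrow> h k x = 0" for k x by (simp add: h_def)
    have "AE x in lebesgue. x \<notin> N" using N by (simp add: AE_not_in negligible_iff_null_sets)
    then have "AE x in lborel. x \<notin> N" by (simp add: AE_completion_iff)
    then show "AE x in lborel. (\<lambda>k. h k x) \<longlonglongrightarrow> f x"
    proof eventually_elim
      case (elim x)
      have "(\<lambda>k. h k x) \<longlonglongrightarrow> clampr (- B) B (f x) * max 0 (min 1 (R + 1 - norm x))"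
        unfolding h_def by (intro tendsto_intros tendsto_clampr lim elim)
      also have "clampr (- B) B (f x) = f x" using B[of x] by (intro clampr_id) auto
      also have "f x * max 0 (min 1 (R + 1 - norm x)) = f x" using R[of x] by (cases "R < norm x") auto
      finally show ?case .
    qed
  qed
qed

text \<open>Dominated convergence twice: first cut off in value and in space, then approximate the
  bounded, compactly supported remainder by continuous functions with a common majorant.\<close>

lemma Lp_continuous_dense:
  fixes f :: "'a::euclidean_space \<Rightarrow> real"
  assumes f: "Lp p lborel f" and p: "0 < p" and e: "0 < e"
  obtains g R where "continuous_on UNIV g" "\<And>x. R < norm x \<Longrightarrow> g x = 0" "Lp p lborel g"
    "(LBINT x. \<bar>f x - g x\<bar> ^ p) < e"
proof -
  have [measurable]: "f \<in> borel_measurable borel" using f by (simp add: Lp_def)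
  define F where "F = (\<lambda>n x. clampr (- real n) (real n) (f x) * indicator (cball 0 (real n)) x)"
  have [measurable]: "F n \<in> borel_measurable borel" for n unfolding F_def
    by (intro borel_measurable_times borel_measurable_indicator) measurable
  have Fle: "\<bar>F n x\<bar> \<le> \<bar>f x\<bar>" "\<bar>F n x\<bar> \<le> real n" for n x
    using abs_clampr_le[of "real n" "f x"] by (auto simp: F_def indicator_def)
  have LF: "Lp p lborel (F n)" for n by (rule Lp_bound[OF f]) (use Fle in auto)
  have Fdom: "\<bar>f x - F n x\<bar> ^ p \<le> (2 * \<bar>f x\<bar>) ^ p" for n x
    using Fle(1)[of n x] by (intro power_mono) auto
  have lim: "(\<lambda>n. LBINT x. \<bar>f x - F n x\<bar> ^ p) \<longlonglongrightarrow> (LINT x|(lborel::'a measure). 0::real)"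
  proof (rule integral_dominated_convergence)
    show "integrable lborel (\<lambda>x. (2 * \<bar>f x\<bar>) ^ p :: real)" using f by (simp add: Lp_def power_mult_distrib)
    show "AE x in lborel. (\<lambda>n. \<bar>f x - F n x\<bar> ^ p) \<longlonglongrightarrow> 0"
    proof (rule AE_I2)
      fix x
      have "eventually (\<lambda>n. \<bar>f x - F n x\<bar> ^ p = 0) sequentially"
        using eventually_ge_at_top[of "nat \<lceil>max (norm x) \<bar>f x\<bar>\<rceil>"]
      proof eventually_elim
        case (elim n)
        then have "norm x \<le> real n" "\<bar>f x\<bar> \<le> real n" by linarith+
        then have "F n x = f x" by (auto simp: F_def clampr_id)
        then show ?case using p by simp
      qed
      then show "(\<lambda>n. \<bar>f x - F n x\<bar> ^ p) \<longlonglongrightarrow> 0" by (simp add: tendsto_eventually)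
    qed
  qed (use Fdom in auto)
  define d where "d = e / (2 * 3 ^ p)"
  have d: "0 < d" using e by (simp add: d_def)
  obtain n where n: "(LBINT x. \<bar>f x - F n x\<bar> ^ p) < d"
    using order_tendstoD(2)[OF lim, of d] d by (auto simp: eventually_sequentially)
  have Fz: "F n x = 0" if "real n < norm x" for x using that by (simp add: F_def)
  obtain g where g: "\<And>k. continuous_on UNIV (g k)" "\<And>k x. \<bar>g k x\<bar> \<le> real n" "\<And>k x. real n + 1 < norm x \<Longrightarrow> g k x = 0"
    "AE x in lborel. (\<lambda>k. g k x) \<longlonglongrightarrow> F n x"
    using bounded_supp_continuous_approx[of "F n" "real n" "real n", OF _ Fle(2) Fz] by auto
  have [measurable]: "g k \<in> borel_measurable borel" for k by (rule borel_measurable_continuous_onI[OF g(1)])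
  have fm: "emeasure lborel (cball (0::'a) (real n + 1)) < \<infinity>" using emeasure_lborel_cball_finite by blast
  have ic: "integrable lborel (\<lambda>x::'a. c * indicator (cball 0 (real n + 1)) x :: real)" for c :: real
    using fm by (intro integrable_mult_right integrable_real_indicator) (auto simp: top.not_eq_extremum)
  have dom: "\<bar>F n x - g k x\<bar> ^ p \<le> (2 * real n) ^ p * indicator (cball 0 (real n + 1)) x" for k x
  proof (cases "real n + 1 < norm x")
    case True
    then have "F n x = 0" by (auto simp: F_def)
    then show ?thesis using g(3)[of x k] True p by (simp add: zero_power)
  next
    case False
    then have "\<bar>F n x - g k x\<bar> \<le> 2 * real n" using Fle(2)[of n x] g(2)[of k x] by linarith
    then show ?thesis using False power_mono[of "\<bar>F n x - g k x\<bar>" "2 * real n" p] by simp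
  qed
  have Lg: "Lp p lborel (g k)" for k
    unfolding Lp_def
  proof
    show "integrable lborel (\<lambda>x. \<bar>g k x\<bar> ^ p)"
    proof (rule integrable_bound[OF ic[of "real n ^ p"]])
      show "AE x in lborel. norm (\<bar>g k x\<bar> ^ p) \<le> norm (real n ^ p * indicator (cball 0 (real n + 1)) x)"
        using g(2,3) p by (auto intro!: AE_I2 power_mono simp: indicator_def not_le zero_power)
    qed measurable
  qed measurable
  have "(\<lambda>k. LBINT x. \<bar>F n x - g k x\<bar> ^ p) \<longlonglongrightarrow> (LINT x|(lborel::'a measure). 0::real)"
  proof (rule integral_dominated_convergence[where w="\<lambda>x. (2 * real n) ^ p * indicator (cball 0 (real n + 1)) x"])
    show "AE x in lborel. (\<lambda>k. \<bar>F n x - g k x\<bar> ^ p) \<longlonglongrightarrow> 0"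
      using g(4)
    proof eventually_elim
      case (elim x)
      from tendsto_power[OF tendsto_rabs[OF tendsto_diff[OF tendsto_const[of "F n x"] elim]], of p]
      show ?case using p by (simp add: zero_power)
    qed
    show "AE x in lborel. norm (\<bar>F n x - g k x\<bar> ^ p) \<le> (2 * real n) ^ p * indicator (cball 0 (real n + 1)) x" for k
      using dom by (auto intro!: AE_I2)
  qed (use ic in auto)
  then obtain k where k: "(LBINT x. \<bar>F n x - g k x\<bar> ^ p) < d"
    using order_tendstoD(2)[of _ "0::real" sequentially d] d by (auto simp: eventually_sequentially)
  show thesis
  proof (rule that[OF g(1) _ Lg])
    show "real n + 1 < norm x \<Longrightarrow> g k x = 0" for x by (rule g(3))
    have "(LBINT x. \<bar>f x - g k x\<bar> ^ p) \<le> 3 ^ p * ((LBINT x. \<bar>f x - F n x\<bar> ^ p) + (LBINT x. \<bar>F n x - g k x\<bar> ^ p))"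
      using Lp_dist_triangle[OF p f LF[of n] Lg[of k] Lg[of k]] p by (simp add: zero_power)
    also have "\<dots> < 3 ^ p * (d + d)" using n k by (intro mult_strict_left_mono add_strict_mono) auto
    also have "\<dots> = e" by (simp add: d_def)
    finally show "(LBINT x. \<bar>f x - g k x\<bar> ^ p) < e" .
  qed
qed

lemma Lp_shift: "Lp p lborel f \<Longrightarrow> Lp p lborel (\<lambda>x. f (x + a :: 'a::euclidean_space))"
  using lborel_integrable_shift[of "\<lambda>x. \<bar>f x\<bar> ^ p" a]
  by (auto simp: Lp_def intro!: measurable_compose[of "\<lambda>x. x + a" borel borel f borel])

text \<open>For a continuous function of compact support this is uniform continuity; the general
  case follows by density, as shifting both functions leaves their distance unchanged.\<close>

lemma Lpconv_shift:
  fixes f :: "'a::euclidean_space \<Rightarrow> real"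
  assumes f: "Lp p lborel f" and p: "0 < p"
  shows "Lpconv p lborel (nhds 0) (\<lambda>a x. f (x + a)) f"
proof (rule Lpconv_approx[OF p Lp_shift[OF f] f])
  fix d :: real assume d: "0 < d"
  have [measurable]: "f \<in> borel_measurable borel" using f by (simp add: Lp_def)
  obtain g R where g: "continuous_on UNIV g" "\<And>x. R < norm x \<Longrightarrow> g x = 0" "Lp p lborel g"
    and gd: "(LBINT x. \<bar>f x - g x\<bar> ^ p) < d"
    using Lp_continuous_dense[OF f p d] by metis
  have [measurable]: "g \<in> borel_measurable borel" by (rule borel_measurable_continuous_onI[OF g(1)])
  \<comment> \<open>The margin 2 ensures that, for shifts of norm below 1, if \<open>x\<close> or
    \<open>x + a\<close> leaves \<open>K\<close> then both points lie beyond radius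
    \<open>R\<close>, where \<open>g\<close> vanishes.\<close>
  define K where "K = cball (0::'a) (\<bar>R\<bar> + 2)"
  define V where "V = measure lborel K"
  have fm: "emeasure lborel K < \<infinity>" unfolding K_def using emeasure_lborel_cball_finite by blast
  have "continuous_on K g" using g(1) continuous_on_subset by blast
  then have uc: "uniformly_continuous_on K g" by (rule compact_uniformly_continuous) (simp add: K_def)
  have "Lpconv p lborel (nhds 0) (\<lambda>a x. g (x + a)) g"
    unfolding Lpconv_def
  proof (intro conjI allI g(3) Lp_shift tendstoI)
    fix e :: real assume e: "0 < e"
    \<comment> \<open>Taking \<open>\<eta>\<close> at most 1 gives \<open>\<eta> ^ p\<close> at most
      \<open>\<eta>\<close>, so the final integral stays below \<open>e\<close> for every
      exponent.\<close>
    define \<eta> where "\<eta> = min 1 (e / (V + 1))"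
    have V: "0 \<le> V" by (simp add: V_def)
    have eta: "0 < \<eta>" using e V by (auto simp: \<eta>_def)
    have "\<eta> ^ p * V \<le> \<eta> ^ 1 * V" using eta p V by (intro mult_right_mono power_decreasing) (auto simp: \<eta>_def)
    also have "\<dots> \<le> e / (V + 1) * V" using V by (intro mult_right_mono) (auto simp: \<eta>_def)
    also have "\<dots> < e" using V e by (simp add: field_simps)
    finally have eV: "\<eta> ^ p * V < e" .
    obtain \<delta> where del: "0 < \<delta>" "\<And>x x'. x \<in> K \<Longrightarrow> x' \<in> K \<Longrightarrow> dist x' x < \<delta> \<Longrightarrow> dist (g x') (g x) < \<eta>"
      using uc eta unfolding uniformly_continuous_on_def by metis
    have "dist (LBINT x. \<bar>g (x + a) - g x\<bar> ^ p) 0 < e" if a: "norm a < min \<delta> 1" for a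
    proof -
      have mid: "\<bar>g (x + a) - g x\<bar> ^ p \<le> \<eta> ^ p * indicator K x" for x
      proof (cases "x \<in> K \<and> x + a \<in> K")
        case True
        then have "\<bar>g (x + a) - g x\<bar> \<le> \<eta>" using del(2)[of x "x + a"] a by (auto simp: dist_norm)
        then show ?thesis using True by (auto intro!: power_mono)
      next
        case False
        have "norm x \<le> norm (x + a) + norm a" "norm (x + a) \<le> norm x + norm a"
          using norm_triangle_ineq4[of "x + a" a] norm_triangle_ineq[of x a] by auto
        then have "R < norm x" "R < norm (x + a)" using False a by (auto simp: K_def)
        then show ?thesis using g(2)[of x] g(2)[of "x + a"] p eta by (auto simp: zero_power)
      qed
      have iK: "integrable lborel (\<lambda>x. \<eta> ^ p * indicator K x :: real)"
        using fm by (intro integrable_mult_right integrable_real_indicator) (auto simp: K_def top.not_eq_extremum)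
      have "(LBINT x. \<bar>g (x + a) - g x\<bar> ^ p) \<le> (LBINT x. \<eta> ^ p * indicator K x)"
        by (rule integral_mono[OF Lp_integrable[OF Lp_diff[OF p Lp_shift[OF g(3)] g(3)]] iK mid])
      also have "\<dots> = \<eta> ^ p * V" using fm by (simp add: V_def K_def)
      finally show ?thesis using eV by simp
    qed
    then show "\<forall>\<^sub>F a in nhds 0. dist (LBINT x. \<bar>g (x + a) - g x\<bar> ^ p) 0 < e"
      unfolding eventually_nhds_metric using del(1) by (intro exI[of _ "min \<delta> 1"]) auto
  qed
  moreover have "(LBINT x. \<bar>f (x + a) - g (x + a)\<bar> ^ p) = (LBINT x. \<bar>f x - g x\<bar> ^ p)" for a
    by (rule lborel_integral_shift) measurable
  ultimately show "\<exists>f' g'. Lpconv p lborel (nhds 0) f' g' \<and> (LBINT x. \<bar>g' x - f x\<bar> ^ p) < d \<and> (\<forall>a. (LBINT x. \<bar>f (x + a) - f' a x\<bar> ^ p) < d)"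
    using gd by (intro exI[of _ "\<lambda>a x. g (x + a)"] exI[of _ g]) (simp add: abs_minus_commute)
qed

section \<open>Smooth functions and test functions\<close>

text \<open>A finite-order version of the coinductive notion, so that the closure properties become
  inductions on \<open>k\<close>. Order 0 asks for nothing: continuity of a derivative follows from
  its differentiability at the next order.\<close>

fun Ck :: "nat \<Rightarrow> ('a::euclidean_space \<Rightarrow> real) \<Rightarrow> bool" where
  "Ck 0 f \<longleftrightarrow> True"
| "Ck (Suc k) f \<longleftrightarrow> (\<forall>x. f differentiable (at x)) \<and> (\<forall>e\<in>Basis. Ck k (dderiv e f))"

lemma smooth_fun_iff_Ck: "smooth_fun f \<longleftrightarrow> (\<forall>k. Ck k f)"
proof
  assume "smooth_fun f"
  then have "Ck k f" for k
    by (induction k arbitrary: f) (auto elim: smooth_fun.cases)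
  then show "\<forall>k. Ck k f" by blast
next
  assume "\<forall>k. Ck k f"
  then show "smooth_fun f"
  proof (coinduction arbitrary: f)
    case smooth_fun
    have "Ck (Suc k) f" for k using smooth_fun by blast
    then show ?case by auto
  qed
qed

lemma Ck_Suc: "Ck (Suc k) f \<Longrightarrow> Ck k f"
  by (induction k arbitrary: f) auto

lemma dderiv_eq: "(f has_derivative D) (at x) \<Longrightarrow> dderiv e f x = D e"
  unfolding dderiv_def using frechet_derivative_at by metis

lemma has_derivative_dderiv: "f differentiable (at x) \<Longrightarrow> (f has_derivative (\<lambda>h. dderiv h f x)) (at x)"
  unfolding dderiv_def by (simp add: frechet_derivative_works[symmetric])

lemma Ck_const: "Ck k (\<lambda>x. c)"
proof (induction k arbitrary: c)
  case (Suc k)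
  have "dderiv e (\<lambda>x::'a. c) = (\<lambda>x. 0)" for e by (rule ext, rule dderiv_eq) (auto intro!: derivative_eq_intros)
  with Suc show ?case by simp
qed simp

lemma dderiv_add:
  "(\<And>x. f differentiable (at x)) \<Longrightarrow> (\<And>x. g differentiable (at x)) \<Longrightarrow>
   dderiv e (\<lambda>x. f x + g x) = (\<lambda>x. dderiv e f x + dderiv e g x)"
  by (rule ext, rule dderiv_eq) (intro has_derivative_add has_derivative_dderiv)

lemma dderiv_mult:
  "f differentiable (at x) \<Longrightarrow> g differentiable (at x) \<Longrightarrow>
   dderiv e (\<lambda>x. f x * g x) x = f x * dderiv e g x + dderiv e f x * g x"
  by (rule dderiv_eq) (intro has_derivative_mult has_derivative_dderiv)

lemma Ck_add: "Ck k f \<Longrightarrow> Ck k g \<Longrightarrow> Ck k (\<lambda>x. f x + g x)"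
proof (induction k arbitrary: f g)
  case (Suc k)
  then show ?case by (auto simp: dderiv_add)
qed simp

lemma Ck_mult: "Ck k f \<Longrightarrow> Ck k g \<Longrightarrow> Ck k (\<lambda>x. f x * g x)"
proof (induction k arbitrary: f g)
  case (Suc k)
  have "dderiv e (\<lambda>x. f x * g x) = (\<lambda>x. f x * dderiv e g x + dderiv e f x * g x)" for e
    using Suc.prems by (intro ext dderiv_mult) auto
  then show ?case using Suc.prems Ck_Suc[OF Suc.prems(1)] Ck_Suc[OF Suc.prems(2)]
    by (auto intro!: Ck_add Suc.IH)
qed simp

lemma Ck_sum: "(\<And>i. i \<in> I \<Longrightarrow> Ck k (f i)) \<Longrightarrow> Ck k (\<lambda>x. \<Sum>i\<in>I. f i x)"
  by (induction I rule: infinite_finite_induct) (auto simp: Ck_const Ck_add)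

lemma dderiv_basis_sum:
  assumes "f differentiable (at x)"
  shows "dderiv h f x = (\<Sum>b\<in>Basis. (h \<bullet> b) * dderiv b f x)"
proof -
  interpret linear "\<lambda>h. dderiv h f x"
    using has_derivative_dderiv[OF assms] by (rule has_derivative_linear)
  have "dderiv h f x = dderiv (\<Sum>b\<in>Basis. (h \<bullet> b) *\<^sub>R b) f x" by (simp add: euclidean_representation)
  then show ?thesis by (simp add: sum scale)
qed

lemma dderiv_affine:
  assumes L: "bounded_linear L" and f: "f differentiable (at (L x + c))"
  shows "dderiv e (\<lambda>x. f (L x + c)) x = dderiv (L e) f (L x + c)"
proof (rule dderiv_eq)
  have "((\<lambda>x. L x + c) has_derivative (\<lambda>h. L h + 0)) (at x)"
    by (intro has_derivative_add bounded_linear_imp_has_derivative L has_derivative_const)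
  from has_derivative_compose[OF this has_derivative_dderiv[OF f]]
  show "((\<lambda>x. f (L x + c)) has_derivative (\<lambda>h. dderiv (L h) f (L x + c))) (at x)"
    by simp
qed

lemma Ck_affine:
  assumes L: "bounded_linear L" shows "Ck k f \<Longrightarrow> Ck k (\<lambda>x. f (L x + c))"
proof (induction k arbitrary: f)
  case (Suc k)
  have d: "f differentiable (at x)" for x using Suc.prems by auto
  have "(\<lambda>x. f (L x + c)) differentiable (at x)" for x
  proof -
    have "(\<lambda>x. L x + c) differentiable (at x)"
      by (intro differentiable_add bounded_linear_imp_differentiable L differentiable_const)
    from differentiable_compose[OF d this] show ?thesis by simp
  qed
  moreover have "dderiv e (\<lambda>x. f (L x + c)) = (\<lambda>x. \<Sum>b\<in>Basis. (L e \<bullet> b) * dderiv b f (L x + c))" for e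
    by (rule ext) (simp add: dderiv_affine[OF L d] dderiv_basis_sum[OF d, of "L e"])
  ultimately show ?case using Suc by (auto intro!: Ck_sum Ck_mult Ck_const)
qed simp

lemma smooth_const: "smooth_fun (\<lambda>x. c)"
  and smooth_add: "smooth_fun f \<Longrightarrow> smooth_fun g \<Longrightarrow> smooth_fun (\<lambda>x. f x + g x)"
  and smooth_mult: "smooth_fun f \<Longrightarrow> smooth_fun g \<Longrightarrow> smooth_fun (\<lambda>x. f x * g x)"
  and smooth_affine: "bounded_linear L \<Longrightarrow> smooth_fun h \<Longrightarrow> smooth_fun (\<lambda>x. h (L x + c'))"
  and smooth_sum: "(\<And>i. i \<in> I \<Longrightarrow> smooth_fun (F i)) \<Longrightarrow> smooth_fun (\<lambda>x. \<Sum>i\<in>I. F i x)"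
  by (auto simp: smooth_fun_iff_Ck Ck_const Ck_add Ck_mult Ck_affine Ck_sum)

lemma smooth_linear_comp: "bounded_linear L \<Longrightarrow> smooth_fun h \<Longrightarrow> smooth_fun (\<lambda>x. h (L x))"
  using smooth_affine[of L h 0] by simp

lemma smooth_prod: "(\<And>i. i \<in> I \<Longrightarrow> smooth_fun (F i)) \<Longrightarrow> smooth_fun (\<lambda>x. \<Prod>i\<in>I. F i x)"
  by (induction I rule: infinite_finite_induct) (auto simp: smooth_const smooth_mult)

lemma smooth_differentiable: "smooth_fun f \<Longrightarrow> f differentiable (at x)"
  by (auto elim: smooth_fun.cases)

lemma smooth_dderiv_Basis: "smooth_fun f \<Longrightarrow> e \<in> Basis \<Longrightarrow> smooth_fun (dderiv e f)"
  by (auto elim: smooth_fun.cases)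

lemma smooth_dderiv: "smooth_fun f \<Longrightarrow> smooth_fun (dderiv e f)"
proof -
  assume f: "smooth_fun f"
  then have "dderiv e f = (\<lambda>x. \<Sum>b\<in>Basis. (e \<bullet> b) * dderiv b f x)"
    by (intro ext dderiv_basis_sum smooth_differentiable)
  moreover have "smooth_fun \<dots>" by (intro smooth_sum smooth_mult smooth_const smooth_dderiv_Basis f)
  ultimately show ?thesis by simp
qed

lemma smooth_continuous: "smooth_fun f \<Longrightarrow> continuous_on S f"
  by (intro continuous_at_imp_continuous_on ballI differentiable_imp_continuous_within smooth_differentiable)

lemma smooth_borel[measurable_dest]: "smooth_fun f \<Longrightarrow> f \<in> borel_measurable borel"
  by (intro borel_measurable_continuous_onI smooth_continuous)

lemma smooth_linear: "bounded_linear (f :: 'a::euclidean_space \<Rightarrow> real) \<Longrightarrow> smooth_fun f"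
proof -
  assume f: "bounded_linear f"
  then have d: "dderiv e f x = f e" for e x
    by (intro dderiv_eq bounded_linear_imp_has_derivative)
  show ?thesis
  proof (rule smooth_fun.intros)
    show "\<forall>x. f differentiable at x" using f bounded_linear_imp_has_derivative differentiable_def by blast
    have "dderiv e f = (\<lambda>x. f e)" for e using d by auto
    then show "\<forall>e\<in>Basis. smooth_fun (dderiv e f)" by (auto simp: smooth_const)
  qed
qed

lemma smooth_real_polynomial: "real_polynomial_function p \<Longrightarrow> smooth_fun p"
  by (induction rule: real_polynomial_function.induct)
     (auto simp: smooth_linear smooth_const smooth_add smooth_mult)

section \<open>Smooth functions of one variable: flat exponential, bump and step\<close>

lemma dderiv_real: "(f has_real_derivative d) (at x) \<Longrightarrow> dderiv 1 f x = d"
  using dderiv_eq[of f "(*) d" x 1] by (simp add: has_field_derivative_def)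

lemma smooth_real_iff:
  fixes f :: "real \<Rightarrow> real"
  assumes "\<And>x. (f has_real_derivative f' x) (at x)"
  shows "smooth_fun f \<longleftrightarrow> smooth_fun f'"
proof -
  have "dderiv 1 f x = f' x" for x
    using assms by (rule dderiv_real)
  then have "dderiv 1 f = f'" by auto
  moreover have "f differentiable (at x)" for x
    using assms[of x] real_differentiable_def by blast
  ultimately show ?thesis
    using smooth_dderiv_Basis[of f 1] smooth_fun.intros[of f] by auto
qed

text \<open>The functions t^(-k) exp(-1/t), extended by 0. The whole family in \<open>k\<close> is
  needed because differentiation maps its members to combinations of other members; smoothness at
  the origin then follows by one induction.\<close>

definition flat_exp :: "nat \<Rightarrow> real \<Rightarrow> real" where
  "flat_exp k t = (if t \<le> 0 then 0 else (1 / t) ^ k * exp (- (1 / t)))"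

lemma flat_exp_tendsto_0: "(flat_exp k \<longlongrightarrow> 0) (at 0)"
proof (rule filterlim_split_at)
  show "(flat_exp k \<longlongrightarrow> 0) (at_left 0)"
    by (rule tendsto_eventually) (auto simp: flat_exp_def eventually_at_left_field intro!: exI[of _ "-1"])
  have "((\<lambda>x::real. x ^ k / exp x) \<longlongrightarrow> 0) at_top" by (rule tendsto_power_div_exp_0)
  then have "((\<lambda>t::real. inverse t ^ k / exp (inverse t)) \<longlongrightarrow> 0) (at_right 0)"
    by (rule filterlim_compose[OF _ filterlim_inverse_at_top_right])
  moreover have "\<forall>\<^sub>F t in at_right 0. inverse t ^ k / exp (inverse t) = flat_exp k t"
    by (auto simp: flat_exp_def eventually_at_right_field exp_minus field_simps intro!: exI[of _ 1])
  ultimately show "(flat_exp k \<longlongrightarrow> 0) (at_right 0)"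
    by (rule Lim_transform_eventually)
qed

text \<open>Away from 0 this is calculus. At 0 the difference quotient of \<open>flat_exp k\<close>
  is \<open>flat_exp (Suc k)\<close>, which tends to 0 because the exponential beats every
  power.\<close>

lemma flat_exp_deriv:
  "(flat_exp k has_real_derivative (- real k * flat_exp (Suc k) t + flat_exp (Suc (Suc k)) t)) (at t)"
proof -
  consider "t < 0" | "t = 0" | "0 < t" by linarith
  then show ?thesis
  proof cases
    case 1
    have "((\<lambda>t. 0) has_real_derivative 0) (at t)" by simp
    then have "(flat_exp k has_real_derivative 0) (at t)"
      by (rule DERIV_cong_ev[THEN iffD1, rotated 3])
         (use 1 in \<open>auto simp: flat_exp_def eventually_nhds intro!: exI[of _ "{..<0}"]\<close>)
    then show ?thesis using 1 by (simp add: flat_exp_def)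
  next
    case 2
    have "((\<lambda>y. (flat_exp k y - flat_exp k 0) / (y - 0)) \<longlongrightarrow> 0) (at 0)"
      using flat_exp_tendsto_0[of "Suc k"]
      by (rule Lim_transform_eventually) (auto simp: flat_exp_def eventually_at intro!: exI[of _ 1])
    then show ?thesis using 2 by (simp add: has_field_derivative_iff flat_exp_def)
  next
    case 3
    have d: "((\<lambda>t. 1 / t) has_real_derivative - ((1 / t) ^ 2)) (at t)"
      using 3 by (auto intro!: derivative_eq_intros simp: power2_eq_square)
    have "((\<lambda>t. (1 / t) ^ k * exp (- (1 / t))) has_real_derivative
        (1 / t) ^ k * (exp (- (1 / t)) * - (- ((1 / t) ^ 2))) + real k * ((1 / t) ^ (k - 1) * - ((1 / t) ^ 2)) * exp (- (1 / t))) (at t)"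
      using DERIV_mult'[OF DERIV_power[OF d, of k] DERIV_fun_exp[OF DERIV_minus[OF d]]] by (simp add: mult_ac)
    also have "(1 / t) ^ k * (exp (- (1 / t)) * - (- ((1 / t) ^ 2))) + real k * ((1 / t) ^ (k - 1) * - ((1 / t) ^ 2)) * exp (- (1 / t))
      = - real k * flat_exp (Suc k) t + flat_exp (Suc (Suc k)) t"
      using 3 by (cases k) (simp_all add: flat_exp_def power2_eq_square algebra_simps add_divide_distrib diff_divide_distrib)
    finally have "((\<lambda>t. (1 / t) ^ k * exp (- (1 / t))) has_real_derivative
        (- real k * flat_exp (Suc k) t + flat_exp (Suc (Suc k)) t)) (at t)" .
    then show ?thesis
      by (rule DERIV_cong_ev[THEN iffD1, rotated 3])
         (use 3 in \<open>auto simp: flat_exp_def eventually_nhds intro!: exI[of _ "{0<..}"]\<close>)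
  qed
qed

lemma smooth_flat_exp: "smooth_fun (flat_exp k)"
  unfolding smooth_fun_iff_Ck
proof
  fix n show "Ck n (flat_exp k)"
  proof (induction n arbitrary: k)
    case (Suc n)
    have "dderiv 1 (flat_exp k) = (\<lambda>t. - real k * flat_exp (Suc k) t + flat_exp (Suc (Suc k)) t)"
      using flat_exp_deriv[of k]
      by (intro ext dderiv_real)
    moreover have "flat_exp k differentiable (at x)" for x
      using flat_exp_deriv[of k x] real_differentiable_def by blast
    moreover have "Ck n (\<lambda>t. - real k * flat_exp (Suc k) t + flat_exp (Suc (Suc k)) t)"
      by (intro Ck_add Ck_mult Ck_const Suc)
    ultimately show ?case by simp
  qed simp
qed

definition bump :: "real \<Rightarrow> real" where "bump t = flat_exp 0 t * flat_exp 0 (1 - t)"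

lemma smooth_bump: "smooth_fun bump"
proof -
  have "smooth_fun (\<lambda>t::real. flat_exp 0 ((- t) + 1))"
    by (rule smooth_affine[of "\<lambda>t. - t"]) (auto simp: smooth_flat_exp intro: bounded_linear_minus bounded_linear_ident)
  then have "smooth_fun (\<lambda>t. flat_exp 0 t * flat_exp 0 (1 - t))"
    by (intro smooth_mult smooth_flat_exp) simp
  then show ?thesis by (simp add: bump_def[abs_def])
qed

lemma bump_nonneg: "0 \<le> bump t"
  and bump_eq_0: "t \<le> 0 \<or> 1 \<le> t \<Longrightarrow> bump t = 0"
  and bump_pos: "0 < t \<Longrightarrow> t < 1 \<Longrightarrow> 0 < bump t"
  by (auto simp: bump_def flat_exp_def)

text \<open>The normalised primitive of the bump. Its derivative is returned as well, since it
  serves as an averaging kernel of mass 1 supported in the unit interval.\<close>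

lemma smooth_step_exists:
  obtains S s :: "real \<Rightarrow> real" where "smooth_fun S" "continuous_on UNIV s"
    "\<And>t. (S has_real_derivative s t) (at t)" "\<And>t. 0 \<le> s t" "\<And>t. t \<le> 0 \<or> 1 \<le> t \<Longrightarrow> s t = 0"
    "\<And>t. t \<le> 0 \<Longrightarrow> S t = 0" "\<And>t. 1 \<le> t \<Longrightarrow> S t = 1" "\<And>t. 0 \<le> S t" "\<And>t. S t \<le> 1"
proof -
  \<comment> \<open>Starting at -1 rather than 0 makes t = 0 an interior point, so that the
    one-sided derivative there is two-sided.\<close>
  define A where "A = (\<lambda>t. integral {-1..t} bump)"
  have cb: "continuous_on X bump" for X by (rule smooth_continuous[OF smooth_bump])
  have A0: "A t = 0" if "t \<le> 0" for t
  proof -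
    have "A t = integral {-1..t} (\<lambda>x. 0::real)" unfolding A_def
      by (rule Henstock_Kurzweil_Integration.integral_cong) (use that in \<open>auto intro!: bump_eq_0\<close>)
    then show ?thesis by simp
  qed
  have dA: "(A has_real_derivative bump t) (at t)" for t
  proof (cases "t < 0")
    case True
    have "((\<lambda>t. 0) has_real_derivative 0) (at t)" by simp
    then have "(A has_real_derivative 0) (at t)"
      by (rule DERIV_cong_ev[THEN iffD1, rotated 3])
         (use True in \<open>auto simp: A0 eventually_nhds intro!: exI[of _ "{..<0}"]\<close>)
    then show ?thesis using True by (simp add: bump_eq_0)
  next
    case False
    have "(A has_real_derivative bump t) (at t within {-1..t+1})"
      unfolding A_def by (rule integral_has_real_derivative[OF cb]) (use False in auto)
    then show ?thesis using False by (subst (asm) at_within_Icc_at) auto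
  qed
  have mono: "A x \<le> A y" if "x \<le> y" for x y
    using that by (rule DERIV_nonneg_imp_nondecreasing) (use dA bump_nonneg in blast)
  have A1: "A t = A 1" if "1 \<le> t" for t
  proof -
    have "A t = A 1"
    proof (cases "t = 1")
      case False
      with that have "1 < t" by simp
      moreover have "continuous_on {1..t} A"
        using dA DERIV_continuous_on has_field_derivative_at_within by blast
      moreover have "(A has_real_derivative 0) (at x)" if "1 < x" "x < t" for x
        using dA[of x] bump_eq_0[of x] that by simp
      ultimately show ?thesis using DERIV_isconst_end by blast
    qed simp
    then show ?thesis .
  qed
  have pos: "0 < A 1"
  proof -
    have "A (1/4) < A (3/4)"
      by (rule DERIV_pos_imp_increasing) (use dA bump_pos in \<open>auto intro!: exI[of _ "bump _"]\<close>)
    moreover have "0 \<le> A (1/4)" using mono[of 0 "1/4"] A0[of 0] by simp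
    moreover have "A (3/4) \<le> A 1" by (rule mono) simp
    ultimately show ?thesis by linarith
  qed
  have sA: "smooth_fun A" using smooth_real_iff[of A bump, OF dA] smooth_bump by blast
  show thesis
  proof (rule that[of "\<lambda>t. (1 / A 1) * A t" "\<lambda>t. (1 / A 1) * bump t"])
    show "smooth_fun (\<lambda>t. (1 / A 1) * A t)" by (intro smooth_mult smooth_const sA)
    show "continuous_on UNIV (\<lambda>t. (1 / A 1) * bump t)" by (intro continuous_intros cb)
    show "((\<lambda>t. (1 / A 1) * A t) has_real_derivative (1 / A 1) * bump t) (at t)" for t
      by (rule DERIV_cmult[OF dA])
    show "0 \<le> (1 / A 1) * bump t" for t using pos bump_nonneg by simp
    show "t \<le> 0 \<or> 1 \<le> t \<Longrightarrow> (1 / A 1) * bump t = 0" for t by (simp add: bump_eq_0)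
    show "t \<le> 0 \<Longrightarrow> (1 / A 1) * A t = 0" for t by (simp add: A0)
    show "1 \<le> t \<Longrightarrow> (1 / A 1) * A t = 1" for t using A1[of t] pos by simp
    show "0 \<le> (1 / A 1) * A t" for t
      using mono[of 0 t] A0[of t] A0[of 0] pos by (cases "t \<le> 0") auto
    show "(1 / A 1) * A t \<le> 1" for t
      using mono[of t 1] A1[of t] pos by (cases "t \<le> 1") auto
  qed
qed

section \<open>Test functions in space and in space-time\<close>

lemma smooth_fst: "smooth_fun f \<Longrightarrow> smooth_fun (\<lambda>z::'a::euclidean_space \<times> 'b::euclidean_space. f (fst z))"
  by (rule smooth_linear_comp[OF bounded_linear_fst])

lemma smooth_snd: "smooth_fun f \<Longrightarrow> smooth_fun (\<lambda>z::'a::euclidean_space \<times> 'b::euclidean_space. f (snd z))"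
  by (rule smooth_linear_comp[OF bounded_linear_snd])

lemma supp_closure_mono: "(\<And>x. f x \<noteq> 0 \<Longrightarrow> g x \<noteq> 0) \<Longrightarrow> supp_closure f \<subseteq> supp_closure g"
  unfolding supp_closure_def by (intro closure_mono) auto

lemma not_supp_closure: "x \<notin> supp_closure f \<Longrightarrow> f x = 0"
  using closure_subset[of "{x. f x \<noteq> 0}"] by (auto simp: supp_closure_def)

lemma compact_supp_closure_mono:
  assumes "compact (supp_closure g)" "\<And>x. f x \<noteq> 0 \<Longrightarrow> g x \<noteq> 0"
  shows "compact (supp_closure f)"
proof -
  have "supp_closure g \<inter> supp_closure f = supp_closure f" using supp_closure_mono[of f g] assms(2) by blast
  moreover have "compact (supp_closure g \<inter> supp_closure f)"
    by (intro compact_Int_closed assms(1)) (simp add: supp_closure_def)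
  ultimately show ?thesis by simp
qed

lemma test_S_smooth: "test_S st \<phi> \<Longrightarrow> smooth_fun \<phi>"
  by (cases st) auto

lemma test_S_mult: "test_S st f \<Longrightarrow> test_S st g \<Longrightarrow> test_S st (\<lambda>x. f x * g x)"
  using supp_closure_mono[of "\<lambda>x. f x * g x" f]
  by (cases st) (auto simp: smooth_mult periodic_x_def intro: compact_supp_closure_mono)

lemma test_S_smooth_mult:
  "test_S (Domain \<Omega>) f \<Longrightarrow> smooth_fun g \<Longrightarrow> test_S (Domain \<Omega>) (\<lambda>x. f x * g x)"
  using supp_closure_mono[of "\<lambda>x. f x * g x" f]
  by (auto simp: smooth_mult intro: compact_supp_closure_mono)

lemma supp_closure_add:
  fixes f g :: "'a::real_normed_vector \<Rightarrow> real"
  shows "supp_closure (\<lambda>x. f x + g x) \<subseteq> supp_closure f \<union> supp_closure g"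
  unfolding supp_closure_def closure_Un[symmetric] by (intro closure_mono) auto

lemma test_S_add: "test_S st f \<Longrightarrow> test_S st g \<Longrightarrow> test_S st (\<lambda>x. f x + g x)"
proof (cases st)
  case (Domain \<Omega>)
  assume "test_S st f" "test_S st g"
  then have *: "compact (supp_closure f \<union> supp_closure g)" "supp_closure f \<union> supp_closure g \<subseteq> \<Omega>" "smooth_fun f" "smooth_fun g"
    using Domain by auto
  have "supp_closure (\<lambda>x. f x + g x) = (supp_closure f \<union> supp_closure g) \<inter> supp_closure (\<lambda>x. f x + g x)"
    using supp_closure_add[of f g] by blast
  moreover have "compact \<dots>" by (intro compact_Int_closed *(1)) (simp add: supp_closure_def)
  ultimately show ?thesis using Domain * supp_closure_add[of f g] by (auto simp: smooth_add)
qed (auto simp: smooth_add periodic_x_def)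

lemma test_S_zero: "test_S st (\<lambda>x. 0)"
  by (cases st) (auto simp: smooth_const periodic_x_def supp_closure_def)

lemma test_S_cmult: "test_S st f \<Longrightarrow> test_S st (\<lambda>x. c * f x)"
  using supp_closure_mono[of "\<lambda>x. c * f x" f]
  by (cases st) (auto simp: smooth_mult smooth_const periodic_x_def intro: compact_supp_closure_mono)

lemma test_S_sum: "(\<And>i. i \<in> I \<Longrightarrow> test_S st (f i)) \<Longrightarrow> test_S st (\<lambda>x. \<Sum>i\<in>I. f i x)"
  by (induction I rule: infinite_finite_induct) (auto simp: test_S_zero test_S_add)

text \<open>Products of a spatial and a temporal factor are the only space-time test functions
  inserted into the weak equations: for a fixed spatial factor they reduce each equation to one for
  a function of time.\<close>

lemma test_ST_product:
  assumes \<phi>: "test_S st \<phi>" and \<theta>: "smooth_fun \<theta>" and ab: "0 < a" "b < T"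
    and supp: "\<And>t. t \<notin> {a..b} \<Longrightarrow> \<theta> t = 0"
  shows "test_ST st T (\<lambda>z. \<phi> (fst z) * \<theta> (snd z))"
proof -
  have s: "smooth_fun (\<lambda>z. \<phi> (fst z) * \<theta> (snd z))"
    by (intro smooth_mult smooth_fst smooth_snd \<theta> test_S_smooth[OF \<phi>])
  show ?thesis
  proof (cases st)
    case Torus
    have "\<exists>a b. 0 < a \<and> b < T \<and> (\<forall>x t. t \<notin> {a..b} \<longrightarrow> \<phi> (fst (x, t)) * \<theta> (snd (x, t)) = 0)"
      using supp ab by (intro exI[of _ a] exI[of _ b]) auto
    then show ?thesis using Torus s \<phi> by (auto simp: periodic_xt_def periodic_x_def)
  next
    case (Domain \<Omega>)
    have sub: "supp_closure (\<lambda>z. \<phi> (fst z) * \<theta> (snd z)) \<subseteq> supp_closure \<phi> \<times> {a..b}"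
    proof -
      have "closed (supp_closure \<phi> \<times> {a..b})" by (intro closed_Times) (auto simp: supp_closure_def)
      moreover have "{z. \<phi> (fst z) * \<theta> (snd z) \<noteq> 0} \<subseteq> supp_closure \<phi> \<times> {a..b}"
        using supp not_supp_closure[of _ \<phi>] by force
      ultimately show ?thesis unfolding supp_closure_def[of "\<lambda>z. _ z * _ z"] by (rule closure_minimal[rotated])
    qed
    have c: "compact (supp_closure \<phi> \<times> {a..b})" using \<phi> Domain by (auto intro: compact_Times)
    have "compact (supp_closure (\<lambda>z. \<phi> (fst z) * \<theta> (snd z)))"
      using compact_Int_closed[OF c, of "supp_closure (\<lambda>z. \<phi> (fst z) * \<theta> (snd z))"] sub
      by (simp add: Int_absorb1 supp_closure_def)
    moreover have "supp_closure \<phi> \<times> {a..b} \<subseteq> \<Omega> \<times> {0<..<T}" using \<phi> Domain ab by auto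
    ultimately show ?thesis using s sub Domain by auto
  qed
qed

lemma dderiv_product_x:
  assumes "smooth_fun \<phi>" "smooth_fun \<theta>"
  shows "dderiv (e, 0) (\<lambda>z. \<phi> (fst z) * \<theta> (snd z)) (x, t) = dderiv e \<phi> x * \<theta> t"
    "dderiv (0, 1) (\<lambda>z. \<phi> (fst z) * \<theta> (snd z)) (x, t) = \<phi> x * dderiv 1 \<theta> t"
proof -
  have 1: "dderiv e' (\<lambda>z. \<phi> (fst z)) (x, t) = dderiv (fst e') \<phi> x" for e'
    using dderiv_affine[OF bounded_linear_fst, of \<phi> "(x, t)" 0 e'] assms by (simp add: smooth_differentiable)
  have 2: "dderiv e' (\<lambda>z. \<theta> (snd z)) (x, t) = dderiv (snd e') \<theta> t" for e'
    using dderiv_affine[OF bounded_linear_snd, of \<theta> "(x, t)" 0 e'] assms by (simp add: smooth_differentiable)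
  have 3: "dderiv e' (\<lambda>z. \<phi> (fst z) * \<theta> (snd z)) (x, t) = \<phi> x * dderiv (snd e') \<theta> t + dderiv (fst e') \<phi> x * \<theta> t" for e'
  proof -
    have "(\<lambda>z. \<phi> (fst z)) differentiable (at (x, t))" "(\<lambda>z. \<theta> (snd z)) differentiable (at (x, t))"
      by (intro smooth_differentiable smooth_fst smooth_snd assms)+
    from dderiv_mult[OF this, of e'] show ?thesis by (simp add: 1 2)
  qed
  have z: "dderiv 0 f y = 0" if "smooth_fun f" for f :: "'z::euclidean_space \<Rightarrow> real" and y
    using dderiv_basis_sum[OF smooth_differentiable[OF that], of 0 y] by simp
  show "dderiv (e, 0) (\<lambda>z. \<phi> (fst z) * \<theta> (snd z)) (x, t) = dderiv e \<phi> x * \<theta> t"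
    "dderiv (0, 1) (\<lambda>z. \<phi> (fst z) * \<theta> (snd z)) (x, t) = \<phi> x * dderiv 1 \<theta> t"
    using 3 z assms by auto
qed

section \<open>Averages over pairs of times\<close>

text \<open>Space-time carries the Borel algebra of the product topology here, not the product
  algebra, so the projections need measurability rules of their own.\<close>

lemma borel_measurable_fst'[measurable (raw)]:
  fixes f :: "'c \<Rightarrow> 'a::topological_space \<times> 'b::topological_space"
  shows "f \<in> M \<rightarrow>\<^sub>M borel \<Longrightarrow> (\<lambda>x. fst (f x)) \<in> M \<rightarrow>\<^sub>M borel"
  by (rule measurable_compose[of f M borel fst borel])
     (auto intro!: borel_measurable_continuous_onI continuous_on_fst continuous_on_id)

lemma borel_measurable_snd'[measurable (raw)]:
  fixes f :: "'c \<Rightarrow> 'a::topological_space \<times> 'b::topological_space"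
  shows "f \<in> M \<rightarrow>\<^sub>M borel \<Longrightarrow> (\<lambda>x. snd (f x)) \<in> M \<rightarrow>\<^sub>M borel"
  by (rule measurable_compose[of f M borel snd borel])
     (auto intro!: borel_measurable_continuous_onI continuous_on_snd continuous_on_id)

lemma
  fixes f :: "'a::euclidean_space \<times> 'b::euclidean_space \<Rightarrow> real"
  assumes f: "integrable lborel f"
  shows lborel_integral_fst: "(LBINT z. f z) = (LBINT x. LBINT y. f (x, y))"
    and lborel_integral_snd: "(LBINT z. f z) = (LBINT y. LBINT x. f (x, y))"
    and lborel_AE_integrable_fst: "AE x in lborel. integrable lborel (\<lambda>y. f (x, y))"
    and lborel_AE_integrable_snd: "AE y in lborel. integrable lborel (\<lambda>x. f (x, y))"
    and lborel_integrable_fst: "integrable lborel (\<lambda>x. LBINT y. f (x, y))"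
    and lborel_integrable_snd: "integrable lborel (\<lambda>y. LBINT x. f (x, y))"
proof -
  have f': "integrable (lborel \<Otimes>\<^sub>M lborel) (case_prod (\<lambda>x y. f (x, y)))" using f by (simp add: lborel_prod)
  show "(LBINT z. f z) = (LBINT x. LBINT y. f (x, y))"
    using lborel_pair.integral_fst[OF f'] by (simp add: lborel_prod)
  show "(LBINT z. f z) = (LBINT y. LBINT x. f (x, y))"
    using lborel_pair.integral_snd[OF f'] by (simp add: lborel_prod)
  show "AE x in lborel. integrable lborel (\<lambda>y. f (x, y))" using lborel_pair.AE_integrable_fst[OF f'] .
  show "AE y in lborel. integrable lborel (\<lambda>x. f (x, y))" using lborel_pair.AE_integrable_snd[OF f'] .
  show "integrable lborel (\<lambda>x. LBINT y. f (x, y))" using lborel_pair.integrable_fst[OF f'] .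
  show "integrable lborel (\<lambda>y. LBINT x. f (x, y))" using lborel_pair.integrable_snd[OF f'] .
qed

lemma lborel_AE_pair: "AE z in (lborel::('a::euclidean_space \<times> 'b::euclidean_space) measure). Q z \<Longrightarrow>
    AE y in lborel. AE x in lborel. Q (x, y)"
proof -
  assume "AE z in (lborel::('a \<times> 'b) measure). Q z"
  then obtain N where N: "{x \<in> space lborel. \<not> Q x} \<subseteq> N" "emeasure lborel N = 0" "N \<in> sets lborel"
    by (rule AE_E)
  have N0: "AE z in (lborel::('a \<times> 'b) measure). z \<notin> N" using N by (intro AE_not_in) (auto simp: null_sets_def)
  have "N \<in> sets (lborel \<Otimes>\<^sub>M lborel)" using N(3) unfolding lborel_prod .
  have "AE x in lborel. AE y in lborel. (x, y) \<notin> N"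
    by (rule lborel_pair.AE_pair) (unfold lborel_prod, rule N0)
  \<comment> \<open>Exchanging the two quantifiers requires a measurable exceptional set; this is
    why \<open>Q\<close> has been replaced by avoidance of a Borel null set
    \<open>N\<close>.\<close>
  then have "AE y in lborel. AE x in lborel. (x, y) \<notin> N"
  proof (subst (asm) lborel_pair.AE_commute)
    have "{x \<in> space (lborel \<Otimes>\<^sub>M lborel). (fst x, snd x) \<notin> N} = space (lborel \<Otimes>\<^sub>M lborel) - N" by auto
    then show "{x \<in> space (lborel \<Otimes>\<^sub>M lborel). (fst x, snd x) \<notin> N} \<in> sets (lborel \<Otimes>\<^sub>M lborel)"
      using sets.compl_sets[OF \<open>N \<in> sets (lborel \<Otimes>\<^sub>M lborel)\<close>] by simp
  qed
  then show ?thesis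
  proof eventually_elim
    case (elim y)
    then show ?case by eventually_elim (use N(1) in auto)
  qed
qed

lemma nn_integral_lborel_fst:
  fixes f :: "'a::euclidean_space \<times> 'b::euclidean_space \<Rightarrow> ennreal"
  assumes "f \<in> borel_measurable borel"
  shows "(\<integral>\<^sup>+z. f z \<partial>lborel) = (\<integral>\<^sup>+x. \<integral>\<^sup>+y. f (x, y) \<partial>lborel \<partial>lborel)"
  using lborel.nn_integral_fst[of f lborel] assms by (simp add: lborel_prod)

lemma nn_integral_lborel_snd:
  fixes f :: "'a::euclidean_space \<times> 'b::euclidean_space \<Rightarrow> ennreal"
  assumes "f \<in> borel_measurable borel"
  shows "(\<integral>\<^sup>+z. f z \<partial>lborel) = (\<integral>\<^sup>+y. \<integral>\<^sup>+x. f (x, y) \<partial>lborel \<partial>lborel)"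
  using lborel_pair.nn_integral_snd[of f] assms by (simp add: lborel_prod)

lemma nn_integral_lborel_shift:
  fixes f :: "'a::euclidean_space \<Rightarrow> ennreal"
  assumes "f \<in> borel_measurable borel"
  shows "(\<integral>\<^sup>+x. f (x + a) \<partial>lborel) = (\<integral>\<^sup>+x. f x \<partial>lborel)"
  using nn_integral_distr[of "(+) a" lborel borel f] assms by (simp add: lborel_distr_plus add.commute)

lemma Lp_iff_nn: "Lp p M f \<longleftrightarrow> f \<in> borel_measurable M \<and> (\<integral>\<^sup>+x. ennreal (\<bar>f x\<bar> ^ p) \<partial>M) < \<infinity>"
  unfolding Lp_def by (auto simp: integrable_iff_bounded)

lemma Lp_tensor:
  fixes f :: "'a::euclidean_space \<Rightarrow> real" and g :: "'b::euclidean_space \<Rightarrow> real"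
  assumes f: "Lp p lborel f" and g: "Lp p lborel g"
  shows "Lp p lborel (\<lambda>z. f (fst z) * g (snd z))"
    and "(LBINT z. \<bar>f (fst z) * g (snd z)\<bar> ^ p) = (LBINT x. \<bar>f x\<bar> ^ p) * (LBINT y. \<bar>g y\<bar> ^ p)"
proof -
  have [measurable]: "f \<in> borel_measurable borel" "g \<in> borel_measurable borel"
    using f g by (auto simp: Lp_def)
  have i: "integrable lborel (\<lambda>x. \<bar>f x\<bar> ^ p)" "integrable lborel (\<lambda>x. \<bar>g x\<bar> ^ p)"
    using f g by (auto simp: Lp_def)
  have I: "integrable lborel (\<lambda>z. \<bar>f (fst z) * g (snd z)\<bar> ^ p)"
    unfolding lborel_prod[symmetric]
  proof (rule lborel_pair.Fubini_integrable)
    have "(\<lambda>z. \<bar>f (fst z) * g (snd z)\<bar> ^ p) \<in> borel_measurable borel" by measurable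
    then show "(\<lambda>z. \<bar>f (fst z) * g (snd z)\<bar> ^ p) \<in> borel_measurable (lborel \<Otimes>\<^sub>M lborel)" by (simp add: lborel_prod)
  qed (use i in \<open>auto simp: abs_mult power_mult_distrib\<close>)
  then show "Lp p lborel (\<lambda>z. f (fst z) * g (snd z))" by (simp add: Lp_def)
  show "(LBINT z. \<bar>f (fst z) * g (snd z)\<bar> ^ p) = (LBINT x. \<bar>f x\<bar> ^ p) * (LBINT y. \<bar>g y\<bar> ^ p)"
    by (subst lborel_integral_fst[OF I]) (simp add: abs_mult power_mult_distrib)
qed

lemma Lpconv_tensor:
  fixes f :: "'k \<Rightarrow> 'a::euclidean_space \<Rightarrow> real" and g :: "'b::euclidean_space \<Rightarrow> real"
  assumes p: "0 < p" and f: "Lpconv p lborel F f f'" and g: "Lp p lborel g"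
  shows "Lpconv p lborel F (\<lambda>k z. f k (fst z) * g (snd z)) (\<lambda>z. f' (fst z) * g (snd z))"
  unfolding Lpconv_def
proof (intro conjI allI Lp_tensor g LpconvD[OF f])
  have "(LBINT z. \<bar>f k (fst z) * g (snd z) - f' (fst z) * g (snd z)\<bar> ^ p) =
     (LBINT x. \<bar>f k x - f' x\<bar> ^ p) * (LBINT y. \<bar>g y\<bar> ^ p)" for k
    using Lp_tensor(2)[OF Lp_diff[OF p LpconvD(1,2)[OF f]] g] by (simp add: left_diff_distrib)
  then show "((\<lambda>k. LBINT z. \<bar>f k (fst z) * g (snd z) - f' (fst z) * g (snd z)\<bar> ^ p) \<longlongrightarrow> 0) F"
    using tendsto_mult_left_zero[OF LpconvD(3)[OF f]] by simp
qed

text \<open>For each fixed second variable the inner integral is translation invariant, so the norm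
  factorises. This supplies joint integrability when functions are translated by an amount that is
  itself an integration variable.\<close>

lemma Lp_sheared:
  fixes f :: "'a::euclidean_space \<Rightarrow> real" and g :: "real \<Rightarrow> real" and c :: "real \<Rightarrow> 'a"
  assumes f: "Lp p lborel f" and g: "Lp p lborel g" and [measurable]: "c \<in> borel_measurable borel"
  shows "Lp p lborel (\<lambda>w. g (snd w) * f (fst w + c (snd w)))"
  unfolding Lp_iff_nn
proof
  have [measurable]: "f \<in> borel_measurable borel" "g \<in> borel_measurable borel"
    using f g by (auto simp: Lp_def)
  have [measurable]: "(\<lambda>w::'a \<times> real. f (fst w + c (snd w))) \<in> borel_measurable borel"
    by (rule measurable_compose[of _ borel borel f borel]) measurable
  show "(\<lambda>w. g (snd w) * f (fst w + c (snd w))) \<in> borel_measurable lborel" by simp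
  have "(\<integral>\<^sup>+w. ennreal (\<bar>g (snd w) * f (fst w + c (snd w))\<bar> ^ p) \<partial>lborel) =
     (\<integral>\<^sup>+r. \<integral>\<^sup>+z. ennreal (\<bar>g r * f (z + c r)\<bar> ^ p) \<partial>lborel \<partial>lborel)"
    by (subst nn_integral_lborel_snd) auto
  also have "\<dots> = (\<integral>\<^sup>+r. ennreal (\<bar>g r\<bar> ^ p) * (\<integral>\<^sup>+z. ennreal (\<bar>f z\<bar> ^ p) \<partial>lborel) \<partial>lborel)"
  proof (intro nn_integral_cong)
    fix r
    have "(\<integral>\<^sup>+z. ennreal (\<bar>g r * f (z + c r)\<bar> ^ p) \<partial>lborel) = (\<integral>\<^sup>+z. ennreal (\<bar>g r\<bar> ^ p) * ennreal (\<bar>f (z + c r)\<bar> ^ p) \<partial>lborel)"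
      by (intro nn_integral_cong) (simp add: abs_mult power_mult_distrib ennreal_mult)
    also have "\<dots> = ennreal (\<bar>g r\<bar> ^ p) * (\<integral>\<^sup>+z. ennreal (\<bar>f (z + c r)\<bar> ^ p) \<partial>lborel)"
      by (rule nn_integral_cmult) (auto intro: measurable_compose[of _ borel borel f borel])
    also have "(\<integral>\<^sup>+z. ennreal (\<bar>f (z + c r)\<bar> ^ p) \<partial>lborel) = (\<integral>\<^sup>+z. ennreal (\<bar>f z\<bar> ^ p) \<partial>lborel)"
      by (rule nn_integral_lborel_shift) measurable
    finally show "(\<integral>\<^sup>+z. ennreal (\<bar>g r * f (z + c r)\<bar> ^ p) \<partial>lborel) = ennreal (\<bar>g r\<bar> ^ p) * (\<integral>\<^sup>+z. ennreal (\<bar>f z\<bar> ^ p) \<partial>lborel)" .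
  qed
  also have "\<dots> = (\<integral>\<^sup>+r. ennreal (\<bar>g r\<bar> ^ p) \<partial>lborel) * (\<integral>\<^sup>+z. ennreal (\<bar>f z\<bar> ^ p) \<partial>lborel)"
    by (rule nn_integral_multc) measurable
  also have "\<dots> < \<infinity>" using f g unfolding Lp_iff_nn by (auto simp: ennreal_mult_less_top)
  finally show "(\<integral>\<^sup>+w. ennreal (\<bar>g (snd w) * f (fst w + c (snd w))\<bar> ^ p) \<partial>lborel) < \<infinity>" .
qed

lemma Lp_sheared_time:
  fixes f :: "'a::euclidean_space \<times> real \<Rightarrow> real" and I :: "real set"
  assumes "0 < p" "Lp p lborel f" "Lp p lborel (indicator I :: real \<Rightarrow> real)" "d \<in> borel_measurable borel"
  shows "Lp p lborel (\<lambda>w. indicator I (snd w) * f (fst w + (0, d (snd w))))"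
proof -
  have [measurable]: "d \<in> borel_measurable borel" by fact
  show ?thesis using Lp_sheared[OF assms(2,3), of "\<lambda>r. (0, d r)"] by measurable
qed

lemma Lpconv_shift_time:
  fixes f :: "'a::euclidean_space \<times> real \<Rightarrow> real"
  assumes d: "(d \<longlongrightarrow> 0) F" and f: "Lp p lborel f" "0 < p"
  shows "Lpconv p lborel F (\<lambda>k z. f (z + (0, d k))) f"
proof (rule Lpconv_compose[OF Lpconv_shift[OF f]])
  show "filterlim (\<lambda>k. (0::'a, d k)) (nhds 0) F" unfolding zero_prod_def by (intro tendsto_Pair tendsto_const d)
qed

text \<open>The change of variables \<open>s = t + r\<close> that turns an integral over pairs of times into an average
  of time translates.\<close>
lemma distr_time_difference:
  "distr lborel borel (\<lambda>w::real \<times> ('a::euclidean_space \<times> real). ((fst (snd w), fst w), snd (snd w) - fst w)) = lborel"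
proof (rule measure_eqI)
  fix A :: "(('a \<times> real) \<times> real) set"
  let ?p = "\<lambda>w::real \<times> ('a \<times> real). ((fst (snd w), fst w), snd (snd w) - fst w)"
  assume "A \<in> sets (distr lborel borel ?p)"
  then have A[measurable]: "A \<in> sets borel" by simp
  have p[measurable]: "?p \<in> borel \<rightarrow>\<^sub>M borel" by measurable
  define a :: "('a \<times> real) \<times> real \<Rightarrow> ennreal" where "a = indicator A"
  have a[measurable]: "a \<in> borel_measurable borel" by (simp add: a_def)
  have m1: "(\<lambda>w. a (?p w)) \<in> borel_measurable borel" by measurable
  have "emeasure (distr lborel borel ?p) A = (\<integral>\<^sup>+w. a (?p w) \<partial>lborel)"
    using nn_integral_distr[of ?p lborel borel a] by (simp add: a_def)
  also have "\<dots> = (\<integral>\<^sup>+t. \<integral>\<^sup>+y. a ((fst y, t), snd y - t) \<partial>lborel \<partial>lborel)"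
    by (subst nn_integral_lborel_fst[OF m1]) simp
  also have "\<dots> = (\<integral>\<^sup>+t. \<integral>\<^sup>+x. \<integral>\<^sup>+s. a ((x, t), s - t) \<partial>lborel \<partial>lborel \<partial>lborel)"
    by (intro nn_integral_cong, subst nn_integral_lborel_fst) simp_all
  also have "\<dots> = (\<integral>\<^sup>+t. \<integral>\<^sup>+x. \<integral>\<^sup>+s. a ((x, t), s) \<partial>lborel \<partial>lborel \<partial>lborel)"
  proof (rule nn_integral_cong, rule nn_integral_cong)
    fix t x
    show "(\<integral>\<^sup>+s. a ((x, t), s - t) \<partial>lborel) = (\<integral>\<^sup>+s. a ((x, t), s) \<partial>lborel)"
      using nn_integral_lborel_shift[of "\<lambda>s. a ((x, t), s)" "- t"] by simp
  qed
  also have "\<dots> = (\<integral>\<^sup>+z. \<integral>\<^sup>+s. a (z, s) \<partial>lborel \<partial>lborel)"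
  proof (rule nn_integral_lborel_snd[symmetric])
    have "(\<lambda>z. \<integral>\<^sup>+s. a (z, s) \<partial>lborel) \<in> borel_measurable lborel"
      by (rule lborel.borel_measurable_nn_integral_fst) (simp add: lborel_prod)
    then show "(\<lambda>z. \<integral>\<^sup>+s. a (z, s) \<partial>lborel) \<in> borel_measurable borel" by simp
  qed
  also have "\<dots> = (\<integral>\<^sup>+w. a w \<partial>lborel)" by (rule nn_integral_lborel_fst[symmetric]) simp
  also have "\<dots> = emeasure lborel A" by (simp add: a_def)
  finally show "emeasure (distr lborel borel ?p) A = emeasure lborel A" .
qed simp

text \<open>For a base time \<open>t\<close> the point \<open>y\<close> runs over all of space-time,
  and \<open>snd y - t\<close> is its delay. Integrating also over \<open>t\<close> gives the
  integral over delays \<open>r\<close> of space-time integrals at fixed delay, which is the form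
  accessible to continuity of translations.\<close>

lemma
  fixes k :: "('a::euclidean_space \<times> real) \<times> real \<Rightarrow> real"
  assumes k: "integrable lborel k"
  shows time_difference_integral:
      "(LBINT t. LBINT y. k ((fst y, t), snd y - t)) = (LBINT r. LBINT z. k (z, r))"
    and time_difference_AE: "AE t in lborel. integrable lborel (\<lambda>y. k ((fst y, t), snd y - t))"
    and time_difference_integrable: "integrable lborel (\<lambda>t. LBINT y. k ((fst y, t), snd y - t))"
proof -
  let ?p = "\<lambda>w::real \<times> ('a \<times> real). ((fst (snd w), fst w), snd (snd w) - fst w)"
  have p[measurable]: "?p \<in> borel \<rightarrow>\<^sub>M borel" by measurable
  have [measurable]: "k \<in> borel_measurable borel" using k by auto
  have i: "integrable lborel (\<lambda>w. k (?p w))"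
    using integrable_distr[of ?p lborel borel k] k by (simp add: distr_time_difference)
  have "(LBINT w. k (?p w)) = (LBINT w. k w)"
    using integral_distr[of ?p lborel borel k] by (simp add: distr_time_difference)
  then show "(LBINT t. LBINT y. k ((fst y, t), snd y - t)) = (LBINT r. LBINT z. k (z, r))"
    using lborel_integral_fst[OF i] lborel_integral_snd[OF k] by simp
  show "AE t in lborel. integrable lborel (\<lambda>y. k ((fst y, t), snd y - t))"
    using lborel_AE_integrable_fst[OF i] by simp
  show "integrable lborel (\<lambda>t. LBINT y. k ((fst y, t), snd y - t))"
    using lborel_integrable_fst[OF i] by simp
qed

text \<open>The integrand depends on the window length \<open>h\<close> as well as on the delay
  \<open>r\<close>, so the limit is required jointly; then every value averaged over a short window
  is close to \<open>l\<close>.\<close>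

lemma average_tendsto:
  fixes J :: "real \<Rightarrow> real \<Rightarrow> real"
  assumes J: "((\<lambda>p. J (fst p) (snd p)) \<longlongrightarrow> l) (nhds 0 \<times>\<^sub>F at_right 0)"
    and int: "\<And>h. 0 < h \<Longrightarrow> integrable lborel (\<lambda>r. indicator {0..<h} r * J r h)"
  shows "((\<lambda>h. (1 / h) * (LBINT r. indicator {0..<h} r * J r h)) \<longlongrightarrow> l) (at_right 0)"
proof (rule tendstoI)
  fix e :: real assume e: "0 < e"
  have "\<forall>\<^sub>F p in nhds 0 \<times>\<^sub>F at_right 0. dist (J (fst p) (snd p)) l < e / 2"
    using tendstoD[OF J, of "e / 2"] e by simp
  then obtain P Q where PQ: "eventually P (nhds 0)" "eventually Q (at_right 0)"
    and J': "\<And>r h. P r \<Longrightarrow> Q h \<Longrightarrow> dist (J r h) l < e / 2"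
    unfolding eventually_prod_filter by auto
  obtain d where d: "0 < d" "\<And>r. \<bar>r\<bar> < d \<Longrightarrow> P r"
    using PQ(1) unfolding eventually_nhds_metric by (auto simp: dist_real_def)
  have "\<forall>\<^sub>F h in at_right 0. Q h \<and> 0 < h \<and> h < (d::real)"
    using PQ(2) eventually_at_right_less[of 0] d(1)
    by (intro eventually_conj) (auto simp: eventually_at_right_field)
  then show "\<forall>\<^sub>F h in at_right 0. dist ((1 / h) * (LBINT r. indicator {0..<h} r * J r h)) l < e"
  proof eventually_elim
    case (elim h)
    have ih: "integrable lborel (\<lambda>r::real. indicator {0..<h} r * c :: real)" for c
      using elim by (intro integrable_mult_left integrable_real_indicator) auto
    have m: "(LBINT r. indicator {0..<h} r * c) = h * c" for c :: real
      using elim by simp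
    have "\<bar>(LBINT r. indicator {0..<h} r * J r h) - h * l\<bar> = \<bar>LBINT r. indicator {0..<h} r * J r h - indicator {0..<h} r * l\<bar>"
      using int[of h] ih[of l] elim by (simp add: m)
    also have "\<dots> \<le> (LBINT r. \<bar>indicator {0..<h} r * J r h - indicator {0..<h} r * l\<bar>)"
      by (rule integral_abs_bound)
    also have "\<dots> \<le> (LBINT r. indicator {0..<h} r * (e / 2))"
    proof (rule integral_mono)
      show "integrable lborel (\<lambda>r. \<bar>indicator {0..<h} r * J r h - indicator {0..<h} r * l\<bar>)"
        using int[of h] ih[of l] elim by auto
      fix r show "\<bar>indicator {0..<h} r * J r h - indicator {0..<h} r * l\<bar> \<le> indicator {0..<h} r * (e / 2)"
        using J'[OF d(2)[of r], of h] elim by (auto simp: indicator_def dist_real_def)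
    qed (rule ih)
    also have "\<dots> = h * (e / 2)" by (rule m)
    finally have "\<bar>(LBINT r. indicator {0..<h} r * J r h) - h * l\<bar> \<le> h * (e / 2)" .
    moreover have "(1 / h) * (LBINT r. indicator {0..<h} r * J r h) - l = (1 / h) * ((LBINT r. indicator {0..<h} r * J r h) - h * l)"
      using elim by (simp add: field_simps)
    ultimately have "\<bar>(1 / h) * (LBINT r. indicator {0..<h} r * J r h) - l\<bar> \<le> (1 / h) * (h * (e / 2))"
      using elim by (simp only: abs_mult) (intro mult_mono, auto)
    then show ?case using elim e by (simp add: dist_real_def)
  qed
qed

section \<open>Statements at almost every time and the du Bois-Reymond lemma\<close>

lemma AE_exists_in_interval:
  assumes "AE t\<in>{0<..<T} in lborel. P t" "0 \<le> a" "a < b" "b \<le> (T::real)"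
  shows "\<exists>t. a < t \<and> t < b \<and> P t"
proof (rule ccontr)
  assume no: "\<not> ?thesis"
  have "AE t in lborel. \<not> (t \<in> {a<..<b})"
    using assms(1) by eventually_elim (use no assms(2-) in auto)
  then have "emeasure lborel {a<..<b} = 0"
    by (subst (asm) AE_iff_measurable[of "{a<..<b}"]) auto
  then show False using assms(3) by simp
qed

text \<open>An inequality outside a null set passes to the limit at 0, since every interval (0, d)
  contains a time at which it holds.\<close>

lemma AE_at_right_limit_le:
  fixes f g :: "real \<Rightarrow> real"
  assumes T: "0 < T" and ae: "AE t\<in>{0<..<T} in lborel. f t \<le> g t"
    and f: "(f \<longlongrightarrow> a) (at_right 0)" and g: "(g \<longlongrightarrow> b) (at_right 0)"
  shows "a \<le> b"
proof (rule ccontr)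
  assume "\<not> a \<le> b"
  then have "((\<lambda>t. f t - g t) \<longlongrightarrow> a - b) (at_right 0)" "0 < a - b" by (auto intro!: tendsto_diff f g)
  then have "\<forall>\<^sub>F t in at_right 0. 0 < f t - g t" by (rule order_tendstoD)
  then obtain d where d: "0 < d" "\<And>t. 0 < t \<Longrightarrow> t < d \<Longrightarrow> 0 < f t - g t"
    unfolding eventually_at_right_field by auto
  obtain t where "0 < t" "t < min d T" "f t \<le> g t"
    using AE_exists_in_interval[OF ae, of 0 "min d T"] d T by auto
  then show False using d(2)[of t] by auto
qed

lemma AE_at_right_limit_unique:
  fixes g :: "real \<Rightarrow> real"
  assumes T: "0 < T" and ae: "AE t\<in>{0<..<T} in lborel. g t = f t"
    and g: "(g \<longlongrightarrow> a) (at_right 0)" and f: "(f \<longlongrightarrow> b) (at_right 0)"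
  shows "a = b"
proof (rule antisym)
  show "a \<le> b" by (rule AE_at_right_limit_le[OF T _ g f]) (use ae in \<open>auto elim: eventually_mono\<close>)
  show "b \<le> a" by (rule AE_at_right_limit_le[OF T _ f g]) (use ae in \<open>auto elim: eventually_mono\<close>)
qed

text \<open>The averages converge in L^1 by continuity of translations, hence almost everywhere
  along a subsequence. One sequence of scales is enough, because the increments studied below are
  known to converge along all scales.\<close>

lemma averages_AE_subseq:
  fixes g s :: "real \<Rightarrow> real"
  assumes g: "integrable lborel g"
    and s: "integrable lborel s" "\<And>r. 0 \<le> s r" "\<And>r. r \<notin> {0..1} \<Longrightarrow> s r = 0" "(LBINT r. s r) = 1"
  obtains e :: "nat \<Rightarrow> real" where "\<And>n. 0 < e n" "e \<longlonglongrightarrow> 0"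
    "AE a in lborel. (\<lambda>n. LBINT r. g (a + e n * r) * s r) \<longlonglongrightarrow> g a"
proof -
  have [measurable]: "g \<in> borel_measurable borel" "s \<in> borel_measurable borel" using g s by auto
  define w where "w = (\<lambda>\<tau>. LBINT a. \<bar>g (a + \<tau>) - g a\<bar>)"
  have Lg: "Lp 1 lborel g" using g by (simp add: Lp1)
  have wlim: "(w \<longlongrightarrow> 0) (nhds 0)"
    using LpconvD(3)[OF Lpconv_shift[OF Lg]] by (simp add: w_def)
  define e where "e = (\<lambda>n. 1 / real (Suc n))"
  have e0: "\<And>n. 0 < e n" "e \<longlonglongrightarrow> 0" unfolding e_def using LIMSEQ_inverse_real_of_nat by (auto simp: inverse_eq_divide)
  define D where "D = (\<lambda>n a. (LBINT r. g (a + e n * r) * s r) - g a)"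
  have tri: "integrable lborel (\<lambda>z::real \<times> real. s (snd z) * g (fst z + e n * snd z))" for n
    using Lp_sheared[of 1 g s "\<lambda>r. e n * r"] Lg s by (simp add: Lp1)
  have tri0: "integrable lborel (\<lambda>z::real \<times> real. s (snd z) * g (fst z))" for n
    using Lp_sheared[of 1 g s "\<lambda>r. 0"] Lg s by (simp add: Lp1)
  have Dae: "AE a in lborel. D n a = (LBINT r. s r * (g (a + e n * r) - g a))" for n
    using lborel_AE_integrable_fst[OF tri[of n]]
  proof eventually_elim
    case (elim a)
    then have "(LBINT r. s r * (g (a + e n * r) - g a)) = (LBINT r. s r * g (a + e n * r)) - (LBINT r. s r * g a)"
      using s(1) by (simp add: right_diff_distrib)
    then show ?case using s(4) by (simp add: D_def mult.commute)
  qed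
  have Dint: "integrable lborel (D n)" for n
    using lborel_integrable_fst[OF tri[of n]] g by (simp add: D_def[abs_def] mult.commute)
  have t2: "integrable lborel (\<lambda>z::real \<times> real. s (snd z) * \<bar>g (fst z + e n * snd z) - g (fst z)\<bar>)" for n
    using integrable_abs[OF integrable_diff[OF tri[of n] tri0]] s(2)
    by (simp add: right_diff_distrib[symmetric] abs_mult)
  \<comment> \<open>Fubini bounds the L^1 error of the average by the average of \<open>w\<close>,
    the L^1 modulus of continuity of \<open>g\<close> under translation.\<close>
  have Dle: "(LBINT a. \<bar>D n a\<bar>) \<le> (LBINT r. s r * w (e n * r))" for n
  proof -
    have "(LBINT a. \<bar>D n a\<bar>) \<le> (LBINT a. LBINT r. s r * \<bar>g (a + e n * r) - g a\<bar>)"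
    proof (rule integral_mono_AE)
      show "integrable lborel (\<lambda>a. \<bar>D n a\<bar>)" using Dint by simp
      show "integrable lborel (\<lambda>a. LBINT r. s r * \<bar>g (a + e n * r) - g a\<bar>)"
        using lborel_integrable_fst[OF t2[of n]] by simp
      show "AE a in lborel. \<bar>D n a\<bar> \<le> (LBINT r. s r * \<bar>g (a + e n * r) - g a\<bar>)"
        using Dae[of n]
      proof eventually_elim
        case (elim a)
        have "\<bar>D n a\<bar> \<le> (LBINT r. \<bar>s r * (g (a + e n * r) - g a)\<bar>)"
          unfolding elim by (rule integral_abs_bound)
        then show ?case using s(2) by (simp add: abs_mult)
      qed
    qed
    also have "\<dots> = (LBINT r. LBINT a. s r * \<bar>g (a + e n * r) - g a\<bar>)"
      using lborel_integral_fst[OF t2[of n]] lborel_integral_snd[OF t2[of n]] by simp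
    also have "\<dots> = (LBINT r. s r * w (e n * r))" by (simp add: w_def)
    finally show ?thesis .
  qed
  have "(\<lambda>n. LBINT a. norm (D n a)) \<longlonglongrightarrow> 0"
  proof (rule tendstoI)
    fix \<epsilon> :: real assume eps: "0 < \<epsilon>"
    obtain d where d: "0 < d" "\<And>r. \<bar>r\<bar> < d \<Longrightarrow> \<bar>w r\<bar> < \<epsilon> / 2"
      using tendstoD[OF wlim, of "\<epsilon> / 2"] eps unfolding eventually_nhds_metric by (auto simp: dist_real_def)
    have "\<forall>\<^sub>F n in sequentially. e n < d" using order_tendstoD(2)[OF e0(2) d(1)] .
    then show "\<forall>\<^sub>F n in sequentially. dist (LBINT a. norm (D n a)) 0 < \<epsilon>"
    proof eventually_elim
      case (elim n)
      have "(LBINT r. s r * w (e n * r)) \<le> (LBINT r. s r * (\<epsilon> / 2))"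
      proof (rule integral_mono)
        show "integrable lborel (\<lambda>r. s r * w (e n * r))"
          using lborel_integrable_snd[OF t2[of n]] by (simp add: w_def)
        show "integrable lborel (\<lambda>r. s r * (\<epsilon> / 2))" using s by simp
        fix r show "s r * w (e n * r) \<le> s r * (\<epsilon> / 2)"
        proof (cases "r \<in> {0..1}")
          case True
          then have "e n * r \<le> e n * 1" using e0(1)[of n] by (intro mult_left_mono) auto
          moreover have "0 \<le> e n * r" using True e0(1)[of n] by simp
          ultimately have "\<bar>e n * r\<bar> < d" using elim by simp
          then show ?thesis using d(2)[of "e n * r"] s(2)[of r] by (intro mult_left_mono) auto
        qed (simp add: s(3))
      qed
      also have "\<dots> = \<epsilon> / 2" using s(4) by simp
      finally have "(LBINT a. \<bar>D n a\<bar>) \<le> \<epsilon> / 2" using Dle[of n] by linarith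
      moreover have "0 \<le> (LBINT a. \<bar>D n a\<bar>)" by simp
      ultimately show ?case using eps by (simp add: dist_real_def)
    qed
  qed
  then obtain \<sigma> where \<sigma>: "strict_mono \<sigma>" "AE a in lborel. (\<lambda>n. D (\<sigma> n) a) \<longlonglongrightarrow> 0"
    using tendsto_L1_AE_subseq[of lborel D, OF Dint] by blast
  show thesis
  proof (rule that[of "\<lambda>n. e (\<sigma> n)"])
    show "(\<lambda>n. e (\<sigma> n)) \<longlonglongrightarrow> 0" using LIMSEQ_subseq_LIMSEQ[OF e0(2) \<sigma>(1)] by (simp add: comp_def)
    show "AE a in lborel. (\<lambda>n. LBINT r. g (a + e (\<sigma> n) * r) * s r) \<longlonglongrightarrow> g a"
      using \<sigma>(2) by eventually_elim (auto simp: D_def intro: LIM_zero_cancel)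
  qed (rule e0)
qed

text \<open>Increments of averages converge to increments of \<open>g\<close> at points where the
  averages do, and these must then equal the integral of \<open>f\<close>. The kernel is left
  general for two uses: the derivative of a smooth step for weak time derivatives, and the indicator
  of the unit interval for the energy.\<close>

lemma du_Bois_Reymond_averages:
  fixes g f s :: "real \<Rightarrow> real"
  assumes T: "0 < T" and g: "integrable lborel g" and f: "integrable lborel f"
    and s: "integrable lborel s" "\<And>r. 0 \<le> s r" "\<And>r. r \<notin> {0..1} \<Longrightarrow> s r = 0" "(LBINT r. s r) = 1"
    and lim: "\<And>a b. 0 < a \<Longrightarrow> a < b \<Longrightarrow> b < T \<Longrightarrow>
      ((\<lambda>e. (LBINT r. g (b + e * r) * s r) - (LBINT r. g (a + e * r) * s r)) \<longlongrightarrow> (LBINT t. indicator {a<..<b} t * f t)) (at_right 0)"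
  shows "\<exists>c. AE t\<in>{0<..<T} in lborel. g t = c + (LBINT x. indicator {0<..<t} x * f x)"
proof -
  obtain e :: "nat \<Rightarrow> real" where e: "\<And>n. 0 < e n" "e \<longlonglongrightarrow> 0"
    and ae: "AE a in lborel. (\<lambda>n. LBINT r. g (a + e n * r) * s r) \<longlonglongrightarrow> g a"
    using averages_AE_subseq[OF g s] by blast
  have er: "filterlim e (at_right 0) sequentially"
    unfolding filterlim_at using e(1) by (auto intro!: always_eventually e(2) simp: less_imp_neq[symmetric])
  have incr: "g b - g a = (LBINT t. indicator {a<..<b} t * f t)"
    if "0 < a" "a < b" "b < T" "(\<lambda>n. LBINT r. g (a + e n * r) * s r) \<longlonglongrightarrow> g a" "(\<lambda>n. LBINT r. g (b + e n * r) * s r) \<longlonglongrightarrow> g b" for a b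
    using LIMSEQ_unique[OF tendsto_diff[OF that(5,4)] filterlim_compose[OF lim[OF that(1-3)] er]] .
  have fi: "integrable lborel (\<lambda>x. indicator {a<..<b} x * f x)" for a b
    using integrable_mult_indicator[OF _ f, of "{a<..<b}"] by simp
  have split: "(LBINT x. indicator {0<..<b} x * f x) = (LBINT x. indicator {0<..<a} x * f x) + (LBINT x. indicator {a<..<b} x * f x)"
    if "0 < a" "a < b" for a b
  proof -
    have "(LBINT x. indicator {0<..<b} x * f x) = (LBINT x. indicator {0<..<a} x * f x + indicator {a<..<b} x * f x)"
    proof (rule integral_cong_AE)
      have "AE x in lborel. x \<noteq> a" by (rule AE_lborel_singleton)
      then show "AE x in lborel. indicator {0<..<b} x * f x = indicator {0<..<a} x * f x + indicator {a<..<b} x * f x"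
        by eventually_elim (use that in \<open>auto simp: indicator_def\<close>)
    qed (use fi[THEN borel_measurable_integrable] in auto)
    then show ?thesis using fi by simp
  qed
  have "AE a\<in>{0<..<T} in lborel. (\<lambda>n. LBINT r. g (a + e n * r) * s r) \<longlonglongrightarrow> g a"
    using ae by eventually_elim simp
  then obtain a where a: "0 < a" "a < T" "(\<lambda>n. LBINT r. g (a + e n * r) * s r) \<longlonglongrightarrow> g a"
    using AE_exists_in_interval[of T "\<lambda>a. (\<lambda>n. LBINT r. g (a + e n * r) * s r) \<longlonglongrightarrow> g a" 0 T] T
    by auto
  \<comment> \<open>All other good times are compared with one good base time \<open>a\<close>, on
    either side of it.\<close>
  define c where "c = g a - (LBINT x. indicator {0<..<a} x * f x)"
  have "AE t\<in>{0<..<T} in lborel. g t = c + (LBINT x. indicator {0<..<t} x * f x)"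
    using ae
  proof eventually_elim
    case (elim t)
    show ?case
    proof
      assume t: "t \<in> {0<..<T}"
      consider "t < a" | "t = a" | "a < t" by linarith
      then show "g t = c + (LBINT x. indicator {0<..<t} x * f x)"
      proof cases
        case 1
        then show ?thesis using incr[of t a] split[of t a] t a elim by (simp add: c_def)
      next
        case 3
        then show ?thesis using incr[of a t] split[of a t] t a elim by (simp add: c_def)
      qed (simp add: c_def)
    qed
  qed
  then show ?thesis by blast
qed

lemma tendsto_integral_initial:
  fixes f :: "real \<Rightarrow> real"
  assumes f: "integrable lborel f"
  shows "((\<lambda>t. LBINT x. indicator {0<..<t} x * f x) \<longlongrightarrow> 0) (at_right 0)"
proof -
  have [measurable]: "f \<in> borel_measurable borel" using f by auto
  have "((\<lambda>t. LBINT x. indicator {0<..<t} x * f x) \<longlongrightarrow> (LINT x|(lborel::real measure). 0)) (at_right 0)"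
  proof (rule tendsto_at_right_sequentially[of _ 1])
    show "(0::real) < 1" by simp
    fix S :: "nat \<Rightarrow> real" assume S: "\<And>n. 0 < S n" "\<And>n. S n < 1" "decseq S" "S \<longlonglongrightarrow> 0"
    show "(\<lambda>n. LBINT x. indicator {0<..<S n} x * f x) \<longlonglongrightarrow> (LINT x|(lborel::real measure). 0)"
    proof (rule integral_dominated_convergence[where w="\<lambda>x. \<bar>f x\<bar>"])
      show "AE x in lborel. (\<lambda>n. indicator {0<..<S n} x * f x) \<longlonglongrightarrow> 0"
      proof (rule AE_I2)
        fix x
        have "\<forall>\<^sub>F n in sequentially. indicator {0<..<S n} x * f x = 0"
        proof (cases "0 < x")
          case True
          have "\<forall>\<^sub>F n in sequentially. S n < x" using order_tendstoD(2)[OF S(4) True] .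
          then show ?thesis by eventually_elim auto
        qed auto
        then show "(\<lambda>n. indicator {0<..<S n} x * f x) \<longlonglongrightarrow> 0" by (rule tendsto_eventually)
      qed
    qed (use f in \<open>auto simp: indicator_def\<close>)
  qed
  then show ?thesis by simp
qed

text \<open>The test function is a mollified indicator of the interval from a to b, the difference
  of two rescaled steps. Its derivative is the difference of two averaging kernels attached to
  \<open>a\<close> and to \<open>b\<close>.\<close>

lemma du_Bois_Reymond_smooth:
  fixes g f :: "real \<Rightarrow> real"
  assumes T: "0 < T" and g: "integrable lborel g" and f: "integrable lborel f"
    and weak: "\<And>\<theta> a b. smooth_fun \<theta> \<Longrightarrow> 0 < a \<Longrightarrow> b < T \<Longrightarrow> (\<And>t. t \<notin> {a..b} \<Longrightarrow> \<theta> t = 0) \<Longrightarrow>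
       (LBINT t. g t * dderiv 1 \<theta> t + f t * \<theta> t) = 0"
  shows "\<exists>c. AE t\<in>{0<..<T} in lborel. g t = c + (LBINT x. indicator {0<..<t} x * f x)"
proof -
  have [measurable]: "g \<in> borel_measurable borel" "f \<in> borel_measurable borel" using g f by auto
  obtain S s where S: "smooth_fun S" and sc: "continuous_on UNIV s"
    and dS: "\<And>t. (S has_real_derivative s t) (at t)" and s0: "\<And>t::real. 0 \<le> s t" "\<And>t. t \<le> 0 \<or> 1 \<le> t \<Longrightarrow> s t = 0"
    and S0: "\<And>t. t \<le> 0 \<Longrightarrow> S t = 0" "\<And>t. 1 \<le> t \<Longrightarrow> S t = 1" "\<And>t. 0 \<le> S t" "\<And>t. S t \<le> 1"
    using smooth_step_exists by blast
  have [measurable]: "s \<in> borel_measurable borel" using sc by (rule borel_measurable_continuous_onI)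
  have s0': "r \<notin> {0..1} \<Longrightarrow> s r = 0" for r using s0(2)[of r] by auto
  have ind: "s r * indicator {0..1} r = s r" for r using s0'[of r] by (auto simp: indicator_def)
  have hb: "has_bochner_integral lborel (\<lambda>x. s x * indicator {0..1} x) (S 1 - S 0)"
    by (rule has_bochner_integral_FTC_Icc_real) (use dS sc in \<open>auto intro: continuous_on_interior[of UNIV]\<close>)
  then have si: "integrable lborel s" "(LBINT r. s r) = 1"
    using S0(1)[of 0] S0(2)[of 1] unfolding ind by (auto simp: has_bochner_integral_iff)
  obtain B where B: "\<And>r. s r \<le> B"
  proof -
    have "bounded (s ` {0..1})" by (rule compact_imp_bounded[OF compact_continuous_image]) (auto intro: continuous_on_subset[OF sc])
    then obtain B where "\<forall>r\<in>{0..1}. \<bar>s r\<bar> \<le> B" by (auto simp: bounded_iff)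
    then have "s r \<le> max B 0" for r using s0'[of r] by (cases "r \<in> {0..1}") force+
    then show thesis by (rule that)
  qed
  define h where "h = (\<lambda>e a t. S ((t - a) / e))"
  have hs: "smooth_fun (h e a)" for e a
    using smooth_affine[of "\<lambda>t. t / e" S "- a / e"] S
    by (simp add: h_def[abs_def] diff_divide_distrib bounded_linear_divide)
  have hD: "(h e a has_real_derivative s ((t - a) / e) / e) (at t)" if "e \<noteq> 0" for e a t
  proof -
    have "((\<lambda>t. (t - a) / e) has_real_derivative 1 / e) (at t)"
      using that by (auto intro!: derivative_eq_intros)
    from DERIV_chain2[OF dS this] show ?thesis by (simp add: h_def[abs_def])
  qed
  have hd: "dderiv 1 (h e a) t = s ((t - a) / e) / e" if "e \<noteq> 0" for e a t
    by (rule dderiv_real[OF hD[OF that]])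
  show ?thesis
  proof (rule du_Bois_Reymond_averages[OF T g f si(1) s0(1) s0' si(2)])
    fix a b assume ab: "0 < a" "a < b" "b < T"
    define \<theta> where "\<theta> = (\<lambda>e t. h e a t - h e b t)"
    have th: "\<theta> e = (\<lambda>t. h e a t + (- 1) * h e b t)" for e by (auto simp: \<theta>_def)
    have ths: "smooth_fun (\<theta> e)" for e unfolding th by (intro smooth_add smooth_mult smooth_const hs)
    have thd: "dderiv 1 (\<theta> e) t = s ((t - a) / e) / e - s ((t - b) / e) / e" if "e \<noteq> 0" for e t
    proof -
      have dm: "dderiv 1 (\<lambda>t. (- 1) * h e b t) t = - dderiv 1 (h e b) t"
        using dderiv_real[OF DERIV_cmult[OF hD[OF that], of "- 1"]] by (simp add: hd[OF that])
      have "dderiv 1 (\<theta> e) = (\<lambda>t. dderiv 1 (h e a) t + dderiv 1 (\<lambda>t. (- 1) * h e b t) t)"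
        unfolding th by (rule dderiv_add) (intro smooth_differentiable smooth_mult smooth_const hs)+
      then show ?thesis using dm that by (simp add: hd)
    qed
    \<comment> \<open>The condition on \<open>e\<close> keeps the support, the interval from
      \<open>a\<close> to \<open>b + e\<close>, inside (0, T). The substitution t = c + e r turns
      the rescaled kernel back into \<open>s\<close>.\<close>
    have eq: "(LBINT r. g (b + e * r) * s r) - (LBINT r. g (a + e * r) * s r) = (LBINT t. f t * \<theta> e t)"
      if e: "0 < e" "e < T - b" for e
    proof -
      have vanish: "\<theta> e t = 0" if "t \<notin> {a..b + e}" for t
        using that e ab S0(1)[of "(t - a) / e"] S0(1)[of "(t - b) / e"] S0(2)[of "(t - a) / e"] S0(2)[of "(t - b) / e"]
        by (auto simp: \<theta>_def h_def not_le field_simps)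
      have w: "(LBINT t. g t * dderiv 1 (\<theta> e) t + f t * \<theta> e t) = 0"
        by (rule weak[OF ths, of a "b + e"]) (use ab e vanish in auto)
      have ig: "integrable lborel (\<lambda>t. g t * (s ((t - c) / e) / e))" for c
        by (rule integrable_bounded_mult[OF g, where B="B / e"]) (use B s0(1) e in \<open>auto simp: divide_right_mono\<close>)
      have ab1: "\<bar>\<theta> e t\<bar> \<le> 1" for t
        using S0(3,4)[of "(t - a) / e"] S0(3,4)[of "(t - b) / e"] by (auto simp: \<theta>_def h_def)
      have [measurable]: "\<theta> e \<in> borel_measurable borel" by (rule smooth_borel[OF ths])
      have iF: "integrable lborel (\<lambda>t. f t * \<theta> e t)"
        by (rule integrable_bounded_mult[OF f, where B=1]) (use ab1 in auto)
      have sub: "(LBINT t. g t * (s ((t - c) / e) / e)) = (LBINT r. g (c + e * r) * s r)" for c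
        using lborel_integral_real_affine[of e "\<lambda>t. g t * (s ((t - c) / e) / e)" c] e by simp
      have "0 = (LBINT t. g t * (s ((t - a) / e) / e) - g t * (s ((t - b) / e) / e) + f t * \<theta> e t)"
        using w e by (simp add: thd right_diff_distrib)
      also have "\<dots> = (LBINT t. g t * (s ((t - a) / e) / e)) - (LBINT t. g t * (s ((t - b) / e) / e)) + (LBINT t. f t * \<theta> e t)"
        using ig iF by simp
      finally show ?thesis unfolding sub by simp
    qed
    have "((\<lambda>e. LBINT t. f t * \<theta> e t) \<longlongrightarrow> (LBINT t. indicator {a<..<b} t * f t)) (at_right 0)"
    proof (rule tendsto_at_right_sequentially[of _ 1])
      fix q :: "nat \<Rightarrow> real" assume q: "\<And>n. 0 < q n" "\<And>n. q n < 1" "decseq q" "q \<longlonglongrightarrow> 0"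
      show "(\<lambda>n. LBINT t. f t * \<theta> (q n) t) \<longlonglongrightarrow> (LBINT t. indicator {a<..<b} t * f t)"
      proof (rule integral_dominated_convergence[where w="\<lambda>x. \<bar>f x\<bar>"])
        have [measurable]: "\<theta> e \<in> borel_measurable borel" for e by (rule smooth_borel[OF ths])
        show "(\<lambda>t. f t * \<theta> (q n) t) \<in> borel_measurable lborel" for n by measurable
        have hlim: "(\<lambda>n. h (q n) c t) \<longlonglongrightarrow> (if t \<le> c then 0 else 1)" for c t
        proof (cases "t \<le> c")
          case True
          then have "h (q n) c t = 0" for n using q(1)[of n] unfolding h_def by (intro S0) (auto simp: divide_nonpos_pos)
          then show ?thesis using True by simp
        next
          case False
          have "\<forall>\<^sub>F n in sequentially. q n < t - c" using order_tendstoD(2)[OF q(4)] False by auto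
          then have "\<forall>\<^sub>F n in sequentially. h (q n) c t = 1"
            by eventually_elim (use q(1) in \<open>auto simp: h_def field_simps intro!: S0(2)\<close>)
          then show ?thesis using False by (auto intro: tendsto_eventually)
        qed
        have "AE t in lborel. t \<noteq> b" by (rule AE_lborel_singleton)
        then show "AE t in lborel. (\<lambda>n. f t * \<theta> (q n) t) \<longlonglongrightarrow> indicator {a<..<b} t * f t"
        proof eventually_elim
          case (elim t)
          have "(\<lambda>n. f t * \<theta> (q n) t) \<longlonglongrightarrow> f t * ((if t \<le> a then 0 else 1) - (if t \<le> b then 0 else 1))"
            unfolding \<theta>_def by (intro tendsto_intros hlim)
          moreover have "f t * ((if t \<le> a then 0 else 1) - (if t \<le> b then 0 else 1)) = indicator {a<..<b} t * f t"
            using elim ab by (auto simp: indicator_def)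
          ultimately show ?case by simp
        qed
        show "AE t in lborel. norm (f t * \<theta> (q n) t) \<le> \<bar>f t\<bar>" for n
        proof (rule AE_I2)
          fix t
          have "\<bar>\<theta> (q n) t\<bar> \<le> 1" using S0(3,4)[of "(t - a) / q n"] S0(3,4)[of "(t - b) / q n"] by (auto simp: \<theta>_def h_def)
          then show "norm (f t * \<theta> (q n) t) \<le> \<bar>f t\<bar>" by (simp add: abs_mult mult_left_le)
        qed
      qed (use f in auto)
    qed simp
    moreover have "\<forall>\<^sub>F e in at_right 0. (LBINT t. f t * \<theta> e t) = (LBINT r. g (b + e * r) * s r) - (LBINT r. g (a + e * r) * s r)"
      unfolding eventually_at_right_field using ab eq by (intro exI[of _ "T - b"]) auto
    ultimately show "((\<lambda>e. (LBINT r. g (b + e * r) * s r) - (LBINT r. g (a + e * r) * s r)) \<longlongrightarrow> (LBINT t. indicator {a<..<b} t * f t)) (at_right 0)"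
      by (rule Lim_transform_eventually)
  qed
qed

section \<open>Conservation laws at almost every time\<close>

text \<open>Separability of a set of continuous functions, with the dense subset taken from the set
  itself, so that its members remain test functions. Each function is described up to small error by
  finitely many values from a countable dense set, and one representative is chosen for each
  description that is realised.\<close>

lemma countable_uniform_dense:
  fixes F :: "('a::metric_space \<Rightarrow> 'b::{second_countable_topology, metric_space}) set"
  assumes K: "compact K" and F: "\<And>f. f \<in> F \<Longrightarrow> continuous_on K f"
  obtains D where "countable D" "D \<subseteq> F" "\<And>f e. f \<in> F \<Longrightarrow> 0 < e \<Longrightarrow> \<exists>g\<in>D. \<forall>x\<in>K. dist (f x) (g x) < e"
proof -
  have "\<exists>C. finite C \<and> C \<subseteq> K \<and> K \<subseteq> (\<Union>c\<in>C. ball c (1 / real (Suc n)))" for n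
  proof -
    have o: "open (ball c (1 / real (Suc n)))" for c :: 'a by simp
    have s: "K \<subseteq> (\<Union>c\<in>K. ball c (1 / real (Suc n)))" by auto
    show ?thesis using compactE_image[OF K o s] by metis
  qed
  then have "\<exists>xs. set xs \<subseteq> K \<and> K \<subseteq> (\<Union>c\<in>set xs. ball c (1 / real (Suc n)))" for n
    by (metis finite_list)
  then obtain L where L: "\<And>n. set (L n) \<subseteq> K" "\<And>n. K \<subseteq> (\<Union>c\<in>set (L n). ball c (1 / real (Suc n)))"
    by metis
  obtain Q :: "'b set" where Q: "countable Q" "\<And>X. open X \<Longrightarrow> X \<noteq> {} \<Longrightarrow> \<exists>d\<in>Q. d \<in> X"
    using countable_dense_exists by metis
  \<comment> \<open>The data \<open>(n, m, q)\<close> record a mesh, an accuracy and one value for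
    each ball of the mesh. Two functions with the same data are uniformly within twice the
    accuracy.\<close>
  define P where "P = (\<lambda>n m q g. g \<in> F \<and> length q = length (L n) \<and>
      (\<forall>i<length (L n). \<forall>x\<in>K \<inter> ball (L n ! i) (1 / real (Suc n)). dist (g x) (q ! i) < 1 / real (Suc m)))"
  define D where "D = (\<lambda>(n, m, q). SOME g. P n m q g) ` {(n, m, q). q \<in> lists Q \<and> (\<exists>g. P n m q g)}"
  show thesis
  proof (rule that[of D])
    have "countable ((UNIV :: nat set) \<times> (UNIV :: nat set) \<times> lists Q)" by (intro countable_SIGMA countable_lists Q) auto
    then have "countable {(n :: nat, m :: nat, q). q \<in> lists Q \<and> (\<exists>g. P n m q g)}"
      by (rule countable_subset[rotated]) auto
    then show "countable D" unfolding D_def by (rule countable_image)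
    have Psome: "P n m q (SOME g. P n m q g)" if "P n m q g" for n m q g using someI[of "P n m q" g] that by simp
    then show "D \<subseteq> F" unfolding D_def by (auto simp: P_def)
    fix f and e :: real assume f: "f \<in> F" and e: "0 < e"
    obtain m where m: "1 / real (Suc m) < e / 2" using e by (meson half_gt_zero nat_approx_posE)
    define d where "d = 1 / real (Suc m) / 2"
    have d: "0 < d" by (simp add: d_def)
    have dd: "1 / real (Suc m) = d + d" unfolding d_def by (rule field_sum_of_halves[symmetric])
    have "uniformly_continuous_on K f" using F[OF f] K by (rule compact_uniformly_continuous)
    then obtain \<delta> where del: "0 < \<delta>" "\<And>x x'. x \<in> K \<Longrightarrow> x' \<in> K \<Longrightarrow> dist x' x < \<delta> \<Longrightarrow> dist (f x') (f x) < d"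
      using d unfolding uniformly_continuous_on_def by metis
    obtain n where n: "1 / real (Suc n) < \<delta>" using del(1) by (meson nat_approx_posE)
    have "\<exists>y\<in>Q. y \<in> ball (f x) d" for x using Q(2)[of "ball (f x) d"] d by auto
    then obtain y where y: "\<And>x. y x \<in> Q" "\<And>x. dist (f x) (y x) < d" by (metis mem_ball)
    define q where "q = map y (L n)"
    have q: "q \<in> lists Q" using y by (auto simp: q_def)
    have Pf: "P n m q f"
      unfolding P_def
    proof (intro conjI allI impI ballI f)
      fix i x assume i: "i < length (L n)" and x: "x \<in> K \<inter> ball (L n ! i) (1 / real (Suc n))"
      have "L n ! i \<in> K" using L(1) i by (meson nth_mem subsetD)
      then have "dist (f x) (f (L n ! i)) < d" using del(2)[of "L n ! i" x] x n by (auto simp: dist_commute)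
      then show "dist (f x) (q ! i) < 1 / real (Suc m)"
        using y(2)[of "L n ! i"] i dist_triangle[of "f x" "q ! i" "f (L n ! i)"] dd by (simp add: q_def del: of_nat_Suc)
    qed (simp add: q_def)
    define g where "g = (SOME g. P n m q g)"
    have Pg: "P n m q g" unfolding g_def by (rule Psome[OF Pf])
    have "g \<in> D" unfolding D_def g_def using q Pf by force
    moreover have "\<forall>x\<in>K. dist (f x) (g x) < e"
    proof
      fix x assume x: "x \<in> K"
      then have "x \<in> (\<Union>c\<in>set (L n). ball c (1 / real (Suc n)))" using L(2)[of n] by (rule subsetD[rotated])
      then obtain c where c: "c \<in> set (L n)" "x \<in> ball c (1 / real (Suc n))" by (rule UN_E)
      then obtain i where i: "i < length (L n)" "x \<in> ball (L n ! i) (1 / real (Suc n))"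
        unfolding in_set_conv_nth by auto
      have "dist (f x) (q ! i) < 1 / real (Suc m)" "dist (g x) (q ! i) < 1 / real (Suc m)"
        using Pf Pg i x by (auto simp: P_def)
      then show "dist (f x) (g x) < e" using m dist_triangle2[of "f x" "g x" "q ! i"] by linarith
    qed
    ultimately show "\<exists>g\<in>D. \<forall>x\<in>K. dist (f x) (g x) < e" by blast
  qed
qed

section \<open>The spatial region, its exhaustion, and tested conservation laws\<close>

definition valid_setting :: "('n::finite) setting \<Rightarrow> bool" where
  "valid_setting st \<longleftrightarrow> (\<forall>\<Omega>. st = Domain \<Omega> \<longrightarrow> open \<Omega> \<and> bounded \<Omega>)"

lemma region_Borel: "valid_setting st \<Longrightarrow> region st \<in> sets borel"
  by (cases st) (auto simp: valid_setting_def)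

lemma region_bounded: "valid_setting st \<Longrightarrow> bounded (region st)"
  by (cases st) (auto simp: valid_setting_def)

lemma region_finite: "valid_setting st \<Longrightarrow> emeasure lborel (region st) < \<infinity>"
  using region_bounded emeasure_bounded_finite by auto

text \<open>On the torus the exhaustion is constantly the unit cell, since test functions need not
  vanish on its faces and local integrability means integrability over the cell. On a domain the
  compact sets eventually contain every compact subset, in particular the support of any test
  function.\<close>

lemma region_exhaustion:
  assumes "valid_setting st"
  obtains K :: "nat \<Rightarrow> (real^'n::finite) set" where "\<And>k. compact (K k)" "\<And>k. K k \<subseteq> region st"
    "\<And>k. K k \<subseteq> K (Suc k)" "(\<Union>k. K k) = region st"
    "\<And>\<phi>. test_S st \<phi> \<Longrightarrow> \<exists>k. \<forall>x\<in>region st - K k. \<phi> x = 0"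
    "\<And>k h. loc_int_S st (h :: _ \<Rightarrow> real) \<Longrightarrow> set_integrable lebesgue (K k) h"
proof (cases st)
  case Torus
  show thesis by (rule that[of "\<lambda>k. cbox 0 One"]) (auto simp: Torus)
next
  case (Domain \<Omega>)
  then have "open \<Omega>" using assms by (auto simp: valid_setting_def)
  then obtain C where C: "\<And>n. compact (C n)" "\<And>n. C n \<subseteq> \<Omega>" "\<And>n. C n \<subseteq> interior (C (Suc n))"
     "\<Union> (range C) = \<Omega>" "\<And>K. compact K \<Longrightarrow> K \<subseteq> \<Omega> \<Longrightarrow> \<exists>N. \<forall>n\<ge>N. K \<subseteq> C n"
    using open_Union_compact_subsets[OF \<open>open \<Omega>\<close>] by metis
  show thesis
  proof (rule that[of C])
    show "C k \<subseteq> C (Suc k)" for k using C(3)[of k] interior_subset by blast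
    fix \<phi> assume "test_S st \<phi>"
    then obtain N where "supp_closure \<phi> \<subseteq> C N" using C(5)[of "supp_closure \<phi>"] Domain by auto
    then show "\<exists>k. \<forall>x\<in>region st - C k. \<phi> x = 0" using not_supp_closure[of _ \<phi>] by blast
  qed (use C Domain in auto)
qed

lemma smooth_bounded_on:
  fixes f :: "'a::euclidean_space \<Rightarrow> real"
  assumes "smooth_fun f" "bounded X"
  obtains B where "0 \<le> B" "\<And>x. x \<in> X \<Longrightarrow> \<bar>f x\<bar> \<le> B"
proof -
  have "bounded (f ` closure X)"
    using assms by (intro compact_imp_bounded compact_continuous_image smooth_continuous) auto
  then obtain B where B: "\<forall>y\<in>f ` closure X. norm y \<le> B" by (auto simp: bounded_iff)
  show thesis
  proof (rule that[of "max B 0"])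
    show "\<bar>f x\<bar> \<le> max B 0" if "x \<in> X" for x
      using B closure_subset[of X] that by force
  qed simp
qed

abbreviation pd :: "'n::finite \<Rightarrow> (real^'n \<Rightarrow> real) \<Rightarrow> real^'n \<Rightarrow> real" where
  "pd j \<equiv> dderiv (axis j 1)"

lemma smooth_pd: "smooth_fun f \<Longrightarrow> smooth_fun (pd j f)"
  by (rule smooth_dderiv)

lemma integrable_mult_smooth:
  fixes \<phi> :: "'a::euclidean_space \<Rightarrow> real"
  assumes f: "integrable M f" and s: "smooth_fun \<phi>" and A: "bounded A" and g: "g \<in> borel_measurable M"
    and fA: "\<And>x. f x \<noteq> 0 \<Longrightarrow> g x \<in> A"
  shows "integrable M (\<lambda>x. f x * \<phi> (g x))"
proof -
  obtain B where "\<And>x. x \<in> A \<Longrightarrow> \<bar>\<phi> x\<bar> \<le> B" using smooth_bounded_on[OF s A] by metis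
  then show ?thesis using measurable_compose[OF g smooth_borel[OF s]] fA by (intro integrable_bounded_mult[OF f, where B=B]) auto
qed

lemma integrable_indicator_continuous:
  fixes f :: "'a::euclidean_space \<Rightarrow> real"
  assumes "compact C" "continuous_on UNIV f"
  shows "integrable lborel (\<lambda>x. indicator C x * f x)"
  using borel_integrable_compact[of C f] continuous_on_subset[OF assms(2)] assms(1) by simp

lemma Lp_indicator_continuous:
  fixes f :: "'a::euclidean_space \<Rightarrow> real"
  assumes "compact C" "continuous_on UNIV f" "0 < p"
  shows "Lp p lborel (\<lambda>x. indicator C x * f x)"
  unfolding Lp_def
proof
  have "(\<lambda>x. \<bar>indicator C x * f x\<bar> ^ p) = (\<lambda>x. indicator C x * \<bar>f x\<bar> ^ p)"
    using assms(3) by (auto simp: indicator_def)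
  moreover have "integrable lborel (\<lambda>x. indicator C x * \<bar>f x\<bar> ^ p)"
    by (rule integrable_indicator_continuous[OF assms(1)]) (intro continuous_intros assms(2))
  ultimately show "integrable lborel (\<lambda>x. \<bar>indicator C x * f x\<bar> ^ p)" by simp
  show "(\<lambda>x. indicator C x * f x) \<in> borel_measurable lborel"
    using integrable_indicator_continuous[OF assms(1,2)] by auto
qed

lemma Lp_test:
  assumes st: "valid_setting st" and s: "smooth_fun \<phi>" and p: "0 < p"
  shows "Lp p lborel (\<lambda>x. indicator (region st) x * \<phi> x)"
proof -
  have cc: "compact (closure (region st))" using region_bounded[OF st] by simp
  have L: "Lp p lborel (\<lambda>x. indicator (closure (region st)) x * \<phi> x)"
    by (rule Lp_indicator_continuous[OF cc smooth_continuous[OF s] p])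
  have [measurable]: "\<phi> \<in> borel_measurable borel" "region st \<in> sets borel"
    by (rule smooth_borel[OF s], rule region_Borel[OF st])
  show ?thesis
    by (rule Lp_bound[OF L]) (use closure_subset[of "region st"] in \<open>auto intro!: AE_I2 simp: indicator_def\<close>)
qed

text \<open>The change, over the times in \<open>J\<close>, of the integral of \<open>\<phi>\<close>
  against a density transported with flux \<open>q\<close>.\<close>

abbreviation flux :: "real set \<Rightarrow> ('n \<Rightarrow> (real^'n::finite) \<times> real \<Rightarrow> real) \<Rightarrow> (real^'n \<Rightarrow> real) \<Rightarrow> real" where
  "flux J q \<phi> \<equiv> (LBINT z. indicator J (snd z) * (\<Sum>j\<in>UNIV. q j z * pd j \<phi> (fst z)))"

lemma integral_tendsto_uniform:
  fixes f :: "'w \<Rightarrow> real" and b :: "nat \<Rightarrow> 'w \<Rightarrow> real" and B :: real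
  assumes f: "integrable M f" and b: "\<And>n. b n \<in> borel_measurable M" "c \<in> borel_measurable M"
    and bc: "\<And>n w. f w \<noteq> 0 \<Longrightarrow> \<bar>b n w - c w\<bar> \<le> 1 / real (Suc n)" and cB: "\<And>w. f w \<noteq> 0 \<Longrightarrow> \<bar>c w\<bar> \<le> B"
  shows "(\<lambda>n. LINT w|M. f w * b n w) \<longlonglongrightarrow> (LINT w|M. f w * c w)"
proof (rule integral_dominated_convergence[where w="\<lambda>w. (B + 1) * \<bar>f w\<bar>"])
  show "AE w in M. (\<lambda>n. f w * b n w) \<longlonglongrightarrow> f w * c w"
  proof (rule AE_I2)
    fix w
    show "(\<lambda>n. f w * b n w) \<longlonglongrightarrow> f w * c w"
    proof (cases "f w = 0")
case False
have "(\<lambda>n. b n w - c w) \<longlonglongrightarrow> 0"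
proof (rule Lim_null_comparison)
  show "\<forall>\<^sub>F n in sequentially. norm (b n w - c w) \<le> 1 / real (Suc n)" using bc[OF False] by simp
  show "(\<lambda>n. 1 / real (Suc n)) \<longlonglongrightarrow> 0" using LIMSEQ_inverse_real_of_nat by (simp add: inverse_eq_divide)
qed
then show ?thesis by (intro tendsto_mult tendsto_const) (rule LIM_zero_cancel)
    qed simp
  qed
  fix n show "AE w in M. norm (f w * b n w) \<le> (B + 1) * \<bar>f w\<bar>"
  proof (rule AE_I2)
    fix w show "norm (f w * b n w) \<le> (B + 1) * \<bar>f w\<bar>"
    proof (cases "f w = 0")
case False
have "\<bar>b n w - c w\<bar> \<le> 1 / real (Suc n)" "1 / real (Suc n) \<le> 1" "\<bar>c w\<bar> \<le> B" using bc[OF False, of n] cB[OF False] by auto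
then have "\<bar>b n w\<bar> \<le> B + 1" by linarith
then show ?thesis by (simp add: abs_mult mult.commute[of "\<bar>f w\<bar>"] mult_right_mono)
    qed simp
  qed
qed (use f b in auto)

text \<open>Countably many test functions are dense in \<open>C\<^sup>1\<close>, so one null set of times serves all of them.\<close>
lemma conservation_law_slices:
  fixes g :: "(real^'n::finite) \<times> real \<Rightarrow> real" and gs :: "(real^'n \<Rightarrow> real) \<Rightarrow> real \<Rightarrow> real" and q :: "'n \<Rightarrow> (real^'n) \<times> real \<Rightarrow> real"
    and g0 :: "real^'n \<Rightarrow> real"
  assumes st: "valid_setting st" and T: "0 < T"
    and g: "integrable lborel g" "\<And>z. z \<notin> region st \<times> {0<..<T} \<Longrightarrow> g z = 0"
    and q: "\<And>j. integrable lborel (q j)" "\<And>j z. z \<notin> region st \<times> {0<..<T} \<Longrightarrow> q j z = 0"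
    and g0: "g0 \<in> borel_measurable borel" "\<And>x. x \<notin> region st \<Longrightarrow> g0 x = 0" "loc_int_S st g0"
    and weak: "\<And>\<phi> \<theta> a b. test_S st \<phi> \<Longrightarrow> smooth_fun \<theta> \<Longrightarrow> 0 < a \<Longrightarrow> b < T \<Longrightarrow> (\<And>t. t \<notin> {a..b} \<Longrightarrow> \<theta> t = 0) \<Longrightarrow>
      (LBINT z. g z * (\<phi> (fst z) * dderiv 1 \<theta> (snd z)) + (\<Sum>j\<in>UNIV. q j z * (pd j \<phi> (fst z) * \<theta> (snd z)))) = 0"
    and gs: "\<And>\<phi>. test_S st \<phi> \<Longrightarrow> AE t\<in>{0<..<T} in lborel. (LBINT x. g (x, t) * \<phi> x) = gs \<phi> t"
    and init: "\<And>\<phi>. test_S st \<phi> \<Longrightarrow> (gs \<phi> \<longlongrightarrow> (LBINT x. g0 x * \<phi> x)) (at_right 0)"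
  shows "AE t\<in>{0<..<T} in lborel. integrable lborel (\<lambda>x. g (x, t)) \<and> (\<forall>\<phi>. test_S st \<phi> \<longrightarrow>
      (LBINT x. g (x, t) * \<phi> x) = (LBINT x. g0 x * \<phi> x) +
        flux {0<..<t} q \<phi>)"
proof -
  define X where "X = region st"
  have Xb: "bounded X" unfolding X_def by (rule region_bounded[OF st])
  have [measurable]: "g \<in> borel_measurable borel" "q j \<in> borel_measurable borel" "g0 \<in> borel_measurable borel" for j
    using g q g0 by auto
  have QX: "fst z \<in> X" "snd z \<in> {0<..<T}" if "g z \<noteq> 0 \<or> q j z \<noteq> 0" for j z
    using g(2)[of z] q(2)[of z j] that by (cases z; auto simp: X_def)+
  have iq: "integrable lborel (\<lambda>z. q j z * pd j \<phi> (fst z))" if "smooth_fun \<phi>" for j \<phi>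
    by (rule integrable_mult_smooth[OF q(1) smooth_pd[OF that] Xb]) (use QX in auto)
  have ig: "integrable lborel (\<lambda>z. g z * \<phi> (fst z))" if "smooth_fun \<phi>" for \<phi>
    by (rule integrable_mult_smooth[OF g(1) that Xb]) (use QX in auto)
  \<comment> \<open>For a single test function the law is the du Bois-Reymond lemma in time, applied
    to the spatial integrals \<open>G\<close> and \<open>H\<close>; the null set still depends on
    \<open>\<phi>\<close>.\<close>
  have fixed: "AE t\<in>{0<..<T} in lborel.
      (LBINT x. g (x, t) * \<phi> x) = (LBINT x. g0 x * \<phi> x) +
        flux {0<..<t} q \<phi>" if phi: "test_S st \<phi>" for \<phi>
  proof -
    have s\<phi>: "smooth_fun \<phi>" by (rule test_S_smooth[OF phi])
    define h where "h = (\<lambda>z. \<Sum>j\<in>UNIV. q j z * pd j \<phi> (fst z))"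
    have ih: "integrable lborel h" unfolding h_def by (intro integrable_sum iq s\<phi>)
    define G where "G = (\<lambda>t. LBINT x. g (x, t) * \<phi> x)"
    define H where "H = (\<lambda>t. LBINT x. h (x, t))"
    have iG: "integrable lborel G" using lborel_integrable_snd[OF ig[OF s\<phi>]] by (simp add: G_def)
    have iH: "integrable lborel H" using lborel_integrable_snd[OF ih] by (simp add: H_def)
    have "\<exists>c. AE t\<in>{0<..<T} in lborel. G t = c + (LBINT x. indicator {0<..<t} x * H x)"
    proof (rule du_Bois_Reymond_smooth[OF T iG iH])
      fix \<theta> a b assume th: "smooth_fun \<theta>" "0 < a" "b < T" "\<And>t. t \<notin> {a..b} \<Longrightarrow> \<theta> t = 0"
      have hz: "h z \<noteq> 0 \<Longrightarrow> snd z \<in> {0<..<T}" for z using QX(2)[of z] sum.neutral by (fastforce simp: h_def)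
      have i1: "integrable lborel (\<lambda>z. (g z * \<phi> (fst z)) * dderiv 1 \<theta> (snd z))"
        by (rule integrable_mult_smooth[OF ig[OF s\<phi>] smooth_dderiv[OF th(1)], of "{0<..<T}"]) (use QX in auto)
      have i2: "integrable lborel (\<lambda>z. h z * \<theta> (snd z))"
        by (rule integrable_mult_smooth[OF ih th(1), of "{0<..<T}"]) (use hz in auto)
      have e1: "(LBINT z. g z * \<phi> (fst z) * dderiv 1 \<theta> (snd z)) = (LBINT t. G t * dderiv 1 \<theta> t)"
        by (subst lborel_integral_snd[OF i1]) (simp add: G_def)
      have e2: "(LBINT z. h z * \<theta> (snd z)) = (LBINT t. H t * \<theta> t)"
        by (subst lborel_integral_snd[OF i2]) (simp add: H_def)
      have j1: "integrable lborel (\<lambda>t. G t * dderiv 1 \<theta> t)" using lborel_integrable_snd[OF i1] by (simp add: G_def)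
      have j2: "integrable lborel (\<lambda>t. H t * \<theta> t)" using lborel_integrable_snd[OF i2] by (simp add: H_def)
      have "(LBINT t. G t * dderiv 1 \<theta> t + H t * \<theta> t) = (LBINT z. g z * \<phi> (fst z) * dderiv 1 \<theta> (snd z) + h z * \<theta> (snd z))"
        using i1 i2 j1 j2 by (simp add: e1 e2)
      also have "\<dots> = (LBINT z. g z * (\<phi> (fst z) * dderiv 1 \<theta> (snd z)) + (\<Sum>j\<in>UNIV. q j z * (pd j \<phi> (fst z) * \<theta> (snd z))))"
        by (simp add: h_def sum_distrib_left sum_distrib_right mult_ac)
      also have "\<dots> = 0" by (rule weak[OF phi th])
      finally show "(LBINT t. G t * dderiv 1 \<theta> t + H t * \<theta> t) = 0" .
    qed
    then obtain c where c: "AE t\<in>{0<..<T} in lborel. G t = c + (LBINT x. indicator {0<..<t} x * H x)" by blast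
    \<comment> \<open>The initial limit is known for \<open>gs\<close>, which agrees with
      \<open>G\<close> only almost everywhere; this is enough to identify the constant.\<close>
    have "(LBINT x. g0 x * \<phi> x) = c"
    proof (rule AE_at_right_limit_unique[OF T _ init[OF phi]])
      show "AE t\<in>{0<..<T} in lborel. gs \<phi> t = c + (LBINT x. indicator {0<..<t} x * H x)"
        using c gs[OF phi] by eventually_elim (auto simp: G_def)
      show "((\<lambda>t. c + (LBINT x. indicator {0<..<t} x * H x)) \<longlongrightarrow> c) (at_right 0)"
        using tendsto_add[OF tendsto_const[of c] tendsto_integral_initial[OF iH]] by simp
    qed
    moreover have "(LBINT x. indicator {0<..<t} x * H x) = (LBINT z. indicator {0<..<t} (snd z) * h z)" for t
    proof -
      have "integrable lborel (\<lambda>z::(real^'n) \<times> real. h z * indicator {0<..<t} (snd z))"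
        by (rule integrable_bounded_mult[where B=1, OF ih]) (auto simp: indicator_def)
      then have "integrable lborel (\<lambda>z::(real^'n) \<times> real. indicator {0<..<t} (snd z) * h z)" by (simp add: mult.commute)
      from lborel_integral_snd[OF this] show ?thesis by (simp add: H_def)
    qed
    ultimately show ?thesis using c by (simp add: G_def h_def)
  qed
  obtain K :: "nat \<Rightarrow> (real^'n) set" where K: "\<And>k. compact (K k)" "\<And>k. K k \<subseteq> X" "\<And>k. K k \<subseteq> K (Suc k)" "(\<Union>k. K k) = X"
    "\<And>\<phi>. test_S st \<phi> \<Longrightarrow> \<exists>k. \<forall>x\<in>X - K k. \<phi> x = 0"
    "\<And>k h. loc_int_S st (h :: _ \<Rightarrow> real) \<Longrightarrow> set_integrable lebesgue (K k) h"
    using region_exhaustion[OF st] unfolding X_def by blast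
  have iK: "integrable lborel (\<lambda>x. indicator (K k) x * g0 x)" for k
  proof -
    have [measurable]: "K k \<in> sets borel" using K(1) by (simp add: borel_compact)
    have "integrable lebesgue (\<lambda>x. indicator (K k) x * g0 x)" using K(6)[OF g0(3), of k] by (simp add: set_integrable_def)
    then show ?thesis by (subst (asm) integrable_completion) auto
  qed
  \<comment> \<open>The 1-jet of a function. Uniform density of jets is density in C^1, which the
    flux term requires because it contains the gradient of \<open>\<phi>\<close>.\<close>
  define J :: "(real^'n \<Rightarrow> real) \<Rightarrow> real^'n \<Rightarrow> real \<times> (real^'n)" where "J = (\<lambda>\<phi> x. (\<phi> x, \<chi> j. pd j \<phi> x))"
  \<comment> \<open>The initial density is only locally integrable, so all approximants of a given
    \<open>\<phi>\<close> must vanish outside one common \<open>K k\<close>.\<close>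
  define F where "F = (\<lambda>k. {\<phi>. test_S st \<phi> \<and> (\<forall>x\<in>X - K k. \<phi> x = 0)})"
  have cJ: "continuous_on A (J \<phi>)" if "smooth_fun \<phi>" for A \<phi>
    unfolding J_def by (intro continuous_intros continuous_on_vec_lambda smooth_continuous smooth_pd that)
  have "\<exists>D. countable D \<and> D \<subseteq> F k \<and> (\<forall>\<phi>\<in>F k. \<forall>e>0. \<exists>\<psi>\<in>D. \<forall>x\<in>closure X. dist (J \<phi> x) (J \<psi> x) < e)" for k
  proof -
    have cc: "compact (closure X)" using Xb by simp
    have "f \<in> J ` F k \<Longrightarrow> continuous_on (closure X) f" for f by (auto simp: F_def intro!: cJ test_S_smooth)
    from countable_uniform_dense[OF cc this]
    obtain D where D: "countable D" "D \<subseteq> J ` F k" "\<And>f e. f \<in> J ` F k \<Longrightarrow> 0 < e \<Longrightarrow> \<exists>g\<in>D. \<forall>x\<in>closure X. dist (f x) (g x) < e"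
      by metis
    obtain D' where D': "D' \<subseteq> F k" "countable D'" "D = J ` D'" using D(1,2) by (metis countable_subset_image)
    then show ?thesis using D(3) by (intro exI[of _ D']) blast
  qed
  then obtain D where D: "\<And>k. countable (D k)" "\<And>k. D k \<subseteq> F k"
    "\<And>k \<phi> e. \<phi> \<in> F k \<Longrightarrow> 0 < e \<Longrightarrow> \<exists>\<psi>\<in>D k. \<forall>x\<in>closure X. dist (J \<phi> x) (J \<psi> x) < e" by metis
  have "AE t in lborel. \<forall>k. \<forall>\<phi>\<in>D k. t \<in> {0<..<T} \<longrightarrow>
      (LBINT x. g (x, t) * \<phi> x) = (LBINT x. g0 x * \<phi> x) +
        flux {0<..<t} q \<phi>"
    unfolding AE_all_countable
  proof
    fix k
    show "AE t in lborel. \<forall>\<phi>\<in>D k. t \<in> {0<..<T} \<longrightarrow>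
      (LBINT x. g (x, t) * \<phi> x) = (LBINT x. g0 x * \<phi> x) +
        flux {0<..<t} q \<phi>"
      by (rule AE_ball_countable'[OF fixed D(1)]) (use D(2) in \<open>auto simp: F_def\<close>)
  qed
  moreover have "AE t in lborel. integrable lborel (\<lambda>x. g (x, t))" by (rule lborel_AE_integrable_snd[OF g(1)])
  ultimately show ?thesis
  proof eventually_elim
    case (elim t)
    show ?case
    proof (intro impI conjI allI elim)
      assume t: "t \<in> {0<..<T}"
      fix \<phi> assume phi: "test_S st \<phi>"
      then obtain k where k: "\<forall>x\<in>X - K k. \<phi> x = 0" using K(5) by blast
      then have FF: "\<phi> \<in> F k" using phi by (simp add: F_def)
      have "\<exists>\<psi>. \<forall>n. \<psi> n \<in> D k \<and> (\<forall>x\<in>closure X. dist (J \<phi> x) (J (\<psi> n) x) < 1 / real (Suc n))"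
        by (rule choice) (use D(3)[OF FF] in \<open>auto simp: Bex_def\<close>)
      then obtain \<psi> where psi: "\<And>n. \<psi> n \<in> D k" "\<And>n x. x \<in> X \<Longrightarrow> dist (J \<phi> x) (J (\<psi> n) x) < 1 / real (Suc n)"
        using closure_subset[of X] by blast
      have psiF: "test_S st (\<psi> n)" "x \<in> X - K k \<Longrightarrow> \<psi> n x = 0" for n x using psi(1) D(2) by (auto simp: F_def)
      have c1: "\<bar>\<psi> n x - \<phi> x\<bar> \<le> 1 / real (Suc n)" if "x \<in> X" for n x
        using psi(2)[OF that, of n] dist_fst_le[of "J \<phi> x" "J (\<psi> n) x"] by (simp add: J_def dist_real_def)
      have c2: "\<bar>pd j (\<psi> n) x - pd j \<phi> x\<bar> \<le> 1 / real (Suc n)" if "x \<in> X" for n x j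
      proof -
        have "dist (pd j \<phi> x) (pd j (\<psi> n) x) \<le> dist (snd (J \<phi> x)) (snd (J (\<psi> n) x))"
          using dist_vec_nth_le[of "snd (J \<phi> x)" j "snd (J (\<psi> n) x)"] by (simp add: J_def)
        also have "\<dots> \<le> dist (J \<phi> x) (J (\<psi> n) x)" by (rule dist_snd_le)
        finally show ?thesis using psi(2)[OF that, of n] by (simp add: dist_real_def abs_minus_commute)
      qed
      have s: "smooth_fun \<phi>" "smooth_fun (\<psi> n)" for n
        using test_S_smooth[OF phi] test_S_smooth[OF psiF(1)[of n]] by simp_all
      note sb = smooth_borel[OF s(1)] smooth_borel[OF s(2)] smooth_borel[OF smooth_pd[OF s(1)]] smooth_borel[OF smooth_pd[OF s(2)]]
      obtain B0 where B0: "\<And>x. x \<in> X \<Longrightarrow> \<bar>\<phi> x\<bar> \<le> B0" using smooth_bounded_on[OF s(1) Xb] by metis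
      have l1: "(\<lambda>n. LBINT x. g (x, t) * \<psi> n x) \<longlonglongrightarrow> (LBINT x. g (x, t) * \<phi> x)"
      proof (rule integral_tendsto_uniform[where B=B0, OF elim(2)])
        have X': "x \<in> X" if "g (x, t) \<noteq> 0" for x using that g(2)[of "(x, t)"] by (auto simp: X_def)
        show "\<bar>\<psi> n x - \<phi> x\<bar> \<le> 1 / real (Suc n)" if "g (x, t) \<noteq> 0" for n x by (rule c1[OF X'[OF that]])
        show "\<bar>\<phi> x\<bar> \<le> B0" if "g (x, t) \<noteq> 0" for x by (rule B0[OF X'[OF that]])
      qed (simp_all add: sb)
      have l2: "(\<lambda>n. LBINT x. g0 x * \<psi> n x) \<longlonglongrightarrow> (LBINT x. g0 x * \<phi> x)"
      proof -
        have red: "g0 x * \<phi>' x = (indicator (K k) x * g0 x) * \<phi>' x" if "\<forall>x\<in>X - K k. \<phi>' x = 0" for \<phi>' x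
          using that g0(2)[of x] by (auto simp: X_def indicator_def)
        have "(\<lambda>n. LBINT x. (indicator (K k) x * g0 x) * \<psi> n x) \<longlonglongrightarrow> (LBINT x. (indicator (K k) x * g0 x) * \<phi> x)"
        proof (rule integral_tendsto_uniform[where B=B0, OF iK])
          have X': "x \<in> X" if "indicator (K k) x * g0 x \<noteq> 0" for x
            using that K(2)[of k] by (auto simp: indicator_def split: if_splits)
          show "\<bar>\<psi> n x - \<phi> x\<bar> \<le> 1 / real (Suc n)" if "indicator (K k) x * g0 x \<noteq> 0" for n x by (rule c1[OF X'[OF that]])
          show "\<bar>\<phi> x\<bar> \<le> B0" if "indicator (K k) x * g0 x \<noteq> 0" for x by (rule B0[OF X'[OF that]])
        qed (simp_all add: sb)
        moreover have "(\<lambda>x. g0 x * \<phi> x) = (\<lambda>x. (indicator (K k) x * g0 x) * \<phi> x)" by (rule ext) (rule red[OF k])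
        moreover have "(\<lambda>x. g0 x * \<psi> n x) = (\<lambda>x. (indicator (K k) x * g0 x) * \<psi> n x)" for n
          by (rule ext, rule red) (use psiF(2) in blast)
        ultimately show ?thesis by (simp only:)
      qed
      have l3: "(\<lambda>n. LBINT z. indicator {0<..<t} (snd z) * (\<Sum>j\<in>UNIV. q j z * pd j (\<psi> n) (fst z)))
          \<longlonglongrightarrow> flux {0<..<t} q \<phi>"
      proof -
        define qt where "qt = (\<lambda>j z. q j z * indicator {0<..<t} (snd z))"
        have iqt: "integrable lborel (qt j)" for j
          unfolding qt_def by (rule integrable_bounded_mult[where B=1, OF q(1)]) (auto simp: indicator_def)
        have iqp: "integrable lborel (\<lambda>z. qt j z * pd j \<psi>' (fst z))" if s': "smooth_fun \<psi>'" for j \<psi>'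
        proof -
          have "integrable lborel (\<lambda>z. (q j z * pd j \<psi>' (fst z)) * indicator {0<..<t} (snd z))"
            by (rule integrable_bounded_mult[where B=1, OF iq[OF s']]) (auto simp: indicator_def)
          then show ?thesis by (simp add: qt_def mult_ac)
        qed
        have eq: "flux {0<..<t} q \<psi>' = (\<Sum>j\<in>UNIV. LBINT z. qt j z * pd j \<psi>' (fst z))"
          if "smooth_fun \<psi>'" for \<psi>'
          unfolding integral_sum[OF iqp[OF that], symmetric]
          by (intro integral_cong refl) (simp add: qt_def sum_distrib_left mult_ac)
        have "(\<lambda>n. LBINT z. qt j z * pd j (\<psi> n) (fst z)) \<longlonglongrightarrow> (LBINT z. qt j z * pd j \<phi> (fst z))" for j
        proof -
          obtain B1 where B1: "\<And>x. x \<in> X \<Longrightarrow> \<bar>pd j \<phi> x\<bar> \<le> B1" using smooth_bounded_on[OF smooth_pd[OF s(1)] Xb] by metis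
          have X': "fst z \<in> X" if "qt j z \<noteq> 0" for z using that q(2)[of z j] by (cases "z \<in> region st \<times> {0<..<T}") (auto simp: qt_def X_def)
          have [measurable]: "pd j \<phi> \<in> borel_measurable borel" "pd j (\<psi> n) \<in> borel_measurable borel" for n by (intro sb)+
          show ?thesis
          proof (rule integral_tendsto_uniform[where B=B1, OF iqt])
            show "\<bar>pd j (\<psi> n) (fst z) - pd j \<phi> (fst z)\<bar> \<le> 1 / real (Suc n)" if "qt j z \<noteq> 0" for n z
              by (rule c2[OF X'[OF that]])
            show "\<bar>pd j \<phi> (fst z)\<bar> \<le> B1" if "qt j z \<noteq> 0" for z by (rule B1[OF X'[OF that]])
          qed measurable
        qed
        then show ?thesis unfolding eq[OF s(1)] eq[OF s(2)] by (intro tendsto_sum)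
      qed
      have "(LBINT x. g (x, t) * \<psi> n x) = (LBINT x. g0 x * \<psi> n x) +
        flux {0<..<t} q (\<psi> n)" for n
        using elim(1) t psi(1) by blast
      then show "(LBINT x. g (x, t) * \<phi> x) = (LBINT x. g0 x * \<phi> x) +
        flux {0<..<t} q \<phi>"
        using LIMSEQ_unique[OF l1] tendsto_add[OF l2 l3] by simp
    qed
  qed
qed

section \<open>The energy between two times\<close>

text \<open>A single sequence of test functions converges in all three senses at once: L^4 of the
  functions and L^2 of the gradients control the convective products. The indicator restricts
  periodic test functions to the unit cell.\<close>

definition H1_seq :: "('n::finite) setting \<Rightarrow> (nat \<Rightarrow> 'n \<Rightarrow> real^'n \<Rightarrow> real) \<Rightarrow> ('n \<Rightarrow> real^'n \<Rightarrow> real) \<Rightarrow> ('n \<Rightarrow> 'n \<Rightarrow> real^'n \<Rightarrow> real) \<Rightarrow> bool" where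
  "H1_seq st \<phi> w Dw \<longleftrightarrow> (\<forall>k i. test_S st (\<phi> k i)) \<and>
    (\<forall>i. Lpconv 2 lborel sequentially (\<lambda>k x. indicator (region st) x * \<phi> k i x) (w i)) \<and>
    (\<forall>i. Lpconv 4 lborel sequentially (\<lambda>k x. indicator (region st) x * \<phi> k i x) (w i)) \<and>
    (\<forall>i j. Lpconv 2 lborel sequentially (\<lambda>k x. indicator (region st) x * pd j (\<phi> k i) x) (Dw i j))"

definition H1_approx :: "('n::finite) setting \<Rightarrow> ('n \<Rightarrow> real^'n \<Rightarrow> real) \<Rightarrow> ('n \<Rightarrow> 'n \<Rightarrow> real^'n \<Rightarrow> real) \<Rightarrow> bool" where
  "H1_approx st w Dw \<longleftrightarrow> (\<exists>\<phi>. H1_seq st \<phi> w Dw)"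

lemma H1_seqD:
  assumes "H1_seq st \<phi> w Dw"
  shows "test_S st (\<phi> k i)"
    "Lpconv 2 lborel sequentially (\<lambda>k x. indicator (region st) x * \<phi> k i x) (w i)"
    "Lpconv 4 lborel sequentially (\<lambda>k x. indicator (region st) x * \<phi> k i x) (w i)"
    "Lpconv 2 lborel sequentially (\<lambda>k x. indicator (region st) x * pd j (\<phi> k i) x) (Dw i j)"
  using assms by (simp_all add: H1_seq_def)

lemma H1_approx_Lp:
  assumes "H1_approx st w Dw"
  shows "Lp 2 lborel (w i)" "Lp 4 lborel (w i)" "Lp 2 lborel (Dw i j)"
proof -
  obtain \<phi> where "H1_seq st \<phi> w Dw" using assms by (auto simp: H1_approx_def)
  from H1_seqD(2-4)[OF this, THEN LpconvD(2)]
  show "Lp 2 lborel (w i)" "Lp 4 lborel (w i)" "Lp 2 lborel (Dw i j)" by blast+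
qed

text \<open>A slice frozen during the times in \<open>I\<close>, so that it can be multiplied with
  space-time fluxes.\<close>

definition tens :: "real set \<Rightarrow> ('a \<Rightarrow> real) \<Rightarrow> 'a \<times> real \<Rightarrow> real" where
  "tens I f z = f (fst z) * indicator I (snd z)"

text \<open>The analytic core in scalar form: Borel components, extended by zero outside the
  space-time cylinder, so that all integrals run over the whole space. The weak equations enter only
  as balances of spatial integrals at almost every time.\<close>

locale energy_data =
  fixes st :: "('n::finite) setting" and T c1 c2 :: real
    and r :: "(real^'n) \<times> real \<Rightarrow> real" and U :: "'n \<Rightarrow> (real^'n) \<times> real \<Rightarrow> real"
    and G V :: "'n \<Rightarrow> 'n \<Rightarrow> (real^'n) \<times> real \<Rightarrow> real" and P :: "(real^'n) \<times> real \<Rightarrow> real"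
    and r0 :: "real^'n \<Rightarrow> real" and m0 :: "'n \<Rightarrow> real^'n \<Rightarrow> real"
  assumes st: "valid_setting st" and T: "0 < T" and c: "0 < c1" "c1 \<le> c2"
    and r_meas: "r \<in> borel_measurable borel"
    and r_bd: "\<And>z. z \<in> region st \<times> {0<..<T} \<Longrightarrow> c1 \<le> r z \<and> r z \<le> c2"
    and r_zero: "\<And>z. z \<notin> region st \<times> {0<..<T} \<Longrightarrow> r z = 0"
    and U_Lp: "\<And>i. Lp 2 lborel (U i)" "\<And>i. Lp 4 lborel (U i)"
    and U_zero: "\<And>i z. z \<notin> region st \<times> {0<..<T} \<Longrightarrow> U i z = 0"
    and G_Lp: "\<And>i j. Lp 2 lborel (G i j)"
    and V_Lp: "\<And>i j. Lp 2 lborel (V i j)" and V_zero: "\<And>i j z. z \<notin> region st \<times> {0<..<T} \<Longrightarrow> V i j z = 0"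
    and P_Lp: "Lp 2 lborel P" and P_zero: "\<And>z. z \<notin> region st \<times> {0<..<T} \<Longrightarrow> P z = 0"
    and div: "AE t\<in>{0<..<T} in lborel. (AE x in lborel. (\<Sum>i\<in>UNIV. G i i (x, t)) = 0)"
    and slice: "AE t\<in>{0<..<T} in lborel. H1_approx st (\<lambda>i x. U i (x, t)) (\<lambda>i j x. G i j (x, t))"
    and mass: "AE t\<in>{0<..<T} in lborel. (\<forall>\<phi>. test_S st \<phi> \<longrightarrow>
      (LBINT x. r (x, t) * \<phi> x) = (LBINT x. r0 x * \<phi> x) +
        flux {0<..<t} (\<lambda>j z. r z * U j z) \<phi>)"
    and mom: "\<And>i. AE t\<in>{0<..<T} in lborel. (\<forall>\<phi>. test_S st \<phi> \<longrightarrow>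
      (LBINT x. (r (x, t) * U i (x, t)) * \<phi> x) = (LBINT x. m0 i x * \<phi> x) +
        flux {0<..<t} (\<lambda>j z. r z * U i z * U j z + (if i = j then P z else 0) - V i j z) \<phi>)"
begin

abbreviation "X \<equiv> region st"
abbreviation "Q \<equiv> region st \<times> {0<..<T}"

definition M :: "'n \<Rightarrow> (real^'n) \<times> real \<Rightarrow> real" where "M i z = r z * U i z"
text \<open>The momentum flux without the pressure, which is kept apart because it disappears
  against divergence-free slices.\<close>

definition Fl :: "'n \<Rightarrow> 'n \<Rightarrow> (real^'n) \<times> real \<Rightarrow> real" where "Fl i j z = M i z * U j z - V i j z"
abbreviation "FP i \<equiv> (\<lambda>j z. Fl i j z + (if i = j then P z else 0))"
definition En :: "real \<Rightarrow> real" where "En t = (1/2) * (LBINT x. (\<Sum>i\<in>UNIV. M i (x, t) * U i (x, t)))"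

lemma r_abs: "\<bar>r z\<bar> \<le> c2"
  using r_bd[of z] r_zero[of z] c by (cases "z \<in> Q") auto

lemma M_Lp: "Lp 2 lborel (M i)" "Lp 4 lborel (M i)"
  unfolding M_def[abs_def] using r_meas r_abs by (auto intro!: Lp_bounded_mult[where B=c2] U_Lp)

lemma MU_Lp: "Lp 2 lborel (\<lambda>z. M i z * U j z)"
  by (intro Lp4_mult M_Lp U_Lp)

lemma Fl_Lp: "Lp 2 lborel (Fl i j)"
  unfolding Fl_def[abs_def] by (intro Lp_diff MU_Lp V_Lp) simp

lemma Flp_Lp: "Lp 2 lborel (\<lambda>z. Fl i j z + (if i = j then P z else 0))"
  using Fl_Lp[of i j] P_Lp by (cases "i = j") (auto intro: Lp_add)

lemma meas[measurable]: "U i \<in> borel_measurable borel" "G i j \<in> borel_measurable borel" "V i j \<in> borel_measurable borel"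
  "P \<in> borel_measurable borel" "M i \<in> borel_measurable borel" "Fl i j \<in> borel_measurable borel" "r \<in> borel_measurable borel"
  using U_Lp G_Lp V_Lp P_Lp M_Lp Fl_Lp r_meas by (auto simp: Lp_def)

lemma zero: assumes "z \<notin> Q" shows "M i z = 0" "Fl i j z = 0"
  using U_zero[OF assms] V_zero[OF assms] by (auto simp: M_def Fl_def)

lemma X_meas[measurable]: "X \<in> sets borel" by (rule region_Borel[OF st])

lemma Lp_ind_interval: "0 < p \<Longrightarrow> I \<in> sets borel \<Longrightarrow> I \<subseteq> {a..b} \<Longrightarrow> Lp p lborel (indicator I :: real \<Rightarrow> real)"
proof -
  assume p: "0 < p" and I: "I \<in> sets borel" "I \<subseteq> {a..b}"
  have "emeasure lborel I \<le> emeasure lborel {a..b}" using I by (intro emeasure_mono) auto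
  also have "\<dots> < \<infinity>" by (cases "a \<le> b") auto
  finally have "integrable lborel (indicator I :: real \<Rightarrow> real)" using I by (intro integrable_real_indicator) auto
  moreover have "\<bar>indicator I x\<bar> ^ p = (indicator I x :: real)" for x using p by (auto simp: indicator_def zero_power)
  ultimately show ?thesis using I by (auto simp: Lp_def)
qed

lemma Lp_tens: "0 < p \<Longrightarrow> I \<in> sets borel \<Longrightarrow> I \<subseteq> {a..b} \<Longrightarrow> Lp p lborel f \<Longrightarrow> Lp p lborel (tens I f :: (real^'n) \<times> real \<Rightarrow> real)"
  unfolding tens_def[abs_def] by (intro Lp_tensor Lp_ind_interval)

lemma Lpconv_tens: "0 < p \<Longrightarrow> I \<in> sets borel \<Longrightarrow> I \<subseteq> {a..b} \<Longrightarrow> Lpconv p lborel F f g \<Longrightarrow>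
   Lpconv p lborel F (\<lambda>k. tens I (f k)) (tens I g :: (real^'n) \<times> real \<Rightarrow> real)"
  unfolding tens_def[abs_def] by (intro Lpconv_tensor Lp_ind_interval)

text \<open>Both sides are continuous in \<open>w\<close> along the approximating test functions:
  the left in L^2, the right through the L^2 convergence of the gradients. Each test function
  carries pressure, but in the limit it multiplies only the trace of \<open>Dw\<close>.\<close>

lemma momentum_H1:
  fixes a :: "'n \<Rightarrow> real^'n \<Rightarrow> real"
  assumes w: "H1_approx st w Dw" and a: "\<And>i. Lp 2 lborel (a i)" "\<And>i x. x \<notin> X \<Longrightarrow> a i x = 0"
    and I: "I \<in> sets borel" "I \<subseteq> {0..T}"
    and eq: "\<And>i \<phi>. test_S st \<phi> \<Longrightarrow> (LBINT x. a i x * \<phi> x) =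
      flux I (FP i) \<phi>"
    and dv: "AE x in lborel. (\<Sum>i\<in>UNIV. Dw i i x) = 0"
  shows "(LBINT x. (\<Sum>i\<in>UNIV. a i x * w i x)) = (LBINT z. (\<Sum>i\<in>UNIV. \<Sum>j\<in>UNIV. Fl i j z * tens I (Dw i j) z))"
proof -
  define F where "F = (\<lambda>i j z. Fl i j z + (if i = j then P z else 0))"
  have F_Lp: "Lp 2 lborel (F i j)" for i j unfolding F_def by (rule Flp_Lp)
  have F_zero: "z \<notin> Q \<Longrightarrow> F i j z = 0" for i j z by (simp add: F_def zero P_zero)
  obtain \<phi> where "H1_seq st \<phi> w Dw" using w by (auto simp: H1_approx_def)
  note phi = H1_seqD[OF this]
  have w_Lp: "Lp 2 lborel (w i)" "Lp 2 lborel (Dw i j)" for i j using H1_approx_Lp[OF w] by auto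
  note tD = Lpconv_tens[OF zero_less_numeral I phi(4)]
  have tDw: "Lp 2 lborel (tens I (Dw i j))" for i j by (intro Lp_tens[OF _ I] w_Lp) simp
  have one: "(LBINT x. a i x * w i x) = (\<Sum>j\<in>UNIV. LBINT z. F i j z * tens I (Dw i j) z)" for i
  proof (rule LIMSEQ_unique)
    show "(\<lambda>k. LBINT x. a i x * (indicator X x * \<phi> k i x)) \<longlonglongrightarrow> (LBINT x. a i x * w i x)"
      by (intro Lpconv1_integral Lpconv2_mult Lpconv_const a phi) simp
    have e: "(LBINT x. a i x * (indicator X x * \<phi> k i x)) =
        (\<Sum>j\<in>UNIV. LBINT z. F i j z * tens I (\<lambda>x. indicator X x * pd j (\<phi> k i) x) z)" for k
    proof -
      have "(LBINT x. a i x * (indicator X x * \<phi> k i x)) = (LBINT x. a i x * \<phi> k i x)"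
        using a(2) by (intro integral_cong) (auto simp: indicator_def)
      also have "\<dots> = flux I (F i) (\<phi> k i)"
        unfolding F_def by (rule eq[OF phi(1)])
      also have "\<dots> = (LBINT z. (\<Sum>j\<in>UNIV. F i j z * tens I (\<lambda>x. indicator X x * pd j (\<phi> k i) x) z))"
      proof (rule integral_cong[OF refl])
        fix z
        show "indicator I (snd z) * (\<Sum>j\<in>UNIV. F i j z * pd j (\<phi> k i) (fst z)) = (\<Sum>j\<in>UNIV. F i j z * tens I (\<lambda>x. indicator X x * pd j (\<phi> k i) x) z)"
        proof (cases "z \<in> Q")
          case True
          then have "indicator X (fst z) = (1::real)" by auto
          then show ?thesis by (simp add: tens_def sum_distrib_left mult_ac)
        qed (simp add: F_zero)
      qed
      also have "\<dots> = (\<Sum>j\<in>UNIV. LBINT z. F i j z * tens I (\<lambda>x. indicator X x * pd j (\<phi> k i) x) z)"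
        by (intro integral_sum Lp2_mult F_Lp LpconvD[OF tD])
      finally show ?thesis .
    qed
    show "(\<lambda>k. LBINT x. a i x * (indicator X x * \<phi> k i x)) \<longlonglongrightarrow> (\<Sum>j\<in>UNIV. LBINT z. F i j z * tens I (Dw i j) z)"
      unfolding e by (intro tendsto_sum Lpconv1_integral Lpconv2_mult Lpconv_const F_Lp tD) simp
  qed
  have iFl: "integrable lborel (\<lambda>z. Fl i j z * tens I (Dw i j) z)" for i j by (intro Lp2_mult Fl_Lp tDw)
  have iP: "integrable lborel (\<lambda>z. P z * tens I (Dw i i) z)" for i by (intro Lp2_mult P_Lp tDw)
  \<comment> \<open>By Fubini the pressure at time \<open>t\<close> meets the divergence of
    \<open>w\<close>, which does not depend on \<open>t\<close> and vanishes for almost every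
    \<open>x\<close>.\<close>
  have P0: "(\<Sum>i\<in>UNIV. LBINT z. P z * tens I (Dw i i) z) = 0"
  proof -
    have iS: "integrable lborel (\<lambda>z. \<Sum>i\<in>UNIV. P z * tens I (Dw i i) z)" by (intro integrable_sum iP)
    have "(\<Sum>i\<in>UNIV. LBINT z. P z * tens I (Dw i i) z) = (LBINT z. (\<Sum>i\<in>UNIV. P z * tens I (Dw i i) z))"
      by (rule integral_sum[symmetric, OF iP])
    also have "\<dots> = (LBINT t. LBINT x. P (x, t) * indicator I t * (\<Sum>i\<in>UNIV. Dw i i x))"
      by (subst lborel_integral_snd[OF iS]) (simp add: tens_def sum_distrib_left mult_ac)
    also have "\<dots> = (LINT t|(lborel::real measure). 0)"
    proof (rule integral_cong[OF refl])
      fix t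
      have [measurable]: "Dw i i \<in> borel_measurable borel" for i using w_Lp by (auto simp: Lp_def)
      have "(LBINT x. P (x, t) * indicator I t * (\<Sum>i\<in>UNIV. Dw i i x)) = (LINT x|(lborel::(real^'n) measure). 0)"
        by (rule integral_cong_AE) (use dv in \<open>auto elim: eventually_mono\<close>)
      then show "(LBINT x. P (x, t) * indicator I t * (\<Sum>i\<in>UNIV. Dw i i x)) = 0" by simp
    qed
    finally show ?thesis by simp
  qed
  have "(LBINT x. (\<Sum>i\<in>UNIV. a i x * w i x)) = (\<Sum>i\<in>UNIV. LBINT x. a i x * w i x)"
    by (intro integral_sum Lp2_mult a w_Lp)
  also have "\<dots> = (\<Sum>i\<in>UNIV. \<Sum>j\<in>UNIV. LBINT z. F i j z * tens I (Dw i j) z)" by (simp add: one)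
  also have "\<dots> = (\<Sum>i\<in>UNIV. \<Sum>j\<in>UNIV. (LBINT z. Fl i j z * tens I (Dw i j) z) + (if i = j then LBINT z. P z * tens I (Dw i i) z else 0))"
  proof (intro sum.cong refl)
    fix i j
    show "(LBINT z. F i j z * tens I (Dw i j) z) = (LBINT z. Fl i j z * tens I (Dw i j) z) + (if i = j then LBINT z. P z * tens I (Dw i i) z else 0)"
      using iFl[of i j] iP[of i] by (auto simp: F_def distrib_right)
  qed
  also have "\<dots> = (\<Sum>i\<in>UNIV. \<Sum>j\<in>UNIV. LBINT z. Fl i j z * tens I (Dw i j) z)"
    by (simp add: sum.distrib P0)
  also have "\<dots> = (LBINT z. (\<Sum>i\<in>UNIV. \<Sum>j\<in>UNIV. Fl i j z * tens I (Dw i j) z))"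
    using iFl by (simp add: integral_sum)
  finally show ?thesis .
qed

text \<open>The admissible test functions are the products of the approximations of \<open>w\<close>
  and \<open>w'\<close>. The product rule for their gradient leads to triple products with
  \<open>M\<close>, which converge in L^1 because two factors converge in L^4 and one in
  L^2.\<close>

lemma mass_H1:
  fixes b :: "real^'n \<Rightarrow> real"
  assumes w: "H1_approx st w Dw" and w': "H1_approx st w' Dw'"
    and b: "b \<in> borel_measurable borel" "\<And>x. \<bar>b x\<bar> \<le> B" "\<And>x. x \<notin> X \<Longrightarrow> b x = 0"
    and I: "I \<in> sets borel" "I \<subseteq> {0..T}"
    and eq: "\<And>\<phi>. test_S st \<phi> \<Longrightarrow> (LBINT x. b x * \<phi> x) = flux I M \<phi>"
  shows "(LBINT x. b x * (\<Sum>i\<in>UNIV. w i x * w' i x)) =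
    (LBINT z. (\<Sum>i\<in>UNIV. \<Sum>j\<in>UNIV. (M j z * tens I (w i) z) * tens I (Dw' i j) z + (M j z * tens I (w' i) z) * tens I (Dw i j) z))"
proof -
  obtain \<phi> where "H1_seq st \<phi> w Dw" using w by (auto simp: H1_approx_def)
  note phi = H1_seqD[OF this]
  obtain \<psi> where "H1_seq st \<psi> w' Dw'" using w' by (auto simp: H1_approx_def)
  note psi = H1_seqD[OF this]
  note t = Lpconv_tens[OF zero_less_numeral I phi(3)] Lpconv_tens[OF zero_less_numeral I psi(3)]
    Lpconv_tens[OF zero_less_numeral I phi(4)] Lpconv_tens[OF zero_less_numeral I psi(4)]
  have c4: "Lpconv 4 lborel sequentially (\<lambda>k. M j) (M j)" for j by (intro Lpconv_const M_Lp) simp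
  let ?A = "\<lambda>k i j z. (M j z * tens I (\<lambda>x. indicator X x * \<phi> k i x) z) * tens I (\<lambda>x. indicator X x * pd j (\<psi> k i) x) z"
  let ?B = "\<lambda>k i j z. (M j z * tens I (\<lambda>x. indicator X x * \<psi> k i x) z) * tens I (\<lambda>x. indicator X x * pd j (\<phi> k i) x) z"
  have cA: "Lpconv 1 lborel sequentially (\<lambda>k. ?A k i j) (\<lambda>z. (M j z * tens I (w i) z) * tens I (Dw' i j) z)" for i j
    by (intro Lpconv2_mult Lpconv4_mult c4 t)
  have cB: "Lpconv 1 lborel sequentially (\<lambda>k. ?B k i j) (\<lambda>z. (M j z * tens I (w' i) z) * tens I (Dw i j) z)" for i j
    by (intro Lpconv2_mult Lpconv4_mult c4 t)
  have cAB: "Lpconv 1 lborel sequentially (\<lambda>k z. \<Sum>j\<in>UNIV. ?A k i j z + ?B k i j z)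
      (\<lambda>z. \<Sum>j\<in>UNIV. (M j z * tens I (w i) z) * tens I (Dw' i j) z + (M j z * tens I (w' i) z) * tens I (Dw i j) z)" for i
    by (intro Lpconv_sum Lpconv_add cA cB) simp_all
  have one: "(LBINT x. b x * (w i x * w' i x)) =
     (LBINT z. (\<Sum>j\<in>UNIV. (M j z * tens I (w i) z) * tens I (Dw' i j) z + (M j z * tens I (w' i) z) * tens I (Dw i j) z))" for i
  proof (rule LIMSEQ_unique)
    show "(\<lambda>k. LBINT x. b x * ((indicator X x * \<phi> k i x) * (indicator X x * \<psi> k i x))) \<longlonglongrightarrow> (LBINT x. b x * (w i x * w' i x))"
      using b by (intro Lpconv1_integral Lpconv_bounded_mult[where B=B] Lpconv2_mult phi psi) auto
    have e: "(LBINT x. b x * ((indicator X x * \<phi> k i x) * (indicator X x * \<psi> k i x))) = (LBINT z. (\<Sum>j\<in>UNIV. ?A k i j z + ?B k i j z))" for k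
    proof -
      have s: "smooth_fun (\<phi> k i)" "smooth_fun (\<psi> k i)" by (intro test_S_smooth[OF phi(1)] test_S_smooth[OF psi(1)])+
      have "(LBINT x. b x * ((indicator X x * \<phi> k i x) * (indicator X x * \<psi> k i x))) = (LBINT x. b x * (\<phi> k i x * \<psi> k i x))"
        using b(3) by (intro integral_cong) (auto simp: indicator_def)
      also have "\<dots> = flux I M (\<lambda>x. \<phi> k i x * \<psi> k i x)"
        by (rule eq) (intro test_S_mult phi psi)
      also have "\<dots> = (LBINT z. (\<Sum>j\<in>UNIV. ?A k i j z + ?B k i j z))"
      proof (rule integral_cong[OF refl])
        fix z
        show "indicator I (snd z) * (\<Sum>j\<in>UNIV. M j z * pd j (\<lambda>x. \<phi> k i x * \<psi> k i x) (fst z)) = (\<Sum>j\<in>UNIV. ?A k i j z + ?B k i j z)"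
        proof (cases "z \<in> Q")
          case True
          then have "indicator X (fst z) = (1::real)" by auto
          moreover have "pd j (\<lambda>x. \<phi> k i x * \<psi> k i x) y = \<phi> k i y * pd j (\<psi> k i) y + pd j (\<phi> k i) y * \<psi> k i y" for j y
            by (intro dderiv_mult smooth_differentiable s)
          moreover have "indicator I y * indicator I y = (indicator I y :: real)" for y by (auto simp: indicator_def)
          ultimately show ?thesis unfolding tens_def sum_distrib_left
            by (intro sum.cong refl) (simp add: indicator_def algebra_simps)
        qed (simp add: zero)
      qed
      finally show ?thesis .
    qed
    show "(\<lambda>k. LBINT x. b x * ((indicator X x * \<phi> k i x) * (indicator X x * \<psi> k i x))) \<longlonglongrightarrow>
       (LBINT z. (\<Sum>j\<in>UNIV. (M j z * tens I (w i) z) * tens I (Dw' i j) z + (M j z * tens I (w' i) z) * tens I (Dw i j) z))"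
      unfolding e by (intro Lpconv1_integral cAB)
  qed
  have i1: "integrable lborel (\<lambda>x. b x * (w i x * w' i x))" for i
  proof -
    have "Lp 1 lborel (\<lambda>x. w i x * w' i x)"
      unfolding Lp1 by (intro Lp2_mult LpconvD(2)[OF phi(2)] LpconvD(2)[OF psi(2)])
    from Lp_bounded_mult[OF this, of b B] show ?thesis using b by (simp add: Lp1)
  qed
  have "(LBINT x. b x * (\<Sum>i\<in>UNIV. w i x * w' i x)) = (\<Sum>i\<in>UNIV. LBINT x. b x * (w i x * w' i x))"
    using i1 by (simp add: sum_distrib_left integral_sum)
  also have "\<dots> = (LBINT z. (\<Sum>i\<in>UNIV. \<Sum>j\<in>UNIV. (M j z * tens I (w i) z) * tens I (Dw' i j) z + (M j z * tens I (w' i) z) * tens I (Dw i j) z))"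
    unfolding one by (rule integral_sum[symmetric]) (use LpconvD(2)[OF cAB] in \<open>simp add: Lp1\<close>)
  finally show ?thesis .
qed

text \<open>Everything known at almost every time is gathered in one predicate, so that two such
  times can be compared without further exceptional sets.\<close>

definition good :: "real \<Rightarrow> bool" where
  "good t \<longleftrightarrow> t \<in> {0<..<T} \<and> H1_approx st (\<lambda>i x. U i (x, t)) (\<lambda>i j x. G i j (x, t)) \<and>
    (AE x in lborel. (\<Sum>i\<in>UNIV. G i i (x, t)) = 0) \<and>
    (\<forall>\<phi>. test_S st \<phi> \<longrightarrow> (LBINT x. r (x, t) * \<phi> x) = (LBINT x. r0 x * \<phi> x) +
        flux {0<..<t} M \<phi>) \<and>
    (\<forall>i \<phi>. test_S st \<phi> \<longrightarrow> (LBINT x. M i (x, t) * \<phi> x) = (LBINT x. m0 i x * \<phi> x) +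
        flux {0<..<t} (FP i) \<phi>)"

lemma AE_good: "AE t\<in>{0<..<T} in lborel. good t"
proof -
  have "AE t in lborel. \<forall>i. t \<in> {0<..<T} \<longrightarrow> (\<forall>\<phi>. test_S st \<phi> \<longrightarrow>
      (LBINT x. M i (x, t) * \<phi> x) = (LBINT x. m0 i x * \<phi> x) +
        flux {0<..<t} (FP i) \<phi>)"
    unfolding AE_all_countable
  proof
    fix i
    show "AE t\<in>{0<..<T} in lborel. (\<forall>\<phi>. test_S st \<phi> \<longrightarrow>
      (LBINT x. M i (x, t) * \<phi> x) = (LBINT x. m0 i x * \<phi> x) +
        flux {0<..<t} (FP i) \<phi>)"
      using mom[of i] by (simp add: M_def Fl_def add.commute[of _ "if _ then _ else _"] add_diff_eq)
  qed
  then show ?thesis using div slice mass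
    by eventually_elim (auto simp: good_def M_def)
qed

lemma good_Lp: "good t \<Longrightarrow> Lp 2 lborel (\<lambda>x. U i (x, t))" "good t \<Longrightarrow> Lp 2 lborel (\<lambda>x. M i (x, t))"
proof -
  assume "good t"
  then show "Lp 2 lborel (\<lambda>x. U i (x, t))" by (auto simp: good_def dest: H1_approx_Lp)
  then show "Lp 2 lborel (\<lambda>x. M i (x, t))" unfolding M_def
    using r_abs by (intro Lp_bounded_mult[where B=c2]) auto
qed

lemma Lp_Xphi: "test_S st \<phi> \<Longrightarrow> Lp 2 lborel (\<lambda>x. indicator X x * \<phi> x)"
  by (intro Lp_test[OF st] test_S_smooth) auto

lemma integrable_Mphi:
  assumes "good t" "test_S st \<phi>"
  shows "integrable lborel (\<lambda>x. M i (x, t) * \<phi> x)"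
  using Lp2_mult[OF good_Lp(2)[OF assms(1)] Lp_Xphi[OF assms(2)], of i]
  by (rule integrable_cong[OF refl, THEN iffD1, rotated]) (auto simp: indicator_def zero)

lemma integrable_rphi:
  assumes "test_S st \<phi>" shows "integrable lborel (\<lambda>x. r (x, t) * \<phi> x)"
proof -
  have "Lp 1 lborel (\<lambda>x. r (x, t) * (indicator X x * \<phi> x))"
    by (rule Lp_bounded_mult[OF Lp_test[OF st test_S_smooth[OF assms]], where B=c2]) (use r_abs in auto)
  then show ?thesis unfolding Lp1
    by (rule integrable_cong[OF refl, THEN iffD1, rotated]) (auto simp: indicator_def r_zero)
qed

lemma integrable_flux:
  assumes q: "\<And>j. Lp 2 lborel (q j)" "\<And>j z. z \<notin> Q \<Longrightarrow> q j z = 0" and \<phi>: "test_S st \<phi>" and J: "J \<in> sets borel"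
  shows "integrable lborel (\<lambda>z. indicator J (snd z) * (\<Sum>j\<in>UNIV. q j z * pd j \<phi> (fst z)))"
proof -
  have s: "smooth_fun (pd j \<phi>)" for j by (intro smooth_pd test_S_smooth[OF \<phi>])
  have [measurable]: "pd j \<phi> \<in> borel_measurable borel" for j by (rule smooth_borel[OF s])
  have L: "Lp 2 lborel (tens {0<..<T} (\<lambda>x. indicator X x * pd j \<phi> x))" for j
    by (rule Lp_tens[where a=0 and b=T]) (auto intro!: Lp_test[OF st s])
  have "integrable lborel (\<lambda>z. \<Sum>j\<in>UNIV. indicator J (snd z) * (q j z * tens {0<..<T} (\<lambda>x. indicator X x * pd j \<phi> x) z))"
  proof (rule integrable_sum)
    fix j
    have "Lp 1 lborel (\<lambda>z. indicator J (snd z) * (q j z * tens {0<..<T} (\<lambda>x. indicator X x * pd j \<phi> x) z))"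
      using J by (intro Lp_bounded_mult[where B=1] Lp2_mult[THEN Lp1(1)[THEN iffD2]] q L) (auto simp: indicator_def)
    then show "integrable lborel (\<lambda>z. indicator J (snd z) * (q j z * tens {0<..<T} (\<lambda>x. indicator X x * pd j \<phi> x) z))"
      by (simp add: Lp1)
  qed
  moreover have "indicator J (snd z) * (\<Sum>j\<in>UNIV. q j z * pd j \<phi> (fst z)) =
     (\<Sum>j\<in>UNIV. indicator J (snd z) * (q j z * tens {0<..<T} (\<lambda>x. indicator X x * pd j \<phi> x) z))" for z
  proof (cases "z \<in> Q")
    case True
    then have "indicator X (fst z) = (1::real)" "indicator {0<..<T} (snd z) = (1::real)" by auto
    then show ?thesis by (simp add: sum_distrib_left tens_def)
  qed (simp add: q(2))
  ultimately show ?thesis by simp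
qed

text \<open>The half-open interval on the right is exactly the difference of the two open ones, so
  no null set of times has to be discarded.\<close>

lemma flux_increment:
  assumes q: "\<And>j. Lp 2 lborel (q j)" "\<And>j z. z \<notin> Q \<Longrightarrow> q j z = 0" and \<phi>: "test_S st \<phi>" and t: "0 < t1" "t1 < t2"
  shows "flux {0<..<t2} q \<phi>
    - flux {0<..<t1} q \<phi>
    = flux {t1..<t2} q \<phi>"
proof -
  note i = integrable_flux[OF q \<phi>]
  have "flux {0<..<t2} q \<phi>
    - flux {0<..<t1} q \<phi>
    = (LBINT z. indicator {0<..<t2} (snd z) * (\<Sum>j\<in>UNIV. q j z * pd j \<phi> (fst z)) - indicator {0<..<t1} (snd z) * (\<Sum>j\<in>UNIV. q j z * pd j \<phi> (fst z)))"
    by (rule integral_diff[symmetric]) (intro i; simp)+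
  also have "\<dots> = flux {t1..<t2} q \<phi>"
    using t by (intro integral_cong) (auto simp: indicator_def)
  finally show ?thesis .
qed

lemma energy_increment:
  assumes g: "good t1" "good t2" and t: "t1 < t2"
  shows "En t2 - En t1 = (1/2) * (LBINT z. (\<Sum>i\<in>UNIV. \<Sum>j\<in>UNIV.
     Fl i j z * (tens {t1..<t2} (\<lambda>x. G i j (x, t1)) z + tens {t1..<t2} (\<lambda>x. G i j (x, t2)) z)
     - ((M j z * tens {t1..<t2} (\<lambda>x. U i (x, t1)) z) * tens {t1..<t2} (\<lambda>x. G i j (x, t2)) z
       + (M j z * tens {t1..<t2} (\<lambda>x. U i (x, t2)) z) * tens {t1..<t2} (\<lambda>x. G i j (x, t1)) z)))"
proof -
  define I where "I = {t1..<t2}"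
  have tt: "0 < t1" "t2 < T" using g by (auto simp: good_def)
  have I: "I \<in> sets borel" "I \<subseteq> {0..T}" using tt by (auto simp: I_def)
  let ?w1 = "\<lambda>i x. U i (x, t1)" and ?w2 = "\<lambda>i x. U i (x, t2)"
  let ?D1 = "\<lambda>i j x. G i j (x, t1)" and ?D2 = "\<lambda>i j x. G i j (x, t2)"
  define a where "a = (\<lambda>i x. M i (x, t2) - M i (x, t1))"
  define b where "b = (\<lambda>x. r (x, t2) - r (x, t1))"
  have H: "H1_approx st ?w1 ?D1" "H1_approx st ?w2 ?D2" using g by (auto simp: good_def)
  have aL: "Lp 2 lborel (a i)" for i unfolding a_def by (intro Lp_diff good_Lp g) simp
  have a0: "x \<notin> X \<Longrightarrow> a i x = 0" for i x by (simp add: a_def zero)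
  have bm: "b \<in> borel_measurable borel" unfolding b_def by measurable
  have bB: "\<bar>b x\<bar> \<le> 2 * c2" for x using r_abs[of "(x, t2)"] r_abs[of "(x, t1)"] by (auto simp: b_def)
  have b0: "x \<notin> X \<Longrightarrow> b x = 0" for x by (simp add: b_def r_zero)
  \<comment> \<open>The initial terms are common to both times and cancel, leaving only the flux
    between them.\<close>
  have eqa: "(LBINT x. a i x * \<phi> x) = flux I (FP i) \<phi>"
    if "test_S st \<phi>" for i \<phi>
  proof -
    have "(LBINT x. a i x * \<phi> x) = (LBINT x. M i (x, t2) * \<phi> x) - (LBINT x. M i (x, t1) * \<phi> x)"
      using integrable_Mphi[OF g(1) that] integrable_Mphi[OF g(2) that] by (simp add: a_def left_diff_distrib)
    also have "\<dots> = flux {0<..<t2} (FP i) \<phi>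
      - flux {0<..<t1} (FP i) \<phi>"
      using g that unfolding good_def by simp
    also have "\<dots> = flux I (FP i) \<phi>"
      unfolding I_def by (rule flux_increment) (use tt t that Flp_Lp in \<open>auto simp: zero P_zero\<close>)
    finally show ?thesis .
  qed
  have eqb: "(LBINT x. b x * \<phi> x) = flux I M \<phi>"
    if "test_S st \<phi>" for \<phi>
  proof -
    have "(LBINT x. b x * \<phi> x) = (LBINT x. r (x, t2) * \<phi> x) - (LBINT x. r (x, t1) * \<phi> x)"
      using integrable_rphi[OF that] by (simp add: b_def left_diff_distrib)
    also have "\<dots> = flux {0<..<t2} M \<phi>
      - flux {0<..<t1} M \<phi>"
      using g that unfolding good_def by simp
    also have "\<dots> = flux I M \<phi>"
      unfolding I_def by (rule flux_increment) (use tt t that M_Lp in \<open>auto simp: zero\<close>)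
    finally show ?thesis .
  qed
  have dv: "AE x in lborel. (\<Sum>i\<in>UNIV. ?D1 i i x) = 0" "AE x in lborel. (\<Sum>i\<in>UNIV. ?D2 i i x) = 0"
    using g by (auto simp: good_def)
  have mm1: "(LBINT x. (\<Sum>i\<in>UNIV. a i x * ?w1 i x)) = (LBINT z. (\<Sum>i\<in>UNIV. \<Sum>j\<in>UNIV. Fl i j z * tens I (?D1 i j) z))"
    by (rule momentum_H1[OF H(1) aL a0 I eqa dv(1)])
  have mm2: "(LBINT x. (\<Sum>i\<in>UNIV. a i x * ?w2 i x)) = (LBINT z. (\<Sum>i\<in>UNIV. \<Sum>j\<in>UNIV. Fl i j z * tens I (?D2 i j) z))"
    by (rule momentum_H1[OF H(2) aL a0 I eqa dv(2)])
  have ms: "(LBINT x. b x * (\<Sum>i\<in>UNIV. ?w1 i x * ?w2 i x)) =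
    (LBINT z. (\<Sum>i\<in>UNIV. \<Sum>j\<in>UNIV. (M j z * tens I (?w1 i) z) * tens I (?D2 i j) z + (M j z * tens I (?w2 i) z) * tens I (?D1 i j) z))"
    by (rule mass_H1[OF H bm bB b0 I eqb])
  have L: "Lp 2 lborel (?w1 i)" "Lp 2 lborel (?w2 i)" "Lp 4 lborel (?w1 i)" "Lp 4 lborel (?w2 i)"
     "Lp 2 lborel (?D1 i j)" "Lp 2 lborel (?D2 i j)" for i j
    by (rule H1_approx_Lp[OF H(1)] H1_approx_Lp[OF H(2)])+
  have tL: "Lp 4 lborel (tens I (?w1 i))" "Lp 4 lborel (tens I (?w2 i))" "Lp 2 lborel (tens I (?D1 i j))" "Lp 2 lborel (tens I (?D2 i j))" for i j
    by (intro Lp_tens[OF _ I] L; simp)+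
  have ii: "integrable lborel (\<lambda>z. Fl i j z * tens I (?D1 i j) z)" "integrable lborel (\<lambda>z. Fl i j z * tens I (?D2 i j) z)"
    "integrable lborel (\<lambda>z. (M j z * tens I (?w1 i) z) * tens I (?D2 i j) z)" "integrable lborel (\<lambda>z. (M j z * tens I (?w2 i) z) * tens I (?D1 i j) z)" for i j
    by (intro Lp2_mult Lp4_mult Fl_Lp M_Lp tL)+
  have ib: "integrable lborel (\<lambda>x. b x * (\<Sum>i\<in>UNIV. ?w1 i x * ?w2 i x))"
  proof -
    have "Lp 1 lborel (\<lambda>x. \<Sum>i\<in>UNIV. ?w1 i x * ?w2 i x)"
      unfolding Lp1 by (intro integrable_sum Lp2_mult L)
    from Lp_bounded_mult[OF this, of b "2 * c2"] show ?thesis using bm bB by (simp add: Lp1)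
  qed
  have ia: "integrable lborel (\<lambda>x. \<Sum>i\<in>UNIV. a i x * ?w1 i x)" "integrable lborel (\<lambda>x. \<Sum>i\<in>UNIV. a i x * ?w2 i x)"
    by (intro integrable_sum Lp2_mult L aL)+
  have iE: "integrable lborel (\<lambda>x. \<Sum>i\<in>UNIV. M i (x, t) * U i (x, t))" if "good t" for t
    by (intro integrable_sum Lp2_mult good_Lp that)
  have "En t2 - En t1 = (1/2) * (LBINT x. (\<Sum>i\<in>UNIV. M i (x, t2) * U i (x, t2)) - (\<Sum>i\<in>UNIV. M i (x, t1) * U i (x, t1)))"
    using iE g by (simp add: En_def right_diff_distrib)
  also have "(LBINT x. (\<Sum>i\<in>UNIV. M i (x, t2) * U i (x, t2)) - (\<Sum>i\<in>UNIV. M i (x, t1) * U i (x, t1)))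
    = (LBINT x. (\<Sum>i\<in>UNIV. a i x * ?w1 i x) + (\<Sum>i\<in>UNIV. a i x * ?w2 i x) - b x * (\<Sum>i\<in>UNIV. ?w1 i x * ?w2 i x))"
    by (intro integral_cong refl)
       (simp add: a_def b_def M_def sum_distrib_left sum.distrib[symmetric] sum_subtractf[symmetric] algebra_simps)
  also have "\<dots> = (LBINT x. (\<Sum>i\<in>UNIV. a i x * ?w1 i x)) + (LBINT x. (\<Sum>i\<in>UNIV. a i x * ?w2 i x)) - (LBINT x. b x * (\<Sum>i\<in>UNIV. ?w1 i x * ?w2 i x))"
    using ia ib by simp
  also have "\<dots> = (LBINT z. (\<Sum>i\<in>UNIV. \<Sum>j\<in>UNIV. Fl i j z * tens I (?D1 i j) z)) + (LBINT z. (\<Sum>i\<in>UNIV. \<Sum>j\<in>UNIV. Fl i j z * tens I (?D2 i j) z))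
     - (LBINT z. (\<Sum>i\<in>UNIV. \<Sum>j\<in>UNIV. (M j z * tens I (?w1 i) z) * tens I (?D2 i j) z + (M j z * tens I (?w2 i) z) * tens I (?D1 i j) z))"
    by (simp only: mm1 mm2 ms)
  also have "\<dots> = (LBINT z. (\<Sum>i\<in>UNIV. \<Sum>j\<in>UNIV. Fl i j z * tens I (?D1 i j) z) + (\<Sum>i\<in>UNIV. \<Sum>j\<in>UNIV. Fl i j z * tens I (?D2 i j) z)
     - (\<Sum>i\<in>UNIV. \<Sum>j\<in>UNIV. (M j z * tens I (?w1 i) z) * tens I (?D2 i j) z + (M j z * tens I (?w2 i) z) * tens I (?D1 i j) z))"
    using ii by (simp del: sum_subtractf)
  also have "\<dots> = (LBINT z. (\<Sum>i\<in>UNIV. \<Sum>j\<in>UNIV. Fl i j z * (tens I (?D1 i j) z + tens I (?D2 i j) z)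
     - ((M j z * tens I (?w1 i) z) * tens I (?D2 i j) z + (M j z * tens I (?w2 i) z) * tens I (?D1 i j) z)))"
    by (simp add: sum_subtractf sum.distrib distrib_left)
  finally show ?thesis unfolding I_def .
qed

end

section \<open>The averaged energy increment and its limit\<close>

lemma diff_eq_diff_of_add_eq: "p + q = u + v \<Longrightarrow> p - v = u - (q::real)"
  by simp

context energy_data
begin

definition Diss :: "real \<Rightarrow> real" where
  "Diss t = (LBINT x. (\<Sum>i\<in>UNIV. \<Sum>j\<in>UNIV. V i j (x, t) * G i j (x, t)))"

lemma integrable_VG: "integrable lborel (\<lambda>z. (\<Sum>i\<in>UNIV. \<Sum>j\<in>UNIV. V i j z * G i j z))"
  by (intro integrable_sum Lp2_mult V_Lp G_Lp)

lemma integrable_Diss: "integrable lborel Diss"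
  using lborel_integrable_snd[OF integrable_VG] by (simp add: Diss_def[abs_def])

lemma integrable_MU: "integrable lborel (\<lambda>z. (\<Sum>i\<in>UNIV. M i z * U i z))"
  by (intro integrable_sum Lp2_mult M_Lp U_Lp)

lemma integrable_En: "integrable lborel En"
  using lborel_integrable_snd[OF integrable_MU] by (simp add: En_def[abs_def])

text \<open>The increment of the energy over \<open>[t, t + h]\<close>, written at the point \<open>z\<close> with time \<open>t\<close>: the fluxes are
  evaluated at the intermediate time \<open>t + \<rho>\<close>.\<close>
definition dens :: "real \<Rightarrow> real \<Rightarrow> (real^'n) \<times> real \<Rightarrow> real" where
  "dens \<rho> h z = (1/2) * (\<Sum>i\<in>UNIV. \<Sum>j\<in>UNIV. Fl i j (z + (0, \<rho>)) * (G i j z + G i j (z + (0, h)))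
     - ((M j (z + (0, \<rho>)) * U i z) * G i j (z + (0, h)) + (M j (z + (0, \<rho>)) * U i (z + (0, h))) * G i j z))"

text \<open>The variable is a space-time point together with a delay. Every factor of
  \<open>dens\<close> becomes a function translated in time by 0, by the delay or by
  \<open>h\<close>, to which the shearing lemma applies.\<close>

lemma integrable_dens_triple:
  assumes ab: "0 \<le> a" "b \<le> T"
  shows "integrable lborel (\<lambda>w. indicator {0..<h} (snd w) * (indicator {a<..<b} (snd (fst w)) * dens (snd w) h (fst w)))"
proof -
  \<comment> \<open>Each factor carries its own copy of the indicator of the delay window; being
    idempotent, the copies collapse to one in the products.\<close>
  define A where "A = (\<lambda>f (d :: real \<Rightarrow> real) (w :: ((real^'n) \<times> real) \<times> real). (indicator {0..<h} (snd w) :: real) * f (fst w + (0, d (snd w))))"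
  have ALp: "Lp p lborel (A f d)" if "0 < p" "Lp p lborel f" "d \<in> borel_measurable borel" for p f d
    unfolding A_def by (rule Lp_sheared_time[OF that(1,2) Lp_ind_interval[of _ _ 0 h] that(3)]) (use that in auto)
  let ?i = "\<lambda>r::real. r" and ?h = "\<lambda>r::real. h" and ?z = "\<lambda>r::real. 0::real"
  define k where "k = (\<lambda>w. (1/2) * (\<Sum>i\<in>UNIV. \<Sum>j\<in>UNIV. A (Fl i j) ?i w * (A (G i j) ?z w + A (G i j) ?h w)
     - ((A (M j) ?i w * A (U i) ?z w) * A (G i j) ?h w + (A (M j) ?i w * A (U i) ?h w) * A (G i j) ?z w)))"
  have "integrable lborel k" unfolding k_def
    by (intro integrable_mult_right integrable_sum integrable_diff integrable_add
        Lp2_mult Lp4_mult Lp_add ALp Fl_Lp G_Lp M_Lp U_Lp) simp_all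
  then have "integrable lborel (\<lambda>w. k w * indicator {a<..<b} (snd (fst w)))"
    by (rule integrable_bounded_mult[where B=1]) (auto simp: indicator_def)
  moreover have "k w * indicator {a<..<b} (snd (fst w)) = indicator {0..<h} (snd w) * (indicator {a<..<b} (snd (fst w)) * dens (snd w) h (fst w))" for w
  proof (cases "snd w \<in> {0..<h}")
    case True
    then show ?thesis by (simp add: k_def A_def dens_def mult_ac zero_prod_def[symmetric])
  qed (simp add: k_def A_def)
  ultimately show ?thesis by simp
qed

text \<open>The bounds on \<open>a\<close>, \<open>b\<close> and \<open>h\<close> keep
  \<open>t\<close> and \<open>t + h\<close> inside (0, T), so the increment identity holds for
  almost every \<open>t\<close>. The change of variables then trades the intermediate time of the
  flux for a delay from the base time.\<close>

lemma energy_average: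
  assumes ab: "0 < a" "b < T" and h: "0 < h" "h \<le> T - b"
  shows "(LBINT t. indicator {a<..<b} t * (En (t + h) - En t)) =
     (LBINT \<rho>. indicator {0..<h} \<rho> * (LBINT z. indicator {a<..<b} (snd z) * dens \<rho> h z))"
proof -
  define k where "k = (\<lambda>w. indicator {0..<h} (snd w) * (indicator {a<..<b} (snd (fst w)) * dens (snd w) h (fst w)))"
  have ik: "integrable lborel k" unfolding k_def by (rule integrable_dens_triple) (use ab in auto)
  have "(LBINT t. indicator {a<..<b} t * (En (t + h) - En t)) = (LBINT t. LBINT y. k ((fst y, t), snd y - t))"
  proof (rule integral_cong_AE)
    have [measurable]: "En \<in> borel_measurable borel" using integrable_En by auto
    show "(\<lambda>t. indicator {a<..<b} t * (En (t + h) - En t)) \<in> borel_measurable lborel" by measurable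
    show "(\<lambda>t. LBINT y. k ((fst y, t), snd y - t)) \<in> borel_measurable lborel"
      using time_difference_integrable[OF ik] by auto
    \<comment> \<open>The shifted exceptional set of times is again null.\<close>
    have "AE t in lborel. t + h \<in> {0<..<T} \<longrightarrow> good (t + h)"
      using lborel_AE_shift[OF AE_good, of h] by simp
    with AE_good show "AE t in lborel. indicator {a<..<b} t * (En (t + h) - En t) = (LBINT y. k ((fst y, t), snd y - t))"
    proof eventually_elim
      case (elim t)
      show ?case
      proof (cases "t \<in> {a<..<b}")
        case True
        then have g: "good t" "good (t + h)" using elim ab h by auto
        have "En (t + h) - En t = (LBINT y. k ((fst y, t), snd y - t))"
          unfolding energy_increment[OF g, OF less_add_same_cancel1[THEN iffD2, OF h(1)]] integral_mult_right_zero[symmetric]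
        proof (rule integral_cong[OF refl])
          fix y :: "(real^'n) \<times> real"
          have s: "(fst y, t) + (0, snd y - t) = y" "(fst y, t) + (0, h) = (fst y, t + h)" by (auto simp: prod_eq_iff)
          show "(1/2) * (\<Sum>i\<in>UNIV. \<Sum>j\<in>UNIV.
             Fl i j y * (tens {t..<t + h} (\<lambda>x. G i j (x, t)) y + tens {t..<t + h} (\<lambda>x. G i j (x, t + h)) y)
             - ((M j y * tens {t..<t + h} (\<lambda>x. U i (x, t)) y) * tens {t..<t + h} (\<lambda>x. G i j (x, t + h)) y
               + (M j y * tens {t..<t + h} (\<lambda>x. U i (x, t + h)) y) * tens {t..<t + h} (\<lambda>x. G i j (x, t)) y))
             = k ((fst y, t), snd y - t)"
          proof (cases "snd y \<in> {t..<t + h}")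
            case T: True
            then have "snd y - t \<in> {0..<h}" by auto
            then show ?thesis using T True by (simp add: k_def dens_def tens_def s)
          next
            case False
            then have "snd y - t \<notin> {0..<h}" by auto
            then show ?thesis using False by (simp add: k_def tens_def)
          qed
        qed
        then show ?thesis using True by simp
      qed (simp add: k_def)
    qed
  qed
  also have "\<dots> = (LBINT \<rho>. LBINT z. k (z, \<rho>))" by (rule time_difference_integral[OF ik])
  also have "\<dots> = (LBINT \<rho>. indicator {0..<h} \<rho> * (LBINT z. indicator {a<..<b} (snd z) * dens \<rho> h z))"
    by (simp add: k_def)
  finally show ?thesis .
qed

text \<open>All translates converge to their undelayed versions, and products converge by Hoelder.
  In the limit the convective part of \<open>Fl i j\<close> is r U_i U_j, the same as the product
  M_j U_i coming from the mass balance, so only the viscous term survives.\<close>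

lemma dens_tendsto:
  "((\<lambda>p. LBINT z. indicator {a<..<b} (snd z) * dens (fst p) (snd p) z) \<longlongrightarrow>
     - (LBINT t. indicator {a<..<b} t * Diss t)) (nhds 0 \<times>\<^sub>F at_right 0)"
proof -
  let ?\<Phi> = "nhds (0::real) \<times>\<^sub>F at_right (0::real)"
  have "((\<lambda>p. snd p) \<longlongrightarrow> 0) ?\<Phi>"
    using filterlim_snd[of "at_right 0" "nhds 0"] by (rule filterlim_mono) (auto simp: at_within_le_nhds)
  note shift = Lpconv_shift_time[OF filterlim_fst, of p f for p f] Lpconv_shift_time[OF this]
  have "Lpconv 1 lborel ?\<Phi> (\<lambda>p. dens (fst p) (snd p)) (\<lambda>z. (1/2) * (\<Sum>i\<in>UNIV. \<Sum>j\<in>UNIV. Fl i j z * (G i j z + G i j z)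
     - ((M j z * U i z) * G i j z + (M j z * U i z) * G i j z)))"
    unfolding dens_def
    by (intro Lpconv_cmult Lpconv_sum Lpconv_diff Lpconv2_mult Lpconv_add Lpconv4_mult shift Lpconv_const Fl_Lp G_Lp M_Lp U_Lp) simp_all
  then have "Lpconv 1 lborel ?\<Phi> (\<lambda>p z. indicator {a<..<b} (snd z) * dens (fst p) (snd p) z)
     (\<lambda>z. indicator {a<..<b} (snd z) * ((1/2) * (\<Sum>i\<in>UNIV. \<Sum>j\<in>UNIV. Fl i j z * (G i j z + G i j z)
     - ((M j z * U i z) * G i j z + (M j z * U i z) * G i j z))))"
    by (intro Lpconv_bounded_mult[where B=1]) (auto simp: indicator_def)
  note lim = Lpconv1_integral[OF this]
  have eq: "(1/2) * (\<Sum>i\<in>UNIV. \<Sum>j\<in>UNIV. Fl i j z * (G i j z + G i j z)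
     - ((M j z * U i z) * G i j z + (M j z * U i z) * G i j z)) = - (\<Sum>i\<in>UNIV. \<Sum>j\<in>UNIV. V i j z * G i j z)" for z
    by (simp add: sum_distrib_left sum_negf[symmetric] Fl_def M_def algebra_simps del: sum_negf)
  have "integrable lborel (\<lambda>z. (\<Sum>i\<in>UNIV. \<Sum>j\<in>UNIV. V i j z * G i j z) * indicator {a<..<b} (snd z))"
    by (rule integrable_bounded_mult[OF integrable_VG, where B=1]) (auto simp: indicator_def)
  then have "integrable lborel (\<lambda>z. indicator {a<..<b} (snd z) * (\<Sum>i\<in>UNIV. \<Sum>j\<in>UNIV. V i j z * G i j z))"
    by (simp add: mult.commute)
  from lborel_integral_snd[OF this]
  have "(LBINT z. indicator {a<..<b} (snd z) * - (\<Sum>i\<in>UNIV. \<Sum>j\<in>UNIV. V i j z * G i j z)) = - (LBINT t. indicator {a<..<b} t * Diss t)"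
    by (simp add: Diss_def)
  then show ?thesis using lim unfolding eq by simp
qed

text \<open>The integral of (En(t + e) - En(t)) / e over (a, b) telescopes to an average of the
  energy after \<open>b\<close> minus one after \<open>a\<close>. Its limit is the dissipation
  between the two times, so the averaged du Bois-Reymond lemma applies.\<close>

lemma energy_evolution: "\<exists>L. AE t\<in>{0<..<T} in lborel. En t = L - (LBINT s. indicator {0<..<t} s * Diss s)"
proof -
  \<comment> \<open>With this kernel the average at \<open>p\<close> is the mean of the energy over
    the window from \<open>p\<close> to \<open>p + e\<close>.\<close>
  define s where "s = (indicator {0..<1} :: real \<Rightarrow> real)"
  have "\<exists>L. AE t\<in>{0<..<T} in lborel. En t = L + (LBINT s. indicator {0<..<t} s * (- Diss s))"
  proof (rule du_Bois_Reymond_averages[where s=s, OF T integrable_En])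
    show "integrable lborel (\<lambda>s. - Diss s)" using integrable_Diss by simp
    show "integrable lborel s" "(LBINT r. s r) = 1" by (auto simp: s_def)
    show "\<And>r. 0 \<le> s r" "\<And>r. r \<notin> {0..1} \<Longrightarrow> s r = 0" by (auto simp: s_def indicator_def)
    fix a b assume ab: "0 < a" "a < b" "b < T"
    have iI: "integrable lborel (\<lambda>t. indicator I t * En t)" if "I \<in> sets borel" for I
      using integrable_mult_indicator[OF _ integrable_En, of I] that by simp
    have avg: "(LBINT r. En (p + e * r) * s r) = (1 / e) * (LBINT t. indicator {p..<p + e} t * En t)" if e: "0 < e" for p e
    proof -
      have "(LBINT t. indicator {p..<p + e} t * En t) = e * (LBINT r. indicator {p..<p + e} (p + e * r) * En (p + e * r))"
        using lborel_integral_real_affine[of e "\<lambda>t. indicator {p..<p + e} t * En t" p] e by simp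
      also have "(\<lambda>r. indicator {p..<p + e} (p + e * r) * En (p + e * r)) = (\<lambda>r. En (p + e * r) * s r)"
        using e by (auto simp: s_def indicator_def zero_le_mult_iff)
      finally show ?thesis using e by simp
    qed
    have ev: "(\<forall>\<^sub>F e in at_right 0. (1 / e) * (LBINT \<rho>. indicator {0..<e} \<rho> * (LBINT z. indicator {a<..<b} (snd z) * dens \<rho> e z)) =
       (LBINT r. En (b + e * r) * s r) - (LBINT r. En (a + e * r) * s r))"
      unfolding eventually_at_right_field
    proof (intro exI[of _ "T - b"] conjI allI impI)
      fix e assume e: "0 < e" "e < T - b"
      have sh: "integrable lborel (\<lambda>t. indicator {a<..<b} t * En (t + e))"
        using integrable_mult_indicator[OF _ lborel_integrable_shift[OF integrable_En, of e], of "{a<..<b}"] by simp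
      note [measurable] = borel_measurable_integrable[OF integrable_En]
      have "(LBINT t. indicator {a<..<b} t * En (t + e)) = (LBINT t. indicator {a + e<..<b + e} (t + e) * En (t + e))"
        by (intro integral_cong) (auto simp: indicator_def)
      also have "\<dots> = (LBINT t. indicator {a + e<..<b + e} t * En t)"
        by (rule lborel_integral_shift[of "\<lambda>t. indicator {a + e<..<b + e} t * En t"]) measurable
      finally have e1: "(LBINT t. indicator {a<..<b} t * En (t + e)) = (LBINT t. indicator {a + e<..<b + e} t * En t)" .
      have "(LBINT \<rho>. indicator {0..<e} \<rho> * (LBINT z. indicator {a<..<b} (snd z) * dens \<rho> e z)) =
         (LBINT t. indicator {a<..<b} t * (En (t + e) - En t))"
        using energy_average[of a b e] ab e by simp
      also have "\<dots> = (LBINT t. indicator {a + e<..<b + e} t * En t) - (LBINT t. indicator {a<..<b} t * En t)"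
        using sh iI[of "{a<..<b}"] by (simp add: right_diff_distrib e1)
      \<comment> \<open>Up to endpoints, (a + e, b + e) together with [a, a + e) covers the same
        times as [b, b + e) together with (a, b). Adding instead of subtracting makes this valid
        also when the windows overlap.\<close>
      also have "\<dots> = (LBINT t. indicator {b..<b + e} t * En t) - (LBINT t. indicator {a..<a + e} t * En t)"
      proof -
        have "(LBINT t. indicator {a + e<..<b + e} t * En t) + (LBINT t. indicator {a..<a + e} t * En t)
          = (LBINT t. indicator {a + e<..<b + e} t * En t + indicator {a..<a + e} t * En t)"
          by (intro integral_add[symmetric] iI) auto
        also have "\<dots> = (LBINT t. indicator {b..<b + e} t * En t + indicator {a<..<b} t * En t)"
        proof (rule integral_cong_AE)
          have "AE t in lborel. t \<noteq> a" "AE t in lborel. t \<noteq> a + e" "AE t in lborel. t \<noteq> b" by (rule AE_lborel_singleton)+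
          then show "AE t in lborel. indicator {a + e<..<b + e} t * En t + indicator {a..<a + e} t * En t = indicator {b..<b + e} t * En t + indicator {a<..<b} t * En t"
            by eventually_elim (use ab e in \<open>auto simp: indicator_def\<close>)
        qed measurable
        also have "\<dots> = (LBINT t. indicator {b..<b + e} t * En t) + (LBINT t. indicator {a<..<b} t * En t)"
          by (intro integral_add iI) auto
        finally show ?thesis by (rule diff_eq_diff_of_add_eq)
      qed
      finally show "(1 / e) * (LBINT \<rho>. indicator {0..<e} \<rho> * (LBINT z. indicator {a<..<b} (snd z) * dens \<rho> e z)) =
         (LBINT r. En (b + e * r) * s r) - (LBINT r. En (a + e * r) * s r)"
        using e by (simp add: avg right_diff_distrib)
    qed (use ab in auto)
    have lim: "((\<lambda>e. (1 / e) * (LBINT \<rho>. indicator {0..<e} \<rho> * (LBINT z. indicator {a<..<b} (snd z) * dens \<rho> e z)))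
       \<longlongrightarrow> - (LBINT t. indicator {a<..<b} t * Diss t)) (at_right 0)"
    proof (rule average_tendsto[OF dens_tendsto])
      fix h :: real assume "0 < h"
      show "integrable lborel (\<lambda>r. indicator {0..<h} r * (LBINT z. indicator {a<..<b} (snd z) * dens r h z))"
        using lborel_integrable_snd[OF integrable_dens_triple[of a b h]] ab by simp
    qed
    have neg: "(LBINT t. indicator {a<..<b} t * (- Diss t)) = - (LBINT t. indicator {a<..<b} t * Diss t)"
      by simp
    show "((\<lambda>e. (LBINT r. En (b + e * r) * s r) - (LBINT r. En (a + e * r) * s r)) \<longlongrightarrow>
       (LBINT t. indicator {a<..<b} t * (- Diss t))) (at_right 0)"
      unfolding neg by (rule Lim_transform_eventually[OF lim ev])
  qed
  then show ?thesis by simp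
qed

end

section \<open>The initial energy\<close>

text \<open>Test functions converging a.e. under a common bound that is concentrated on a set where
  every locally integrable function is integrable. This permits dominated convergence against the
  initial data, of which only local integrability is known.\<close>

definition test_approx_seq :: "('n::finite) setting \<Rightarrow> (real^'n \<Rightarrow> real) \<Rightarrow> (nat \<Rightarrow> real^'n \<Rightarrow> real) \<Rightarrow> real \<Rightarrow> (real^'n) set \<Rightarrow> bool" where
  "test_approx_seq st f \<phi> B K \<longleftrightarrow> (\<forall>n. test_S st (\<phi> n)) \<and> K \<in> sets borel \<and> K \<subseteq> region st \<and>
     (\<forall>h :: real^'n \<Rightarrow> real. loc_int_S st h \<longrightarrow> set_integrable lebesgue K h) \<and>
     (\<forall>n x. x \<in> region st \<longrightarrow> \<bar>\<phi> n x\<bar> \<le> B * indicator K x) \<and>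
     (AE x\<in>region st in lborel. (\<lambda>n. \<phi> n x) \<longlonglongrightarrow> f x)"

definition bounded_test_approx :: "('n::finite) setting \<Rightarrow> (real^'n \<Rightarrow> real) \<Rightarrow> bool" where
  "bounded_test_approx st f \<longleftrightarrow> (\<exists>\<phi> B K. test_approx_seq st f \<phi> B K)"

lemma test_approx_seqD:
  assumes "test_approx_seq st f \<phi> B K"
  shows "test_S st (\<phi> n)" "K \<in> sets borel" "K \<subseteq> region st"
    "\<forall>h :: real^'n::finite \<Rightarrow> real. loc_int_S st h \<longrightarrow> set_integrable lebesgue K h"
    "x \<in> region st \<Longrightarrow> \<bar>\<phi> n x\<bar> \<le> B * indicator K x"
    "AE x\<in>region st in lborel. (\<lambda>n. \<phi> n x) \<longlonglongrightarrow> f x"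
  using assms by (auto simp: test_approx_seq_def)

text \<open>The initial velocity is merely measurable; information on it comes through the locally
  integrable momentum \<open>m0\<close>. The sets \<open>Kx k\<close> exhaust the region and
  localise the approximations.\<close>

locale energy_data_init = energy_data st T c1 c2 r U G V P r0 m0
  for st :: "('n::finite) setting" and T c1 c2 r U G V P r0 m0 +
  fixes u0 :: "'n \<Rightarrow> real^'n \<Rightarrow> real" and Kx :: "nat \<Rightarrow> (real^'n) set"
  assumes r0: "r0 \<in> borel_measurable borel" "\<And>x. x \<notin> region st \<Longrightarrow> r0 x = 0" "loc_int_S st r0"
    and u0: "\<And>i. u0 i \<in> borel_measurable borel"
    and m0_eq: "\<And>i x. m0 i x = r0 x * u0 i x" and m0: "\<And>i. loc_int_S st (m0 i)"
    and Kx: "\<And>k. Kx k \<in> sets borel" "\<And>k. Kx k \<subseteq> Kx (Suc k)" "(\<Union>k. Kx k) = region st"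
    and approx: "\<And>f B k. f \<in> borel_measurable borel \<Longrightarrow> (\<And>x. \<bar>f x\<bar> \<le> B) \<Longrightarrow> (\<And>x. x \<notin> Kx k \<Longrightarrow> f x = 0) \<Longrightarrow> bounded_test_approx st f"
begin

lemma u0_meas[measurable]: "u0 i \<in> borel_measurable borel" "r0 \<in> borel_measurable borel" "m0 i \<in> borel_measurable borel"
proof -
  have "m0 i = (\<lambda>x. r0 x * u0 i x)" using m0_eq by auto
  then show "m0 i \<in> borel_measurable borel" using u0 r0 by simp
qed (auto simp: u0 r0)

lemma m0_zero: "x \<notin> X \<Longrightarrow> m0 i x = 0"
  by (simp add: m0_eq r0)

lemma integral_tests_tendsto:
  fixes \<phi> :: "nat \<Rightarrow> real^'n \<Rightarrow> real"
  assumes h: "h \<in> borel_measurable borel" "\<And>x. x \<notin> X \<Longrightarrow> h x = 0" "set_integrable lebesgue K h"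
    and K: "K \<in> sets borel" and \<phi>: "\<And>n. \<phi> n \<in> borel_measurable borel" "\<And>n x. x \<in> X \<Longrightarrow> \<bar>\<phi> n x\<bar> \<le> B * indicator K x"
    and f: "AE x\<in>X in lborel. (\<lambda>n. \<phi> n x) \<longlonglongrightarrow> f x" "f \<in> borel_measurable borel"
  shows "(\<lambda>n. LBINT x. h x * \<phi> n x) \<longlonglongrightarrow> (LBINT x. h x * f x)"
proof (rule integral_dominated_convergence[where w="\<lambda>x. B * \<bar>indicator K x * h x\<bar>"])
  have "integrable lebesgue (\<lambda>x. indicator K x * h x)" using h(3) by (simp add: set_integrable_def)
  then have "integrable lborel (\<lambda>x. indicator K x * h x)" using h(1) K by (subst (asm) integrable_completion) auto
  then show "integrable lborel (\<lambda>x. B * \<bar>indicator K x * h x\<bar>)" by simp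
  show "AE x in lborel. (\<lambda>n. h x * \<phi> n x) \<longlonglongrightarrow> h x * f x"
    using f(1)
  proof eventually_elim
    case (elim x)
    then show ?case using h(2)[of x] by (cases "x \<in> X") (auto intro: tendsto_intros)
  qed
  fix n show "AE x in lborel. norm (h x * \<phi> n x) \<le> B * \<bar>indicator K x * h x\<bar>"
  proof (rule AE_I2)
    fix x show "norm (h x * \<phi> n x) \<le> B * \<bar>indicator K x * h x\<bar>"
      using \<phi>(2)[of x n] h(2)[of x] mult_left_mono[of "\<bar>\<phi> n x\<bar>" "B * indicator K x" "\<bar>h x\<bar>"]
      by (cases "x \<in> X") (auto simp: abs_mult mult_ac)
  qed
qed (use h \<phi> f in auto)

lemma flux_initial:
  assumes q: "\<And>j. Lp 2 lborel (q j)" "\<And>j z. z \<notin> Q \<Longrightarrow> q j z = 0" and \<phi>: "test_S st \<phi>"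
  shows "((\<lambda>t. flux {0<..<t} q \<phi>) \<longlongrightarrow> 0) (at_right 0)"
proof -
  define h where "h = (\<lambda>z. \<Sum>j\<in>UNIV. q j z * pd j \<phi> (fst z))"
  have i: "integrable lborel (\<lambda>z. indicator J (snd z) * h z)" if "J \<in> sets borel" for J
    unfolding h_def by (rule integrable_flux[OF q \<phi> that])
  have ih: "integrable lborel h" using i[of UNIV] by simp
  have "(LBINT z. indicator {0<..<t} (snd z) * h z) = (LBINT s. indicator {0<..<t} s * (LBINT x. h (x, s)))" for t
    by (subst lborel_integral_snd[OF i]) simp_all
  then show ?thesis
    using tendsto_integral_initial[OF lborel_integrable_snd[OF ih]] by (simp add: h_def)
qed

text \<open>Testing with squares provides nonnegative test functions even though the approximants
  have no sign. They approximate the indicator of the part of \<open>Kx k\<close> where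
  \<open>h\<close> is negative; an indicator equals its own square.\<close>

lemma nonneg_of_tests:
  assumes h: "h \<in> borel_measurable borel" "\<And>x. x \<notin> X \<Longrightarrow> h x = 0" and loc: "\<And>K. K \<in> sets borel \<Longrightarrow> K \<subseteq> X \<Longrightarrow>
      (\<forall>h :: real^'n \<Rightarrow> real. loc_int_S st h \<longrightarrow> set_integrable lebesgue K h) \<Longrightarrow> set_integrable lebesgue K h"
    and test: "\<And>\<phi>. test_S st \<phi> \<Longrightarrow> 0 \<le> (LBINT x. h x * (\<phi> x * \<phi> x))"
  shows "AE x in lborel. 0 \<le> h x"
proof -
  have "AE x in lborel. \<not> (x \<in> Kx k \<and> h x < 0)" for k
  proof -
    define A where "A = {x \<in> Kx k. h x < 0}"
    have A[measurable]: "A \<in> sets borel" using Kx(1)[of k] h(1) unfolding A_def by measurable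
    define f where "f = (indicator A :: real^'n \<Rightarrow> real)"
    have fm: "f \<in> borel_measurable borel" unfolding f_def by measurable
    have "\<bar>f x\<bar> \<le> 1" "x \<notin> Kx k \<Longrightarrow> f x = 0" for x by (auto simp: f_def A_def indicator_def)
    then have "bounded_test_approx st f" by (rule approx[OF fm])
    then obtain \<phi> B K where "test_approx_seq st f \<phi> B K"
      unfolding bounded_test_approx_def by blast
    note ap = test_approx_seqD[OF this]
    have pm: "\<phi> n \<in> borel_measurable borel" for n by (rule smooth_borel[OF test_S_smooth[OF ap(1)]])
    have ff: "f x * f x = f x" for x by (simp add: f_def indicator_def)
    have "(\<lambda>n. LBINT x. h x * (\<phi> n x * \<phi> n x)) \<longlonglongrightarrow> (LBINT x. h x * (f x * f x))"
    proof (rule integral_tests_tendsto[where K=K and B="B * B"])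
      show "set_integrable lebesgue K h" by (rule loc[OF ap(2-4)])
      show "AE x\<in>X in lborel. (\<lambda>n. \<phi> n x * \<phi> n x) \<longlonglongrightarrow> f x * f x"
        using ap(6) by eventually_elim (auto intro: tendsto_mult)
      show "\<bar>\<phi> n x * \<phi> n x\<bar> \<le> B * B * indicator K x" if "x \<in> X" for n x
        using mult_mono[OF ap(5)[OF that, of n] ap(5)[OF that, of n]] ap(5)[OF that, of n] by (auto simp: abs_mult indicator_def split: if_splits)
    qed (use h ap pm fm in auto)
    then have "0 \<le> (LBINT x. h x * (f x * f x))" by (rule LIMSEQ_le_const) (use test ap(1) in auto)
    then have nn: "0 \<le> (LBINT x. h x * f x)" by (simp add: ff)
    have hf: "h x * f x \<le> 0" for x by (auto simp: f_def A_def indicator_def)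
    have fK: "AE x in lborel. \<bar>h x * f x\<bar> \<le> \<bar>B\<bar> * \<bar>indicator K x * h x\<bar>"
      using ap(6)
    proof eventually_elim
      case (elim x)
      show ?case
      proof (cases "x \<in> X")
        case True
        have "\<bar>f x\<bar> \<le> B * indicator K x"
          by (rule LIMSEQ_le_const2[OF tendsto_rabs]) (use elim True ap(5)[OF True] in auto)
        then show ?thesis using mult_left_mono[of "\<bar>f x\<bar>" "B * indicator K x" "\<bar>h x\<bar>"]
          by (auto simp: abs_mult indicator_def mult_ac split: if_splits)
      qed (simp add: h)
    qed
    have "integrable lebesgue (\<lambda>x. indicator K x * h x)" using loc[OF ap(2-4)] by (simp add: set_integrable_def)
    then have iK: "integrable lborel (\<lambda>x. indicator K x * h x)" using h(1) ap(2) by (subst (asm) integrable_completion) auto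
    have hf_int: "integrable lborel (\<lambda>x. h x * f x)"
      by (rule integrable_bound[of lborel "\<lambda>x. \<bar>B\<bar> * \<bar>indicator K x * h x\<bar>"]) (use iK h(1) fm fK in auto)
    have "0 \<le> (LBINT x. - (h x * f x))" by (rule integral_nonneg_AE) (use hf in auto)
    then have "(LBINT x. - (h x * f x)) = 0" using nn by simp
    then have "AE x in lborel. - (h x * f x) = 0"
      by (subst (asm) integral_nonneg_eq_0_iff_AE) (use hf_int hf in auto)
    then show ?thesis by eventually_elim (auto simp: f_def A_def)
  qed
  then have "AE x in lborel. \<forall>k. \<not> (x \<in> Kx k \<and> h x < 0)" unfolding AE_all_countable by blast
  then show ?thesis
  proof eventually_elim
    case (elim x)
    then show ?case using h(2)[of x] Kx(3) by (cases "x \<in> X") (auto simp: not_less)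
  qed
qed

lemma integrable_Xphi:
  assumes "test_S st \<phi>" shows "integrable lborel (\<lambda>x. indicator X x * \<phi> x)"
  using Lp_test[OF st test_S_smooth[OF assms], of 1] by (simp add: Lp1)

lemma set_integrable_X: "K \<in> sets borel \<Longrightarrow> K \<subseteq> X \<Longrightarrow> set_integrable lebesgue K (\<lambda>x. a * indicator X x :: real)"
proof -
  assume K: "K \<in> sets borel" "K \<subseteq> X"
  have "emeasure lborel K \<le> emeasure lborel X" using K by (intro emeasure_mono) auto
  then have "emeasure lborel K < \<infinity>" using region_finite[OF st] by auto
  then have "integrable lborel (\<lambda>x. a * indicator K x :: real)" using K by auto
  then have "integrable lebesgue (\<lambda>x. a * indicator K x :: real)" using K by (subst integrable_completion) auto
  moreover have "(\<lambda>x. indicator K x *\<^sub>R (a * indicator X x)) = (\<lambda>x. a * indicator K x)"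
    using K(2) by (intro ext) (auto simp: indicator_def)
  ultimately show ?thesis by (simp only: set_integrable_def)
qed

lemma r0phi: "test_S st \<phi> \<Longrightarrow> integrable lborel (\<lambda>x. r0 x * \<phi> x)"
proof -
  assume phi: "test_S st \<phi>"
  obtain K :: "nat \<Rightarrow> (real^'n) set" where K: "\<And>k. compact (K k)"
    "\<And>\<phi>. test_S st \<phi> \<Longrightarrow> \<exists>k. \<forall>x\<in>X - K k. \<phi> x = 0"
    "\<And>k h. loc_int_S st (h :: _ \<Rightarrow> real) \<Longrightarrow> set_integrable lebesgue (K k) h"
    using region_exhaustion[OF st] by metis
  obtain k where k: "\<forall>x\<in>X - K k. \<phi> x = 0" using K(2)[OF phi] by blast
  have [measurable]: "K k \<in> sets borel" using K(1) by (simp add: borel_compact)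
  have "integrable lebesgue (\<lambda>x. indicator (K k) x * r0 x)" using K(3)[OF r0(3), of k] by (simp add: set_integrable_def)
  then have i: "integrable lborel (\<lambda>x. indicator (K k) x * r0 x)" by (subst (asm) integrable_completion) auto
  have "indicator (K k) x * r0 x \<noteq> 0 \<Longrightarrow> x \<in> X" for x using r0(2)[of x] by auto
  then have "integrable lborel (\<lambda>x. (indicator (K k) x * r0 x) * \<phi> x)"
    using integrable_mult_smooth[OF i test_S_smooth[OF phi] region_bounded[OF st], of "\<lambda>x. x"] by simp
  moreover have "(indicator (K k) x * r0 x) * \<phi> x = r0 x * \<phi> x" for x
    using k r0(2)[of x] by (auto simp: indicator_def)
  ultimately show ?thesis by simp
qed

lemma mass_limit:
  assumes "test_S st \<phi>"
  shows "((\<lambda>t. (LBINT x. r0 x * \<phi> x) + flux {0<..<t} M \<phi>) \<longlongrightarrow> (LBINT x. r0 x * \<phi> x)) (at_right 0)"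
  using tendsto_add[OF tendsto_const flux_initial[OF M_Lp(1) zero(1) assms]] by simp

text \<open>Affine bounds survive weak limits: the pairing of \<open>a * r + b\<close> with the
  square of a test function is nonnegative at almost every time, hence also in the limit t to
  0.\<close>

lemma r0_bound:
  assumes nn: "\<And>z. z \<in> Q \<Longrightarrow> 0 \<le> a * r z + b"
  shows "AE x\<in>X in lborel. 0 \<le> a * r0 x + b"
proof -
  have "AE x in lborel. 0 \<le> a * r0 x + b * indicator X x"
  proof (rule nonneg_of_tests)
    show "set_integrable lebesgue K (\<lambda>x. a * r0 x + b * indicator X x)"
      if "K \<in> sets borel" "K \<subseteq> X" "\<forall>h::real^'n \<Rightarrow> real. loc_int_S st h \<longrightarrow> set_integrable lebesgue K h" for K
      using that(3) r0(3) by (intro set_integral_add set_integrable_X[OF that(1,2)] set_integrable_mult_right) blast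
    fix \<phi> assume phi: "test_S st \<phi>"
    define p where "p = (\<lambda>x. \<phi> x * \<phi> x)"
    have p: "test_S st p" unfolding p_def by (intro test_S_mult phi)
    have "0 \<le> a * (LBINT x. r0 x * p x) + b * (LBINT x. indicator X x * p x)"
    proof (rule AE_at_right_limit_le[OF T _ tendsto_const tendsto_add[OF tendsto_mult[OF tendsto_const mass_limit[OF p]] tendsto_const]])
      show "AE t\<in>{0<..<T} in lborel. 0 \<le> a * ((LBINT x. r0 x * p x) + flux {0<..<t} M p) + b * (LBINT x. indicator X x * p x)"
        using AE_good
      proof eventually_elim
        case (elim t)
        show ?case
        proof
          assume t: "t \<in> {0<..<T}"
          have "0 \<le> (LBINT x. a * (r (x, t) * p x) + b * (indicator X x * p x))"
          proof (rule integral_nonneg)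
            fix x show "0 \<le> a * (r (x, t) * p x) + b * (indicator X x * p x)"
              using mult_nonneg_nonneg[OF nn[of "(x, t)"], of "p x"] t by (cases "x \<in> X") (auto simp: p_def r_zero distrib_right mult.assoc)
          qed
          then have "0 \<le> a * (LBINT x. r (x, t) * p x) + b * (LBINT x. indicator X x * p x)"
            using integrable_rphi[OF p] integrable_Xphi[OF p] by simp
          then show "0 \<le> a * ((LBINT x. r0 x * p x) + flux {0<..<t} M p) + b * (LBINT x. indicator X x * p x)"
            using elim t p by (simp add: good_def)
        qed
      qed
    qed
    then show "0 \<le> (LBINT x. (a * r0 x + b * indicator X x) * (\<phi> x * \<phi> x))"
      using r0phi[OF p] integrable_Xphi[OF p] by (simp add: p_def distrib_right mult.assoc)
  qed (auto simp: r0)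
  then show ?thesis by eventually_elim auto
qed

lemma r0_lower: "AE x\<in>X in lborel. c1 \<le> r0 x" and r0_upper: "AE x\<in>X in lborel. r0 x \<le> c2"
  using r0_bound[of 1 "- c1"] r0_bound[of "- 1" c2] r_bd by auto

text \<open>Integrating r |U - \<phi>|^2 \<ge> 0 bounds the energy from below by an expression that
  is linear in \<open>r\<close> and \<open>M\<close>. Such an expression passes to the weak initial
  limit, which the quadratic energy itself need not do.\<close>

lemma test_energy_bound:
  assumes L: "AE t\<in>{0<..<T} in lborel. En t = L - (LBINT s. indicator {0<..<t} s * Diss s)"
    and phi: "\<And>i. test_S st (\<phi> i)"
  shows "2 * (\<Sum>i\<in>UNIV. LBINT x. m0 i x * \<phi> i x) - (\<Sum>i\<in>UNIV. LBINT x. r0 x * (\<phi> i x * \<phi> i x)) \<le> 2 * L"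
proof -
  have p2: "test_S st (\<lambda>x. \<phi> i x * \<phi> i x)" for i by (intro test_S_mult phi)
  define fm where "fm = (\<lambda>i t. flux {0<..<t} (FP i) (\<phi> i))"
  define fr where "fr = (\<lambda>i t. flux {0<..<t} M (\<lambda>x. \<phi> i x * \<phi> i x))"
  have l1: "(fm i \<longlongrightarrow> 0) (at_right 0)" for i
    unfolding fm_def by (rule flux_initial[OF Flp_Lp _ phi]) (auto simp: zero P_zero)
  have l2: "(fr i \<longlongrightarrow> 0) (at_right 0)" for i
    unfolding fr_def by (rule flux_initial[OF M_Lp(1) _ p2]) (auto simp: zero)
  let ?f = "\<lambda>t. 2 * (\<Sum>i\<in>UNIV. (LBINT x. m0 i x * \<phi> i x) + fm i t) - (\<Sum>i\<in>UNIV. (LBINT x. r0 x * (\<phi> i x * \<phi> i x)) + fr i t)"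
  let ?g = "\<lambda>t. 2 * (L - (LBINT s. indicator {0<..<t} s * Diss s))"
  show ?thesis
  proof (rule AE_at_right_limit_le[OF T])
    have "(?f \<longlongrightarrow> 2 * (\<Sum>i\<in>UNIV. (LBINT x. m0 i x * \<phi> i x) + 0) - (\<Sum>i\<in>UNIV. (LBINT x. r0 x * (\<phi> i x * \<phi> i x)) + 0)) (at_right 0)"
      by (intro tendsto_intros l1 l2)
    then show "(?f \<longlongrightarrow> 2 * (\<Sum>i\<in>UNIV. LBINT x. m0 i x * \<phi> i x) - (\<Sum>i\<in>UNIV. LBINT x. r0 x * (\<phi> i x * \<phi> i x))) (at_right 0)"
      by simp
    have "(?g \<longlongrightarrow> 2 * (L - 0)) (at_right 0)"
      by (intro tendsto_intros tendsto_integral_initial integrable_Diss)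
    then show "(?g \<longlongrightarrow> 2 * L) (at_right 0)" by simp
    show "AE t\<in>{0<..<T} in lborel. ?f t \<le> ?g t"
      using AE_good L
    proof eventually_elim
      case (elim t)
      show ?case
      proof
        assume t: "t \<in> {0<..<T}"
        then have g: "good t" using elim by simp
        have "?f t = 2 * (\<Sum>i\<in>UNIV. LBINT x. M i (x, t) * \<phi> i x) - (\<Sum>i\<in>UNIV. LBINT x. r (x, t) * (\<phi> i x * \<phi> i x))"
          using g phi p2 by (simp add: good_def fm_def fr_def)
        also have "\<dots> = (\<Sum>i\<in>UNIV. LBINT x. 2 * (M i (x, t) * \<phi> i x) - r (x, t) * (\<phi> i x * \<phi> i x))"
          using integrable_Mphi[OF g phi] integrable_rphi[OF p2] by (simp add: sum_distrib_left sum_subtractf)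
        also have "\<dots> \<le> (\<Sum>i\<in>UNIV. LBINT x. M i (x, t) * U i (x, t))"
        proof (intro sum_mono integral_mono)
          fix i x
          have "0 \<le> r (x, t)" using r_bd[of "(x, t)"] r_zero[of "(x, t)"] c by (cases "(x, t) \<in> Q") auto
          then have "0 \<le> r (x, t) * ((U i (x, t) - \<phi> i x) * (U i (x, t) - \<phi> i x))" by simp
          then show "2 * (M i (x, t) * \<phi> i x) - r (x, t) * (\<phi> i x * \<phi> i x) \<le> M i (x, t) * U i (x, t)"
            by (simp add: M_def algebra_simps)
        qed (use integrable_Mphi[OF g phi] integrable_rphi[OF p2] in \<open>auto intro!: Lp2_mult good_Lp g\<close>)
        also have "\<dots> = 2 * En t"
          unfolding En_def by (subst integral_sum) (auto intro!: Lp2_mult good_Lp g)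
        also have "\<dots> = ?g t" using elim t by simp
        finally show "?f t \<le> ?g t" .
      qed
    qed
  qed
qed

text \<open>Twice the initial energy density; its integrability is a conclusion, drawn from the
  lower bound for \<open>L\<close>.\<close>

definition w0 :: "real^'n \<Rightarrow> real" where "w0 x = (\<Sum>i\<in>UNIV. r0 x * (u0 i x)^2)"

lemma w0_meas[measurable]: "w0 \<in> borel_measurable borel"
  unfolding w0_def[abs_def] by measurable

lemma integrable_r0_mult:
  assumes [measurable]: "g \<in> borel_measurable borel" and b: "\<And>x. \<bar>g x\<bar> \<le> B"
  shows "integrable lborel (\<lambda>x. r0 x * g x)"
proof (rule integrable_bound[where f="\<lambda>x. c2 * B * indicator X x"])
  show "integrable lborel (\<lambda>x. c2 * B * indicator X x)" using region_finite[OF st] by auto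
  show "AE x in lborel. norm (r0 x * g x) \<le> norm (c2 * B * indicator X x)"
    using r0_lower r0_upper
  proof eventually_elim
    case (elim x)
    show ?case
    proof (cases "x \<in> X")
      case True
      have "\<bar>r0 x\<bar> * \<bar>g x\<bar> \<le> c2 * B" using elim True c b[of x] by (intro mult_mono) auto
      then show ?thesis using True abs_ge_self[of "c2 * B"] by (simp add: abs_mult)
    qed (simp add: r0)
  qed
qed measurable

text \<open>In the bound for test functions the best choice is the initial velocity, for which 2 m0
  u0 - r0 |u0|^2 is \<open>w0\<close>. It is reached by truncating \<open>u0\<close>, approximating
  the truncation by test functions and finally removing the truncation by monotone
  convergence.\<close>

lemma initial_energy_le:
  assumes L: "AE t\<in>{0<..<T} in lborel. En t = L - (LBINT s. indicator {0<..<t} s * Diss s)"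
  shows "integrable lborel w0" "(LBINT x. w0 x) \<le> 2 * L"
proof -
  define s where "s = (\<lambda>x. \<Sum>i\<in>UNIV. \<bar>u0 i x\<bar>)"
  have us: "\<bar>u0 i x\<bar> \<le> s x" for i x unfolding s_def by (rule member_le_sum) auto
  \<comment> \<open>On \<open>S k\<close> all components of \<open>u0\<close> are bounded by
    \<open>k\<close>, and \<open>S k\<close> lies in one of the exhausting sets, as the bounded
    approximation requires.\<close>
  define S where "S = (\<lambda>k. Kx k \<inter> {x. s x \<le> real k})"
  have S[measurable]: "S k \<in> sets borel" for k
    using Kx(1)[of k] unfolding S_def s_def by measurable
  have w0_nn: "AE x in lborel. 0 \<le> w0 x"
    using r0_lower
  proof eventually_elim
    case (elim x)
    then show ?case using c r0(2)[of x] by (cases "x \<in> X") (auto simp: w0_def intro!: sum_nonneg)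
  qed
  have bound: "integrable lborel (\<lambda>x. indicator (S k) x * w0 x)" "(LBINT x. indicator (S k) x * w0 x) \<le> 2 * L" for k
  proof -
    define f where "f = (\<lambda>i x. indicator (S k) x * u0 i x)"
    have fm: "f i \<in> borel_measurable borel" for i unfolding f_def by measurable
    have fb: "\<bar>f i x\<bar> \<le> real k" for i x using us[of i x] by (auto simp: f_def S_def indicator_def)
    have f0: "x \<notin> Kx k \<Longrightarrow> f i x = 0" for i x by (auto simp: f_def S_def indicator_def)
    have "\<exists>\<phi> B K. test_approx_seq st (f i) \<phi> B K" for i
      using approx[OF fm fb f0] unfolding bounded_test_approx_def by blast
    then obtain \<phi> B K where "\<And>i. test_approx_seq st (f i) (\<phi> i) (B i) (K i)" by metis
    note ap = test_approx_seqD[OF this]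
    have pm: "\<phi> i n \<in> borel_measurable borel" for i n by (rule smooth_borel[OF test_S_smooth[OF ap(1)]])
    have l1: "(\<lambda>n. LBINT x. m0 i x * \<phi> i n x) \<longlonglongrightarrow> (LBINT x. m0 i x * f i x)" for i
      by (rule integral_tests_tendsto[OF _ m0_zero ap(4)[rule_format, OF m0] ap(2) pm ap(5) ap(6) fm]) auto
    have l2: "(\<lambda>n. LBINT x. r0 x * (\<phi> i n x * \<phi> i n x)) \<longlonglongrightarrow> (LBINT x. r0 x * (f i x * f i x))" for i
    proof (rule integral_tests_tendsto[OF r0(1,2) ap(4)[rule_format, OF r0(3)] ap(2), where B="B i * B i"])
      show "AE x\<in>X in lborel. (\<lambda>n. \<phi> i n x * \<phi> i n x) \<longlonglongrightarrow> f i x * f i x"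
        using ap(6)[of i] by eventually_elim (auto intro: tendsto_mult)
      show "\<bar>\<phi> i n x * \<phi> i n x\<bar> \<le> B i * B i * indicator (K i) x" if "x \<in> X" for n x
        using mult_mono[OF ap(5)[OF that, of i n] ap(5)[OF that, of i n]] ap(5)[OF that, of i n] by (auto simp: abs_mult indicator_def split: if_splits)
    qed (use pm fm in auto)
    have "2 * (\<Sum>i\<in>UNIV. LBINT x. m0 i x * f i x) - (\<Sum>i\<in>UNIV. LBINT x. r0 x * (f i x * f i x)) \<le> 2 * L"
    proof (rule LIMSEQ_le_const2)
      show "(\<lambda>n. 2 * (\<Sum>i\<in>UNIV. LBINT x. m0 i x * \<phi> i n x) - (\<Sum>i\<in>UNIV. LBINT x. r0 x * (\<phi> i n x * \<phi> i n x)))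
        \<longlonglongrightarrow> 2 * (\<Sum>i\<in>UNIV. LBINT x. m0 i x * f i x) - (\<Sum>i\<in>UNIV. LBINT x. r0 x * (f i x * f i x))"
        by (intro tendsto_intros l1 l2)
      show "\<exists>N. \<forall>n\<ge>N. 2 * (\<Sum>i\<in>UNIV. LBINT x. m0 i x * \<phi> i n x) - (\<Sum>i\<in>UNIV. LBINT x. r0 x * (\<phi> i n x * \<phi> i n x)) \<le> 2 * L"
        using test_energy_bound[OF L, of "\<lambda>i. \<phi> i n" for n] ap(1) by blast
    qed
    moreover have "m0 i x * f i x = r0 x * (f i x * f i x)" for i x
      by (auto simp: m0_eq f_def indicator_def)
    ultimately have le: "(\<Sum>i\<in>UNIV. LBINT x. r0 x * (f i x * f i x)) \<le> 2 * L" by simp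
    have ii: "integrable lborel (\<lambda>x. r0 x * (f i x * f i x))" for i
    proof (rule integrable_r0_mult)
      show "\<bar>f i x * f i x\<bar> \<le> real k * real k" for x using mult_mono[OF fb[of i x] fb[of i x]] by (simp add: abs_mult)
    qed (use fm in auto)
    have eq: "indicator (S k) x * w0 x = (\<Sum>i\<in>UNIV. r0 x * (f i x * f i x))" for x
      by (auto simp: w0_def f_def indicator_def power2_eq_square)
    show "integrable lborel (\<lambda>x. indicator (S k) x * w0 x)" unfolding eq by (intro integrable_sum ii)
    show "(LBINT x. indicator (S k) x * w0 x) \<le> 2 * L"
      unfolding eq using le by (subst integral_sum) (rule ii)
  qed
  have Smono: "S k \<subseteq> S (Suc k)" for k using Kx(2)[of k] by (auto simp: S_def)
  have SU: "\<exists>k. x \<in> S k" if x: "x \<in> X" for x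
  proof -
    obtain k where k: "x \<in> Kx k" using x Kx(3) by blast
    obtain N where "s x \<le> real N" using real_arch_simple by blast
    then have "x \<in> S (max k N)" using k lift_Suc_mono_le[of Kx k "max k N", OF Kx(2)] by (auto simp: S_def)
    then show ?thesis by blast
  qed
  have "(\<integral>\<^sup>+x. ennreal (w0 x) \<partial>lborel) = (\<integral>\<^sup>+x. (SUP k. ennreal (indicator (S k) x * w0 x)) \<partial>lborel)"
  proof (rule nn_integral_cong)
    fix x
    show "ennreal (w0 x) = (SUP k. ennreal (indicator (S k) x * w0 x))"
    proof (cases "x \<in> X")
      case True
      then obtain k where "x \<in> S k" using SU by blast
      then have "ennreal (w0 x) \<le> (SUP k. ennreal (indicator (S k) x * w0 x))"
        by (intro SUP_upper2[of k]) auto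
      moreover have "(SUP k. ennreal (indicator (S k) x * w0 x)) \<le> ennreal (w0 x)"
        by (rule SUP_least) (auto simp: indicator_def)
      ultimately show ?thesis by (rule antisym)
    qed (simp add: w0_def r0)
  qed
  also have "\<dots> = (SUP k. \<integral>\<^sup>+x. ennreal (indicator (S k) x * w0 x) \<partial>lborel)"
  proof (rule nn_integral_monotone_convergence_SUP)
    show "incseq (\<lambda>k x. ennreal (indicator (S k) x * w0 x))"
    proof (rule incseq_SucI, rule le_funI)
      fix k x show "ennreal (indicator (S k) x * w0 x) \<le> ennreal (indicator (S (Suc k)) x * w0 x)"
        using Smono[of k] by (auto simp: indicator_def)
    qed
  qed measurable
  also have "\<dots> \<le> ennreal (2 * L)"
  proof (rule SUP_least)
    fix k
    have "AE x in lborel. 0 \<le> indicator (S k) x * w0 x" using w0_nn by eventually_elim auto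
    then have "(\<integral>\<^sup>+x. ennreal (indicator (S k) x * w0 x) \<partial>lborel) = ennreal (LBINT x. indicator (S k) x * w0 x)"
      by (rule nn_integral_eq_integral[OF bound(1)])
    also have "\<dots> \<le> ennreal (2 * L)" by (intro ennreal_leI bound)
    finally show "(\<integral>\<^sup>+x. ennreal (indicator (S k) x * w0 x) \<partial>lborel) \<le> ennreal (2 * L)" .
  qed
  finally have nn: "(\<integral>\<^sup>+x. ennreal (w0 x) \<partial>lborel) \<le> ennreal (2 * L)" .
  show i: "integrable lborel w0"
    by (rule integrableI_nonneg) (use w0_nn nn in \<open>auto simp: le_less_trans[OF nn]\<close>)
  have "0 \<le> (LBINT x. indicator (S 0) x * w0 x)" by (intro integral_nonneg_AE) (use w0_nn in \<open>auto elim: eventually_mono\<close>)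
  then have L0: "0 \<le> 2 * L" using bound(2)[of 0] by linarith
  show "(LBINT x. w0 x) \<le> 2 * L"
    using nn L0 unfolding nn_integral_eq_integral[OF i w0_nn] by (simp add: ennreal_le_iff)
qed

text \<open>The bounds of \<open>r0\<close> hold only almost everywhere; clamping provides a version
  that is bounded at every point, as the testing of the mass balance demands.\<close>

definition r0c :: "real^'n \<Rightarrow> real" where "r0c x = indicator X x * clampr c1 c2 (r0 x)"

lemma r0c_AE: "AE x in lborel. r0c x = r0 x"
  using r0_lower r0_upper
proof eventually_elim
  case (elim x)
  then show ?case by (cases "x \<in> X") (auto simp: r0c_def clampr_id r0)
qed

lemma r0c: "r0c \<in> borel_measurable borel" "0 \<le> r0c x" "r0c x \<le> c2" "x \<notin> X \<Longrightarrow> r0c x = 0"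
  using clampr_bounds[OF c(2), of "r0 x"] c by (auto simp: r0c_def[abs_def] indicator_def)

lemma m0_Lp:
  assumes "integrable lborel w0" shows "Lp 2 lborel (m0 i)"
  unfolding Lp_def
proof
  show "integrable lborel (\<lambda>x. \<bar>m0 i x\<bar>^2)"
  proof (rule integrable_bound[where f="\<lambda>x. c2 * w0 x"])
    show "AE x in lborel. norm (\<bar>m0 i x\<bar>^2) \<le> norm (c2 * w0 x)"
      using r0_lower r0_upper
    proof eventually_elim
      case (elim x)
      show ?case
      proof (cases "x \<in> X")
        case True
        then have rr: "0 \<le> r0 x" "r0 x \<le> c2" using elim c by auto
        have "r0 x * (u0 i x)^2 \<le> w0 x" unfolding w0_def using rr by (intro member_le_sum) auto
        then have "r0 x * (r0 x * (u0 i x)^2) \<le> c2 * w0 x" using rr by (intro mult_mono) auto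
        moreover have "0 \<le> c2 * w0 x" using rr c by (auto simp: w0_def intro!: mult_nonneg_nonneg sum_nonneg)
        moreover have "0 \<le> r0 x * (r0 x * (u0 i x)^2)" using rr by simp
        ultimately show ?thesis by (simp add: m0_eq power2_eq_square mult_ac)
      qed (simp add: m0_zero)
    qed
  qed (use assms in auto)
qed simp

definition init_err :: "real \<Rightarrow> real" where
  "init_err t = (LBINT y. (\<Sum>i\<in>UNIV. \<Sum>j\<in>UNIV. Fl i j y * tens {0<..<t} (\<lambda>x. G i j (x, t)) y
     - (M j y * tens {0<..<t} (\<lambda>x. U i (x, t)) y) * tens {0<..<t} (\<lambda>x. G i j (x, t)) y))"

text \<open>Testing both increments from 0 to \<open>t\<close> with the slice at \<open>t\<close>
  leaves a mixed term m0 U and a term r0 |U|^2. Young's inequality with weight \<open>r0\<close>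
  absorbs the mixed term, and the terms r0 |U|^2 then cancel.\<close>

lemma energy_le_initial:
  assumes w: "integrable lborel w0" and g: "good t"
  shows "En t \<le> (1/2) * (LBINT x. w0 x) + init_err t"
proof -
  have t: "0 < t" "t < T" using g by (auto simp: good_def)
  define I where "I = {0<..<t}"
  have I: "I \<in> sets borel" "I \<subseteq> {0..T}" using t by (auto simp: I_def)
  let ?w = "\<lambda>i x. U i (x, t)" and ?D = "\<lambda>i j x. G i j (x, t)"
  have H: "H1_approx st ?w ?D" using g by (auto simp: good_def)
  define a where "a = (\<lambda>i x. M i (x, t) - m0 i x)"
  define b where "b = (\<lambda>x. r (x, t) - r0c x)"
  have aL: "Lp 2 lborel (a i)" for i unfolding a_def by (intro Lp_diff good_Lp g m0_Lp w) simp
  have a0: "x \<notin> X \<Longrightarrow> a i x = 0" for i x by (simp add: a_def zero m0_zero)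
  have bm: "b \<in> borel_measurable borel" unfolding b_def using r0c(1) by measurable
  have bB: "\<bar>b x\<bar> \<le> 2 * c2" for x using r_abs[of "(x, t)"] r0c(2,3)[of x] by (auto simp: b_def)
  have b0: "x \<notin> X \<Longrightarrow> b x = 0" for x by (simp add: b_def r_zero r0c)
  have m0phi: "integrable lborel (\<lambda>x. m0 i x * \<phi> x)" if "test_S st \<phi>" for i \<phi>
  proof -
    have "integrable lborel (\<lambda>x. m0 i x * (indicator X x * \<phi> x))" by (intro Lp2_mult m0_Lp w Lp_Xphi that)
    moreover have "(\<lambda>x. m0 i x * (indicator X x * \<phi> x)) = (\<lambda>x. m0 i x * \<phi> x)" by (rule ext) (auto simp: indicator_def m0_zero)
    ultimately show ?thesis by (simp only:)
  qed
  have eqa: "(LBINT x. a i x * \<phi> x) = flux I (FP i) \<phi>"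
    if "test_S st \<phi>" for i \<phi>
    using g that integrable_Mphi[OF g that, of i] m0phi[OF that, of i] by (simp add: a_def left_diff_distrib good_def I_def)
  have eqb: "(LBINT x. b x * \<phi> x) = flux I M \<phi>"
    if "test_S st \<phi>" for \<phi>
  proof -
    have [measurable]: "\<phi> \<in> borel_measurable borel" by (rule smooth_borel[OF test_S_smooth[OF that]])
    have "(LBINT x. b x * \<phi> x) = (LBINT x. r (x, t) * \<phi> x - r0 x * \<phi> x)"
    proof (rule integral_cong_AE)
      show "AE x in lborel. b x * \<phi> x = r (x, t) * \<phi> x - r0 x * \<phi> x"
        using r0c_AE by eventually_elim (simp add: b_def left_diff_distrib)
      show "(\<lambda>x. b x * \<phi> x) \<in> borel_measurable lborel" using bm by measurable
    qed measurable
    then show ?thesis using g that integrable_rphi[OF that, of t] r0phi[OF that] by (simp add: good_def I_def)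
  qed
  have dv: "AE x in lborel. (\<Sum>i\<in>UNIV. ?D i i x) = 0" using g by (auto simp: good_def)
  have mm: "(LBINT x. (\<Sum>i\<in>UNIV. a i x * ?w i x)) = (LBINT z. (\<Sum>i\<in>UNIV. \<Sum>j\<in>UNIV. Fl i j z * tens I (?D i j) z))"
    by (rule momentum_H1[OF H aL a0 I eqa dv])
  have ms: "(LBINT x. b x * (\<Sum>i\<in>UNIV. ?w i x * ?w i x)) =
    (LBINT z. (\<Sum>i\<in>UNIV. \<Sum>j\<in>UNIV. (M j z * tens I (?w i) z) * tens I (?D i j) z + (M j z * tens I (?w i) z) * tens I (?D i j) z))"
    by (rule mass_H1[OF H H bm bB b0 I eqb])
  note L = H1_approx_Lp[OF H]
  have tL: "Lp 4 lborel (tens I (?w i))" "Lp 2 lborel (tens I (?D i j))" for i j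
    by (intro Lp_tens[OF _ I] L; simp)+
  have ii: "integrable lborel (\<lambda>z. Fl i j z * tens I (?D i j) z)" "integrable lborel (\<lambda>z. (M j z * tens I (?w i) z) * tens I (?D i j) z)" for i j
    by (intro Lp2_mult Lp4_mult Fl_Lp M_Lp tL)+
  define S where "S = (\<lambda>x. \<Sum>i\<in>UNIV. ?w i x * ?w i x)"
  have iS: "integrable lborel S" unfolding S_def by (intro integrable_sum Lp2_mult L)
  have iMU: "integrable lborel (\<lambda>x. (\<Sum>i\<in>UNIV. M i (x, t) * U i (x, t)))" by (intro integrable_sum Lp2_mult good_Lp g)
  have imU: "integrable lborel (\<lambda>x. (\<Sum>i\<in>UNIV. m0 i x * U i (x, t)))" by (intro integrable_sum Lp2_mult good_Lp g m0_Lp w)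
  have ir0S: "integrable lborel (\<lambda>x. r0c x * S x)"
    using Lp_bounded_mult[of 1 lborel S r0c c2] iS r0c by (simp add: Lp1)
  have e1: "2 * En t - (LBINT x. (\<Sum>i\<in>UNIV. m0 i x * U i (x, t))) = (LBINT z. (\<Sum>i\<in>UNIV. \<Sum>j\<in>UNIV. Fl i j z * tens I (?D i j) z))"
    unfolding mm[symmetric] a_def En_def using iMU imU by (simp add: left_diff_distrib sum_subtractf)
  have ms2: "(LBINT x. b x * S x) = 2 * (LBINT z. (\<Sum>i\<in>UNIV. \<Sum>j\<in>UNIV. (M j z * tens I (?w i) z) * tens I (?D i j) z))"
    unfolding S_def ms integral_mult_right_zero[symmetric]
    by (intro integral_cong refl) (simp add: sum_distrib_left mult_ac)
  have "(LBINT x. b x * S x) = (LBINT x. (\<Sum>i\<in>UNIV. M i (x, t) * U i (x, t)) - r0c x * S x)"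
    by (intro integral_cong refl) (simp add: b_def S_def M_def sum_distrib_left sum_subtractf[symmetric] algebra_simps)
  also have "\<dots> = 2 * En t - (LBINT x. r0c x * S x)" using iMU ir0S by (simp add: En_def)
  finally have e2: "2 * En t - (LBINT x. r0c x * S x) = 2 * (LBINT z. (\<Sum>i\<in>UNIV. \<Sum>j\<in>UNIV. (M j z * tens I (?w i) z) * tens I (?D i j) z))"
    using ms2 by simp
  \<comment> \<open>This is the integrated form of r0 |u0 - U|^2 \<ge> 0, the only place where
    equality is lost.\<close>
  have e3: "2 * (LBINT x. (\<Sum>i\<in>UNIV. m0 i x * U i (x, t))) \<le> (LBINT x. w0 x) + (LBINT x. r0c x * S x)"
  proof -
    have "(LBINT x. 2 * (\<Sum>i\<in>UNIV. m0 i x * U i (x, t))) \<le> (LBINT x. w0 x + r0c x * S x)"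
    proof (rule integral_mono_AE)
      show "AE x in lborel. 2 * (\<Sum>i\<in>UNIV. m0 i x * U i (x, t)) \<le> w0 x + r0c x * S x"
        using r0c_AE
      proof eventually_elim
        case (elim x)
        have r: "0 \<le> r0 x" using elim r0c(2)[of x] by simp
        have "2 * (m0 i x * U i (x, t)) \<le> r0 x * (u0 i x)^2 + r0 x * (U i (x, t) * U i (x, t))" for i
        proof -
          have "0 \<le> r0 x * (u0 i x - U i (x, t))^2" using r by simp
          then show ?thesis by (simp add: m0_eq power2_eq_square algebra_simps)
        qed
        then have "(\<Sum>i\<in>UNIV. 2 * (m0 i x * U i (x, t))) \<le> (\<Sum>i\<in>UNIV. r0 x * (u0 i x)^2 + r0 x * (U i (x, t) * U i (x, t)))"
          by (rule sum_mono)
        then show ?case by (simp add: elim w0_def S_def sum.distrib sum_distrib_left)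
      qed
    qed (use imU w ir0S in auto)
    then show ?thesis using imU w ir0S by simp
  qed
  have "init_err t = (LBINT z. (\<Sum>i\<in>UNIV. \<Sum>j\<in>UNIV. Fl i j z * tens I (?D i j) z)) - (LBINT z. (\<Sum>i\<in>UNIV. \<Sum>j\<in>UNIV. (M j z * tens I (?w i) z) * tens I (?D i j) z))"
    unfolding init_err_def I_def[symmetric] using ii by (simp add: sum_subtractf)
  then show ?thesis using e1 e2 e3 by linarith
qed

text \<open>The analogue of \<open>dens\<close> for the increment from time \<open>0\<close> to \<open>t < h\<close>; here \<open>\<rho>\<close> is negative.\<close>
definition idens :: "real \<Rightarrow> real \<Rightarrow> (real^'n) \<times> real \<Rightarrow> real" where
  "idens \<rho> h z = (\<Sum>i\<in>UNIV. \<Sum>j\<in>UNIV. Fl i j (z + (0, \<rho>)) * (indicator {0<..<h} (snd z) * G i j z)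
     - (M j (z + (0, \<rho>)) * U i z) * (indicator {0<..<h} (snd z) * G i j z))"

lemma Lp_time_indicator: "0 < p \<Longrightarrow> Lp p lborel f \<Longrightarrow> Lp p lborel (\<lambda>z. indicator {0<..<h::real} (snd z) * f z)"
  for f :: "(real^'n) \<times> real \<Rightarrow> real"
  by (rule Lp_bounded_mult[where B=1]) (auto simp: indicator_def)

lemma integrable_idens_triple: "integrable lborel (\<lambda>w. indicator {-h<..<0} (snd w) * idens (snd w) h (fst w))"
proof -
  define A where "A = (\<lambda>f (d :: real \<Rightarrow> real) (w :: ((real^'n) \<times> real) \<times> real). (indicator {-h<..<0} (snd w) :: real) * f (fst w + (0, d (snd w))))"
  have ALp: "Lp p lborel (A f d)" if "0 < p" "Lp p lborel f" "d \<in> borel_measurable borel" for p f d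
    unfolding A_def by (rule Lp_sheared_time[OF that(1,2) Lp_ind_interval[of _ _ "-h" 0] that(3)]) (use that in auto)
  let ?i = "\<lambda>r::real. r" and ?z = "\<lambda>r::real. 0::real"
  let ?G = "\<lambda>i j z. indicator {0<..<h} (snd z) * G i j z"
  define k where "k = (\<lambda>w. (\<Sum>i\<in>UNIV. \<Sum>j\<in>UNIV. A (Fl i j) ?i w * A (?G i j) ?z w - (A (M j) ?i w * A (U i) ?z w) * A (?G i j) ?z w))"
  have "integrable lborel k" unfolding k_def
    by (intro integrable_sum integrable_diff
        Lp2_mult Lp4_mult ALp Lp_time_indicator Fl_Lp G_Lp M_Lp U_Lp) simp_all
  moreover have "k = (\<lambda>w. indicator {-h<..<0} (snd w) * idens (snd w) h (fst w))"
  proof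
    fix w show "k w = indicator {-h<..<0} (snd w) * idens (snd w) h (fst w)"
    proof (cases "snd w \<in> {-h<..<0}")
      case True
      then show ?thesis by (simp add: k_def A_def idens_def mult_ac zero_prod_def[symmetric])
    qed (simp add: k_def A_def)
  qed
  ultimately show ?thesis by (simp only:)
qed

text \<open>No cancellation is involved: the gradient restricted to times in (0, h) tends to 0 in
  L^2, while the other factors stay convergent. The delay enters with a minus sign because averages
  are taken over nonnegative delays.\<close>

lemma idens_tendsto: "((\<lambda>p. LBINT z. idens (- fst p) (snd p) z) \<longlongrightarrow> 0) (nhds 0 \<times>\<^sub>F at_right 0)"
proof -
  let ?\<Phi> = "nhds (0::real) \<times>\<^sub>F at_right (0::real)"
  have "((\<lambda>p. - fst p) \<longlongrightarrow> - 0) ?\<Phi>" by (intro tendsto_minus filterlim_fst)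
  then have "((\<lambda>p. - fst p) \<longlongrightarrow> 0) ?\<Phi>" by simp
  note shift = Lpconv_shift_time[OF this]
  have G0: "Lpconv 2 lborel (at_right 0) (\<lambda>h z. indicator {0<..<h} (snd z) * G i j z) (\<lambda>z. 0)" for i j
    unfolding Lpconv_def
  proof (intro conjI allI Lp_time_indicator G_Lp Lp_zero)
    have iG: "integrable lborel (\<lambda>z. \<bar>G i j z\<bar>^2)" using G_Lp[of i j] by (simp add: Lp_def)
    have "(LBINT z. \<bar>indicator {0<..<h} (snd z) * G i j z - 0\<bar>^2) = (LBINT s. indicator {0<..<h} s * (LBINT x. \<bar>G i j (x, s)\<bar>^2))" for h
    proof -
      have "integrable lborel (\<lambda>z. \<bar>G i j z\<bar>^2 * indicator {0<..<h} (snd z))"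
        by (rule integrable_bounded_mult[OF iG, where B=1]) (auto simp: indicator_def)
      then have i: "integrable lborel (\<lambda>z. indicator {0<..<h} (snd z) * \<bar>G i j z\<bar>^2)" by (simp add: mult.commute)
      have "(LBINT z. \<bar>indicator {0<..<h} (snd z) * G i j z - 0\<bar>^2) = (LBINT z. indicator {0<..<h} (snd z) * \<bar>G i j z\<bar>^2)"
        by (intro integral_cong) (auto simp: indicator_def)
      also have "\<dots> = (LBINT s. indicator {0<..<h} s * (LBINT x. \<bar>G i j (x, s)\<bar>^2))"
        by (subst lborel_integral_snd[OF i]) simp
      finally show ?thesis .
    qed
    then show "((\<lambda>h. LBINT z. \<bar>indicator {0<..<h} (snd z) * G i j z - 0\<bar>^2) \<longlongrightarrow> 0) (at_right 0)"
      using tendsto_integral_initial[OF lborel_integrable_snd[OF iG]] by simp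
  qed simp_all
  have s2: "Lpconv 2 lborel ?\<Phi> (\<lambda>k z. indicator {0<..<snd k} (snd z) * G i j z) (\<lambda>z. 0)" for i j
    by (rule Lpconv_compose[OF G0 filterlim_snd])
  have "Lpconv 1 lborel ?\<Phi> (\<lambda>p. idens (- fst p) (snd p)) (\<lambda>z. \<Sum>i\<in>UNIV. \<Sum>j\<in>UNIV. Fl i j z * 0 - (M j z * U i z) * 0)"
    unfolding idens_def
    by (intro Lpconv_sum Lpconv_diff Lpconv2_mult Lpconv4_mult shift s2 Lpconv_const Fl_Lp M_Lp U_Lp) simp_all
  from Lpconv1_integral[OF this] show ?thesis by simp
qed

theorem energy_equality:
  "AE t\<in>{0<..<T} in lborel. En t + (LBINT s. indicator {0<..<t} s * Diss s) = (1/2) * (LBINT x. w0 x)"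
proof -
  obtain L where L: "AE t\<in>{0<..<T} in lborel. En t = L - (LBINT s. indicator {0<..<t} s * Diss s)"
    using energy_evolution by blast
  note w = initial_energy_le[OF L]
  define E0 where "E0 = (1/2) * (LBINT x. w0 x)"
  \<comment> \<open>If \<open>L\<close> exceeded \<open>E0\<close> by \<open>\<delta>\<close>, then
    for almost every small \<open>t\<close> the energy would still exceed \<open>E0\<close> by
    \<open>\<delta> / 2\<close>, so \<open>init_err t\<close> would be at least
    \<open>\<delta> / 2\<close>. But its mean over (0, h) tends to 0 with \<open>h\<close>.\<close>
  have "L \<le> E0"
  proof (rule ccontr)
    assume "\<not> L \<le> E0"
    define \<delta> where "\<delta> = L - E0"
    have del: "0 < \<delta>" using \<open>\<not> L \<le> E0\<close> by (simp add: \<delta>_def)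
    define K where "K = (\<lambda>h. LBINT \<rho>. indicator {0..<h} \<rho> * (LBINT z. idens (- \<rho>) h z))"
    define k where "k = (\<lambda>h w. indicator {-h<..<0} (snd w) * idens (snd w) h (fst w))"
    have ik: "integrable lborel (k h)" for h unfolding k_def by (rule integrable_idens_triple)
    define \<kappa> where "\<kappa> = (\<lambda>h t. LBINT y. k h ((fst y, t), snd y - t))"
    have i\<kappa>: "integrable lborel (\<kappa> h)" for h unfolding \<kappa>_def by (rule time_difference_integrable[OF ik])
    have iK0: "integrable lborel (\<lambda>\<rho>. indicator {-h<..<0} \<rho> * (LBINT z. idens \<rho> h z))" for h
      using lborel_integrable_snd[OF ik[of h]] by (simp add: k_def)
    have KK: "integrable lborel (\<lambda>\<rho>. indicator {0..<h} \<rho> * (LBINT z. idens (- \<rho>) h z)) \<and> (LBINT t. \<kappa> h t) = K h" for h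
    proof
      have m: "(\<lambda>\<rho>. LBINT z. idens (- \<rho>) h z) \<in> borel_measurable borel"
      proof -
        have f1: "(\<lambda>w::real \<times> ((real^'n) \<times> real). f (snd w + (0, - fst w))) \<in> borel_measurable borel" if "f \<in> borel_measurable borel" for f :: "(real^'n) \<times> real \<Rightarrow> real"
          by (rule measurable_compose[of _ borel borel f borel]) (use that in measurable)
        have "(\<lambda>w. idens (- fst w) h (snd w)) \<in> borel_measurable borel"
          unfolding idens_def
          by (intro borel_measurable_sum borel_measurable_diff borel_measurable_times f1 meas) measurable
        then have "(\<lambda>\<rho>. LBINT z. idens (- \<rho>) h z) \<in> borel_measurable lborel"
          by (intro lborel.borel_measurable_lebesgue_integral) (simp add: split_beta' lborel_prod)
        then show ?thesis by simp
      qed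
      have flip: "integrable lborel (\<lambda>\<rho>. indicator {-h<..<0} (- \<rho>) * (LBINT z. idens (- \<rho>) h z))"
        using lborel_integrable_real_affine[OF iK0[of h], of "-1" 0] by simp
      \<comment> \<open>Reflection sends (-h, 0) to (0, h), which differs from the window of
        \<open>average_tendsto\<close> only in the point 0.\<close>
      have ae: "AE \<rho> in lborel. indicator {-h<..<0} (- \<rho>) * (LBINT z. idens (- \<rho>) h z) = indicator {0..<h} \<rho> * (LBINT z. idens (- \<rho>) h z)"
        using AE_lborel_singleton[of "0::real"] by eventually_elim (auto simp: indicator_def)
      show "integrable lborel (\<lambda>\<rho>. indicator {0..<h} \<rho> * (LBINT z. idens (- \<rho>) h z))"
        by (rule integrable_cong_AE_imp[OF flip]) (use ae m in \<open>auto elim: eventually_mono\<close>)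
      have "(LBINT t. \<kappa> h t) = (LBINT \<rho>. LBINT z. k h (z, \<rho>))"
        unfolding \<kappa>_def by (rule time_difference_integral[OF ik])
      also have "\<dots> = (LBINT \<rho>. indicator {-h<..<0} \<rho> * (LBINT z. idens \<rho> h z))" by (simp add: k_def)
      also have "\<dots> = (LBINT \<rho>. indicator {-h<..<0} (- \<rho>) * (LBINT z. idens (- \<rho>) h z))"
        using lborel_integral_real_affine[of "-1" "\<lambda>\<rho>. indicator {-h<..<0} \<rho> * (LBINT z. idens \<rho> h z)" 0] by simp
      also have "\<dots> = K h" unfolding K_def by (rule integral_cong_AE) (use flip m ae in auto)
      finally show "(LBINT t. \<kappa> h t) = K h" .
    qed
    have iK: "integrable lborel (\<lambda>\<rho>. indicator {0..<h} \<rho> * (LBINT z. idens (- \<rho>) h z))" for h using KK by blast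
    have "((\<lambda>h. (1 / h) * K h) \<longlongrightarrow> 0) (at_right 0)"
      unfolding K_def by (rule average_tendsto[OF idens_tendsto iK])
    then have "\<forall>\<^sub>F h in at_right 0. (1 / h) * K h < \<delta> / 2" using del by (intro order_tendstoD) auto
    moreover have "\<forall>\<^sub>F t in at_right 0. dist (LBINT s. indicator {0<..<t} s * Diss s) 0 < \<delta> / 2"
      using del by (intro tendstoD tendsto_integral_initial integrable_Diss) auto
    ultimately have "\<forall>\<^sub>F h in at_right 0. (1 / h) * K h < \<delta> / 2 \<and> dist (LBINT s. indicator {0<..<h} s * Diss s) 0 < \<delta> / 2"
      by (rule eventually_conj)
    then obtain d where d: "0 < d" "\<And>h. 0 < h \<Longrightarrow> h < d \<Longrightarrow> (1 / h) * K h < \<delta> / 2 \<and> \<bar>LBINT s. indicator {0<..<h} s * Diss s\<bar> < \<delta> / 2"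
      unfolding eventually_at_right_field by (auto simp: dist_real_def)
    define h where "h = min d T / 2"
    have h: "0 < h" "h < d" "h < T" using d(1) T by (auto simp: h_def min_def)
    have low: "AE t in lborel. indicator {0<..<h} t * (\<delta> / 2) \<le> \<kappa> h t"
      using AE_good L
    proof eventually_elim
      case (elim t)
      show ?case
      proof (cases "t \<in> {0<..<h}")
        case True
        then have t: "t \<in> {0<..<T}" using h by auto
        then have g: "good t" using elim by simp
        have "\<kappa> h t = init_err t"
          unfolding \<kappa>_def init_err_def
        proof (rule integral_cong[OF refl])
          fix y :: "(real^'n) \<times> real"
          have s: "(fst y, t) + (0, snd y - t) = y" by (auto simp: prod_eq_iff)
          show "k h ((fst y, t), snd y - t) = (\<Sum>i\<in>UNIV. \<Sum>j\<in>UNIV. Fl i j y * tens {0<..<t} (\<lambda>x. G i j (x, t)) y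
             - (M j y * tens {0<..<t} (\<lambda>x. U i (x, t)) y) * tens {0<..<t} (\<lambda>x. G i j (x, t)) y)"
          proof (cases "snd y \<in> {0<..<t}")
            case y: True
            then have "snd y - t \<in> {-h<..<0}" using True by auto
            then show ?thesis using y True by (simp add: k_def idens_def tens_def s)
          next
            case False
            \<comment> \<open>If the flux time is not before \<open>t\<close> the delay is
              nonnegative; if it is not after 0 the flux vanishes. For \<open>t\<close> below
              \<open>h\<close> nothing else is cut off.\<close>
            then have "snd y - t \<notin> {-h<..<0} \<or> y \<notin> Q" by (cases y) auto
            then show ?thesis using False by (auto simp: k_def idens_def tens_def s zero)
          qed
        qed
        moreover have "En t \<le> E0 + init_err t" unfolding E0_def by (rule energy_le_initial[OF w(1) g])
        moreover have "En t = L - (LBINT s. indicator {0<..<t} s * Diss s)" using elim t by simp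
        moreover have "\<bar>LBINT s. indicator {0<..<t} s * Diss s\<bar> < \<delta> / 2" using d(2)[of t] True h by auto
        ultimately have "\<delta> / 2 \<le> \<kappa> h t" by (simp add: \<delta>_def)
        then show ?thesis using True by simp
      next
        case False
        then have "k h ((fst y, t), snd y - t) = 0" for y by (simp add: k_def idens_def)
        then show ?thesis using False by (simp add: \<kappa>_def)
      qed
    qed
    have "h * (\<delta> / 2) = (LBINT t. indicator {0<..<h} t * (\<delta> / 2))" using h by simp
    also have "\<dots> \<le> (LBINT t. \<kappa> h t)"
      by (rule integral_mono_AE[OF _ i\<kappa> low]) (use h in auto)
    also have "\<dots> = K h" using KK by blast
    finally have "\<delta> / 2 \<le> (1 / h) * K h" using h by (simp add: field_simps)
    then show False using d(2)[OF h(1,2)] by auto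
  qed
  moreover have "E0 \<le> L" using w(2) by (simp add: E0_def)
  ultimately have "L = E0" by simp
  then show ?thesis using L unfolding E0_def by (auto elim!: eventually_mono)
qed

end

section \<open>The Sobolev inequality for test functions\<close>

text \<open>The fundamental theorem for g^2 bounds its value at \<open>z\<close> by its value at any
  \<open>y\<close> plus the integral of 2 |g g'|; averaging over \<open>y\<close> removes the point
  value. No boundary condition is required, so the estimate also serves periodic functions on the
  cell.\<close>

lemma sup_le_average_1D:
  fixes g g' :: "real \<Rightarrow> real"
  assumes ab: "a < b" and d: "\<And>x. (g has_real_derivative g' x) (at x)" and c: "continuous_on UNIV g'" and z: "z \<in> {a..b}"
  shows "(g z)^2 \<le> (LBINT t. indicator {a..b} t * ((1 / (b - a)) * (g t)^2 + 2 * \<bar>g t * g' t\<bar>))"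
proof -
  have cg: "continuous_on UNIV g" using d DERIV_isCont by (auto intro!: continuous_at_imp_continuous_on)
  have i: "integrable lborel (\<lambda>t. indicator {a..b} t * f t)" if "continuous_on UNIV f" for f :: "real \<Rightarrow> real"
    using borel_integrable_compact[of "{a..b}" f] continuous_on_subset[OF that] by simp
  define V where "V = (LBINT t. indicator {a..b} t * \<bar>2 * (g t * g' t)\<bar>)"
  have iV: "integrable lborel (\<lambda>t. indicator {a..b} t * \<bar>2 * (g t * g' t)\<bar>)"
    by (rule i) (intro continuous_intros cg c)
  have ftc: "\<bar>(g v)^2 - (g u)^2\<bar> \<le> V" if "a \<le> u" "u \<le> v" "v \<le> b" for u v
  proof -
    have "has_bochner_integral lborel (\<lambda>x. (2 * (g x * g' x)) * indicator {u..v} x) ((g v)^2 - (g u)^2)"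
    proof (rule has_bochner_integral_FTC_Icc_real)
      show "((\<lambda>x. (g x)^2) has_real_derivative 2 * (g x * g' x)) (at x)" for x
        using DERIV_power[OF d[of x], of 2] by (simp add: mult_ac)
      show "isCont (\<lambda>x. 2 * (g x * g' x)) x" for x
        using c cg by (intro continuous_intros) (auto simp: continuous_on_eq_continuous_at)
    qed fact
    then have h: "integrable lborel (\<lambda>x. (2 * (g x * g' x)) * indicator {u..v} x)"
      "(g v)^2 - (g u)^2 = (LBINT x. (2 * (g x * g' x)) * indicator {u..v} x)"
      by (auto simp: has_bochner_integral_iff)
    have "\<bar>(g v)^2 - (g u)^2\<bar> \<le> (LBINT x. \<bar>(2 * (g x * g' x)) * indicator {u..v} x\<bar>)"
      unfolding h(2) by (rule integral_abs_bound)
    also have "\<dots> \<le> V" unfolding V_def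
      by (rule integral_mono) (use h(1) iV that in \<open>auto simp: indicator_def\<close>)
    finally show ?thesis .
  qed
  have le: "(g z)^2 \<le> (g y)^2 + V" if "y \<in> {a..b}" for y
    using ftc[of y z] ftc[of z y] that z by (cases "y \<le> z") auto
  have i2: "integrable lborel (\<lambda>t. indicator {a..b} t * (g t)^2)" by (rule i) (intro continuous_intros cg)
  have c1: "(LBINT y. indicator {a..b} y * k) = (b - a) * k" for k :: real using ab by simp
  have ik: "integrable lborel (\<lambda>y. indicator {a..b} y * k)" for k :: real by (rule i) (intro continuous_intros)
  have "(b - a) * (g z)^2 = (LBINT y. indicator {a..b} y * (g z)^2)" using ab by (simp add: c1)
  also have "\<dots> \<le> (LBINT y. indicator {a..b} y * (g y)^2 + indicator {a..b} y * V)"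
    by (rule integral_mono[OF ik integrable_add[OF i2 ik]]) (use le in \<open>auto simp: indicator_def\<close>)
  also have "\<dots> = (LBINT y. indicator {a..b} y * (g y)^2) + (b - a) * V" using i2 ik[of V] ab by (simp add: c1)
  finally have "(g z)^2 \<le> (1 / (b - a)) * (LBINT y. indicator {a..b} y * (g y)^2) + V"
    using ab by (simp add: field_simps)
  also have "\<dots> = (LBINT t. (1 / (b - a)) * (indicator {a..b} t * (g t)^2) + indicator {a..b} t * \<bar>2 * (g t * g' t)\<bar>)"
    using i2 iV by (simp add: V_def)
  also have "\<dots> = (LBINT t. indicator {a..b} t * ((1 / (b - a)) * (g t)^2 + 2 * \<bar>g t * g' t\<bar>))"
    by (intro integral_cong) (auto simp: algebra_simps abs_mult)
  finally show ?thesis .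
qed

lemma indicator_Times_pair: "(indicator (A \<times> B) (x, y) :: real) = indicator A x * indicator B y"
  by (auto simp: indicator_def)

text \<open>Bound one factor f^2 by its supremum along the first axis and the other by its supremum
  along the second. The resulting functions depend on different variables, so the integral of their
  product factorises.\<close>

lemma Ladyzhenskaya_2D:
  fixes f f1 f2 :: "real \<times> real \<Rightarrow> real"
  assumes ab: "a < b" and cf: "continuous_on UNIV f" "continuous_on UNIV f1" "continuous_on UNIV f2"
    and d1: "\<And>x y. ((\<lambda>x. f (x, y)) has_real_derivative f1 (x, y)) (at x)"
    and d2: "\<And>x y. ((\<lambda>y. f (x, y)) has_real_derivative f2 (x, y)) (at y)"
  defines "C \<equiv> {a..b} \<times> {a..b}"
  shows "(LBINT z. indicator C z * (f z) ^ 4) \<le>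
    (2 / (b - a)^2 + 8) * ((LBINT z. indicator C z * (f z)^2) * (LBINT z. indicator C z * ((f z)^2 + ((f1 z)^2 + (f2 z)^2))))"
proof -
  define K0 where "K0 = 1 / (b - a)"
  have K0: "0 < K0" using ab by (simp add: K0_def)
  have C: "compact C" unfolding C_def by (intro compact_Times) auto
  let ?i = "indicator {a..b} :: real \<Rightarrow> real"
  define h1 where "h1 = (\<lambda>z. K0 * (f z)^2 + 2 * \<bar>f z * f1 z\<bar>)"
  define h2 where "h2 = (\<lambda>z. K0 * (f z)^2 + 2 * \<bar>f z * f2 z\<bar>)"
  have ch: "continuous_on UNIV h1" "continuous_on UNIV h2" unfolding h1_def h2_def by (intro continuous_intros cf)+
  have ih: "integrable lborel (\<lambda>z. indicator C z * h1 z)" "integrable lborel (\<lambda>z. indicator C z * h2 z)"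
    by (intro integrable_indicator_continuous C ch)+
  define Pf where "Pf = (\<lambda>y. LBINT x. ?i x * h1 (x, y))"
  define Qf where "Qf = (\<lambda>x. LBINT y. ?i y * h2 (x, y))"
  have cs: "continuous_on UNIV (\<lambda>x. g (x, y))" "continuous_on UNIV (\<lambda>y. g (x, y))" if "continuous_on UNIV g" for g :: "real \<times> real \<Rightarrow> real" and x y
    using that by (auto intro!: continuous_on_compose2[OF that] continuous_intros)
  have fP: "(f (x, y))^2 \<le> Pf y" if "x \<in> {a..b}" for x y
    unfolding Pf_def h1_def K0_def by (rule sup_le_average_1D[OF ab d1 cs(1)[OF cf(2)] that])
  have fQ: "(f (x, y))^2 \<le> Qf x" if "y \<in> {a..b}" for x y
    unfolding Qf_def h2_def K0_def by (rule sup_le_average_1D[OF ab d2 cs(2)[OF cf(3)] that])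
  have ind': "(indicator C (x, y) :: real) = ?i y * ?i x" for x y by (simp add: C_def indicator_Times_pair mult.commute)
  have iP: "integrable lborel (\<lambda>y. ?i y * Pf y)"
    using lborel_integrable_snd[OF ih(1)] by (simp add: ind' Pf_def mult.assoc)
  have iQ: "integrable lborel (\<lambda>x. ?i x * Qf x)"
    using lborel_integrable_fst[OF ih(2)] by (simp add: C_def indicator_Times_pair Qf_def mult.assoc)
  have eP: "(LBINT y. ?i y * Pf y) = (LBINT z. indicator C z * h1 z)"
    by (subst lborel_integral_snd[OF ih(1)]) (simp add: ind' Pf_def mult.assoc)
  have eQ: "(LBINT x. ?i x * Qf x) = (LBINT z. indicator C z * h2 z)"
    by (subst lborel_integral_fst[OF ih(2)]) (simp add: C_def indicator_Times_pair Qf_def mult.assoc)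
  have tens: "integrable lborel (\<lambda>z. (?i (fst z) * Qf (fst z)) * (?i (snd z) * Pf (snd z)))"
    using Lp_tensor(1)[of 1 "\<lambda>x. ?i x * Qf x" "\<lambda>y. ?i y * Pf y"] iP iQ by (simp add: Lp1)
  have "(LBINT z. indicator C z * (f z) ^ 4) \<le> (LBINT z. (?i (fst z) * Qf (fst z)) * (?i (snd z) * Pf (snd z)))"
  proof (rule integral_mono[OF _ tens])
    show "integrable lborel (\<lambda>z. indicator C z * (f z) ^ 4)"
      by (rule integrable_indicator_continuous[OF C]) (intro continuous_intros cf)
    fix z :: "real \<times> real"
    show "indicator C z * (f z) ^ 4 \<le> (?i (fst z) * Qf (fst z)) * (?i (snd z) * Pf (snd z))"
    proof (cases z)
      case (Pair x y)
      show ?thesis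
      proof (cases "x \<in> {a..b} \<and> y \<in> {a..b}")
        case True
        have "(f (x, y)) ^ 4 = (f (x, y))^2 * (f (x, y))^2" by (simp add: power2_eq_square power4_eq_xxxx)
        also have "\<dots> \<le> Qf x * Pf y" using fP[of x y] fQ[of y x] True by (intro mult_mono) (auto intro: order_trans[OF zero_le_power2])
        finally show ?thesis using True by (simp add: Pair C_def)
      qed (auto simp: Pair C_def)
    qed
  qed
  also have "\<dots> = (LBINT x. ?i x * Qf x) * (LBINT y. ?i y * Pf y)"
    by (subst lborel_integral_fst[OF tens]) simp
  also have "\<dots> = (LBINT z. indicator C z * h2 z) * (LBINT z. indicator C z * h1 z)" by (simp only: eP eQ)
  finally have main: "(LBINT z. indicator C z * (f z) ^ 4) \<le> (LBINT z. indicator C z * h2 z) * (LBINT z. indicator C z * h1 z)" .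
  define I where "I = (LBINT z. indicator C z * (f z)^2)"
  define D where "D = (LBINT z. indicator C z * ((f1 z)^2 + (f2 z)^2))"
  have I0: "0 \<le> I" "0 \<le> D" unfolding I_def D_def by (auto intro!: integral_nonneg_AE)
  have sq: "integrable lborel (\<lambda>z. indicator C z * (g z)^2)" if "continuous_on UNIV g" for g :: "real \<times> real \<Rightarrow> real"
    by (rule integrable_indicator_continuous[OF C]) (intro continuous_intros that)
  have bnd: "0 \<le> (LBINT z. indicator C z * (K0 * (f z)^2 + 2 * \<bar>f z * g z\<bar>)) \<and>
     (LBINT z. indicator C z * (K0 * (f z)^2 + 2 * \<bar>f z * g z\<bar>)) \<le> K0 * I + 2 * (sqrt I * sqrt D)"
    if g: "continuous_on UNIV g" "\<And>z. (g z)^2 \<le> (f1 z)^2 + (f2 z)^2" for g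
  proof
    show "0 \<le> (LBINT z. indicator C z * (K0 * (f z)^2 + 2 * \<bar>f z * g z\<bar>))"
      using K0 by (auto intro!: integral_nonneg_AE)
    have Dle: "(LBINT z. indicator C z * (g z)^2) \<le> D"
      unfolding D_def
    proof (rule integral_mono)
      show "integrable lborel (\<lambda>z. indicator C z * ((f1 z)^2 + (f2 z)^2))"
        by (rule integrable_indicator_continuous[OF C]) (intro continuous_intros cf)
      show "indicator C z * (g z)^2 \<le> indicator C z * ((f1 z)^2 + (f2 z)^2)" for z
        using g(2)[of z] by (auto simp: indicator_def)
    qed (rule sq[OF g(1)])
    have ia: "integrable lborel (\<lambda>z. indicator C z * \<bar>f z * g z\<bar>)"
      by (rule integrable_indicator_continuous[OF C]) (intro continuous_intros cf g)
    have "(LBINT z. indicator C z * \<bar>f z * g z\<bar>) = (LBINT z. (indicator C z * \<bar>f z\<bar>) * (indicator C z * \<bar>g z\<bar>))"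
      by (intro integral_cong) (auto simp: indicator_def abs_mult)
    also have "\<dots> \<le> \<bar>LBINT z. (indicator C z * \<bar>f z\<bar>) * (indicator C z * \<bar>g z\<bar>)\<bar>" by simp
    also have "\<dots> \<le> sqrt (LBINT z. \<bar>indicator C z * \<bar>f z\<bar>\<bar>^2) * sqrt (LBINT z. \<bar>indicator C z * \<bar>g z\<bar>\<bar>^2)"
      by (intro Cauchy_Schwarz_integral Lp_indicator_continuous C continuous_intros cf g) auto
    also have "(\<lambda>z. \<bar>indicator C z * \<bar>f z\<bar>\<bar>^2) = (\<lambda>z. indicator C z * (f z)^2)" by (auto simp: indicator_def)
    also have "(\<lambda>z. \<bar>indicator C z * \<bar>g z\<bar>\<bar>^2) = (\<lambda>z. indicator C z * (g z)^2)" by (auto simp: indicator_def)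
    also have "sqrt (LBINT z. indicator C z * (f z)^2) * sqrt (LBINT z. indicator C z * (g z)^2) \<le> sqrt I * sqrt D"
      unfolding I_def[symmetric] using Dle I0 by (intro mult_left_mono real_sqrt_le_mono) auto
    finally have S: "(LBINT z. indicator C z * \<bar>f z * g z\<bar>) \<le> sqrt I * sqrt D" .
    have "(LBINT z. indicator C z * (K0 * (f z)^2 + 2 * \<bar>f z * g z\<bar>)) = (LBINT z. K0 * (indicator C z * (f z)^2) + 2 * (indicator C z * \<bar>f z * g z\<bar>))"
      by (intro integral_cong) (auto simp: algebra_simps)
    also have "\<dots> = K0 * I + 2 * (LBINT z. indicator C z * \<bar>f z * g z\<bar>)"
      using sq[OF cf(1)] ia by (simp add: I_def)
    finally show "(LBINT z. indicator C z * (K0 * (f z)^2 + 2 * \<bar>f z * g z\<bar>)) \<le> K0 * I + 2 * (sqrt I * sqrt D)"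
      using S by linarith
  qed
  have b1: "0 \<le> (LBINT z. indicator C z * h1 z) \<and> (LBINT z. indicator C z * h1 z) \<le> K0 * I + 2 * (sqrt I * sqrt D)"
    unfolding h1_def by (rule bnd[OF cf(2)]) simp
  have b2: "0 \<le> (LBINT z. indicator C z * h2 z) \<and> (LBINT z. indicator C z * h2 z) \<le> K0 * I + 2 * (sqrt I * sqrt D)"
    unfolding h2_def by (rule bnd[OF cf(3)]) simp
  have qb: "(x + y) * (x + y) \<le> 2 * x\<^sup>2 + 2 * y\<^sup>2" for x y :: real
    using sum_squares_bound[of x y] by (simp add: power2_eq_square algebra_simps)
  have "(LBINT z. indicator C z * h2 z) * (LBINT z. indicator C z * h1 z) \<le> (K0 * I + 2 * (sqrt I * sqrt D)) * (K0 * I + 2 * (sqrt I * sqrt D))"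
    using b1 b2 by (intro mult_mono) auto
  \<comment> \<open>From (x + y)^2 \<le> 2 x^2 + 2 y^2. The two terms produce the constants 2 / (b -
    a)^2 and 8 of the statement.\<close>
  also have "\<dots> \<le> 2 * (K0 * I)^2 + 2 * (2 * (sqrt I * sqrt D))^2"
    by (rule qb)
  also have "\<dots> = (2 / (b - a)^2) * (I * I) + 8 * (I * D)"
    using I0 by (simp add: K0_def power_mult_distrib power_divide) (simp add: power2_eq_square)
  also have "\<dots> \<le> (2 / (b - a)^2 + 8) * (I * (I + D))"
  proof -
    have "0 \<le> (2 / (b - a)^2) * (I * D) + 8 * (I * I)" using I0 by simp
    then show ?thesis by (simp only: distrib_left distrib_right)
  qed
  also have "I + D = (LBINT z. indicator C z * ((f z)^2 + ((f1 z)^2 + (f2 z)^2)))"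
  proof -
    have "integrable lborel (\<lambda>z. indicator C z * ((f1 z)^2 + (f2 z)^2))"
      by (rule integrable_indicator_continuous[OF C]) (intro continuous_intros cf)
    then show ?thesis unfolding I_def D_def using sq[OF cf(1)] by (simp add: distrib_left)
  qed
  finally show ?thesis using main unfolding I_def by linarith
qed

text \<open>Apply the planar inequality on each slice of constant first coordinate. One factor, the
  L^2 norm of the slice, is bounded uniformly over slices by the one-dimensional estimate; the other
  is integrated over the slices.\<close>

lemma Ladyzhenskaya_3D:
  fixes f f1 f2 f3 :: "real \<times> (real \<times> real) \<Rightarrow> real"
  assumes ab: "a < b" and cf: "continuous_on UNIV f" "continuous_on UNIV f1" "continuous_on UNIV f2" "continuous_on UNIV f3"
    and d3: "\<And>z w. ((\<lambda>z. f (z, w)) has_real_derivative f3 (z, w)) (at z)"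
    and d1: "\<And>z x y. ((\<lambda>x. f (z, (x, y))) has_real_derivative f1 (z, (x, y))) (at x)"
    and d2: "\<And>z x y. ((\<lambda>y. f (z, (x, y))) has_real_derivative f2 (z, (x, y))) (at y)"
  defines "C \<equiv> {a..b} \<times> ({a..b} \<times> {a..b})"
  shows "(LBINT z. indicator C z * (f z) ^ 4) \<le>
    ((2 / (b - a)^2 + 8) * (1 / (b - a) + 1)) * (LBINT z. indicator C z * ((f z)^2 + ((f1 z)^2 + ((f2 z)^2 + (f3 z)^2))))^2"
proof -
  define K where "K = 2 / (b - a)^2 + 8"
  \<comment> \<open>The summand 1 comes from 2 |f f3| \<le> f^2 + f3^2, the other from the average
    in the one-dimensional estimate.\<close>
  define K1 where "K1 = 1 / (b - a) + 1"
  have K: "0 \<le> K" "1 \<le> K1" using ab by (auto simp: K_def K1_def)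
  define C2 where "C2 = {a..b} \<times> {a..b}"
  have C2: "compact C2" unfolding C2_def by (intro compact_Times) auto
  have C: "compact C" unfolding C_def by (intro compact_Times) auto
  have CC: "C = {a..b} \<times> C2" by (simp add: C_def C2_def)
  let ?i = "indicator {a..b} :: real \<Rightarrow> real"
  define g where "g = (\<lambda>v. (f v)^2 + ((f1 v)^2 + ((f2 v)^2 + (f3 v)^2)))"
  have cg: "continuous_on UNIV g" unfolding g_def by (intro continuous_intros cf)
  define N where "N = (LBINT v. indicator C v * g v)"
  have ig: "integrable lborel (\<lambda>v. indicator C v * g v)" by (intro integrable_indicator_continuous C cg)
  have cw: "continuous_on UNIV (\<lambda>w. h (z, w))" "continuous_on UNIV (\<lambda>z. h (z, w))" if "continuous_on UNIV h" for h :: "real \<times> (real \<times> real) \<Rightarrow> real" and z w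
    using that by (auto intro!: continuous_on_compose2[OF that] continuous_intros)
  have i4: "integrable lborel (\<lambda>v. indicator C v * (f v) ^ 4)"
    by (rule integrable_indicator_continuous[OF C]) (intro continuous_intros cf)
  define Iz where "Iz = (\<lambda>z. LBINT w. indicator C2 w * (f (z, w))^2)"
  define Hz where "Hz = (\<lambda>z. LBINT w. indicator C2 w * g (z, w))"
  have iHz: "integrable lborel (\<lambda>z. ?i z * Hz z)"
    using lborel_integrable_fst[OF ig] by (simp add: CC indicator_Times_pair Hz_def mult.assoc)
  have eHz: "(LBINT z. ?i z * Hz z) = N"
    unfolding N_def by (subst lborel_integral_fst[OF ig]) (simp add: CC indicator_Times_pair Hz_def mult.assoc)
  have i2: "integrable lborel (\<lambda>w. indicator C2 w * (f (z, w))^2)" for z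
    by (rule integrable_indicator_continuous[OF C2]) (intro continuous_intros cw cf)
  have IzN: "Iz z \<le> K1 * N" if z: "z \<in> {a..b}" for z
  proof -
    have pt: "indicator C2 w * (f (z, w))^2 \<le> (LBINT z. indicator C (z, w) * (K1 * g (z, w)))" for w
    proof (cases "w \<in> C2")
      case True
      have "(f (z, w))^2 \<le> (LBINT t. ?i t * ((1 / (b - a)) * (f (t, w))^2 + 2 * \<bar>f (t, w) * f3 (t, w)\<bar>))"
        by (rule sup_le_average_1D[OF ab d3 cw(2)[OF cf(4)] z])
      also have "\<dots> \<le> (LBINT t. ?i t * (K1 * g (t, w)))"
      proof (rule integral_mono)
        show "integrable lborel (\<lambda>t. ?i t * ((1 / (b - a)) * (f (t, w))^2 + 2 * \<bar>f (t, w) * f3 (t, w)\<bar>))"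
          using ab by (intro integrable_indicator_continuous continuous_intros cw cf) auto
        show "integrable lborel (\<lambda>t. ?i t * (K1 * g (t, w)))"
          by (rule integrable_indicator_continuous) (auto intro!: continuous_intros cw cg)
        fix t
        have "2 * \<bar>f (t, w) * f3 (t, w)\<bar> \<le> (f (t, w))^2 + (f3 (t, w))^2"
          using sum_squares_bound[of "\<bar>f (t, w)\<bar>" "\<bar>f3 (t, w)\<bar>"] by (simp add: abs_mult)
        then have "(1 / (b - a)) * (f (t, w))^2 + 2 * \<bar>f (t, w) * f3 (t, w)\<bar> \<le> K1 * (f (t, w))^2 + 1 * (f3 (t, w))^2"
          by (simp add: K1_def distrib_right)
        also have "\<dots> \<le> K1 * (f (t, w))^2 + K1 * (f3 (t, w))^2" using K by (intro add_left_mono mult_right_mono) auto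
        also have "\<dots> \<le> K1 * g (t, w)" unfolding distrib_left[symmetric] using K by (intro mult_left_mono) (auto simp: g_def)
        finally show "?i t * ((1 / (b - a)) * (f (t, w))^2 + 2 * \<bar>f (t, w) * f3 (t, w)\<bar>) \<le> ?i t * (K1 * g (t, w))"
          by (intro mult_left_mono) auto
      qed
      finally show ?thesis using True by (simp add: CC indicator_Times_pair)
    qed (simp add: CC indicator_Times_pair)
    have ig': "integrable lborel (\<lambda>v. indicator C v * (K1 * g v))" by (intro integrable_indicator_continuous C continuous_intros cg)
    have "Iz z \<le> (LBINT w. LBINT z. indicator C (z, w) * (K1 * g (z, w)))"
      unfolding Iz_def by (rule integral_mono[OF i2 lborel_integrable_snd[OF ig']]) (rule pt)
    also have "\<dots> = (LBINT v. indicator C v * (K1 * g v))" by (rule lborel_integral_snd[OF ig', symmetric])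
    also have "\<dots> = (LBINT v. K1 * (indicator C v * g v))" by (simp add: mult_ac)
    also have "\<dots> = K1 * N" by (simp add: N_def)
    finally show ?thesis .
  qed
  have "(LBINT v. indicator C v * (f v) ^ 4) = (LBINT z. ?i z * (LBINT w. indicator C2 w * (f (z, w)) ^ 4))"
    by (subst lborel_integral_fst[OF i4]) (simp add: CC indicator_Times_pair mult.assoc)
  also have "\<dots> \<le> (LBINT z. (K * (K1 * N)) * (?i z * Hz z))"
  proof (rule integral_mono)
    show "integrable lborel (\<lambda>z. ?i z * (LBINT w. indicator C2 w * (f (z, w)) ^ 4))"
      using lborel_integrable_fst[OF i4] by (simp add: CC indicator_Times_pair mult.assoc)
    show "integrable lborel (\<lambda>z. (K * (K1 * N)) * (?i z * Hz z))" using iHz by simp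
    fix z
    show "?i z * (LBINT w. indicator C2 w * (f (z, w)) ^ 4) \<le> (K * (K1 * N)) * (?i z * Hz z)"
    proof (cases "z \<in> {a..b}")
      case True
      have "(LBINT w. indicator C2 w * (f (z, w)) ^ 4) \<le> K * ((LBINT w. indicator C2 w * (f (z, w))^2) *
          (LBINT w. indicator C2 w * ((f (z, w))^2 + ((f1 (z, w))^2 + (f2 (z, w))^2))))"
        unfolding K_def C2_def
        by (rule Ladyzhenskaya_2D[of a b "\<lambda>w. f (z, w)" "\<lambda>w. f1 (z, w)" "\<lambda>w. f2 (z, w)", OF ab cw(1)[OF cf(1)] cw(1)[OF cf(2)] cw(1)[OF cf(3)] d1 d2])
      also have "\<dots> \<le> K * ((K1 * N) * Hz z)"
      proof (intro mult_left_mono mult_mono)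
        show "(LBINT w. indicator C2 w * (f (z, w))^2) \<le> K1 * N" using IzN[OF True] by (simp add: Iz_def)
        show "(LBINT w. indicator C2 w * ((f (z, w))^2 + ((f1 (z, w))^2 + (f2 (z, w))^2))) \<le> Hz z"
          unfolding Hz_def
        proof (rule integral_mono)
          show "integrable lborel (\<lambda>w. indicator C2 w * ((f (z, w))^2 + ((f1 (z, w))^2 + (f2 (z, w))^2)))"
            by (rule integrable_indicator_continuous[OF C2]) (intro continuous_intros cw cf)
          show "integrable lborel (\<lambda>w. indicator C2 w * g (z, w))"
            by (rule integrable_indicator_continuous[OF C2]) (intro cw cg)
        qed (auto simp: g_def indicator_def)
        show "0 \<le> K1 * N" using K unfolding N_def g_def by (auto intro!: mult_nonneg_nonneg integral_nonneg_AE)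
      qed (use K in \<open>auto intro!: integral_nonneg_AE\<close>)
      finally show ?thesis using True by (simp add: mult_ac)
    qed simp
  qed
  also have "\<dots> = (K * K1) * N\<^sup>2" using eHz by (simp add: power2_eq_square)
  finally show ?thesis by (simp add: K_def K1_def N_def g_def)
qed

section \<open>Transfer from coordinate boxes to the region\<close>

lemma pd_zero_outside:
  fixes \<phi> :: "'a::euclidean_space \<Rightarrow> real"
  assumes "smooth_fun \<phi>" "x \<notin> supp_closure \<phi>"
  shows "dderiv e \<phi> x = 0"
proof -
  have "open (- supp_closure \<phi>)" by (simp add: supp_closure_def open_Compl)
  then have "(\<phi> has_derivative (\<lambda>h. 0)) (at x)"
    by (intro has_derivative_transform_within_open[of "\<lambda>x. 0" "\<lambda>h. 0" x UNIV "- supp_closure \<phi>" \<phi>])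
       (use assms not_supp_closure[of _ \<phi>] in auto)
  then show ?thesis by (rule dderiv_eq)
qed

lemma line_derivative:
  fixes \<phi> :: "real^'n::finite \<Rightarrow> real"
  assumes "smooth_fun \<phi>"
  shows "((\<lambda>t. \<phi> (t *\<^sub>R axis p 1 + c)) has_real_derivative pd p \<phi> (t *\<^sub>R axis p 1 + c)) (at t)"
proof -
  have d: "\<phi> differentiable (at x)" for x using assms by (rule smooth_differentiable)
  have "((\<lambda>t. t *\<^sub>R axis p 1 + c) has_derivative (\<lambda>h. h *\<^sub>R axis p 1)) (at t)"
    by (auto intro!: derivative_eq_intros)
  from has_derivative_compose[OF this has_derivative_dderiv[OF d]]
  have "((\<lambda>t. \<phi> (t *\<^sub>R axis p 1 + c)) has_derivative (\<lambda>h. dderiv (h *\<^sub>R axis p 1) \<phi> (t *\<^sub>R axis p 1 + c))) (at t)" .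
  moreover have "dderiv (h *\<^sub>R axis p 1) \<phi> x = pd p \<phi> x * h" for h x
    using linear_scale[OF has_derivative_linear[OF has_derivative_dderiv[OF d[of x]]]] by (simp add: mult.commute)
  ultimately show ?thesis by (simp add: has_field_derivative_def)
qed

lemma emeasure_lborel_box_cart:
  fixes l u :: "real^'n::finite"
  assumes "\<And>i. l $ i \<le> u $ i"
  shows "(\<Prod>b\<in>Basis. (u - l) \<bullet> b) = (\<Prod>i\<in>UNIV. u $ i - l $ i)"
proof -
  have B: "Basis = range (\<lambda>i. axis i (1::real) :: real^'n)" by (auto simp: Basis_vec_def)
  have "inj (\<lambda>i. axis i (1::real) :: real^'n)" by (auto simp: inj_on_def axis_eq_axis)
  then show ?thesis unfolding B by (simp add: prod.reindex inner_axis)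
qed

text \<open>The index type is an arbitrary type with two elements; naming them \<open>p\<close> and
  \<open>q\<close> identifies Lebesgue measure on it with that of the plane. Agreement on boxes
  suffices.\<close>

lemma lborel_coordinates_2:
  fixes p q :: "'n::finite"
  assumes pq: "p \<noteq> q" "UNIV = {p, q}"
  shows "distr lborel borel (\<lambda>w::real \<times> real. fst w *\<^sub>R axis p 1 + snd w *\<^sub>R axis q 1 :: real^'n) = lborel"
proof (rule lborel_eqI[symmetric])
  let ?T = "\<lambda>w::real \<times> real. fst w *\<^sub>R axis p 1 + snd w *\<^sub>R axis q 1 :: real^'n"
  have T[measurable]: "?T \<in> borel \<rightarrow>\<^sub>M borel"
    by (intro borel_measurable_continuous_onI continuous_intros)
  fix l u :: "real^'n" assume le: "\<And>b. b \<in> Basis \<Longrightarrow> l \<bullet> b \<le> u \<bullet> b"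
  have lu: "l $ i \<le> u $ i" for i using le[of "axis i 1"] by (simp add: inner_axis axis_in_Basis_iff)
  have all: "(\<forall>i. Pr i) \<longleftrightarrow> Pr p \<and> Pr q" for Pr using pq(2) by (metis UNIV_I insertE singletonD)
  have "?T -` box l u \<inter> space lborel = {l $ p<..<u $ p} \<times> {l $ q<..<u $ q}"
    using pq(1) by (auto simp: mem_box_cart all axis_def)
  then have "emeasure (distr lborel borel ?T) (box l u) = emeasure lborel ({l $ p<..<u $ p} \<times> {l $ q<..<u $ q})"
    by (subst emeasure_distr) (auto simp: T)
  also have "\<dots> = emeasure lborel {l $ p<..<u $ p} * emeasure lborel {l $ q<..<u $ q}"
    by (subst lborel_prod[symmetric], rule lborel.emeasure_pair_measure_Times) auto
  also have "\<dots> = ennreal (\<Prod>b\<in>Basis. (u - l) \<bullet> b)"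
    unfolding emeasure_lborel_box_cart[OF lu] pq(2) using pq(1) lu by (simp add: ennreal_mult)
  finally show "emeasure (distr lborel borel ?T) (box l u) = ennreal (\<Prod>b\<in>Basis. (u - l) \<bullet> b)" .
qed simp

lemma lborel_coordinates_3:
  fixes p q s :: "'n::finite"
  assumes pq: "p \<noteq> q" "p \<noteq> s" "q \<noteq> s" "UNIV = {p, q, s}"
  shows "distr lborel borel (\<lambda>w::real \<times> (real \<times> real). fst w *\<^sub>R axis p 1 + (fst (snd w) *\<^sub>R axis q 1 + snd (snd w) *\<^sub>R axis s 1) :: real^'n) = lborel"
proof (rule lborel_eqI[symmetric])
  let ?T = "\<lambda>w::real \<times> (real \<times> real). fst w *\<^sub>R axis p 1 + (fst (snd w) *\<^sub>R axis q 1 + snd (snd w) *\<^sub>R axis s 1) :: real^'n"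
  have T[measurable]: "?T \<in> borel \<rightarrow>\<^sub>M borel"
    by (intro borel_measurable_continuous_onI continuous_intros)
  fix l u :: "real^'n" assume le: "\<And>b. b \<in> Basis \<Longrightarrow> l \<bullet> b \<le> u \<bullet> b"
  have lu: "l $ i \<le> u $ i" for i using le[of "axis i 1"] by (simp add: inner_axis axis_in_Basis_iff)
  have all: "(\<forall>i. Pr i) \<longleftrightarrow> Pr p \<and> Pr q \<and> Pr s" for Pr using pq(4) by (metis UNIV_I insertE singletonD)
  have "?T -` box l u \<inter> space lborel = {l $ p<..<u $ p} \<times> ({l $ q<..<u $ q} \<times> {l $ s<..<u $ s})"
    using pq(1-3) by (auto simp: mem_box_cart all axis_def)
  then have "emeasure (distr lborel borel ?T) (box l u) = emeasure lborel ({l $ p<..<u $ p} \<times> ({l $ q<..<u $ q} \<times> {l $ s<..<u $ s}))"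
    by (subst emeasure_distr) (auto simp: T)
  also have "\<dots> = emeasure lborel {l $ p<..<u $ p} * emeasure lborel ({l $ q<..<u $ q} \<times> {l $ s<..<u $ s})"
    by (subst lborel_prod[symmetric], rule lborel.emeasure_pair_measure_Times) (auto simp: borel_prod[symmetric])
  also have "emeasure lborel ({l $ q<..<u $ q} \<times> {l $ s<..<u $ s}) = emeasure lborel {l $ q<..<u $ q} * emeasure lborel {l $ s<..<u $ s}"
    by (subst lborel_prod[symmetric], rule lborel.emeasure_pair_measure_Times) auto
  also have "emeasure lborel {l $ p<..<u $ p} * (emeasure lborel {l $ q<..<u $ q} * emeasure lborel {l $ s<..<u $ s}) = ennreal (\<Prod>b\<in>Basis. (u - l) \<bullet> b)"
    unfolding emeasure_lborel_box_cart[OF lu] pq(4) using pq(1-3) lu by (simp add: ennreal_mult)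
  finally show "emeasure (distr lborel borel ?T) (box l u) = ennreal (\<Prod>b\<in>Basis. (u - l) \<bullet> b)" .
qed simp

definition cube :: "real \<Rightarrow> real \<Rightarrow> (real^'n::finite) set" where
  "cube a b = {x. \<forall>i. a \<le> x $ i \<and> x $ i \<le> b}"

lemma cube_cbox: "cube a b = cbox (\<chi> i. a) (\<chi> i. b)"
  by (auto simp: cube_def mem_box_cart)

abbreviation gsq :: "(real^'n::finite \<Rightarrow> real) \<Rightarrow> real^'n \<Rightarrow> real" where
  "gsq \<phi> x \<equiv> (\<phi> x)^2 + (\<Sum>j\<in>UNIV. (pd j \<phi> x)^2)"

lemma Sobolev_cube_2:
  fixes \<phi> :: "real^'n::finite \<Rightarrow> real"
  assumes card: "CARD('n) = 2" and ab: "a < b" and s: "smooth_fun \<phi>"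
  shows "(LBINT x. indicator (cube a b) x * (\<phi> x) ^ 4) \<le> (2 / (b - a)^2 + 8) *
     ((LBINT x. indicator (cube a b) x * (\<phi> x)^2) * (LBINT x. indicator (cube a b) x * gsq \<phi> x))"
proof -
  obtain p q :: 'n where pq: "p \<noteq> q" "UNIV = {p, q}" using card by (metis card_2_iff)
  let ?T = "\<lambda>w::real \<times> real. fst w *\<^sub>R axis p 1 + snd w *\<^sub>R axis q 1 :: real^'n"
  have T[measurable]: "?T \<in> borel \<rightarrow>\<^sub>M borel" and cT: "continuous_on UNIV ?T"
    by (intro borel_measurable_continuous_onI continuous_intros)+
  have all: "(\<forall>i. Pr i) \<longleftrightarrow> Pr p \<and> Pr q" for Pr using pq(2) by (metis UNIV_I insertE singletonD)
  have ind: "(indicator (cube a b) (?T w) :: real) = indicator ({a..b} \<times> {a..b}) w" for w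
    using pq(1) by (cases w) (auto simp: indicator_def cube_def all axis_def)
  have tr: "(LBINT x. indicator (cube a b) x * h x) = (LBINT w. indicator ({a..b} \<times> {a..b}) w * h (?T w))"
    if "continuous_on UNIV h" for h :: "real^'n \<Rightarrow> real"
  proof -
    have [measurable]: "h \<in> borel_measurable borel" "cube a b \<in> sets borel"
      using that by (auto simp: cube_cbox borel_measurable_continuous_onI)
    have "(LINT x|distr lborel borel ?T. indicator (cube a b) x * h x) = (LBINT w. indicator (cube a b) (?T w) * h (?T w))"
      by (rule integral_distr) measurable
    then show ?thesis unfolding lborel_coordinates_2[OF pq] by (simp only: ind)
  qed
  have c: "continuous_on UNIV \<phi>" "\<And>j. continuous_on UNIV (pd j \<phi>)" by (intro smooth_continuous smooth_pd s)+
  have c': "continuous_on UNIV (\<lambda>w. h (?T w))" if "continuous_on UNIV h" for h :: "real^'n \<Rightarrow> real"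
    by (rule continuous_on_compose2[OF that cT]) simp
  have "(LBINT w. indicator ({a..b} \<times> {a..b}) w * (\<phi> (?T w)) ^ 4) \<le>
    (2 / (b - a)^2 + 8) * ((LBINT w. indicator ({a..b} \<times> {a..b}) w * (\<phi> (?T w))^2) *
      (LBINT w. indicator ({a..b} \<times> {a..b}) w * ((\<phi> (?T w))^2 + ((pd p \<phi> (?T w))^2 + (pd q \<phi> (?T w))^2))))"
  proof (rule Ladyzhenskaya_2D[OF ab c'[OF c(1)] c'[OF c(2)] c'[OF c(2)]])
    show "((\<lambda>x. \<phi> (?T (x, y))) has_real_derivative pd p \<phi> (?T (x, y))) (at x)" for x y
      using line_derivative[OF s, of p "y *\<^sub>R axis q 1" x] by simp
    show "((\<lambda>y. \<phi> (?T (x, y))) has_real_derivative pd q \<phi> (?T (x, y))) (at y)" for x y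
      using line_derivative[OF s, of q "x *\<^sub>R axis p 1" y] by (simp add: add.commute)
  qed
  moreover have "gsq \<phi> x = (\<phi> x)^2 + ((pd p \<phi> x)^2 + (pd q \<phi> x)^2)" for x
    by (subst pq(2)) (use pq(1) in simp)
  ultimately show ?thesis
    by (subst (1 2 3) tr) (auto intro!: continuous_intros c)
qed

lemma Sobolev_cube_3:
  fixes \<phi> :: "real^'n::finite \<Rightarrow> real"
  assumes card: "CARD('n) = 3" and ab: "a < b" and s: "smooth_fun \<phi>"
  shows "(LBINT x. indicator (cube a b) x * (\<phi> x) ^ 4) \<le> ((2 / (b - a)^2 + 8) * (1 / (b - a) + 1)) *
     (LBINT x. indicator (cube a b) x * gsq \<phi> x)^2"
proof -
  obtain p q k :: 'n where pq: "p \<noteq> q" "p \<noteq> k" "q \<noteq> k" "UNIV = {p, q, k}" using card by (metis card_3_iff)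
  let ?T = "\<lambda>w::real \<times> (real \<times> real). fst w *\<^sub>R axis p 1 + (fst (snd w) *\<^sub>R axis q 1 + snd (snd w) *\<^sub>R axis k 1) :: real^'n"
  have T[measurable]: "?T \<in> borel \<rightarrow>\<^sub>M borel" and cT: "continuous_on UNIV ?T"
    by (intro borel_measurable_continuous_onI continuous_intros)+
  have all: "(\<forall>i. Pr i) \<longleftrightarrow> Pr p \<and> Pr q \<and> Pr k" for Pr using pq(4) by (metis UNIV_I insertE singletonD)
  let ?C = "{a..b} \<times> ({a..b} \<times> {a..b})"
  have ind: "(indicator (cube a b) (?T w) :: real) = indicator ?C w" for w
    using pq(1-3) by (cases w) (auto simp: indicator_def cube_def all axis_def)
  have tr: "(LBINT x. indicator (cube a b) x * h x) = (LBINT w. indicator ?C w * h (?T w))"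
    if "continuous_on UNIV h" for h :: "real^'n \<Rightarrow> real"
  proof -
    have [measurable]: "h \<in> borel_measurable borel" "cube a b \<in> sets borel"
      using that by (auto simp: cube_cbox borel_measurable_continuous_onI)
    have "(LINT x|distr lborel borel ?T. indicator (cube a b) x * h x) = (LBINT w. indicator (cube a b) (?T w) * h (?T w))"
      by (rule integral_distr) measurable
    then show ?thesis unfolding lborel_coordinates_3[OF pq] by (simp only: ind)
  qed
  have c: "continuous_on UNIV \<phi>" "\<And>j. continuous_on UNIV (pd j \<phi>)" by (intro smooth_continuous smooth_pd s)+
  have c': "continuous_on UNIV (\<lambda>w. h (?T w))" if "continuous_on UNIV h" for h :: "real^'n \<Rightarrow> real"
    by (rule continuous_on_compose2[OF that cT]) simp
  have "(LBINT w. indicator ?C w * (\<phi> (?T w)) ^ 4) \<le>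
    ((2 / (b - a)^2 + 8) * (1 / (b - a) + 1)) *
      (LBINT w. indicator ?C w * ((\<phi> (?T w))^2 + ((pd q \<phi> (?T w))^2 + ((pd k \<phi> (?T w))^2 + (pd p \<phi> (?T w))^2))))^2"
  proof (rule Ladyzhenskaya_3D[OF ab c'[OF c(1)] c'[OF c(2)] c'[OF c(2)] c'[OF c(2)]])
    show "((\<lambda>z. \<phi> (?T (z, w))) has_real_derivative pd p \<phi> (?T (z, w))) (at z)" for z w
      using line_derivative[OF s, of p "fst w *\<^sub>R axis q 1 + snd w *\<^sub>R axis k 1" z] by simp
    show "((\<lambda>x. \<phi> (?T (z, (x, y)))) has_real_derivative pd q \<phi> (?T (z, (x, y)))) (at x)" for x y z
      using line_derivative[OF s, of q "z *\<^sub>R axis p 1 + y *\<^sub>R axis k 1" x] by (simp add: add.left_commute)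
    show "((\<lambda>y. \<phi> (?T (z, (x, y)))) has_real_derivative pd k \<phi> (?T (z, (x, y)))) (at y)" for x y z
      using line_derivative[OF s, of k "z *\<^sub>R axis p 1 + x *\<^sub>R axis q 1" y] by (simp add: add_ac)
  qed
  moreover have "gsq \<phi> x = (\<phi> x)^2 + ((pd q \<phi> x)^2 + ((pd k \<phi> x)^2 + (pd p \<phi> x)^2))" for x
    by (subst pq(4)) (use pq(1-3) in simp)
  ultimately show ?thesis
    by (subst (1 2) tr) (auto intro!: continuous_intros c)
qed

lemma One_vec_nth: "(\<Sum>Basis :: real^'n::finite) $ i = 1"
proof -
  have "(\<Sum>Basis :: real^'n) $ i = (\<Sum>Basis :: real^'n) \<bullet> axis i 1" by (simp add: inner_axis)
  also have "\<dots> = 1" by (rule inner_sum_Basis) (simp add: axis_in_Basis_iff)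
  finally show ?thesis .
qed

lemma unit_cell_cube: "(cbox 0 One :: (real^'n::finite) set) = cube 0 1"
  by (auto simp: mem_box_cart cube_def One_vec_nth simp del: sum_component)

lemma gsq_nonneg: "0 \<le> gsq \<phi> x"
  by (auto intro!: add_nonneg_nonneg sum_nonneg)

text \<open>A domain is enclosed in a cube, to which its test functions extend by zero; on the torus
  the cube is the unit cell. The planar form keeps the L^2 norm as a separate factor, since it will
  be bounded uniformly in time while the other is only integrated.\<close>

lemma Sobolev_test:
  fixes st :: "('n::finite) setting"
  assumes st: "valid_setting st" and card: "CARD('n) = 2 \<or> CARD('n) = 3"
  obtains C where "0 \<le> C"
    "\<And>\<phi>. test_S st \<phi> \<Longrightarrow> (LBINT x. indicator (region st) x * (\<phi> x) ^ 4) \<le> C * (LBINT x. indicator (region st) x * gsq \<phi> x)^2"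
    "\<And>\<phi>. CARD('n) = 2 \<Longrightarrow> test_S st \<phi> \<Longrightarrow> (LBINT x. indicator (region st) x * (\<phi> x) ^ 4) \<le>
       C * ((LBINT x. indicator (region st) x * (\<phi> x)^2) * (LBINT x. indicator (region st) x * gsq \<phi> x))"
proof -
  obtain a b :: real where ab: "a < b" and vals: "\<And>\<phi> x. test_S st \<phi> \<Longrightarrow> x \<notin> region st \<Longrightarrow> x \<in> cube a b \<Longrightarrow> \<phi> x = 0 \<and> (\<forall>j. pd j \<phi> x = 0)"
    and sub: "region st \<subseteq> cube a b"
  proof (cases st)
    case Torus
    show thesis by (rule that[of 0 1]) (auto simp: Torus unit_cell_cube)
  next
    case (Domain \<Omega>)
    have "bounded \<Omega>" using st Domain by (simp add: valid_setting_def)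
    then obtain R where R: "0 < R" "\<And>x. x \<in> \<Omega> \<Longrightarrow> norm x \<le> R" by (auto simp: bounded_pos)
    show thesis
    proof (rule that[of "-R" R])
      show "region st \<subseteq> cube (- R) R"
      proof
        fix x assume "x \<in> region st"
        then have "norm x \<le> R" using R(2) Domain by simp
        then have "\<bar>x $ i\<bar> \<le> R" for i using component_le_norm_cart[of x i] by linarith
        then show "x \<in> cube (- R) R" by (auto simp: cube_def abs_le_iff minus_le_iff)
      qed
      fix \<phi> x assume "test_S st \<phi>" "x \<notin> region st"
      then have "smooth_fun \<phi>" "x \<notin> supp_closure \<phi>" using Domain by auto
      then show "\<phi> x = 0 \<and> (\<forall>j. pd j \<phi> x = 0)" by (simp add: not_supp_closure pd_zero_outside)
    qed (use R in auto)
  qed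
  \<comment> \<open>The second factor is at least 1, so this constant covers the planar inequality
    as well.\<close>
  define C where "C = (2 / (b - a)^2 + 8) * (1 / (b - a) + 1)"
  have C0: "0 \<le> C" using ab by (simp add: C_def)
  have tr: "(LBINT x. indicator (region st) x * h x) = (LBINT x. indicator (cube a b) x * h x)"
    if "\<And>x. x \<notin> region st \<Longrightarrow> x \<in> cube a b \<Longrightarrow> h x = 0" for h :: "real^'n \<Rightarrow> real"
    using that sub by (intro integral_cong) (auto simp: indicator_def)
  have t4: "(LBINT x. indicator (region st) x * (\<phi> x) ^ 4) = (LBINT x. indicator (cube a b) x * (\<phi> x) ^ 4)"
    and t2: "(LBINT x. indicator (region st) x * (\<phi> x)^2) = (LBINT x. indicator (cube a b) x * (\<phi> x)^2)"
    and tg: "(LBINT x. indicator (region st) x * gsq \<phi> x) = (LBINT x. indicator (cube a b) x * gsq \<phi> x)"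
    if "test_S st \<phi>" for \<phi>
    using vals[OF that] by (intro tr; simp)+
  have i2g: "(LBINT x. indicator (cube a b) x * (\<phi> x)^2) \<le> (LBINT x. indicator (cube a b) x * gsq \<phi> x)" if s: "smooth_fun \<phi>" for \<phi> :: "real^'n \<Rightarrow> real"
  proof (rule integral_mono)
    have cc: "compact (cube a b :: (real^'n) set)" by (simp add: cube_cbox)
    show "integrable lborel (\<lambda>x. indicator (cube a b) x * (\<phi> x)^2)" "integrable lborel (\<lambda>x. indicator (cube a b) x * gsq \<phi> x)"
      by (intro integrable_indicator_continuous cc continuous_intros smooth_continuous smooth_pd s)+
  qed (auto simp: indicator_def sum_nonneg)
  have nn: "0 \<le> (LBINT x. indicator (cube a b) x * (\<phi> x)^2)" "0 \<le> (LBINT x. indicator (cube a b) x * gsq \<phi> x)" for \<phi> :: "real^'n \<Rightarrow> real"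
    by (intro integral_nonneg mult_nonneg_nonneg gsq_nonneg; simp)+
  have two: "(LBINT x. indicator (cube a b) x * (\<phi> x) ^ 4) \<le> C * ((LBINT x. indicator (cube a b) x * (\<phi> x)^2) * (LBINT x. indicator (cube a b) x * gsq \<phi> x))"
    if "CARD('n) = 2" "smooth_fun \<phi>" for \<phi> :: "real^'n \<Rightarrow> real"
  proof -
    have "2 / (b - a)^2 + 8 \<le> C" unfolding C_def
      using mult_left_mono[of 1 "1 / (b - a) + 1" "2 / (b - a)^2 + 8"] ab by (simp add: add_nonneg_nonneg)
    then have "(2 / (b - a)^2 + 8) * ((LBINT x. indicator (cube a b) x * (\<phi> x)^2) * (LBINT x. indicator (cube a b) x * gsq \<phi> x))
      \<le> C * ((LBINT x. indicator (cube a b) x * (\<phi> x)^2) * (LBINT x. indicator (cube a b) x * gsq \<phi> x))"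
      by (rule mult_right_mono) (intro mult_nonneg_nonneg nn)
    then show ?thesis using Sobolev_cube_2[OF that(1) ab that(2)] by linarith
  qed
  show thesis
  proof (rule that[OF C0])
    fix \<phi> assume phi: "test_S st \<phi>"
    have s: "smooth_fun \<phi>" by (rule test_S_smooth[OF phi])
    show "(LBINT x. indicator (region st) x * (\<phi> x) ^ 4) \<le> C * (LBINT x. indicator (region st) x * gsq \<phi> x)^2"
      unfolding t4[OF phi] tg[OF phi]
    proof (cases "CARD('n) = 2")
      case True
      have "C * ((LBINT x. indicator (cube a b) x * (\<phi> x)^2) * (LBINT x. indicator (cube a b) x * gsq \<phi> x))
        \<le> C * ((LBINT x. indicator (cube a b) x * gsq \<phi> x) * (LBINT x. indicator (cube a b) x * gsq \<phi> x))"
        by (intro mult_left_mono mult_right_mono i2g s nn C0)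
      then show "(LBINT x. indicator (cube a b) x * (\<phi> x) ^ 4) \<le> C * (LBINT x. indicator (cube a b) x * gsq \<phi> x)^2"
        using two[OF True s] by (simp only: power2_eq_square)
    next
      case False
      then show "(LBINT x. indicator (cube a b) x * (\<phi> x) ^ 4) \<le> C * (LBINT x. indicator (cube a b) x * gsq \<phi> x)^2"
        using Sobolev_cube_3[OF _ ab s] card unfolding C_def by simp
    qed
    show "(LBINT x. indicator (region st) x * (\<phi> x) ^ 4) \<le>
       C * ((LBINT x. indicator (region st) x * (\<phi> x)^2) * (LBINT x. indicator (region st) x * gsq \<phi> x))"
      if "CARD('n) = 2" unfolding t4[OF phi] tg[OF phi] t2[OF phi] by (rule two[OF that s])
  qed
qed

lemma test_S_diff: "test_S st f \<Longrightarrow> test_S st g \<Longrightarrow> test_S st (\<lambda>x. f x - g x)"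
  using test_S_add[of st f "\<lambda>x. (-1) * g x"] test_S_cmult[of st g "-1"] by simp

lemma pd_diff:
  assumes "smooth_fun f" "smooth_fun g" shows "dderiv e (\<lambda>x. f x - g x) x = dderiv e f x - dderiv e g x"
  by (rule dderiv_eq) (intro has_derivative_diff has_derivative_dderiv smooth_differentiable assms)

lemma Lp2_diff_triangle:
  assumes "Lp 2 M f" "Lp 2 M g" "Lp 2 M w"
  shows "(LINT x|M. (f x - g x)^2) \<le> 9 * ((LINT x|M. \<bar>f x - w x\<bar>^2) + (LINT x|M. \<bar>g x - w x\<bar>^2))"
  using Lp_dist_triangle[of 2 M f w g g] assms by (simp add: power2_commute[of "w _"])

text \<open>The Sobolev inequality applied to differences makes the sequence Cauchy in L^4. Its
  limit is identified with \<open>w\<close> through an a.e. convergent subsequence and Fatou's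
  lemma.\<close>

lemma tests_L4:
  fixes st :: "('n::finite) setting" and \<phi> :: "nat \<Rightarrow> real^'n \<Rightarrow> real"
  assumes st: "valid_setting st" and C: "0 \<le> C"
    "\<And>\<phi>. test_S st \<phi> \<Longrightarrow> (LBINT x. indicator (region st) x * (\<phi> x) ^ 4) \<le> C * (LBINT x. indicator (region st) x * gsq \<phi> x)^2"
    and \<phi>: "\<And>k. test_S st (\<phi> k)"
    and w: "Lpconv 2 lborel sequentially (\<lambda>k x. indicator (region st) x * \<phi> k x) w"
    and Dw: "\<And>j. Lpconv 2 lborel sequentially (\<lambda>k x. indicator (region st) x * pd j (\<phi> k) x) (Dw j)"
  shows "Lpconv 4 lborel sequentially (\<lambda>k x. indicator (region st) x * \<phi> k x) w"
proof -
  define X where "X = region st"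
  define f where "f = (\<lambda>k x. indicator X x * \<phi> k x)"
  have s: "smooth_fun (\<phi> k)" for k by (rule test_S_smooth[OF \<phi>])
  have fL: "Lp p lborel (f k)" if "0 < p" for p k unfolding f_def X_def by (rule Lp_test[OF st s that])
  have gL: "Lp 2 lborel (\<lambda>x. indicator X x * pd j (\<phi> k) x)" for j k unfolding X_def by (rule Lp_test[OF st smooth_pd[OF s]]) simp
  have wL: "Lp 2 lborel w" using LpconvD(2)[OF w] .
  have DwL: "Lp 2 lborel (Dw j)" for j using LpconvD(2)[OF Dw] .
  have wm[measurable]: "w \<in> borel_measurable borel" using wL by (simp add: Lp_def)
  have fm[measurable]: "f k \<in> borel_measurable borel" for k using fL[of 1] by (simp add: Lp_def)
  \<comment> \<open>The squared H^1 distance to the limit; the 9 is 3^2 from the triangle inequality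
    for squares.\<close>
  define e where "e = (\<lambda>k. 9 * ((LBINT x. \<bar>f k x - w x\<bar>^2) + (\<Sum>j\<in>UNIV. LBINT x. \<bar>indicator X x * pd j (\<phi> k) x - Dw j x\<bar>^2)))"
  have "e \<longlonglongrightarrow> 9 * (0 + (\<Sum>j\<in>(UNIV::'n set). 0))"
    unfolding e_def f_def X_def by (intro tendsto_intros LpconvD(3)[OF w] LpconvD(3)[OF Dw])
  then have e0: "e \<longlonglongrightarrow> 0" by simp
  have gs: "(LBINT x. indicator X x * gsq (\<lambda>x. \<phi> k x - \<phi> l x) x) \<le> e k + e l" for k l
  proof -
    have eq: "indicator X x * gsq (\<lambda>x. \<phi> k x - \<phi> l x) x = (f k x - f l x)^2 + (\<Sum>j\<in>UNIV. (indicator X x * pd j (\<phi> k) x - indicator X x * pd j (\<phi> l) x)^2)" for x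
      by (auto simp: indicator_def f_def pd_diff[OF s s])
    have i1: "integrable lborel (\<lambda>x. (f k x - f l x)^2)" using Lp_integrable[OF Lp_diff[OF _ fL fL], of 2 k l] by simp
    have i2: "integrable lborel (\<lambda>x. (indicator X x * pd j (\<phi> k) x - indicator X x * pd j (\<phi> l) x)^2)" for j
      using Lp_integrable[OF Lp_diff[OF _ gL gL], of j k j l] by simp
    have "(LBINT x. indicator X x * gsq (\<lambda>x. \<phi> k x - \<phi> l x) x) = (LBINT x. (f k x - f l x)^2) + (\<Sum>j\<in>UNIV. LBINT x. (indicator X x * pd j (\<phi> k) x - indicator X x * pd j (\<phi> l) x)^2)"
      unfolding eq using i1 i2 by simp
    also have "\<dots> \<le> 9 * ((LBINT x. \<bar>f k x - w x\<bar>^2) + (LBINT x. \<bar>f l x - w x\<bar>^2)) +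
       (\<Sum>j\<in>UNIV. 9 * ((LBINT x. \<bar>indicator X x * pd j (\<phi> k) x - Dw j x\<bar>^2) + (LBINT x. \<bar>indicator X x * pd j (\<phi> l) x - Dw j x\<bar>^2)))"
      by (intro add_mono sum_mono Lp2_diff_triangle fL gL wL DwL) simp_all
    also have "\<dots> = e k + e l" by (simp add: e_def sum.distrib sum_distrib_left[symmetric])
    finally show ?thesis .
  qed
  have L4: "(LBINT x. (f k x - f l x) ^ 4) \<le> C * (e k + e l)^2" for k l
  proof -
    have "(LBINT x. (f k x - f l x) ^ 4) = (LBINT x. indicator X x * (\<phi> k x - \<phi> l x) ^ 4)"
      by (intro integral_cong) (auto simp: f_def indicator_def)
    also have "\<dots> \<le> C * (LBINT x. indicator X x * gsq (\<lambda>x. \<phi> k x - \<phi> l x) x)^2"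
      unfolding X_def by (rule C(2)[OF test_S_diff[OF \<phi> \<phi>]])
    also have "\<dots> \<le> C * (e k + e l)^2"
      by (intro mult_left_mono power_mono gs C(1) integral_nonneg mult_nonneg_nonneg gsq_nonneg) simp
    finally show ?thesis .
  qed
  have "(\<lambda>k. LBINT x. norm (\<bar>f k x - w x\<bar>^2)) \<longlonglongrightarrow> 0"
    using LpconvD(3)[OF w] by (simp add: f_def X_def)
  then obtain \<sigma> where \<sigma>: "strict_mono \<sigma>" "AE x in lborel. (\<lambda>n. \<bar>f (\<sigma> n) x - w x\<bar>^2) \<longlonglongrightarrow> 0"
    using tendsto_L1_AE_subseq[of lborel "\<lambda>k x. \<bar>f k x - w x\<bar>^2"] Lp_integrable[OF Lp_diff[OF _ fL wL]] by auto
  have ae: "AE x in lborel. (\<lambda>n. f (\<sigma> n) x) \<longlonglongrightarrow> w x"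
    using \<sigma>(2)
  proof eventually_elim
    case (elim x)
    have "(\<lambda>n. sqrt (\<bar>f (\<sigma> n) x - w x\<bar>^2)) \<longlonglongrightarrow> sqrt 0" by (intro tendsto_intros elim)
    then have "(\<lambda>n. f (\<sigma> n) x - w x) \<longlonglongrightarrow> 0" by (simp add: tendsto_rabs_zero_iff)
    then show ?case by (rule LIM_zero_cancel)
  qed
  \<comment> \<open>Fatou's lemma with the second index sent to infinity along the subsequence;
    nonnegative integrals are used because \<open>w\<close> is not yet known to lie in L^4.\<close>
  have nn: "(\<integral>\<^sup>+x. ennreal (\<bar>f k x - w x\<bar> ^ 4) \<partial>lborel) \<le> ennreal (C * (e k)^2)" for k
  proof -
    have "(\<integral>\<^sup>+x. ennreal (\<bar>f k x - w x\<bar> ^ 4) \<partial>lborel) = (\<integral>\<^sup>+x. liminf (\<lambda>n. ennreal (\<bar>f k x - f (\<sigma> n) x\<bar> ^ 4)) \<partial>lborel)"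
    proof (rule nn_integral_cong_AE)
      show "AE x in lborel. ennreal (\<bar>f k x - w x\<bar> ^ 4) = liminf (\<lambda>n. ennreal (\<bar>f k x - f (\<sigma> n) x\<bar> ^ 4))"
        using ae
      proof eventually_elim
        case (elim x)
        have "(\<lambda>n. ennreal (\<bar>f k x - f (\<sigma> n) x\<bar> ^ 4)) \<longlonglongrightarrow> ennreal (\<bar>f k x - w x\<bar> ^ 4)"
          by (intro tendsto_intros elim)
        then show ?case by (rule lim_imp_Liminf[OF sequentially_bot, symmetric])
      qed
    qed
    also have "\<dots> \<le> liminf (\<lambda>n. \<integral>\<^sup>+x. ennreal (\<bar>f k x - f (\<sigma> n) x\<bar> ^ 4) \<partial>lborel)"
      by (rule nn_integral_liminf) measurable
    also have "\<dots> \<le> liminf (\<lambda>n. ennreal (C * (e k + e (\<sigma> n))^2))"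
    proof (rule Liminf_mono, rule always_eventually, rule allI)
      fix n
      have "integrable lborel (\<lambda>x. \<bar>f k x - f (\<sigma> n) x\<bar> ^ 4)" by (intro Lp_integrable Lp_diff fL) simp_all
      then have "(\<integral>\<^sup>+x. ennreal (\<bar>f k x - f (\<sigma> n) x\<bar> ^ 4) \<partial>lborel) = ennreal (LBINT x. \<bar>f k x - f (\<sigma> n) x\<bar> ^ 4)"
        by (intro nn_integral_eq_integral) auto
      also have "\<dots> \<le> ennreal (C * (e k + e (\<sigma> n))^2)" using L4[of k "\<sigma> n"] by (intro ennreal_leI) simp
      finally show "(\<integral>\<^sup>+x. ennreal (\<bar>f k x - f (\<sigma> n) x\<bar> ^ 4) \<partial>lborel) \<le> ennreal (C * (e k + e (\<sigma> n))^2)" .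
    qed
    also have "\<dots> = ennreal (C * (e k)^2)"
    proof (rule lim_imp_Liminf[OF sequentially_bot])
      have "(\<lambda>n. e (\<sigma> n)) \<longlonglongrightarrow> 0" using LIMSEQ_subseq_LIMSEQ[OF e0 \<sigma>(1)] by (simp add: comp_def)
      then have "(\<lambda>n. ennreal (C * (e k + e (\<sigma> n))^2)) \<longlonglongrightarrow> ennreal (C * (e k + 0)^2)" by (intro tendsto_intros)
      then show "(\<lambda>n. ennreal (C * (e k + e (\<sigma> n))^2)) \<longlonglongrightarrow> ennreal (C * (e k)^2)" by simp
    qed
    finally show ?thesis .
  qed
  have dL: "Lp 4 lborel (\<lambda>x. f k x - w x)" for k
    unfolding Lp_iff_nn using le_less_trans[OF nn[of k]] by auto
  have w4: "Lp 4 lborel w"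
    using Lp_diff[OF _ fL[of 4 0] dL[of 0]] by simp
  show ?thesis
    unfolding f_def[symmetric] X_def[symmetric]
  proof (rule Lpconv_sandwich[where e="\<lambda>k. C * (e k)^2"])
    show "Lp 4 lborel (f k)" for k by (rule fL) simp
    show "(LBINT x. \<bar>f k x - w x\<bar> ^ 4) \<le> C * (e k)^2" for k
    proof -
      have "ennreal (LBINT x. \<bar>f k x - w x\<bar> ^ 4) \<le> ennreal (C * (e k)^2)"
        using nn[of k] by (subst (asm) nn_integral_eq_integral[OF Lp_integrable[OF dL]]) auto
      then show ?thesis using C(1) by (subst (asm) ennreal_le_iff) auto
    qed
    have "(\<lambda>k. C * (e k)^2) \<longlonglongrightarrow> C * 0\<^sup>2" by (intro tendsto_intros e0)
    then show "(\<lambda>k. C * (e k)^2) \<longlonglongrightarrow> 0" by simp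
  qed (rule w4)
qed

lemma tests_L4_bound:
  fixes st :: "('n::finite) setting" and \<phi> :: "nat \<Rightarrow> real^'n \<Rightarrow> real"
  assumes st: "valid_setting st"
    and C: "\<And>\<phi>. test_S st \<phi> \<Longrightarrow> (LBINT x. indicator (region st) x * (\<phi> x) ^ 4) \<le>
       C * ((LBINT x. indicator (region st) x * (\<phi> x)^2) * (LBINT x. indicator (region st) x * gsq \<phi> x))"
    and \<phi>: "\<And>k. test_S st (\<phi> k)"
    and w: "Lpconv 2 lborel sequentially (\<lambda>k x. indicator (region st) x * \<phi> k x) w"
    and w4: "Lpconv 4 lborel sequentially (\<lambda>k x. indicator (region st) x * \<phi> k x) w"
    and Dw: "\<And>j. Lpconv 2 lborel sequentially (\<lambda>k x. indicator (region st) x * pd j (\<phi> k) x) (Dw j)"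
  shows "(LBINT x. (w x) ^ 4) \<le> C * ((LBINT x. (w x)^2) * ((LBINT x. (w x)^2) + (\<Sum>j\<in>UNIV. LBINT x. (Dw j x)^2)))"
proof (rule LIMSEQ_le)
  define X where "X = region st"
  define f where "f = (\<lambda>k x. indicator X x * \<phi> k x)"
  have sq: "(\<lambda>k. LBINT x. (h k x)^2) \<longlonglongrightarrow> (LBINT x. (v x)^2)" if "Lpconv 2 lborel sequentially h v" for h and v :: "real^'n \<Rightarrow> real"
    using Lpconv1_integral[OF Lpconv2_mult[OF that that]] by (simp add: power2_eq_square)
  have q: "(\<lambda>k. LBINT x. (f k x) ^ 4) \<longlonglongrightarrow> (LBINT x. (w x) ^ 4)"
    using sq[OF Lpconv4_mult[OF w4 w4]] by (simp add: f_def X_def power2_eq_square power4_eq_xxxx mult.assoc)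
  show "(\<lambda>k. LBINT x. (f k x) ^ 4) \<longlonglongrightarrow> (LBINT x. (w x) ^ 4)" by (rule q)
  show "(\<lambda>k. C * ((LBINT x. (f k x)^2) * ((LBINT x. (f k x)^2) + (\<Sum>j\<in>UNIV. LBINT x. (indicator X x * pd j (\<phi> k) x)^2))))
    \<longlonglongrightarrow> C * ((LBINT x. (w x)^2) * ((LBINT x. (w x)^2) + (\<Sum>j\<in>UNIV. LBINT x. (Dw j x)^2)))"
    unfolding f_def X_def by (intro tendsto_intros sq w Dw)
  have "(LBINT x. (f k x) ^ 4) \<le> C * ((LBINT x. (f k x)^2) * ((LBINT x. (f k x)^2) + (\<Sum>j\<in>UNIV. LBINT x. (indicator X x * pd j (\<phi> k) x)^2)))" for k
  proof -
    have s: "smooth_fun (\<phi> k)" by (rule test_S_smooth[OF \<phi>])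
    have i1: "integrable lborel (\<lambda>x. (f k x)^2)" using Lp_integrable[OF Lp_test[OF st s, of 2]] by (simp add: f_def X_def)
    have i2: "integrable lborel (\<lambda>x. (indicator X x * pd j (\<phi> k) x)^2)" for j
      using Lp_integrable[OF Lp_test[OF st smooth_pd[OF s], of 2]] by (simp add: X_def)
    have "(LBINT x. indicator X x * gsq (\<phi> k) x) = (LBINT x. (f k x)^2 + (\<Sum>j\<in>UNIV. (indicator X x * pd j (\<phi> k) x)^2))"
      by (intro integral_cong) (auto simp: f_def indicator_def)
    also have "\<dots> = (LBINT x. (f k x)^2) + (\<Sum>j\<in>UNIV. LBINT x. (indicator X x * pd j (\<phi> k) x)^2)" using i1 i2 by simp
    finally have e: "(LBINT x. indicator X x * gsq (\<phi> k) x) = \<dots>" .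
    have p: "indicator X x * (\<phi> k x) ^ n = (f k x) ^ n" if "0 < n" for x n using that by (auto simp: f_def indicator_def)
    show ?thesis using C[OF \<phi>, of k] unfolding X_def[symmetric] e by (simp add: p)
  qed
  then show "\<exists>N. \<forall>k\<ge>N. (LBINT x. (f k x) ^ 4) \<le> C * ((LBINT x. (f k x)^2) * ((LBINT x. (f k x)^2) + (\<Sum>j\<in>UNIV. LBINT x. (indicator X x * pd j (\<phi> k) x)^2)))"
    by blast
qed

section \<open>Mollification on the torus\<close>

text \<open>The two-parameter family is closed under differentiation, which closes the induction on
  the order.\<close>

lemma smooth_sin_cos: "smooth_fun (\<lambda>t::real. a * sin t + b * cos t)"
  unfolding smooth_fun_iff_Ck
proof
  fix k show "Ck k (\<lambda>t::real. a * sin t + b * cos t)"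
  proof (induction k arbitrary: a b)
    case (Suc k)
    have d: "((\<lambda>t. a * sin t + b * cos t) has_real_derivative (- b) * sin t + a * cos t) (at t)" for t
      by (auto intro!: derivative_eq_intros)
    have "dderiv 1 (\<lambda>t. a * sin t + b * cos t) = (\<lambda>t. (- b) * sin t + a * cos t)"
      using d by (intro ext dderiv_real)
    moreover have "(\<lambda>t. a * sin t + b * cos t) differentiable (at t)" for t
      using d real_differentiable_def by blast
    ultimately show ?case using Suc[of "- b" a] by simp
  qed simp
qed

lemma test_trig: "test_S Torus (\<lambda>x::real^'n::finite. cos (2 * pi * x $ i))" "test_S Torus (\<lambda>x::real^'n. sin (2 * pi * x $ i))"
proof -
  have L: "bounded_linear (\<lambda>x::real^'n. 2 * pi * x $ i)"
    by (intro bounded_linear_mult_right[THEN bounded_linear_compose] bounded_linear_vec_nth)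
  have "smooth_fun (\<lambda>t::real. cos t)" "smooth_fun (\<lambda>t::real. sin t)"
    using smooth_sin_cos[of 0 1] smooth_sin_cos[of 1 0] by simp_all
  then have s: "smooth_fun (\<lambda>x::real^'n. cos (2 * pi * x $ i))" "smooth_fun (\<lambda>x::real^'n. sin (2 * pi * x $ i))"
    using smooth_linear_comp[OF L, of cos] smooth_linear_comp[OF L, of sin] by simp_all
  have "cos (2 * pi * (x + n)) = cos (2 * pi * x)" "sin (2 * pi * (x + n)) = sin (2 * pi * x)" if "n \<in> \<int>" for x n :: real
    using that by (auto elim!: Ints_cases simp: distrib_left cos_add sin_add)
  then show "test_S Torus (\<lambda>x::real^'n. cos (2 * pi * x $ i))" "test_S Torus (\<lambda>x::real^'n. sin (2 * pi * x $ i))"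
    using s by (auto simp: periodic_x_def)
qed

lemma test_const: "test_S Torus (\<lambda>x::real^'n::finite. c)"
  by (simp add: smooth_const periodic_x_def)

text \<open>Kernels that are finite sums of products of test functions: integrating against them
  yields a test function, and differentiation passes under the integral for free.\<close>
inductive separated :: "(real^'n::finite \<Rightarrow> real^'n \<Rightarrow> real) \<Rightarrow> bool" where
  separated_basic: "test_S Torus a \<Longrightarrow> test_S Torus b \<Longrightarrow> separated (\<lambda>x y. a x * b y)"
| separated_add: "separated F \<Longrightarrow> separated G \<Longrightarrow> separated (\<lambda>x y. F x y + G x y)"

lemma separated_mult:
  assumes "separated F" "separated G" shows "separated (\<lambda>x y. F x y * G x y)"
  using assms
proof (induction arbitrary: G rule: separated.induct)
  case (separated_basic a b)
  from separated_basic(3,1,2) show ?case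
  proof (induction rule: separated.induct)
    case (separated_basic a' b')
    have "separated (\<lambda>x y. (a x * a' x) * (b y * b' y))"
      by (intro separated.separated_basic test_S_mult separated_basic)
    then show ?case by (simp add: mult_ac)
  next
    case (separated_add F G)
    then have "separated (\<lambda>x y. a x * b y * F x y + a x * b y * G x y)" by (intro separated.separated_add) auto
    then show ?case by (simp add: distrib_left)
  qed
next
  case (separated_add F1 F2)
  then have "separated (\<lambda>x y. F1 x y * G x y + F2 x y * G x y)" by (intro separated.separated_add) auto
  then show ?case by (simp add: distrib_right)
qed

lemma separated_const: "separated (\<lambda>x y. c)"
  using separated_basic[OF test_const[of c] test_const[of 1]] by simp

lemma separated_power: "separated F \<Longrightarrow> separated (\<lambda>x y. F x y ^ n)"
  by (induction n) (auto simp: separated_const separated_mult)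

lemma separated_prod: "finite I \<Longrightarrow> (\<And>i. i \<in> I \<Longrightarrow> separated (F i)) \<Longrightarrow> separated (\<lambda>x y. \<Prod>i\<in>I. F i x y)"
  by (induction I rule: finite_induct) (auto simp: separated_const separated_mult)

lemma separated_tests:
  assumes "separated F" shows "test_S Torus (F x)" "test_S Torus (\<lambda>x. F x y)"
  using assms
proof (induction rule: separated.induct)
  case (separated_basic a b)
  { case 1 show ?case by (rule test_S_cmult) fact }
  { case 2 show ?case using test_S_cmult[OF separated_basic(1), of "b y"] by (simp add: mult.commute) }
qed (rule test_S_add; assumption)+

lemma separated_integral:
  fixes v :: "real^'n::finite \<Rightarrow> real"
  assumes "separated F" and v: "integrable lborel v" "\<And>x. x \<notin> cbox 0 One \<Longrightarrow> v x = 0"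
  shows "test_S Torus (\<lambda>x. LBINT y. v y * F x y) \<and> (\<forall>x. integrable lborel (\<lambda>y. v y * F x y)) \<and>
     (\<forall>j x. integrable lborel (\<lambda>y. v y * pd j (\<lambda>x. F x y) x) \<and>
        pd j (\<lambda>x. LBINT y. v y * F x y) x = (LBINT y. v y * pd j (\<lambda>x. F x y) x))"
  using assms(1)
proof (induction rule: separated.induct)
  case (separated_basic a b)
  have s: "smooth_fun a" "smooth_fun b" using separated_basic by auto
  obtain B where B: "\<And>x. x \<in> cbox 0 One \<Longrightarrow> \<bar>b x\<bar> \<le> B" using smooth_bounded_on[OF s(2) bounded_cbox] by metis
  have i: "integrable lborel (\<lambda>y. v y * b y)"
    by (rule integrable_bounded_mult[where B=B, OF v(1)]) (use smooth_borel[OF s(2)] v(2) B in auto)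
  define c where "c = (LBINT y. v y * b y)"
  have e1: "(\<lambda>y. v y * (k * b y)) = (\<lambda>y. k * (v y * b y))" for k by (simp add: mult_ac)
  have e: "(LBINT y. v y * (a x * b y)) = c * a x" for x unfolding e1 by (simp add: c_def)
  have d: "pd j (\<lambda>x. a x * k) x = pd j a x * k" for j k x
    by (rule dderiv_eq[of "\<lambda>x. a x * k" "\<lambda>h. dderiv h a x * k"])
       (intro has_derivative_mult_left has_derivative_dderiv smooth_differentiable s)
  have d': "pd j (\<lambda>x. k * a x) x = k * pd j a x" for j k x using d[of j k x] by (simp add: mult.commute)
  show ?case unfolding e d d'
    using i by (auto simp: e1 c_def intro!: test_S_cmult[OF separated_basic(1), simplified] test_S_cmult separated_basic(1))
next
  case (separated_add F G)
  note IH = separated_add.IH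
  have sm: "smooth_fun (\<lambda>x. LBINT y. v y * F x y)" "smooth_fun (\<lambda>x. LBINT y. v y * G x y)"
    using IH by (auto dest: test_S_smooth)
  have sF: "smooth_fun (\<lambda>x. F x y)" "smooth_fun (\<lambda>x. G x y)" for y
    using separated_tests(2)[OF separated_add.hyps(1), of y] separated_tests(2)[OF separated_add.hyps(2), of y] by auto
  have e: "(LBINT y. v y * (F x y + G x y)) = (LBINT y. v y * F x y) + (LBINT y. v y * G x y)" for x
    using IH by (simp add: distrib_left)
  have dd: "pd j (\<lambda>x. F x y + G x y) x = pd j (\<lambda>x. F x y) x + pd j (\<lambda>x. G x y) x" for j x y
    by (rule fun_cong[OF dderiv_add]) (intro smooth_differentiable sF)+
  have dI: "pd j (\<lambda>x. (LBINT y. v y * F x y) + (LBINT y. v y * G x y)) x = pd j (\<lambda>x. LBINT y. v y * F x y) x + pd j (\<lambda>x. LBINT y. v y * G x y) x" for j x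
    by (rule fun_cong[OF dderiv_add]) (intro smooth_differentiable sm)+
  show ?case unfolding e dd dI
    using IH by (auto simp: distrib_left intro!: test_S_add[of Torus, simplified] smooth_add)
qed

text \<open>An unnormalised trigonometric kernel of de la Vallee Poussin type: nonnegative,
  periodic, equal to 1 exactly at integer points, and concentrating there as \<open>N\<close> grows.
  As a trigonometric polynomial it separates into finitely many products of functions of
  \<open>x\<close> and of \<open>y\<close>.\<close>

definition ker :: "nat \<Rightarrow> real^'n::finite \<Rightarrow> real" where
  "ker N z = (\<Prod>i\<in>UNIV. (cos (pi * z $ i))^2) ^ N"

lemma cos_square_diff: "(cos (pi * (s - t)))^2 = 1/2 + ((1/2 * cos (2 * pi * s)) * cos (2 * pi * t) + (1/2 * sin (2 * pi * s)) * sin (2 * pi * t))"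
proof -
  have "cos (2 * pi * s - 2 * pi * t) = 2 * (cos (pi * (s - t)))^2 - 1"
    using cos_double_cos[of "pi * (s - t)"] by (simp add: algebra_simps)
  then show ?thesis by (simp add: cos_diff)
qed

lemma separated_ker: "separated (\<lambda>x y::real^'n::finite. ker N (x - y))"
proof -
  have "separated (\<lambda>x y::real^'n. 1/2 + ((1/2 * cos (2 * pi * x $ i)) * cos (2 * pi * y $ i) + (1/2 * sin (2 * pi * x $ i)) * sin (2 * pi * y $ i)))" for i
    by (intro separated_add separated_const separated_basic test_S_cmult test_trig)
  then have "separated (\<lambda>x y::real^'n. (cos (pi * (x - y) $ i))^2)" for i
    by (simp add: cos_square_diff)
  then have "separated (\<lambda>x y::real^'n. \<Prod>i\<in>UNIV. (cos (pi * (x - y) $ i))^2)" by (intro separated_prod) simp_all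
  then show ?thesis unfolding ker_def by (rule separated_power)
qed

lemma ker_bounds: "0 \<le> ker N z" "ker N z \<le> 1"
proof -
  have "(cos (pi * z $ i))^2 \<le> 1" for i by (simp add: abs_square_le_1)
  then show "0 \<le> ker N z" "ker N z \<le> 1" unfolding ker_def
    by (auto intro!: zero_le_power[OF prod_nonneg] power_le_one[OF prod_nonneg prod_le_1])
qed

lemma ker_minus: "ker N (- z) = ker N z"
  by (simp add: ker_def)

lemma smooth_ker: "smooth_fun (ker N :: real^'n::finite \<Rightarrow> real)"
proof -
  have "smooth_fun (\<lambda>x::real^'n. ker N (x - 0))" using test_S_smooth[OF separated_tests(2)[OF separated_ker, where y=0]] .
  then show ?thesis by simp
qed

lemma ker_meas[measurable]: "ker N \<in> borel_measurable borel"
  by (rule smooth_borel[OF smooth_ker])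

text \<open>Moves a derivative of the mollified function onto the integration variable, where the
  weak derivative of the slice can be invoked.\<close>

lemma pd_ker_swap: "pd j (\<lambda>x. ker N (x - y)) x = - pd j (\<lambda>y. ker N (x - y)) (y :: real^'n::finite)"
proof -
  have d: "(ker N :: real^'n \<Rightarrow> real) differentiable (at z)" for z by (rule smooth_differentiable[OF smooth_ker])
  have 1: "pd j (\<lambda>x. ker N (x - y)) x = pd j (ker N) (x - y)"
    using dderiv_affine[OF bounded_linear_ident, of "ker N" x "- y" "axis j 1"] d by simp
  have m: "bounded_linear (\<lambda>x::real^'n. - x)" by (intro bounded_linear_minus bounded_linear_ident)
  have 2: "pd j (\<lambda>y. ker N (x - y)) y = dderiv (- axis j 1) (ker N) (x - y)"
    using dderiv_affine[OF m, of "ker N" y x "axis j 1"] d by simp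
  have 3: "dderiv (- axis j 1) (ker N) (x - y) = - pd j (ker N) (x - y)"
    using linear_neg[OF has_derivative_linear[OF has_derivative_dderiv[OF d[of "x - y"]]]] .
  show ?thesis unfolding 1 2 3 by simp
qed

lemma nn_integral_periodic_shift:
  fixes w :: "real \<Rightarrow> ennreal"
  assumes [measurable]: "w \<in> borel_measurable borel" and per: "\<And>s. w (s + 1) = w s"
  shows "(\<integral>\<^sup>+s. indicator {0..1} s * w (s + a) \<partial>lborel) = (\<integral>\<^sup>+s. indicator {0..1} s * w s \<partial>lborel)"
proof -
  have perI: "w (s + of_int n) = w s" for s n
  proof -
    have nat: "w (s + real n) = w s" for s n
    proof (induction n)
      case (Suc n)
      have "w (s + real (Suc n)) = w ((s + real n) + 1)" by (simp add: algebra_simps)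
      then show ?case using Suc per by simp
    qed simp
    show ?thesis
    proof (cases "0 \<le> n")
      case True
      then show ?thesis using nat[of s "nat n"] by simp
    next
      case False
      then show ?thesis using nat[of "s + of_int n" "nat (- n)"] by simp
    qed
  qed
  \<comment> \<open>Only the fractional part of the shift matters. The part of the shifted interval
    beyond 1 is then moved back by one period.\<close>
  define c where "c = a - of_int \<lfloor>a\<rfloor>"
  have c: "0 \<le> c" "c < 1" unfolding c_def by linarith+
  have "w (s + a) = w (s + c)" for s
    using perI[of "s + c" "\<lfloor>a\<rfloor>"] by (simp add: c_def algebra_simps)
  then have "(\<integral>\<^sup>+s. indicator {0..1} s * w (s + a) \<partial>lborel) = (\<integral>\<^sup>+s. indicator {c..1 + c} (s + c) * w (s + c) \<partial>lborel)"
    by (intro nn_integral_cong) (auto simp: indicator_def)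
  also have "\<dots> = (\<integral>\<^sup>+s. indicator {c..1 + c} s * w s \<partial>lborel)"
    by (rule nn_integral_lborel_shift[of "\<lambda>s. indicator {c..1 + c} s * w s"]) measurable
  also have "\<dots> = (\<integral>\<^sup>+s. indicator {c..1} s * w s + indicator {1..1 + c} s * w s \<partial>lborel)"
    by (intro nn_integral_cong_AE, rule AE_mp[OF AE_lborel_singleton[of 1]])
       (use c in \<open>auto simp: indicator_def intro!: AE_I2\<close>)
  also have "\<dots> = (\<integral>\<^sup>+s. indicator {c..1} s * w s \<partial>lborel) + (\<integral>\<^sup>+s. indicator {1..1 + c} s * w s \<partial>lborel)"
    by (rule nn_integral_add) measurable
  also have "(\<integral>\<^sup>+s. indicator {1..1 + c} s * w s \<partial>lborel) = (\<integral>\<^sup>+s. indicator {1..1 + c} (s + 1) * w (s + 1) \<partial>lborel)"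
    by (rule nn_integral_lborel_shift[symmetric, of "\<lambda>s. indicator {1..1 + c} s * w s"]) measurable
  also have "\<dots> = (\<integral>\<^sup>+s. indicator {0..c} s * w s \<partial>lborel)"
    by (intro nn_integral_cong) (auto simp: indicator_def per)
  also have "(\<integral>\<^sup>+s. indicator {c..1} s * w s \<partial>lborel) + (\<integral>\<^sup>+s. indicator {0..c} s * w s \<partial>lborel)
    = (\<integral>\<^sup>+s. indicator {c..1} s * w s + indicator {0..c} s * w s \<partial>lborel)"
    by (rule nn_integral_add[symmetric]) measurable
  also have "\<dots> = (\<integral>\<^sup>+s. indicator {0..1} s * w s \<partial>lborel)"
    by (intro nn_integral_cong_AE, rule AE_mp[OF AE_lborel_singleton[of c]])
       (use c in \<open>auto simp: indicator_def intro!: AE_I2\<close>)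
  finally show ?thesis .
qed

text \<open>The mass depends on the dimension, which no other argument reveals; hence the type
  argument.\<close>

definition kmass :: "nat \<Rightarrow> 'n::finite itself \<Rightarrow> real" where
  "kmass N _ = (LBINT y. indicator (cbox 0 One) (y :: real^'n) * ker N y)"

text \<open>The integral factorises over the coordinates, and each factor integrates a function of
  period 1 over a full period. Hence the mass is the same for every \<open>x\<close>.\<close>

lemma ker_mass:
  fixes x :: "real^'n::finite"
  shows "(LBINT y. indicator (cbox 0 One) y * ker N (x - y)) = kmass N TYPE('n)"
    and "integrable lborel (\<lambda>y. indicator (cbox 0 One) y * ker N (x - y))"
proof -
  have cont: "continuous_on UNIV (\<lambda>y. ker N (x - y))" for x :: "real^'n"
    by (intro continuous_on_compose2[OF smooth_continuous[OF smooth_ker]] continuous_intros) auto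
  have i: "integrable lborel (\<lambda>y. indicator (cbox 0 One) y * ker N (x - y))" for x :: "real^'n"
    by (rule integrable_indicator_continuous[OF compact_cbox cont])
  show "integrable lborel (\<lambda>y. indicator (cbox 0 One) y * ker N (x - y))" by (rule i)
  define w where "w = (\<lambda>s. ennreal (((cos (pi * s))^2) ^ N))"
  have wm[measurable]: "w \<in> borel_measurable borel" unfolding w_def by measurable
  have wper: "w (s + 1) = w s" for s by (simp add: w_def distrib_left)
  have B: "Basis = range (\<lambda>i. axis i (1::real) :: real^'n)" by (auto simp: Basis_vec_def)
  have inj: "inj (\<lambda>i. axis i (1::real) :: real^'n)" by (auto simp: inj_on_def axis_eq_axis)
  have "ennreal (indicator (cbox 0 One) y * ker N (x - y)) = (\<Prod>b\<in>Basis. indicator {0..1} (y \<bullet> b) * w (y \<bullet> b + - (x \<bullet> b)))" for x y :: "real^'n"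
  proof -
    have "(\<Prod>b\<in>Basis. indicator {0..1} (y \<bullet> b) * w (y \<bullet> b + - (x \<bullet> b))) = (\<Prod>i\<in>UNIV. indicator {0..1} (y $ i) * w (y $ i + - (x $ i)))"
      unfolding B by (subst prod.reindex[OF inj]) (simp add: inner_axis)
    also have "\<dots> = (\<Prod>i\<in>UNIV. ennreal (indicator {0..1} (y $ i) * ((cos (pi * (x $ i - y $ i)))^2) ^ N))"
    proof (rule prod.cong[OF refl])
      fix i
      have "cos (pi * (y $ i + - (x $ i))) = cos (pi * (x $ i - y $ i))"
        using cos_minus[of "pi * (x $ i - y $ i)"] by (simp add: algebra_simps)
      then show "indicator {0..1} (y $ i) * w (y $ i + - (x $ i)) = ennreal (indicator {0..1} (y $ i) * ((cos (pi * (x $ i - y $ i)))^2) ^ N)"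
        by (auto simp: w_def indicator_def)
    qed
    also have "\<dots> = ennreal (\<Prod>i\<in>UNIV. indicator {0..1} (y $ i) * ((cos (pi * (x $ i - y $ i)))^2) ^ N)"
      by (rule prod_ennreal) auto
    also have "(\<Prod>i\<in>UNIV. indicator {0..1} (y $ i) * ((cos (pi * (x $ i - y $ i)))^2) ^ N) = indicator (cbox 0 One) y * ker N (x - y)"
    proof (cases "y \<in> cbox 0 One")
      case True
      then have "indicator {0..1} (y $ i) = (1::real)" for i by (auto simp: unit_cell_cube cube_def)
      then show ?thesis using True by (simp add: ker_def prod_power_distrib)
    next
      case False
      then obtain i where "y $ i \<notin> {0..1}" by (auto simp: unit_cell_cube cube_def)
      then have "(\<Prod>i\<in>UNIV. indicator {0..1} (y $ i) * ((cos (pi * (x $ i - y $ i)))^2) ^ N) = 0"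
        by (intro prod_zero bexI[of _ i]) auto
      then show ?thesis using False by simp
    qed
    finally show ?thesis by simp
  qed
  then have nn: "(\<integral>\<^sup>+y. ennreal (indicator (cbox 0 One) y * ker N (x - y)) \<partial>lborel) = (\<Prod>b\<in>(Basis :: (real^'n) set). \<integral>\<^sup>+s. indicator {0..1} s * w (s + - (x \<bullet> b)) \<partial>lborel)" for x :: "real^'n"
    by (simp only:) (rule nn_integral_lborel_prod, auto)
  have "ennreal (LBINT y. indicator (cbox 0 One) y * ker N (x - y)) = (\<integral>\<^sup>+y. ennreal (indicator (cbox 0 One) y * ker N (x - y)) \<partial>lborel)"
    using i[of x] by (subst nn_integral_eq_integral) (auto simp: ker_bounds)
  also have "\<dots> = (\<integral>\<^sup>+y. ennreal (indicator (cbox 0 One) y * ker N ((0 :: real^'n) - y)) \<partial>lborel)"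
    by (simp only: nn nn_integral_periodic_shift[OF wm wper])
  also have "\<dots> = ennreal (LBINT y. indicator (cbox 0 One) y * ker N ((0 :: real^'n) - y))"
    using i[of 0] by (subst nn_integral_eq_integral) (auto simp: ker_bounds)
  finally have "(LBINT y. indicator (cbox 0 One) y * ker N (x - y)) = (LBINT y. indicator (cbox 0 One) y * ker N ((0 :: real^'n) - y))"
    by (subst (asm) ennreal_inj) (auto intro!: integral_nonneg simp: ker_bounds)
  then show "(LBINT y. indicator (cbox 0 One) y * ker N (x - y)) = kmass N TYPE('n)"
    by (simp add: kmass_def ker_minus)
qed

lemma ker_power: "ker N z = (ker 1 z) ^ N"
  by (simp add: ker_def)

text \<open>The kernel is 1 only if all coordinate differences are integers. For \<open>x\<close> in
  the open cell the differences have modulus below 1, so this forces equality; on the boundary,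
  opposite faces would be identified.\<close>

lemma ker_less_one:
  fixes x y :: "real^'n::finite"
  assumes x: "x \<in> box 0 One" and y: "y \<in> cbox 0 One" and ne: "x \<noteq> y"
  shows "ker 1 (x - y) < 1"
proof -
  obtain i where i: "x $ i \<noteq> y $ i" using ne by (auto simp: vec_eq_iff)
  have "0 < x $ i" "x $ i < 1" "0 \<le> y $ i" "y $ i \<le> 1"
    using x y by (auto simp: mem_box_cart One_vec_nth simp del: sum_component)
  then have d: "\<bar>x $ i - y $ i\<bar> < 1" "x $ i - y $ i \<noteq> 0" using i by auto
  have "x $ i - y $ i \<notin> \<int>"
  proof
    assume "x $ i - y $ i \<in> \<int>"
    then obtain z where z: "x $ i - y $ i = of_int z" by (rule Ints_cases)
    then have "\<bar>real_of_int z\<bar> < 1" using d by simp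
    then have "z = 0" by linarith
    then show False using z d by simp
  qed
  then have "sin (pi * (x $ i - y $ i)) \<noteq> 0" using sin_times_pi_eq_0[of "x $ i - y $ i"] by (simp add: mult.commute)
  then have "(cos (pi * (x $ i - y $ i)))^2 < 1" by (simp add: cos_squared_eq)
  moreover have "ker 1 (x - y) = (cos (pi * (x $ i - y $ i)))^2 * (\<Prod>j\<in>UNIV - {i}. (cos (pi * (x $ j - y $ j)))^2)"
    by (simp add: ker_def prod.remove[of UNIV i])
  moreover have "(\<Prod>j\<in>UNIV - {i}. (cos (pi * (x $ j - y $ j)))^2) \<le> 1"
    by (rule prod_le_1) (simp add: abs_square_le_1)
  ultimately show ?thesis
    using mult_left_mono[of "\<Prod>j\<in>UNIV - {i}. (cos (pi * (x $ j - y $ j)))^2" 1 "(cos (pi * (x $ i - y $ i)))^2"] by simp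
qed

text \<open>Near \<open>x\<close> the base kernel exceeds \<open>q\<close>, so its N-th power
  exceeds \<open>q ^ N\<close> on a fixed ball. The mass therefore decays no faster than any
  prescribed geometric rate.\<close>

lemma kmass_lower:
  fixes x :: "real^'n::finite"
  assumes x: "x \<in> box 0 One" and q: "0 \<le> q" "q < 1"
  obtains V where "0 < V" "\<And>N. V * q ^ N \<le> kmass N TYPE('n)"
proof -
  have "continuous_on UNIV (\<lambda>y. ker 1 (x - y))"
    by (intro continuous_on_compose2[OF smooth_continuous[OF smooth_ker]] continuous_intros) auto
  then have "open {y. q < ker 1 (x - y)}" by (intro open_Collect_less continuous_intros)
  moreover have "x \<in> {y. q < ker 1 (x - y)}" using q by (simp add: ker_def)
  ultimately have "open ({y. q < ker 1 (x - y)} \<inter> box 0 One)" "x \<in> {y. q < ker 1 (x - y)} \<inter> box 0 One" using x by auto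
  then obtain \<eta> where eta: "0 < \<eta>" "ball x \<eta> \<subseteq> {y. q < ker 1 (x - y)} \<inter> box 0 One" unfolding open_contains_ball by blast
  have em: "emeasure lborel (ball x \<eta>) < \<infinity>" by (rule emeasure_lborel_ball_finite)
  show thesis
  proof (rule that[of "measure lborel (ball x \<eta>)"])
    have "emeasure lborel (ball x \<eta>) \<noteq> 0" using eta(1) open_not_negligible[of "ball x \<eta>"]
      by (auto simp: negligible_iff_null_sets null_sets_def)
    then show "0 < measure lborel (ball x \<eta>)"
      using em by (simp add: measure_def enn2real_positive_iff zero_less_iff_neq_zero)
    fix N
    have "measure lborel (ball x \<eta>) * q ^ N = (LBINT y. indicator (ball x \<eta>) y * q ^ N)"
      by simp
    also have "\<dots> \<le> (LBINT y. indicator (cbox 0 One) y * ker N (x - y))"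
    proof (rule integral_mono[OF _ ker_mass(2)])
      show "integrable lborel (\<lambda>y. indicator (ball x \<eta>) y * q ^ N)"
        using em by (intro integrable_mult_left integrable_real_indicator) auto
      fix y
      show "indicator (ball x \<eta>) y * q ^ N \<le> indicator (cbox 0 One) y * ker N (x - y)"
      proof (cases "y \<in> ball x \<eta>")
        case True
        then have "q < ker 1 (x - y)" "y \<in> box 0 One" using eta(2) by auto
        then have "q < ker 1 (x - y)" "y \<in> cbox 0 One" using box_subset_cbox[of 0 "One :: real^'n"] by auto
        then show ?thesis using True q by (simp add: ker_power[of N] power_mono)
      qed (simp add: ker_bounds)
    qed
    also have "\<dots> = kmass N TYPE('n)" by (rule ker_mass(1))
    finally show "measure lborel (ball x \<eta>) * q ^ N \<le> kmass N TYPE('n)" .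
  qed
qed

lemma half_in_box: "(\<chi> i. 1/2) \<in> box 0 (One :: real^'n::finite)"
  by (simp add: mem_box_cart One_vec_nth del: sum_component)

lemma kmass_pos: "0 < kmass N TYPE('n::finite)"
proof -
  obtain V where "0 < V" "\<And>N. V * (1/2) ^ N \<le> kmass N TYPE('n)"
    using kmass_lower[OF half_in_box, of "1/2"] by auto
  then show ?thesis by (metis less_le_trans mult_pos_pos zero_less_power half_gt_zero zero_less_one)
qed

definition Aop :: "nat \<Rightarrow> (real^'n::finite \<Rightarrow> real) \<Rightarrow> real^'n \<Rightarrow> real" where
  "Aop N v x = (1 / kmass N TYPE('n)) * (LBINT y. v y * ker N (x - y))"

lemma Aop_test:
  fixes v :: "real^'n::finite \<Rightarrow> real"
  assumes v: "integrable lborel v" "\<And>x. x \<notin> cbox 0 One \<Longrightarrow> v x = 0"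
  shows "test_S Torus (Aop N v)" and "integrable lborel (\<lambda>y. v y * ker N (x - y))"
    and "pd j (Aop N v) x = (1 / kmass N TYPE('n)) * (LBINT y. v y * pd j (\<lambda>x. ker N (x - y)) x)"
proof -
  note S = separated_integral[OF separated_ker v, of N]
  have t: "test_S Torus (\<lambda>x. LBINT y. v y * ker N (x - y))" using S by blast
  show "test_S Torus (Aop N v)" unfolding Aop_def[abs_def] by (rule test_S_cmult[OF t])
  show "integrable lborel (\<lambda>y. v y * ker N (x - y))" using S by blast
  have "pd j (Aop N v) x = (1 / kmass N TYPE('n)) * pd j (\<lambda>x. LBINT y. v y * ker N (x - y)) x"
    unfolding Aop_def[abs_def]
    by (rule dderiv_eq[where D="\<lambda>h. (1 / kmass N TYPE('n)) * dderiv h (\<lambda>x. LBINT y. v y * ker N (x - y)) x"])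
       (intro has_derivative_mult_right has_derivative_dderiv smooth_differentiable test_S_smooth[OF t])
  then show "pd j (Aop N v) x = (1 / kmass N TYPE('n)) * (LBINT y. v y * pd j (\<lambda>x. ker N (x - y)) x)"
    using S by simp
qed

text \<open>The hypothesis is the weak derivative identity tested with the kernel itself, so
  differentiating the mollification mollifies the derivative.\<close>

lemma Aop_weak_derivative:
  fixes v g :: "real^'n::finite \<Rightarrow> real"
  assumes v: "integrable lborel v" "\<And>x. x \<notin> cbox 0 One \<Longrightarrow> v x = 0"
    and weak: "(LBINT y. v y * pd j (\<lambda>y. ker N (x - y)) y) = - (LBINT y. g y * ker N (x - y))"
  shows "pd j (Aop N v) x = Aop N g x"
proof -
  have "(LBINT y. v y * pd j (\<lambda>x. ker N (x - y)) x) = - (LBINT y. v y * pd j (\<lambda>y. ker N (x - y)) y)"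
    by (simp add: pd_ker_swap)
  also have "\<dots> = (LBINT y. g y * ker N (x - y))"
    using weak by simp
  finally show ?thesis using Aop_test(3)[OF v, of j N x] by (simp add: Aop_def)
qed

lemma Aop_bound:
  fixes v :: "real^'n::finite \<Rightarrow> real"
  assumes v: "integrable lborel v" "\<And>x. x \<notin> cbox 0 One \<Longrightarrow> v x = 0" and B: "\<And>x. \<bar>v x\<bar> \<le> B"
  shows "\<bar>Aop N v x\<bar> \<le> B"
proof -
  have "\<bar>LBINT y. v y * ker N (x - y)\<bar> \<le> (LBINT y. \<bar>v y * ker N (x - y)\<bar>)" by (rule integral_abs_bound)
  also have "\<dots> \<le> (LBINT y. B * (indicator (cbox 0 One) y * ker N (x - y)))"
  proof (rule integral_mono)
    show "integrable lborel (\<lambda>y. \<bar>v y * ker N (x - y)\<bar>)" using Aop_test(2)[OF v] by simp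
    show "integrable lborel (\<lambda>y. B * (indicator (cbox 0 One) y * ker N (x - y)))" using ker_mass(2)[of N x] by simp
    fix y show "\<bar>v y * ker N (x - y)\<bar> \<le> B * (indicator (cbox 0 One) y * ker N (x - y))"
      using B[of y] v(2)[of y] ker_bounds(1)[of N "x - y"] by (auto simp: abs_mult indicator_def mult_right_mono)
  qed
  also have "\<dots> = B * kmass N TYPE('n)" using ker_mass[of N x] by simp
  finally show ?thesis using kmass_pos[where 'n='n, of N] by (simp add: Aop_def abs_mult field_simps)
qed

text \<open>Splitting the kernel into two square roots, Cauchy-Schwarz gives Jensen's inequality
  pointwise. Integration over \<open>x\<close> then uses that the kernel has the same mass in both
  variables.\<close>

lemma Aop_contraction:
  fixes v :: "real^'n::finite \<Rightarrow> real"
  assumes L: "Lp 2 lborel v" and i: "integrable lborel v" and v0: "\<And>x. x \<notin> cbox 0 One \<Longrightarrow> v x = 0"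
  shows "(LBINT x. indicator (cbox 0 One) x * (Aop N v x)^2) \<le> (LBINT x. (v x)^2)"
proof -
  define k where "k = kmass N TYPE('n)"
  have k: "0 < k" by (simp add: k_def kmass_pos)
  let ?X = "cbox 0 One :: (real^'n) set"
  have vm[measurable]: "v \<in> borel_measurable borel" using L by (simp add: Lp_def)
  have v2: "integrable lborel (\<lambda>y. (v y)^2)" using L by (simp add: Lp_def)
  have km[measurable]: "(\<lambda>y. ker N (x - y)) \<in> borel_measurable borel" for x :: "real^'n"
    by (rule smooth_borel[OF test_S_smooth[OF separated_tests(1)[OF separated_ker]]])
  have sk: "\<bar>sqrt (ker N z)\<bar> \<le> 1" for z :: "real^'n" using ker_bounds[of N z] by simp
  have pt: "(Aop N v x)^2 \<le> (1 / k) * (LBINT y. (v y)^2 * ker N (x - y))" for x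
  proof -
    have LA: "Lp 2 lborel (\<lambda>y. sqrt (ker N (x - y)) * v y)"
      by (rule Lp_bounded_mult[OF L, where B=1]) (use sk in auto)
    have LX: "Lp 2 lborel (\<lambda>y. indicator ?X y * sqrt (ker N (x - y)))"
    proof (rule Lp_indicator_continuous)
      show "continuous_on UNIV (\<lambda>y. sqrt (ker N (x - y)))"
        by (intro continuous_intros continuous_on_compose2[OF smooth_continuous[OF smooth_ker]]) auto
    qed auto
    have "\<bar>LBINT y. (sqrt (ker N (x - y)) * v y) * (indicator ?X y * sqrt (ker N (x - y)))\<bar> \<le>
       sqrt (LBINT y. \<bar>sqrt (ker N (x - y)) * v y\<bar>^2) * sqrt (LBINT y. \<bar>indicator ?X y * sqrt (ker N (x - y))\<bar>^2)"
      by (rule Cauchy_Schwarz_integral[OF LA LX])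
    also have "(\<lambda>y. (sqrt (ker N (x - y)) * v y) * (indicator ?X y * sqrt (ker N (x - y)))) = (\<lambda>y. v y * ker N (x - y))"
    proof
      fix y
      have "sqrt (ker N (x - y)) * sqrt (ker N (x - y)) = ker N (x - y)" by (simp add: ker_bounds(1))
      then show "(sqrt (ker N (x - y)) * v y) * (indicator ?X y * sqrt (ker N (x - y))) = v y * ker N (x - y)"
        using v0[of y] by (cases "y \<in> ?X") (simp_all add: mult_ac)
    qed
    also have "(\<lambda>y. \<bar>sqrt (ker N (x - y)) * v y\<bar>^2) = (\<lambda>y. (v y)^2 * ker N (x - y))"
      by (auto simp: power_mult_distrib ker_bounds(1) mult.commute)
    also have "(\<lambda>y. \<bar>indicator ?X y * sqrt (ker N (x - y))\<bar>^2) = (\<lambda>y. indicator ?X y * ker N (x - y))"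
      by (auto simp: power_mult_distrib indicator_def ker_bounds(1))
    also have "(LBINT y. indicator ?X y * ker N (x - y)) = k" unfolding k_def by (rule ker_mass(1))
    finally have "\<bar>LBINT y. v y * ker N (x - y)\<bar> \<le> sqrt (LBINT y. (v y)^2 * ker N (x - y)) * sqrt k" .
    then have "\<bar>LBINT y. v y * ker N (x - y)\<bar>^2 \<le> (sqrt (LBINT y. (v y)^2 * ker N (x - y)) * sqrt k)^2"
      by (rule power_mono) simp
    also have "\<dots> = (LBINT y. (v y)^2 * ker N (x - y)) * k"
      using k by (simp add: power_mult_distrib integral_nonneg ker_bounds(1))
    finally have "(LBINT y. v y * ker N (x - y))^2 \<le> (LBINT y. (v y)^2 * ker N (x - y)) * k" by simp
    then show ?thesis using k by (simp add: Aop_def k_def[symmetric] power_mult_distrib power_divide field_simps power2_eq_square)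
  qed
  have iX: "Lp 1 lborel (indicator ?X :: real^'n \<Rightarrow> real)" unfolding Lp1 using emeasure_lborel_cbox_finite by (intro integrable_real_indicator) auto
  have tens: "integrable lborel (\<lambda>z. (indicator ?X (fst z) * (v (snd z))^2) * ker N (fst z - snd z))"
  proof (rule integrable_bounded_mult[where B=1])
    show "integrable lborel (\<lambda>z. indicator ?X (fst z) * (v (snd z))^2)"
      using Lp_tensor(1)[OF iX, of "\<lambda>y. (v y)^2"] v2 by (simp add: Lp1)
    have "(\<lambda>z::(real^'n) \<times> (real^'n). ker N (fst z - snd z)) \<in> borel_measurable borel"
      by (rule borel_measurable_continuous_onI)
         (intro continuous_on_compose2[OF smooth_continuous[OF smooth_ker]] continuous_intros, auto)
    then show "(\<lambda>z::(real^'n) \<times> (real^'n). ker N (fst z - snd z)) \<in> borel_measurable lborel" by simp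
  qed (simp add: abs_of_nonneg[OF ker_bounds(1)] ker_bounds(2))
  have "(LBINT x. indicator ?X x * (Aop N v x)^2) \<le> (LBINT x. (1 / k) * (LBINT y. (indicator ?X x * (v y)^2) * ker N (x - y)))"
  proof (rule integral_mono)
    have c: "continuous_on UNIV (Aop N v)" by (rule smooth_continuous[OF test_S_smooth[OF Aop_test(1)[OF i v0]]])
    show "integrable lborel (\<lambda>x. indicator ?X x * (Aop N v x)^2)"
      by (rule integrable_indicator_continuous) (auto intro!: continuous_intros c)
    show "integrable lborel (\<lambda>x. (1 / k) * (LBINT y. (indicator ?X x * (v y)^2) * ker N (x - y)))"
      using lborel_integrable_fst[OF tens] by simp
    fix x
    show "indicator ?X x * (Aop N v x)^2 \<le> (1 / k) * (LBINT y. (indicator ?X x * (v y)^2) * ker N (x - y))"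
      using pt[of x] by (cases "x \<in> ?X") auto
  qed
  also have "\<dots> = (1 / k) * (LBINT z. (indicator ?X (fst z) * (v (snd z))^2) * ker N (fst z - snd z))"
    by (subst lborel_integral_fst[OF tens]) simp
  also have "\<dots> = (1 / k) * (LBINT y. LBINT x. (v y)^2 * (indicator ?X x * ker N (y - x)))"
  proof -
    have "ker N (x - y) = ker N (y - x)" for x y :: "real^'n" using ker_minus[of N "x - y"] by simp
    then show ?thesis by (subst lborel_integral_snd[OF tens]) (simp add: mult_ac)
  qed
  also have "\<dots> = (1 / k) * (LBINT y. (v y)^2 * k)" by (simp add: ker_mass(1) k_def)
  also have "\<dots> = (LBINT y. (v y)^2)" using k by simp
  finally show ?thesis .
qed

text \<open>Near \<open>x\<close> continuity controls the error. Away from \<open>x\<close> the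
  kernel is at most \<open>q ^ N\<close> with q < 1, while the normalising mass is at least a
  constant times \<open>q' ^ N\<close> with a larger rate.\<close>

lemma Aop_pointwise:
  fixes g :: "real^'n::finite \<Rightarrow> real"
  assumes g: "continuous_on UNIV g" "\<And>x. \<bar>g x\<bar> \<le> B" and x: "x \<in> box 0 One"
  shows "(\<lambda>N. Aop N (\<lambda>y. indicator (cbox 0 One) y * g y) x) \<longlonglongrightarrow> g x"
proof (rule tendstoI)
  fix e :: real assume e: "0 < e"
  let ?X = "cbox 0 One :: (real^'n) set"
  have B: "0 \<le> B" using g(2)[of 0] by simp
  obtain \<delta> where del: "0 < \<delta>" "\<And>y. dist y x < \<delta> \<Longrightarrow> dist (g y) (g x) < e / 2"
    using g(1) e unfolding continuous_on_iff by (metis UNIV_I half_gt_zero)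
  define S where "S = ?X - ball x \<delta>"
  have Sc: "compact S" unfolding S_def by (rule compact_diff) auto
  have kc: "continuous_on A (\<lambda>y. ker 1 (x - y))" for A
    by (intro continuous_on_compose2[OF smooth_continuous[OF smooth_ker]] continuous_intros) auto
  obtain q where q: "0 \<le> q" "q < 1" "\<And>y. y \<in> S \<Longrightarrow> ker 1 (x - y) \<le> q"
  proof (cases "S = {}")
    case False
    obtain y0 where "y0 \<in> S" "\<forall>y\<in>S. ker 1 (x - y) \<le> ker 1 (x - y0)"
      using continuous_attains_sup[OF Sc False kc] by blast
    moreover have "ker 1 (x - y0) < 1" using \<open>y0 \<in> S\<close> x del(1) by (intro ker_less_one) (auto simp: S_def)
    ultimately show thesis using ker_bounds(1)[of 1 "x - y0"] by (intro that[of "ker 1 (x - y0)"]) auto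
  qed (use that[of 0] in auto)
  \<comment> \<open>Any number strictly between \<open>q\<close> and 1 works: the far contribution
    is then a multiple of \<open>(q / q') ^ N\<close>.\<close>
  define q' where "q' = (1 + q) / 2"
  have q': "0 < q'" "q < q'" "q' < 1" using q by (auto simp: q'_def)
  obtain V where V: "0 < V" "\<And>N. V * q' ^ N \<le> kmass N TYPE('n)" using kmass_lower[OF x, of q'] q' by auto
  define VX where "VX = measure lborel ?X"
  have fX: "emeasure lborel ?X < \<infinity>" by (rule emeasure_lborel_cbox_finite)
  have ig: "integrable lborel (\<lambda>y. indicator ?X y * g y)" by (rule integrable_indicator_continuous[OF compact_cbox g(1)])
  have main: "\<bar>Aop N (\<lambda>y. indicator ?X y * g y) x - g x\<bar> \<le> e / 2 + (2 * B * VX / V) * (q / q') ^ N" for N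
  proof -
    define k where "k = kmass N TYPE('n)"
    have k: "0 < k" by (simp add: k_def kmass_pos)
    have i1: "integrable lborel (\<lambda>y. indicator ?X y * g y * ker N (x - y))" by (rule Aop_test(2)[OF ig]) simp
    have i2: "integrable lborel (\<lambda>y. indicator ?X y * ker N (x - y))" by (rule ker_mass(2))
    have i3: "integrable lborel (\<lambda>y. indicator ?X y * (2 * B * q ^ N))" using fX by simp
    have "k * (Aop N (\<lambda>y. indicator ?X y * g y) x - g x) = (LBINT y. indicator ?X y * g y * ker N (x - y)) - g x * (LBINT y. indicator ?X y * ker N (x - y))"
      using k ker_mass(1)[of N x] by (simp add: Aop_def k_def[symmetric] algebra_simps)
    also have "\<dots> = (LBINT y. indicator ?X y * (g y - g x) * ker N (x - y))"
    proof -
      have "(\<lambda>y. indicator ?X y * (g y - g x) * ker N (x - y)) = (\<lambda>y. indicator ?X y * g y * ker N (x - y) - g x * (indicator ?X y * ker N (x - y)))"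
        by (simp add: algebra_simps)
      then show ?thesis using i1 i2 by simp
    qed
    finally have eqk: "k * (Aop N (\<lambda>y. indicator ?X y * g y) x - g x) = (LBINT y. indicator ?X y * (g y - g x) * ker N (x - y))" .
    have "\<bar>k * (Aop N (\<lambda>y. indicator ?X y * g y) x - g x)\<bar> \<le> (LBINT y. \<bar>indicator ?X y * (g y - g x) * ker N (x - y)\<bar>)"
      unfolding eqk by (rule integral_abs_bound)
    also have "\<dots> \<le> (LBINT y. (e / 2) * (indicator ?X y * ker N (x - y)) + indicator ?X y * (2 * B * q ^ N))"
    proof (rule integral_mono)
      have "integrable lborel (\<lambda>y. indicator ?X y * g y * ker N (x - y) - g x * (indicator ?X y * ker N (x - y)))" using i1 i2 by simp
      then show "integrable lborel (\<lambda>y. \<bar>indicator ?X y * (g y - g x) * ker N (x - y)\<bar>)"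
        by (intro integrable_abs) (simp add: algebra_simps)
      fix y
      show "\<bar>indicator ?X y * (g y - g x) * ker N (x - y)\<bar> \<le> (e / 2) * (indicator ?X y * ker N (x - y)) + indicator ?X y * (2 * B * q ^ N)"
      proof (cases "y \<in> ?X")
        case True
        have k0: "0 \<le> ker N (x - y)" by (rule ker_bounds)
        have qn: "0 \<le> 2 * B * q ^ N" using B q by simp
        show ?thesis
        proof (cases "y \<in> S")
          case y: True
          have "ker N (x - y) \<le> q ^ N" unfolding ker_power[of N] using q(3)[OF y] ker_bounds(1) by (intro power_mono) auto
          moreover have "\<bar>g y - g x\<bar> \<le> 2 * B" using g(2)[of x] g(2)[of y] by linarith
          ultimately have "\<bar>g y - g x\<bar> * ker N (x - y) \<le> 2 * B * q ^ N" using k0 by (intro mult_mono) auto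
          then show ?thesis using True e k0 by (simp add: abs_mult add_increasing)
        next
          case False
          then have "dist y x < \<delta>" using True by (simp add: S_def dist_commute)
          then have "\<bar>g y - g x\<bar> \<le> e / 2" using del(2)[of y] by (simp add: dist_real_def)
          then have "\<bar>g y - g x\<bar> * ker N (x - y) \<le> e / 2 * ker N (x - y)" using k0 by (rule mult_right_mono)
          then show ?thesis using True k0 qn by (simp add: abs_mult)
        qed
      qed simp
    qed (use i2 i3 in auto)
    also have "\<dots> = (e / 2) * k + VX * (2 * B * q ^ N)"
      using i2 i3 ker_mass(1)[of N x] by (simp add: k_def VX_def)
    finally have "k * \<bar>Aop N (\<lambda>y. indicator ?X y * g y) x - g x\<bar> \<le> (e / 2) * k + VX * (2 * B * q ^ N)"
      using k by (simp add: abs_mult)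
    then have "\<bar>Aop N (\<lambda>y. indicator ?X y * g y) x - g x\<bar> \<le> e / 2 + VX * (2 * B * q ^ N) / k"
      using k by (simp add: field_simps)
    also have "VX * (2 * B * q ^ N) / k \<le> VX * (2 * B * q ^ N) / (V * q' ^ N)"
      using V q' B q k unfolding k_def VX_def by (intro divide_left_mono mult_pos_pos mult_nonneg_nonneg V(2)) auto
    also have "\<dots> = (2 * B * VX / V) * (q / q') ^ N" by (simp add: power_divide)
    finally show ?thesis by simp
  qed
  have "(\<lambda>N. (2 * B * VX / V) * (q / q') ^ N) \<longlonglongrightarrow> (2 * B * VX / V) * 0"
    using q q' by (intro tendsto_mult tendsto_const LIMSEQ_realpow_zero) auto
  then have "\<forall>\<^sub>F N in sequentially. (2 * B * VX / V) * (q / q') ^ N < e / 2" using e by (intro order_tendstoD) auto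
  then show "\<forall>\<^sub>F N in sequentially. dist (Aop N (\<lambda>y. indicator ?X y * g y) x) (g x) < e"
  proof eventually_elim
    case (elim N)
    then show ?case using main[of N] by (simp add: dist_real_def)
  qed
qed

lemma Lp_unit_cell_integrable:
  fixes v :: "real^'n::finite \<Rightarrow> real"
  assumes "Lp 2 lborel v" "\<And>x. x \<notin> cbox 0 One \<Longrightarrow> v x = 0"
  shows "integrable lborel v"
  by (rule Lp2_integrable[OF assms(1) _ emeasure_lborel_cbox_finite assms(2)]) auto

lemma Aop_linear:
  fixes v w :: "real^'n::finite \<Rightarrow> real"
  assumes "integrable lborel v" "\<And>x. x \<notin> cbox 0 One \<Longrightarrow> v x = 0" "integrable lborel w" "\<And>x. x \<notin> cbox 0 One \<Longrightarrow> w x = 0"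
  shows "Aop N (\<lambda>y. v y - w y) x = Aop N v x - Aop N w x"
  using Aop_test(2)[OF assms(1,2), of N x] Aop_test(2)[OF assms(3,4), of N x]
  by (simp add: Aop_def left_diff_distrib right_diff_distrib)

text \<open>Pointwise convergence with a uniform bound settles continuous functions; contraction in
  L^2 extends this to all of L^2 by density.\<close>

lemma Aop_converges:
  fixes v :: "real^'n::finite \<Rightarrow> real"
  assumes L: "Lp 2 lborel v" and v0: "\<And>x. x \<notin> cbox 0 One \<Longrightarrow> v x = 0"
  shows "Lpconv 2 lborel sequentially (\<lambda>N x. indicator (cbox 0 One) x * Aop N v x) v"
proof -
  let ?X = "cbox 0 One :: (real^'n) set"
  have AL: "Lp 2 lborel (\<lambda>x. indicator ?X x * Aop N u x)" if "integrable lborel u" "\<And>x. x \<notin> ?X \<Longrightarrow> u x = 0" for N u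
    by (rule Lp_indicator_continuous) (use smooth_continuous[OF test_S_smooth[OF Aop_test(1)[OF that]]] in auto)
  have iv: "integrable lborel v" by (rule Lp_unit_cell_integrable[OF L v0])
  show ?thesis
  proof (rule Lpconv_approx[OF _ AL[OF iv v0] L])
    fix d :: real assume d: "0 < d"
    obtain g R where g: "continuous_on UNIV g" "\<And>x. R < norm x \<Longrightarrow> g x = 0" "Lp 2 lborel g"
      and gd: "(LBINT x. \<bar>v x - g x\<bar> ^ 2) < d"
      using Lp_continuous_dense[OF L _ d] by auto
    define u where "u = (\<lambda>x. indicator ?X x * g x)"
    have uL: "Lp 2 lborel u" unfolding u_def by (rule Lp_indicator_continuous) (use g in auto)
    have u0: "x \<notin> ?X \<Longrightarrow> u x = 0" for x by (simp add: u_def)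
    have iu: "integrable lborel u" by (rule Lp_unit_cell_integrable[OF uL u0])
    have um[measurable]: "u \<in> borel_measurable borel" using uL by (simp add: Lp_def)
    have vud: "(LBINT x. (v x - u x)^2) < d"
    proof -
      have "(LBINT x. (v x - u x)^2) \<le> (LBINT x. \<bar>v x - g x\<bar> ^ 2)"
        by (rule integral_mono)
           (use Lp_integrable[OF Lp_diff[OF _ L uL]] Lp_integrable[OF Lp_diff[OF _ L g(3)]] v0 in \<open>auto simp: u_def indicator_def\<close>)
      then show ?thesis using gd by linarith
    qed
    obtain B where B: "0 \<le> B" "\<And>x. \<bar>g x\<bar> \<le> B"
    proof -
      have "bounded (g ` cball 0 \<bar>R\<bar>)" by (intro compact_imp_bounded compact_continuous_image continuous_on_subset[OF g(1)]) auto
      then obtain B where B: "\<forall>x\<in>cball 0 \<bar>R\<bar>. \<bar>g x\<bar> \<le> B" by (auto simp: bounded_iff)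
      have "\<bar>g x\<bar> \<le> max B 0" for x
      proof (cases "norm x \<le> \<bar>R\<bar>")
        case True
        then have "\<bar>g x\<bar> \<le> B" using B by auto
        then show ?thesis by simp
      next
        case False
        then have "g x = 0" by (intro g(2)) simp
        then show ?thesis by simp
      qed
      then show thesis by (intro that[of "max B 0"]) auto
    qed
    have uB: "\<bar>u x\<bar> \<le> B" for x using B by (simp add: u_def indicator_def)
    have mid: "(\<lambda>N. LBINT x. (indicator ?X x * Aop N u x - u x)^2) \<longlonglongrightarrow> (LINT x|(lborel :: (real^'n) measure). 0)"
    proof (rule integral_dominated_convergence[where w="\<lambda>x. (2 * B)^2 * indicator ?X x"])
      show "integrable lborel (\<lambda>x. (2 * B)^2 * indicator ?X x)" using emeasure_lborel_cbox_finite[of 0 "One::real^'n"] by simp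
      \<comment> \<open>Pointwise convergence is available at interior points only; the faces of the
        cell form a null set.\<close>
      have "AE x in lborel. x \<notin> ?X - box 0 One"
        using negligible_frontier_interval[of 0 "One::real^'n"] by (intro AE_not_in) (auto simp: negligible_iff_null_sets null_sets_def)
      then show "AE x in lborel. (\<lambda>N. (indicator ?X x * Aop N u x - u x)^2) \<longlonglongrightarrow> 0"
      proof eventually_elim
        case (elim x)
        show ?case
        proof (cases "x \<in> ?X")
          case True
          then have "x \<in> box 0 One" using elim by auto
          from Aop_pointwise[OF g(1) B(2) this] have "(\<lambda>N. (Aop N u x - g x)^2) \<longlonglongrightarrow> (g x - g x)^2"
            unfolding u_def[symmetric] by (intro tendsto_intros)
          then show ?thesis using True by (simp add: u_def)
        qed (simp add: u0)
      qed
      fix N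
      show "(\<lambda>x. (indicator ?X x * Aop N u x - u x)^2) \<in> borel_measurable lborel"
        using AL[OF iu u0, of N] by (auto simp: Lp_def)
      show "AE x in lborel. norm ((indicator ?X x * Aop N u x - u x)^2) \<le> (2 * B)^2 * indicator ?X x"
      proof (rule AE_I2)
        fix x show "norm ((indicator ?X x * Aop N u x - u x)^2) \<le> (2 * B)^2 * indicator ?X x"
        proof (cases "x \<in> ?X")
          case True
          have "\<bar>Aop N u x - u x\<bar> \<le> 2 * B" using Aop_bound[OF iu u0 uB, of N x] uB[of x] by linarith
          then show ?thesis using True power_mono[of "\<bar>Aop N u x - u x\<bar>" "2 * B" 2] by simp
        qed (simp add: u0)
      qed
    qed simp
    then have "Lpconv 2 lborel sequentially (\<lambda>N x. indicator ?X x * Aop N u x) u" using AL[OF iu u0] uL by (simp add: Lpconv_def)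
    moreover have "(LBINT x. \<bar>indicator ?X x * Aop N v x - indicator ?X x * Aop N u x\<bar>^2) < d" for N
    proof -
      define D where "D = (\<lambda>x. v x - u x)"
      have DL: "Lp 2 lborel D" "integrable lborel D" "x \<notin> ?X \<Longrightarrow> D x = 0" for x
        using Lp_diff[OF _ L uL] iv iu v0 u0 by (auto simp: D_def)
      have "(LBINT x. \<bar>indicator ?X x * Aop N v x - indicator ?X x * Aop N u x\<bar>^2) = (LBINT x. indicator ?X x * (Aop N D x)^2)"
        using Aop_linear[OF iv v0 iu u0, of N] by (intro integral_cong) (auto simp: indicator_def D_def)
      also have "\<dots> \<le> (LBINT x. (D x)^2)" by (rule Aop_contraction[OF DL])
      finally show ?thesis using vud by (simp add: D_def)
    qed
    ultimately show "\<exists>f' g'. Lpconv 2 lborel sequentially f' g' \<and> (LBINT x. \<bar>g' x - v x\<bar>^2) < d \<and>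
        (\<forall>N. (LBINT x. \<bar>indicator ?X x * Aop N v x - f' N x\<bar>^2) < d)"
      using vud by (intro exI[of _ "\<lambda>N x. indicator ?X x * Aop N u x"] exI[of _ u]) (simp add: power2_commute)
  qed simp
qed

text \<open>Mollification preserves the bound of \<open>f\<close>, and convergence in L^2 yields
  a.e. convergence of a subsequence.\<close>

lemma torus_bounded_approx:
  fixes f :: "real^'n::finite \<Rightarrow> real"
  assumes fm: "f \<in> borel_measurable borel" and B: "\<And>x. \<bar>f x\<bar> \<le> B" and f0: "\<And>x. x \<notin> cbox 0 One \<Longrightarrow> f x = 0"
  shows "bounded_test_approx Torus f"
proof -
  let ?X = "cbox 0 One :: (real^'n) set"
  have L: "Lp 2 lborel f"
  proof (rule Lp_bound[OF _ _ AE_I2])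
    show "Lp 2 lborel (\<lambda>x. indicator ?X x * B)" by (rule Lp_indicator_continuous) auto
    show "\<bar>f x\<bar> \<le> \<bar>indicator ?X x * B\<bar>" for x using B[of x] f0[of x] by (cases "x \<in> ?X") auto
  qed (use fm in simp)
  have i: "integrable lborel f" by (rule Lp_unit_cell_integrable[OF L f0])
  note cv = Aop_converges[OF L f0]
  have "(\<lambda>N. LBINT x. norm (\<bar>indicator ?X x * Aop N f x - f x\<bar>^2)) \<longlonglongrightarrow> 0" using LpconvD(3)[OF cv] by simp
  then obtain \<sigma> where \<sigma>: "strict_mono \<sigma>" "AE x in lborel. (\<lambda>n. \<bar>indicator ?X x * Aop (\<sigma> n) f x - f x\<bar>^2) \<longlonglongrightarrow> 0"
    using tendsto_L1_AE_subseq[of lborel "\<lambda>N x. \<bar>indicator ?X x * Aop N f x - f x\<bar>^2"] Lp_integrable[OF Lp_diff[OF _ LpconvD(1,2)[OF cv]]] by auto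
  have "test_approx_seq Torus f (\<lambda>n. Aop (\<sigma> n) f) B ?X"
    unfolding test_approx_seq_def
  proof (intro conjI allI impI Aop_test(1)[OF i f0])
    show "\<bar>Aop (\<sigma> n) f x\<bar> \<le> B * indicator ?X x" if "x \<in> region Torus" for n x
      using Aop_bound[OF i f0 B, of "\<sigma> n" x] that by simp
    show "AE x\<in>region Torus in lborel. (\<lambda>n. Aop (\<sigma> n) f x) \<longlonglongrightarrow> f x"
      using \<sigma>(2)
    proof eventually_elim
      case (elim x)
      show ?case
      proof
        assume "x \<in> region Torus"
        then have x: "x \<in> ?X" by simp
        have "(\<lambda>n. sqrt (\<bar>indicator ?X x * Aop (\<sigma> n) f x - f x\<bar>^2)) \<longlonglongrightarrow> sqrt 0" by (intro tendsto_intros elim)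
        then have "(\<lambda>n. Aop (\<sigma> n) f x - f x) \<longlonglongrightarrow> 0" using x by (simp add: tendsto_rabs_zero_iff)
        then show "(\<lambda>n. Aop (\<sigma> n) f x) \<longlonglongrightarrow> f x" by (rule LIM_zero_cancel)
      qed
    qed
  qed auto
  then show ?thesis unfolding bounded_test_approx_def by blast
qed

section \<open>Bounded approximation on domains\<close>

lemma box_bump:
  fixes a b :: "real^'n::finite"
  assumes sub: "cbox a b \<subseteq> \<Omega>" and ab: "\<And>i. i \<in> Basis \<Longrightarrow> a \<bullet> i < b \<bullet> i"
  obtains \<eta> where "test_S (Domain \<Omega>) \<eta>" "\<And>x. 0 \<le> \<eta> x" "\<And>x. x \<in> box a b \<Longrightarrow> 0 < \<eta> x"
proof -
  define \<eta> where "\<eta> = (\<lambda>x. \<Prod>i\<in>Basis. bump ((x \<bullet> i) / (b \<bullet> i - a \<bullet> i) + - (a \<bullet> i) / (b \<bullet> i - a \<bullet> i)))"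
  have arg: "(x \<bullet> i) / (b \<bullet> i - a \<bullet> i) + - (a \<bullet> i) / (b \<bullet> i - a \<bullet> i) = (x \<bullet> i - a \<bullet> i) / (b \<bullet> i - a \<bullet> i)" for x i :: "real^'n"
    by (simp add: diff_divide_distrib)
  have eta: "\<eta> = (\<lambda>x. \<Prod>i\<in>Basis. bump ((x \<bullet> i - a \<bullet> i) / (b \<bullet> i - a \<bullet> i)))" unfolding \<eta>_def arg ..
  have s: "smooth_fun \<eta>" unfolding \<eta>_def
  proof (rule smooth_prod)
    fix i :: "real^'n" assume "i \<in> Basis"
    have "bounded_linear (\<lambda>x::real^'n. (x \<bullet> i) / (b \<bullet> i - a \<bullet> i))"
      by (rule bounded_linear_compose[OF bounded_linear_divide bounded_linear_inner_left])
    then show "smooth_fun (\<lambda>x. bump ((x \<bullet> i) / (b \<bullet> i - a \<bullet> i) + - (a \<bullet> i) / (b \<bullet> i - a \<bullet> i)))"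
      by (rule smooth_affine[OF _ smooth_bump])
  qed
  have "{x. \<eta> x \<noteq> 0} \<subseteq> cbox a b"
  proof
    fix x assume "x \<in> {x. \<eta> x \<noteq> 0}"
    then have "bump ((x \<bullet> i - a \<bullet> i) / (b \<bullet> i - a \<bullet> i)) \<noteq> 0" if "i \<in> Basis" for i
      using that by (auto simp: eta)
    then have "0 < (x \<bullet> i - a \<bullet> i) / (b \<bullet> i - a \<bullet> i) \<and> (x \<bullet> i - a \<bullet> i) / (b \<bullet> i - a \<bullet> i) < 1" if "i \<in> Basis" for i
      using that bump_eq_0 not_le by blast
    then show "x \<in> cbox a b" using ab by (fastforce simp: mem_box field_simps)
  qed
  then have supp: "supp_closure \<eta> \<subseteq> cbox a b" unfolding supp_closure_def by (rule closure_minimal) (rule closed_cbox)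
  have "compact (supp_closure \<eta>)"
    using compact_Int_closed[OF compact_cbox, of "supp_closure \<eta>" a b] supp by (simp add: Int_absorb1 supp_closure_def)
  then have "test_S (Domain \<Omega>) \<eta>" using s supp sub by auto
  moreover have "0 < \<eta> x" if "x \<in> box a b" for x
    unfolding \<eta>_def arg using that ab by (intro prod_pos bump_pos) (auto simp: mem_box)
  ultimately show thesis
    using that[of \<eta>] by (auto simp: \<eta>_def intro!: prod_nonneg bump_nonneg)
qed

text \<open>A finite sum of bumps subordinate to a cover. It is only made positive on
  \<open>K\<close>, not equal to 1; the approximation below compensates by dividing by it.\<close>

lemma cutoff_exists:
  fixes K :: "(real^'n::finite) set"
  assumes "open \<Omega>" "compact K" "K \<subseteq> \<Omega>"
  obtains \<eta> where "test_S (Domain \<Omega>) \<eta>" "\<And>x. x \<in> K \<Longrightarrow> 0 < \<eta> x"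
proof -
  have "\<exists>\<eta>. test_S (Domain \<Omega>) \<eta> \<and> (\<forall>x. 0 \<le> \<eta> x) \<and> 0 < \<eta> p" if p: "p \<in> K" for p
  proof -
    obtain a b where ab: "cbox a b \<subseteq> \<Omega>" "p \<in> box a b" "\<forall>i\<in>Basis. a \<bullet> i < b \<bullet> i"
      using open_contains_cbox[OF assms(1)] p assms(3) by (metis subsetD)
    then obtain \<eta> where "test_S (Domain \<Omega>) \<eta>" "\<And>x. 0 \<le> \<eta> x" "\<And>x. x \<in> box a b \<Longrightarrow> 0 < \<eta> x"
      using box_bump[OF ab(1)] by metis
    then show ?thesis using ab(2) by blast
  qed
  then obtain E where E: "\<And>p. p \<in> K \<Longrightarrow> test_S (Domain \<Omega>) (E p)" "\<And>p x. p \<in> K \<Longrightarrow> 0 \<le> E p x" "\<And>p. p \<in> K \<Longrightarrow> 0 < E p p"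
    by metis
  have op: "open {x. 0 < E p x}" if "p \<in> K" for p
    by (intro open_Collect_less continuous_intros smooth_continuous test_S_smooth[OF E(1)[OF that]])
  have cov: "K \<subseteq> (\<Union>p\<in>K. {x. 0 < E p x})" using E(3) by auto
  obtain F where F: "F \<subseteq> K" "finite F" "K \<subseteq> (\<Union>p\<in>F. {x. 0 < E p x})"
    using compactE_image[OF assms(2) op cov] by metis
  show thesis
  proof (rule that[of "\<lambda>x. \<Sum>p\<in>F. E p x"])
    show "test_S (Domain \<Omega>) (\<lambda>x. \<Sum>p\<in>F. E p x)" by (rule test_S_sum) (use E(1) F(1) in blast)
    fix x assume "x \<in> K"
    then obtain p where "p \<in> F" "0 < E p x" using F(3) by blast
    then show "0 < (\<Sum>p\<in>F. E p x)" using F E(2) by (intro sum_pos2[of F p]) auto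
  qed
qed

text \<open>Approximate f / \<eta> by continuous functions and these, uniformly on the support of
  the cutoff \<open>\<eta>\<close>, by polynomials. Multiplying back by \<open>\<eta>\<close> gives
  smooth functions with compact support in the domain.\<close>

lemma domain_bounded_approx:
  fixes f :: "real^'n::finite \<Rightarrow> real"
  assumes \<Omega>: "open \<Omega>" "bounded \<Omega>" and K: "compact K" "K \<subseteq> \<Omega>"
    and fm: "f \<in> borel_measurable borel" and B: "\<And>x. \<bar>f x\<bar> \<le> B" and f0: "\<And>x. x \<notin> K \<Longrightarrow> f x = 0"
  shows "bounded_test_approx (Domain \<Omega>) f"
proof -
  obtain \<eta> where eta: "test_S (Domain \<Omega>) \<eta>" "\<And>x. x \<in> K \<Longrightarrow> 0 < \<eta> x" using cutoff_exists[OF \<Omega>(1) K] by metis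
  define S where "S = supp_closure \<eta>"
  have S: "compact S" "S \<subseteq> \<Omega>" using eta(1) by (auto simp: S_def)
  have s\<eta>: "smooth_fun \<eta>" by (rule test_S_smooth[OF eta(1)])
  have em: "\<eta> \<in> borel_measurable borel" by (rule smooth_borel[OF s\<eta>])
  obtain E where E: "0 \<le> E" "\<And>x. x \<in> \<Omega> \<Longrightarrow> \<bar>\<eta> x\<bar> \<le> E" using smooth_bounded_on[OF s\<eta> \<Omega>(2)] by metis
  have E': "\<bar>\<eta> x\<bar> \<le> E" for x
    using E(2)[of x] S(2) not_supp_closure[of x \<eta>] E(1) by (cases "x \<in> S") (auto simp: S_def)
  obtain d where d: "0 < d" "\<And>x. x \<in> K \<Longrightarrow> d \<le> \<eta> x"
  proof (cases "K = {}")
    case False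
    obtain x0 where "x0 \<in> K" "\<forall>x\<in>K. \<eta> x0 \<le> \<eta> x"
      using continuous_attains_inf[OF K(1) False smooth_continuous[OF s\<eta>]] by blast
    then show thesis using eta(2) by (intro that[of "\<eta> x0"]) auto
  qed (use that[of 1] in auto)
  have B0: "0 \<le> B" using B[of 0] by simp
  \<comment> \<open>Outside \<open>K\<close> the numerator vanishes, so division by zero there gives
    0; on \<open>K\<close> the cutoff is bounded below by \<open>d\<close>, so \<open>h\<close> is
    bounded.\<close>
  define h where "h = (\<lambda>x. f x / \<eta> x)"
  have hm: "h \<in> borel_measurable borel" unfolding h_def using fm em by measurable
  have hB: "\<bar>h x\<bar> \<le> B / d" for x
  proof (cases "x \<in> K")
    case True
    then have "\<bar>f x\<bar> / \<bar>\<eta> x\<bar> \<le> B / d" using B[of x] d(2)[OF True] d(1) B0 by (intro frac_le) auto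
    then show ?thesis by (simp add: h_def)
  qed (use f0 B0 d in \<open>auto simp: h_def\<close>)
  obtain R where R: "\<And>x. x \<in> K \<Longrightarrow> norm x \<le> R" using compact_imp_bounded[OF K(1)] unfolding bounded_iff by blast
  have h0: "R < norm x \<Longrightarrow> h x = 0" for x using R[of x] f0[of x] by (cases "x \<in> K") (auto simp: h_def)
  obtain g :: "nat \<Rightarrow> real^'n \<Rightarrow> real" where g: "\<And>k. continuous_on UNIV (g k)" "\<And>k x. \<bar>g k x\<bar> \<le> B / d" "\<And>k x. R + 1 < norm x \<Longrightarrow> g k x = 0"
      "AE x in lborel. (\<lambda>k. g k x) \<longlonglongrightarrow> h x"
  proof (rule bounded_supp_continuous_approx[OF hm hB h0])
    fix g assume a: "\<And>k. continuous_on UNIV (g k)" "\<And>k x. \<bar>g k x\<bar> \<le> B / d" "\<And>k x. R + 1 < norm x \<Longrightarrow> g k x = 0"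
      "AE x in lborel. (\<lambda>k. g k x) \<longlonglongrightarrow> h x"
    show thesis by (rule that[OF a])
  qed
  have "\<exists>p. real_polynomial_function p \<and> (\<forall>x\<in>S. \<bar>g k x - p x\<bar> < 1 / real (Suc k))" for k
  proof -
    have c: "continuous_on S (g k)" by (rule continuous_on_subset[OF g(1)]) simp
    have e: "0 < 1 / real (Suc k)" by simp
    show ?thesis
    proof (rule Stone_Weierstrass_real_polynomial_function[OF S(1) c e])
      fix p assume "real_polynomial_function p" "\<And>x. x \<in> S \<Longrightarrow> \<bar>g k x - p x\<bar> < 1 / real (Suc k)"
      then show ?thesis by (intro exI[of _ p] conjI ballI)
    qed
  qed
  then have "\<forall>k. \<exists>p. real_polynomial_function p \<and> (\<forall>x\<in>S. \<bar>g k x - p x\<bar> < 1 / real (Suc k))" ..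
  from choice[OF this] obtain p where "\<forall>k. real_polynomial_function (p k) \<and> (\<forall>x\<in>S. \<bar>g k x - p k x\<bar> < 1 / real (Suc k))" ..
  then have p: "\<And>k. real_polynomial_function (p k)" "\<And>k x. x \<in> S \<Longrightarrow> \<bar>g k x - p k x\<bar> < 1 / real (Suc k)" by blast+
  define \<phi> where "\<phi> = (\<lambda>k x. \<eta> x * p k x)"
  have out: "x \<notin> S \<Longrightarrow> \<eta> x = 0" for x using not_supp_closure[of x \<eta>] by (simp add: S_def)
  have "test_approx_seq (Domain \<Omega>) f \<phi> (E * (B / d + 1)) S"
    unfolding test_approx_seq_def
  proof (intro conjI allI impI)
    show "test_S (Domain \<Omega>) (\<phi> n)" for n
      unfolding \<phi>_def by (rule test_S_smooth_mult[OF eta(1) smooth_real_polynomial[OF p(1)]])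
    show "S \<in> sets borel" using S(1) by (simp add: borel_compact)
    show "S \<subseteq> region (Domain \<Omega>)" using S(2) by simp
    show "set_integrable lebesgue S h" if "loc_int_S (Domain \<Omega>) h" for h :: "real^'n \<Rightarrow> real" using that S by simp
    show "\<bar>\<phi> n x\<bar> \<le> E * (B / d + 1) * indicator S x" for n x
    proof (cases "x \<in> S")
      case True
      have "1 / real (Suc n) \<le> 1" by simp
      then have "\<bar>p n x\<bar> \<le> B / d + 1" using p(2)[OF True, of n] g(2)[of n x] by linarith
      then show ?thesis using True E' E(1) unfolding \<phi>_def abs_mult by (simp add: mult_mono)
    qed (simp add: \<phi>_def out)
    show "AE x in lborel. x \<in> region (Domain \<Omega>) \<longrightarrow> (\<lambda>n. \<phi> n x) \<longlonglongrightarrow> f x"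
      using g(4)
    proof eventually_elim
      case (elim x)
      have fx: "\<eta> x * h x = f x" using eta(2)[of x] f0[of x] by (cases "x \<in> K") (auto simp: h_def)
      show ?case
      proof (cases "x \<in> S")
        case True
        have "(\<lambda>k. g k x - p k x) \<longlonglongrightarrow> 0"
        proof (rule Lim_null_comparison)
          show "\<forall>\<^sub>F k in sequentially. norm (g k x - p k x) \<le> 1 / real (Suc k)"
            by (intro always_eventually allI) (use p(2)[OF True] in \<open>auto intro: less_imp_le simp del: of_nat_Suc\<close>)
          show "(\<lambda>k. 1 / real (Suc k)) \<longlonglongrightarrow> 0" using LIMSEQ_inverse_real_of_nat by (simp add: inverse_eq_divide)
        qed
        from tendsto_diff[OF elim this] have "(\<lambda>k. p k x) \<longlonglongrightarrow> h x" by simp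
        then have "(\<lambda>k. \<eta> x * p k x) \<longlonglongrightarrow> \<eta> x * h x" by (intro tendsto_intros)
        then show ?thesis by (simp add: \<phi>_def fx)
      next
        case False
        then show ?thesis using out[OF False] fx by (simp add: \<phi>_def)
      qed
    qed
  qed
  then show ?thesis unfolding bounded_test_approx_def by blast
qed

text \<open>The derivative of a test function is again one with support in the same interval, so
  \<open>H\<close> has zero weak derivative and is a.e. constant. Testing with a nontrivial
  nonnegative bump shows that the constant is 0.\<close>

lemma fundamental_lemma_time:
  fixes H :: "real \<Rightarrow> real"
  assumes T: "0 < T" and H: "integrable lborel H"
    and weak: "\<And>\<theta> a b. smooth_fun \<theta> \<Longrightarrow> 0 < a \<Longrightarrow> b < T \<Longrightarrow> (\<And>t. t \<notin> {a..b} \<Longrightarrow> \<theta> t = 0) \<Longrightarrow> (LBINT t. H t * \<theta> t) = 0"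
  shows "AE t\<in>{0<..<T} in lborel. H t = 0"
proof -
  have "\<exists>c. AE t\<in>{0<..<T} in lborel. H t = c + (LBINT x. indicator {0<..<t} x * 0)"
  proof (rule du_Bois_Reymond_smooth[OF T H])
    fix \<theta> a b assume th: "smooth_fun \<theta>" "0 < a" "b < T" "\<And>t. t \<notin> {a..b} \<Longrightarrow> \<theta> t = 0"
    have "dderiv 1 \<theta> t = 0" if "t \<notin> {a..b}" for t
    proof -
      have "{t. \<theta> t \<noteq> 0} \<subseteq> {a..b}" using th(4) by blast
      then have "supp_closure \<theta> \<subseteq> {a..b}" unfolding supp_closure_def by (rule closure_minimal) simp
      then show ?thesis using pd_zero_outside[OF th(1)] that by blast
    qed
    then have "(LBINT t. H t * dderiv 1 \<theta> t) = 0" by (intro weak[OF smooth_dderiv[OF th(1)] th(2,3)]) auto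
    then show "(LBINT t. H t * dderiv 1 \<theta> t + 0 * \<theta> t) = 0" by simp
  qed simp
  then obtain c where c: "AE t\<in>{0<..<T} in lborel. H t = c" by auto
  \<comment> \<open>A bump living exactly on the middle third of (0, T).\<close>
  define \<theta> where "\<theta> = (\<lambda>t. bump (t / (T / 3) + - 1))"
  have s: "smooth_fun \<theta>" unfolding \<theta>_def by (rule smooth_affine[OF bounded_linear_divide smooth_bump])
  have th0: "\<theta> t = 0" if "t \<notin> {T/3..2*T/3}" for t
    unfolding \<theta>_def using that T by (intro bump_eq_0) (auto simp: field_simps)
  have w: "(LBINT t. H t * \<theta> t) = 0" by (rule weak[OF s, of "T/3" "2*T/3"]) (use T th0 in auto)
  have "c = 0"
  proof (rule ccontr)
    assume "c \<noteq> 0"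
    have [measurable]: "\<theta> \<in> borel_measurable borel" "H \<in> borel_measurable borel" using smooth_borel[OF s] H by auto
    have "(LBINT t. H t * \<theta> t) = (LBINT t. c * \<theta> t)"
    proof (rule integral_cong_AE)
      show "AE t in lborel. H t * \<theta> t = c * \<theta> t"
        using c by eventually_elim (use th0 T in force)
    qed measurable
    then have z: "(LBINT t. \<theta> t) = 0" using w \<open>c \<noteq> 0\<close> by simp
    have eq: "\<theta> = (\<lambda>t. indicator {T/3..2*T/3} t * \<theta> t)" using th0 unfolding indicator_def by (intro ext) fastforce
    have i: "integrable lborel \<theta>"
      by (subst eq, rule integrable_indicator_continuous[OF compact_Icc smooth_continuous[OF s]])
    have "AE t in lborel. \<theta> t = 0"
      using z by (subst (asm) integral_nonneg_eq_0_iff_AE[OF i]) (auto simp: \<theta>_def bump_nonneg)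
    then have "AE t\<in>{0<..<T} in lborel. \<theta> t = 0" by eventually_elim simp
    from AE_exists_in_interval[OF this, of "T/3" "2*T/3"] T obtain t where t: "T/3 < t" "t < 2*T/3" "\<theta> t = 0" by auto
    have "0 < \<theta> t" unfolding \<theta>_def using t T by (intro bump_pos) (auto simp: field_simps)
    then show False using t(3) by simp
  qed
  then show ?thesis using c by simp
qed

text \<open>The identity is needed for all \<open>x\<close> at once, outside a null set of times
  that does not depend on \<open>x\<close>. For a product \<open>a x * b y\<close> the point
  \<open>x\<close> enters only as a factor, so a separated kernel involves only finitely many null
  sets.\<close>

lemma separated_weak_AE:
  fixes v g :: "real \<Rightarrow> real^'n::finite \<Rightarrow> real"
  assumes F: "separated F"
    and int: "AE t\<in>{0<..<T} in lborel. integrable lborel (v t) \<and> integrable lborel (g t)"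
    and zero: "\<And>t x. x \<notin> cbox 0 One \<Longrightarrow> v t x = 0" "\<And>t x. x \<notin> cbox 0 One \<Longrightarrow> g t x = 0"
    and weak: "\<And>\<phi>. test_S Torus \<phi> \<Longrightarrow> AE t\<in>{0<..<T} in lborel. (LBINT y. v t y * pd j \<phi> y) = - (LBINT y. g t y * \<phi> y)"
  shows "AE t\<in>{0<..<T} in lborel. (\<forall>x. (LBINT y. v t y * pd j (F x) y) = - (LBINT y. g t y * F x y))"
  using F
proof (induction rule: separated.induct)
  case (separated_basic a b)
  have s: "smooth_fun b" using separated_basic by auto
  have d: "pd j (\<lambda>y. k * b y) y = k * pd j b y" for k y
    by (rule dderiv_eq[where D="\<lambda>h. k * dderiv h b y"]) (intro has_derivative_mult_right has_derivative_dderiv smooth_differentiable s)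
  have e: "(LBINT y. u y * (k * h y)) = k * (LBINT y. u y * h y)" for u h :: "real^'n \<Rightarrow> real" and k
    by (simp add: mult.left_commute)
  show ?case using weak[OF separated_basic(2)]
    by eventually_elim (simp add: d e)
next
  case (separated_add F G)
  have i: "integrable lborel (\<lambda>y. u y * h y)" if h: "integrable lborel u" "\<And>x. x \<notin> cbox 0 One \<Longrightarrow> u x = 0" "smooth_fun h" for u h :: "real^'n \<Rightarrow> real"
  proof -
    obtain B where "\<And>x. x \<in> cbox 0 One \<Longrightarrow> \<bar>h x\<bar> \<le> B" using smooth_bounded_on[OF h(3) bounded_cbox] by metis
    then show ?thesis using h smooth_borel[OF h(3)] by (intro integrable_bounded_mult[where B=B]) auto
  qed
  have sF: "smooth_fun (F x)" "smooth_fun (G x)" for x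
    using test_S_smooth[OF separated_tests(1)[OF separated_add.hyps(1)]] test_S_smooth[OF separated_tests(1)[OF separated_add.hyps(2)]] by auto
  have d: "pd j (\<lambda>y. F x y + G x y) y = pd j (F x) y + pd j (G x) y" for x y
    by (rule fun_cong[OF dderiv_add]) (intro smooth_differentiable sF)+
  show ?case using separated_add.IH int
  proof eventually_elim
    case (elim t)
    show ?case
    proof (intro impI allI)
      fix x assume t: "t \<in> {0<..<T}"
      then have ii: "integrable lborel (v t)" "integrable lborel (g t)" using elim by auto
      note I = i[OF ii(1) zero(1) smooth_pd[OF sF(1)]] i[OF ii(1) zero(1) smooth_pd[OF sF(2)]] i[OF ii(2) zero(2) sF(1)] i[OF ii(2) zero(2) sF(2)]
      show "(LBINT y. v t y * pd j (\<lambda>y. F x y + G x y) y) = - (LBINT y. g t y * (F x y + G x y))"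
        using elim t I by (simp add: d distrib_left)
    qed
  qed
qed

section \<open>From weak solutions to Borel data\<close>

text \<open>The bridge from set integrals over Lebesgue measure to Borel integrands on the whole
  space. Completeness of Lebesgue measure makes the left integrand measurable from its a.e. equality
  with \<open>g\<close>.\<close>

lemma set_lebesgue_Borel:
  fixes F g :: "'a::euclidean_space \<Rightarrow> real"
  assumes g: "g \<in> borel_measurable borel" and AE: "AE x\<in>A in lborel. F x = g x" and zero: "\<And>x. x \<notin> A \<Longrightarrow> g x = 0"
  shows "(LINT x:A|lebesgue. F x) = (LBINT x. g x)"
    and "set_integrable lebesgue A F \<longleftrightarrow> integrable lborel g"
proof -
  have ae: "AE x in lebesgue. g x = indicator A x *\<^sub>R F x"
    unfolding AE_completion_iff using AE by eventually_elim (auto simp: indicator_def zero)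
  have gm: "g \<in> borel_measurable lebesgue" using g by (simp add: measurable_completion)
  have m: "(\<lambda>x. indicator A x *\<^sub>R F x) \<in> borel_measurable lebesgue" by (rule borel_measurable_AE[OF gm ae])
  show "(LINT x:A|lebesgue. F x) = (LBINT x. g x)"
    unfolding set_lebesgue_integral_def integral_cong_AE[OF gm m ae, symmetric] by (rule integral_completion) (simp add: g)
  show "set_integrable lebesgue A F \<longleftrightarrow> integrable lborel g"
    unfolding set_integrable_def integrable_cong_AE[OF gm m ae, symmetric] by (rule integrable_completion) (simp add: g)
qed

lemma loc_int_S_Borel:
  fixes f g :: "real^'n::finite \<Rightarrow> real"
  assumes "valid_setting st" "loc_int_S st f" "g \<in> borel_measurable borel" "AE x\<in>region st in lborel. f x = g x"
  shows "loc_int_S st g"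
proof -
  have *: "set_integrable lebesgue K g" if f: "set_integrable lebesgue K f" and K: "compact K" "K \<subseteq> region st" for K
  proof -
    have [measurable]: "K \<in> sets borel" "g \<in> borel_measurable borel" using K assms(3) by (auto simp: borel_compact)
    have "integrable lborel (\<lambda>x. indicator K x * g x)"
    proof (subst set_lebesgue_Borel(2)[symmetric, of _ K f])
      show "AE x\<in>K in lborel. f x = indicator K x * g x"
        using assms(4) by eventually_elim (use K in auto)
    qed (use f in auto)
    then show ?thesis by (subst set_lebesgue_Borel(2)[of "\<lambda>x. indicator K x * g x"]) auto
  qed
  show ?thesis using assms(2) * by (cases st) auto
qed

lemma power2_norm_vec: "(norm (v :: real^'n::finite))^2 = (\<Sum>i\<in>UNIV. (v $ i)^2)"
  unfolding power2_norm_eq_inner by (simp add: inner_vec_def power2_eq_square)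

lemma power2_norm_mat: "(norm (A :: real^'n::finite^'m::finite))^2 = (\<Sum>i\<in>UNIV. \<Sum>j\<in>UNIV. (A $ i $ j)^2)"
  unfolding power2_norm_eq_inner by (simp add: inner_vec_def power2_eq_square)

lemma set_integrable_component:
  fixes f :: "'a \<Rightarrow> real^'n::finite"
  assumes "set_integrable M A f"
  shows "set_integrable M A (\<lambda>x. f x $ i)"
  using integrable_bounded_linear[OF bounded_linear_vec_nth assms[unfolded set_integrable_def], of i]
  by (simp add: set_integrable_def)

lemma loc_int_S_component:
  assumes "loc_int_S st (f :: real^'n::finite \<Rightarrow> real^'n)"
  shows "loc_int_S st (\<lambda>x. f x $ i)"
  using assms set_integrable_component by (cases st) auto

text \<open>The parameters with suffix \<open>b\<close> are Borel representatives of the Lebesgue measurable data.\<close>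
locale weak_solution_data =
  fixes st :: "('n::finite) setting" and T c1 c2 :: real and \<nu> :: "real \<Rightarrow> real"
    and \<rho> :: "(real^'n) \<times> real \<Rightarrow> real" and u :: "(real^'n) \<times> real \<Rightarrow> real^'n"
    and G :: "(real^'n) \<times> real \<Rightarrow> real^'n^'n" and P :: "(real^'n) \<times> real \<Rightarrow> real"
    and \<rho>0 :: "real^'n \<Rightarrow> real" and u0 :: "real^'n \<Rightarrow> real^'n"
    and \<rho>b ub Gb Pb \<rho>0b u0b
  assumes dim: "CARD('n) = 2 \<or> CARD('n) = 3"
    and T: "T > 0"
    and nu_cont: "continuous_on {0<..} \<nu>"
    and st: "valid_setting st"
    and ws: "weak_solution st T \<nu> \<rho> u G P \<rho>0 u0"
    and dirichlet: "\<And>\<Omega>. st = Domain \<Omega> \<Longrightarrow>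
        (AE t\<in>{0<..<T} in lborel. H10 \<Omega> (\<lambda>x. u (x, t)) (\<lambda>x. G (x, t)))"
    and c: "0 < c1" "c1 \<le> c2"
    and rho_bd: "AE z in lebesgue. z \<in> region st \<times> {0<..<T} \<longrightarrow> c1 \<le> \<rho> z \<and> \<rho> z \<le> c2"
    and u_LinfL2: "\<exists>C. AE t\<in>{0<..<T} in lborel.
        set_integrable lebesgue (region st) (\<lambda>x. (norm (u (x, t)))^2) \<and>
        (LINT x:region st|lebesgue. (norm (u (x, t)))^2) \<le> C"
    and u_L2H1: "set_integrable lebesgue (region st \<times> {0<..<T}) (\<lambda>z. (norm (u z))^2)"
      "set_integrable lebesgue (region st \<times> {0<..<T}) (\<lambda>z. (norm (G z))^2)"
    and P_L2: "set_integrable lebesgue (region st \<times> {0<..<T}) (\<lambda>z. (P z)^2)"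
    and u_L4: "CARD('n) = 3 \<Longrightarrow>
        set_integrable lebesgue (region st \<times> {0<..<T}) (\<lambda>z. (norm (u z)) ^ 4)"
    and b_meas: "\<rho>b \<in> borel_measurable borel" "\<And>i. ub i \<in> borel_measurable borel" "\<And>i j. Gb i j \<in> borel_measurable borel"
      "Pb \<in> borel_measurable borel" "\<rho>0b \<in> borel_measurable borel" "\<And>i. u0b i \<in> borel_measurable borel"
    and b_AE: "AE z in lborel. \<rho> z = \<rho>b z" "\<And>i. AE z in lborel. u z $ i = ub i z" "\<And>i j. AE z in lborel. G z $ i $ j = Gb i j z"
      "AE z in lborel. P z = Pb z" "AE x in lborel. \<rho>0 x = \<rho>0b x" "\<And>i. AE x in lborel. u0 x $ i = u0b i x"
begin

abbreviation "X \<equiv> region st"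
abbreviation "Q \<equiv> region st \<times> {0<..<T}"

text \<open>Clamping makes the density bounds valid at every point of the cylinder and keeps the
  argument of the viscosity in a compact subinterval of (0, \<infinity>), where it is bounded.
  Cutting off by \<open>Q\<close> gives the extension by zero.\<close>

definition "R = (\<lambda>z. indicator Q z * clampr c1 c2 (\<rho>b z))"
definition "U = (\<lambda>i z. indicator Q z * ub i z)"
definition "DU = (\<lambda>i j z. indicator Q z * Gb i j z)"
definition "Pr = (\<lambda>z. indicator Q z * Pb z)"
definition "nu = (\<lambda>z. \<nu> (clampr c1 c2 (\<rho>b z)))"
definition "V = (\<lambda>i j z. nu z * ((DU i j z + DU j i z) / 2))"
definition "R0 = (\<lambda>x. indicator X x * \<rho>0b x)"
definition "M0 = (\<lambda>i x. R0 x * u0b i x)"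

lemma X_sets[measurable]: "X \<in> sets borel" by (rule region_Borel[OF st])

lemma Q_sets[measurable]: "Q \<in> sets borel" by (intro borel_Times X_sets) simp

lemma Q_finite: "emeasure lborel Q < \<infinity>"
  using emeasure_bounded_finite[OF bounded_Times[OF region_bounded[OF st], of "{0<..<T}"]] by simp

lemma nu_continuous: "continuous_on UNIV (\<lambda>s. \<nu> (clampr c1 c2 s))"
proof (rule continuous_on_compose2[OF nu_cont])
  show "continuous_on UNIV (clampr c1 c2)" unfolding clampr_def[abs_def] by (intro continuous_intros)
  show "clampr c1 c2 ` UNIV \<subseteq> {0<..}" using clampr_bounds(1)[OF c(2)] c(1) by (auto intro: less_le_trans)
qed

lemma nu_bounded: obtains B where "\<And>z. \<bar>nu z\<bar> \<le> B"
proof -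
  have "bounded (\<nu> ` {c1..c2})"
    by (intro compact_imp_bounded compact_continuous_image continuous_on_subset[OF nu_cont]) (use c in auto)
  then obtain B where "\<forall>s\<in>{c1..c2}. \<bar>\<nu> s\<bar> \<le> B" by (auto simp: bounded_iff)
  then show thesis using clampr_bounds[OF c(2)] by (intro that[of B]) (auto simp: nu_def)
qed

lemma meas[measurable]:
  "R \<in> borel_measurable borel" "U i \<in> borel_measurable borel" "DU i j \<in> borel_measurable borel" "Pr \<in> borel_measurable borel"
  "nu \<in> borel_measurable borel" "V i j \<in> borel_measurable borel" "R0 \<in> borel_measurable borel" "M0 i \<in> borel_measurable borel" "u0b i \<in> borel_measurable borel"
proof -
  note [measurable] = b_meas
  show D: "R \<in> borel_measurable borel" "\<And>i. U i \<in> borel_measurable borel" "\<And>i j. DU i j \<in> borel_measurable borel" "Pr \<in> borel_measurable borel"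
    "R0 \<in> borel_measurable borel" "u0b i \<in> borel_measurable borel"
    unfolding R_def U_def DU_def Pr_def R0_def by measurable
  show "nu \<in> borel_measurable borel"
    unfolding nu_def by (rule measurable_compose[OF b_meas(1) borel_measurable_continuous_onI[OF nu_continuous]])
  note [measurable] = this D
  show "V i j \<in> borel_measurable borel" "M0 i \<in> borel_measurable borel" unfolding V_def M0_def by measurable
qed

lemma zero: "z \<notin> Q \<Longrightarrow> R z = 0" "z \<notin> Q \<Longrightarrow> U i z = 0" "z \<notin> Q \<Longrightarrow> DU i j z = 0" "z \<notin> Q \<Longrightarrow> Pr z = 0" "z \<notin> Q \<Longrightarrow> V i j z = 0"
  "x \<notin> X \<Longrightarrow> R0 x = 0" "x \<notin> X \<Longrightarrow> M0 i x = 0"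
  by (simp_all add: R_def U_def DU_def Pr_def V_def R0_def M0_def)

text \<open>All identifications of the original data with their Borel versions at one point, so that
  a single null set has to be avoided.\<close>

definition "eqs z \<longleftrightarrow> \<rho> z = R z \<and> (\<forall>i. u z $ i = U i z) \<and> (\<forall>i j. G z $ i $ j = DU i j z) \<and> P z = Pr z \<and> \<nu> (\<rho> z) = nu z \<and>
  (\<forall>i j. \<nu> (\<rho> z) * symgrad (G z) $ i $ j = V i j z)"

lemma AE_eqs: "AE z\<in>Q in lborel. eqs z"
proof -
  have "AE z in lborel. \<forall>i. u z $ i = ub i z" "AE z in lborel. \<forall>i j. G z $ i $ j = Gb i j z"
    using b_AE(2,3) by (simp_all add: AE_all_countable)
  with b_AE(1,4) rho_bd[unfolded AE_completion_iff] show ?thesis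
  proof eventually_elim
    case (elim z)
    then show ?case
      by (auto simp: eqs_def R_def U_def DU_def Pr_def V_def nu_def symgrad_def transpose_def clampr_id)
  qed
qed

lemma AE_eqs_slice: "AE t\<in>{0<..<T} in lborel. (AE x\<in>X in lborel. eqs (x, t))"
  using lborel_AE_pair[OF AE_eqs]
proof eventually_elim
  case (elim t)
  show ?case
  proof
    assume "t \<in> {0<..<T}"
    with elim show "AE x\<in>X in lborel. eqs (x, t)" by (elim eventually_mono) auto
  qed
qed

lemma LINT_Q:
  fixes F g :: "(real^'n) \<times> real \<Rightarrow> real"
  assumes "g \<in> borel_measurable borel" "\<And>z. z \<in> Q \<Longrightarrow> eqs z \<Longrightarrow> F z = g z" "\<And>z. z \<notin> Q \<Longrightarrow> g z = 0"
  shows "(LINT z:Q|lebesgue. F z) = (LBINT z. g z)" "set_integrable lebesgue Q F \<longleftrightarrow> integrable lborel g"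
proof -
  have "AE z\<in>Q in lborel. F z = g z" using AE_eqs by eventually_elim (use assms(2) in auto)
  from set_lebesgue_Borel[OF assms(1) this assms(3)]
  show "(LINT z:Q|lebesgue. F z) = (LBINT z. g z)" "set_integrable lebesgue Q F \<longleftrightarrow> integrable lborel g" by auto
qed

lemma AE_init: "AE x\<in>X in lborel. \<rho>0 x = R0 x \<and> (\<forall>i. u0 x $ i = u0b i x)"
proof -
  have "AE x in lborel. \<forall>i. u0 x $ i = u0b i x" using b_AE(6) by (simp add: AE_all_countable)
  with b_AE(5) show ?thesis by eventually_elim (auto simp: R0_def)
qed

lemma R_bounds: "z \<in> Q \<Longrightarrow> c1 \<le> R z" "z \<in> Q \<Longrightarrow> R z \<le> c2" "\<bar>R z\<bar> \<le> c2"
  using clampr_bounds[OF c(2), of "\<rho>b z"] c by (auto simp: R_def indicator_def)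

section \<open>Integrability of the components and H^1 regularity of the slices\<close>

lemma Lp_of_square:
  assumes "(f :: 'a::euclidean_space \<Rightarrow> real) \<in> borel_measurable borel" "integrable lborel s" "\<And>x. (f x)^2 \<le> s x"
  shows "Lp 2 lborel f"
  unfolding Lp_def
proof
  show "integrable lborel (\<lambda>x. \<bar>f x\<bar>^2)"
    by (rule integrable_bound[OF assms(2)]) (use assms(1,3) order_trans[OF assms(3) abs_ge_self] in auto)
qed (use assms(1) in simp)

lemma square_le_sum: "(a i)^2 \<le> (\<Sum>i\<in>(UNIV::'n set). (a i :: real)^2)"
  by (rule member_le_sum) auto

lemma square_le_sum2: "(a i j)^2 \<le> (\<Sum>i\<in>(UNIV::'n set). \<Sum>j\<in>(UNIV::'n set). (a i j :: real)^2)"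
  by (rule order_trans[OF square_le_sum member_le_sum[where f="\<lambda>i. \<Sum>j\<in>UNIV. (a i j)^2"]]) (auto intro: sum_nonneg)

lemma U_Lp2: "Lp 2 lborel (U i)"
proof (rule Lp_of_square)
  show "integrable lborel (\<lambda>z. \<Sum>i\<in>UNIV. (U i z)^2)"
    by (subst LINT_Q(2)[symmetric, of _ "\<lambda>z. (norm (u z))^2"]) (use u_L2H1 in \<open>auto simp: power2_norm_vec eqs_def zero\<close>)
qed (auto intro: square_le_sum)

lemma DU_Lp2: "Lp 2 lborel (DU i j)"
proof (rule Lp_of_square)
  show "integrable lborel (\<lambda>z. \<Sum>i\<in>UNIV. \<Sum>j\<in>UNIV. (DU i j z)^2)"
    by (subst LINT_Q(2)[symmetric, of _ "\<lambda>z. (norm (G z))^2"]) (use u_L2H1 in \<open>auto simp: power2_norm_mat eqs_def zero\<close>)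
qed (auto intro: square_le_sum2[where a="\<lambda>i j. DU i j _"])

lemma Pr_Lp2: "Lp 2 lborel Pr"
proof (rule Lp_of_square)
  show "integrable lborel (\<lambda>z. (Pr z)^2)"
    by (subst LINT_Q(2)[symmetric, of _ "\<lambda>z. (P z)^2"]) (use P_L2 in \<open>auto simp: eqs_def zero\<close>)
qed auto

lemma V_Lp2: "Lp 2 lborel (V i j)"
proof -
  obtain B where "\<And>z. \<bar>nu z\<bar> \<le> B" using nu_bounded by blast
  then show ?thesis unfolding V_def
    by (intro Lp_bounded_mult[where B=B]) (auto simp: add_divide_distrib intro!: Lp_add Lp_cmult[of _ _ _ "1/2", simplified] DU_Lp2)
qed

lemma U_Lp4_3D: assumes "CARD('n) = 3" shows "Lp 4 lborel (U i)"
proof -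
  have "Lp 2 lborel (\<lambda>z. (U i z)^2)"
  proof (rule Lp_of_square)
    show "integrable lborel (\<lambda>z. (\<Sum>i\<in>UNIV. (U i z)^2)^2)"
    proof (subst LINT_Q(2)[symmetric, of _ "\<lambda>z. (norm (u z)) ^ 4"])
      have "(norm (u z)) ^ 4 = ((norm (u z))^2)^2" for z by simp
      then show "eqs z \<Longrightarrow> (norm (u z)) ^ 4 = (\<Sum>i\<in>UNIV. (U i z)^2)^2" for z
        by (simp only: power2_norm_vec) (simp add: eqs_def)
    qed (use u_L4[OF assms] in \<open>auto simp: zero\<close>)
    show "((U i z)^2)^2 \<le> (\<Sum>i\<in>UNIV. (U i z)^2)^2" for z by (intro power_mono square_le_sum) auto
  qed auto
  then show ?thesis by (simp add: Lp_def)
qed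

lemma slice_Lp2:
  "AE t\<in>{0<..<T} in lborel. (\<forall>i. Lp 2 lborel (\<lambda>x. U i (x, t))) \<and> (\<forall>i j. Lp 2 lborel (\<lambda>x. DU i j (x, t)))"
proof -
  have *: "AE t in lborel. Lp 2 lborel (\<lambda>x. f (x, t))" if f: "Lp 2 lborel f" for f :: "(real^'n) \<times> real \<Rightarrow> real"
    using lborel_AE_integrable_snd[OF f[THEN Lp_integrable]]
  proof eventually_elim
    case (elim t)
    have [measurable]: "f \<in> borel_measurable borel" using Lp_measurable[OF f] by simp
    show ?case unfolding Lp_def using elim by auto
  qed
  have "AE t in lborel. \<forall>i. Lp 2 lborel (\<lambda>x. U i (x, t))" "AE t in lborel. \<forall>i j. Lp 2 lborel (\<lambda>x. DU i j (x, t))"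
    using *[OF U_Lp2] *[OF DU_Lp2] by (simp_all add: AE_all_countable)
  then show ?thesis by eventually_elim auto
qed

text \<open>Only L^2 convergence is recorded here; convergence in L^4 is added afterwards by the
  Sobolev inequality, in the same way for both geometries.\<close>

definition "H1_slice t \<longleftrightarrow> (\<exists>\<phi>. \<forall>i. (\<forall>k. test_S st (\<phi> k i)) \<and>
   Lpconv 2 lborel sequentially (\<lambda>k x. indicator X x * \<phi> k i x) (\<lambda>x. U i (x, t)) \<and>
   (\<forall>j. Lpconv 2 lborel sequentially (\<lambda>k x. indicator X x * pd j (\<phi> k i) x) (\<lambda>x. DU i j (x, t))))"

lemma H1_slice_domain:
  assumes dom: "st = Domain \<Omega>"
  shows "AE t\<in>{0<..<T} in lborel. H1_slice t"
  using dirichlet[OF dom] slice_Lp2 AE_eqs_slice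
proof eventually_elim
  case (elim t)
  show ?case
  proof
    assume t: "t \<in> {0<..<T}"
    note L = elim(2)[rule_format, OF t] note ae = elim(3)[rule_format, OF t]
    obtain \<phi> where \<phi>: "\<And>k. testv_S st (\<phi> k)"
      and lim: "(\<lambda>k. (LINT x:X|lebesgue. (norm (\<phi> k x - u (x, t)))^2 + (norm (jac (\<phi> k) x - G (x, t)))^2)) \<longlonglongrightarrow> 0"
      using elim(1) t dom by (auto simp: H10_def)
    have test: "test_S st (\<lambda>x. \<phi> k x $ i)" for k i using \<phi> by (simp add: testv_S_def)
    have s: "smooth_fun (\<lambda>x. \<phi> k x $ i)" for k i by (rule test_S_smooth[OF test])
    define a where "a = (\<lambda>k i x. indicator X x * \<phi> k x $ i - U i (x, t))"
    define b where "b = (\<lambda>k i j x. indicator X x * pd j (\<lambda>y. \<phi> k y $ i) x - DU i j (x, t))"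
    have aL: "Lp 2 lborel (a k i)" for k i unfolding a_def using L by (intro Lp_diff Lp_test[OF st s]) auto
    have bL: "Lp 2 lborel (b k i j)" for k i j unfolding b_def using L by (intro Lp_diff Lp_test[OF st smooth_pd[OF s]]) auto
    have ai: "integrable lborel (\<lambda>x. (a k i x)^2)" and bi: "integrable lborel (\<lambda>x. (b k i j x)^2)" for k i j
      using aL[THEN Lp_integrable] bL[THEN Lp_integrable] by auto
    \<comment> \<open>The combined H^1 error is a sum of squares of components, so its convergence
      to 0 forces each component to converge.\<close>
    have eq: "(LINT x:X|lebesgue. (norm (\<phi> k x - u (x, t)))^2 + (norm (jac (\<phi> k) x - G (x, t)))^2)
       = (LBINT x. (\<Sum>i\<in>UNIV. (a k i x)^2) + (\<Sum>i\<in>UNIV. \<Sum>j\<in>UNIV. (b k i j x)^2))" for k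
    proof (rule set_lebesgue_Borel(1))
      show "(\<lambda>x. (\<Sum>i\<in>UNIV. (a k i x)^2) + (\<Sum>i\<in>UNIV. \<Sum>j\<in>UNIV. (b k i j x)^2)) \<in> borel_measurable borel"
        using aL bL by (intro borel_measurable_add borel_measurable_sum borel_measurable_power) (auto simp: Lp_def)
      show "AE x\<in>X in lborel. (norm (\<phi> k x - u (x, t)))^2 + (norm (jac (\<phi> k) x - G (x, t)))^2 =
        (\<Sum>i\<in>UNIV. (a k i x)^2) + (\<Sum>i\<in>UNIV. \<Sum>j\<in>UNIV. (b k i j x)^2)"
        using ae by eventually_elim (auto simp: power2_norm_vec power2_norm_mat eqs_def a_def b_def jac_def)
      show "x \<notin> X \<Longrightarrow> (\<Sum>i\<in>UNIV. (a k i x)^2) + (\<Sum>i\<in>UNIV. \<Sum>j\<in>UNIV. (b k i j x)^2) = 0" for x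
        by (simp add: a_def b_def zero)
    qed
    have ia: "(LBINT x. (a k i x)^2) \<le> (LBINT x. (\<Sum>i\<in>UNIV. (a k i x)^2) + (\<Sum>i\<in>UNIV. \<Sum>j\<in>UNIV. (b k i j x)^2))" for k i
      by (intro integral_mono integrable_add integrable_sum ai bi)
         (use square_le_sum[of "\<lambda>i. a k i _"] in \<open>auto intro!: order_trans[OF square_le_sum] add_increasing2 sum_nonneg\<close>)
    have ib: "(LBINT x. (b k i j x)^2) \<le> (LBINT x. (\<Sum>i\<in>UNIV. (a k i x)^2) + (\<Sum>i\<in>UNIV. \<Sum>j\<in>UNIV. (b k i j x)^2))" for k i j
      by (intro integral_mono integrable_add integrable_sum ai bi)
         (auto intro!: order_trans[OF square_le_sum2[where a="\<lambda>i j. b k i j _"]] add_increasing sum_nonneg)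
    have la: "(\<lambda>k. LBINT x. (a k i x)^2) \<longlonglongrightarrow> 0" for i
      by (rule tendsto_sandwich[OF _ _ tendsto_const lim]) (auto simp: eq ia)
    have lb: "(\<lambda>k. LBINT x. (b k i j x)^2) \<longlonglongrightarrow> 0" for i j
      by (rule tendsto_sandwich[OF _ _ tendsto_const lim]) (auto simp: eq ib)
    show "H1_slice t"
      unfolding H1_slice_def
    proof (intro exI[of _ "\<lambda>k i x. \<phi> k x $ i"] allI conjI test)
      show "Lpconv 2 lborel sequentially (\<lambda>k x. indicator X x * \<phi> k x $ i) (\<lambda>x. U i (x, t))" for i
        using la[of i] L by (auto simp: Lpconv_def a_def intro!: Lp_test[OF st s])
      show "Lpconv 2 lborel sequentially (\<lambda>k x. indicator X x * pd j (\<lambda>x. \<phi> k x $ i) x) (\<lambda>x. DU i j (x, t))" for i j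
        using lb[of i j] L by (auto simp: Lpconv_def b_def intro!: Lp_test[OF st smooth_pd[OF s]])
    qed
  qed
qed

lemma integrable_times_smooth:
  assumes "integrable lborel f" "\<And>x. x \<notin> X \<Longrightarrow> f x = 0" "smooth_fun \<phi>"
  shows "integrable lborel (\<lambda>x. f x * \<phi> x)"
  using integrable_mult_smooth[OF assms(1,3) region_bounded[OF st], of "\<lambda>x. x"] assms(2) by auto

lemma integrable_times_smooth':
  assumes "integrable lborel f" "\<And>z. z \<notin> Q \<Longrightarrow> f z = 0" "smooth_fun \<phi>"
  shows "integrable lborel (\<lambda>z. f z * \<phi> (fst z))"
  by (rule integrable_mult_smooth[OF assms(1,3) region_bounded[OF st]]) (use assms(2) in force)+

lemma integrable_times_time:
  assumes "integrable lborel f" "\<And>z. z \<notin> Q \<Longrightarrow> f z = 0" "smooth_fun \<theta>"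
  shows "integrable lborel (\<lambda>z. f z * \<theta> (snd z))"
  by (rule integrable_mult_smooth[OF assms(1,3), of "{0<..<T}"]) (use assms(2) in force)+

lemma X_finite: "emeasure lborel X < \<infinity>"
  using region_finite[OF st] .

text \<open>The weak gradient is given in space-time only. Product test functions and the
  fundamental lemma in time localise it to almost every time, for each fixed spatial test
  function.\<close>

lemma slice_weak_gradient:
  assumes \<phi>: "test_S st \<phi>"
  shows "AE t\<in>{0<..<T} in lborel. (LBINT x. U i (x, t) * pd j \<phi> x) = - (LBINT x. DU i j (x, t) * \<phi> x)"
proof -
  have s: "smooth_fun \<phi>" by (rule test_S_smooth[OF \<phi>])
  define h where "h = (\<lambda>z. U i z * pd j \<phi> (fst z) + DU i j z * \<phi> (fst z))"
  have ih: "integrable lborel h"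
    unfolding h_def
    by (intro integrable_add integrable_times_smooth' s smooth_pd zero Lp2_integrable[OF U_Lp2 Q_sets Q_finite] Lp2_integrable[OF DU_Lp2 Q_sets Q_finite])
  have "AE t\<in>{0<..<T} in lborel. (LBINT x. h (x, t)) = 0"
  proof (rule fundamental_lemma_time[OF T])
    show "integrable lborel (\<lambda>t. LBINT x. h (x, t))" by (rule lborel_integrable_snd[OF ih])
    fix \<theta> a b assume th: "smooth_fun \<theta>" "0 < a" "b < T" "\<And>t. t \<notin> {a..b} \<Longrightarrow> \<theta> t = 0"
    have [measurable]: "\<theta> \<in> borel_measurable borel" "\<phi> \<in> borel_measurable borel" "pd j \<phi> \<in> borel_measurable borel" "h \<in> borel_measurable borel"
      using smooth_borel th(1) s smooth_pd[OF s] ih by auto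
    have hz: "h z = 0" if "z \<notin> Q" for z using that by (simp add: h_def zero)
    have iht: "integrable lborel (\<lambda>z. h z * \<theta> (snd z))"
      by (rule integrable_times_time[OF ih hz th(1)])
    have iU: "integrable lborel (\<lambda>z. U i z * pd j \<phi> (fst z) * \<theta> (snd z))"
      by (intro integrable_times_time integrable_times_smooth' th(1) s smooth_pd zero Lp2_integrable[OF U_Lp2 Q_sets Q_finite]) (simp_all add: zero)
    have iD: "integrable lborel (\<lambda>z. DU i j z * \<phi> (fst z) * \<theta> (snd z))"
      by (intro integrable_times_time integrable_times_smooth' th(1) s zero Lp2_integrable[OF DU_Lp2 Q_sets Q_finite]) (simp_all add: zero)
    have "(LBINT t. (LBINT x. h (x, t)) * \<theta> t) = (LBINT z. h z * \<theta> (snd z))"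
      unfolding lborel_integral_snd[OF iht] by simp
    also have "\<dots> = (LBINT z. U i z * pd j \<phi> (fst z) * \<theta> (snd z)) + (LBINT z. DU i j z * \<phi> (fst z) * \<theta> (snd z))"
      using iU iD by (simp add: h_def distrib_right)
    also have "(LBINT z. U i z * pd j \<phi> (fst z) * \<theta> (snd z)) =
        (LINT z:Q|lebesgue. u z $ i * dx j (\<lambda>z. \<phi> (fst z) * \<theta> (snd z)) z)"
      by (rule LINT_Q(1)[symmetric]) (auto simp: eqs_def zero dx_def dderiv_product_x[OF s th(1)])
    also have "(LBINT z. DU i j z * \<phi> (fst z) * \<theta> (snd z)) = (LINT z:Q|lebesgue. G z $ i $ j * (\<phi> (fst z) * \<theta> (snd z)))"
      by (rule LINT_Q(1)[symmetric]) (auto simp: eqs_def zero)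
    also have "(LINT z:Q|lebesgue. u z $ i * dx j (\<lambda>z. \<phi> (fst z) * \<theta> (snd z)) z) = - \<dots>"
      using ws test_ST_product[OF \<phi> th] unfolding weak_solution_def weak_grad_x_def by blast
    finally show "(LBINT t. (LBINT x. h (x, t)) * \<theta> t) = 0" by simp
  qed
  then show ?thesis using slice_Lp2
  proof eventually_elim
    case (elim t)
    show ?case
    proof
      assume t: "t \<in> {0<..<T}"
      have L: "integrable lborel (\<lambda>x. U i (x, t))" "integrable lborel (\<lambda>x. DU i j (x, t))"
        by (rule Lp2_integrable[OF _ X_sets X_finite], use elim(2) t zero in auto)+
      have "integrable lborel (\<lambda>x. U i (x, t) * pd j \<phi> x)" "integrable lborel (\<lambda>x. DU i j (x, t) * \<phi> x)"
        by (intro integrable_times_smooth L s smooth_pd; simp add: zero)+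
      then show "(LBINT x. U i (x, t) * pd j \<phi> x) = - (LBINT x. DU i j (x, t) * \<phi> x)"
        using elim(1) t by (simp add: h_def)
    qed
  qed
qed

text \<open>The mollified slices are the approximating test functions; as mollification commutes
  with the weak derivative, functions and gradients converge by the same result.\<close>

lemma H1_slice_torus:
  assumes tor: "st = Torus"
  shows "AE t\<in>{0<..<T} in lborel. H1_slice t"
proof -
  have X: "X = cbox 0 One" by (simp add: tor)
  have tt: "test_S Torus f \<Longrightarrow> test_S st f" for f :: "real^'n \<Rightarrow> real" by (simp add: tor)
  have int: "AE t\<in>{0<..<T} in lborel. (\<forall>i j. integrable lborel (\<lambda>x. U i (x, t)) \<and> integrable lborel (\<lambda>x. DU i j (x, t)))"
    using slice_Lp2
  proof eventually_elim
    case (elim t)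
    then show ?case using Lp2_integrable[OF _ X_sets X_finite, of "\<lambda>x. U _ (x, t)"] Lp2_integrable[OF _ X_sets X_finite, of "\<lambda>x. DU _ _ (x, t)"]
      by (simp add: zero)
  qed
  have z: "x \<notin> cbox 0 One \<Longrightarrow> U i (x, t) = 0" "x \<notin> cbox 0 One \<Longrightarrow> DU i j (x, t) = 0" for i j x t
    by (intro zero; simp add: X)+
  have "AE t\<in>{0<..<T} in lborel. (\<forall>x. (LBINT y. U i (y, t) * pd j (\<lambda>y. ker N (x - y)) y) = - (LBINT y. DU i j (y, t) * ker N (x - y)))" for i j N
  proof (rule separated_weak_AE[OF separated_ker])
    show "AE t\<in>{0<..<T} in lborel. integrable lborel (\<lambda>x. U i (x, t)) \<and> integrable lborel (\<lambda>x. DU i j (x, t))"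
      using int by eventually_elim auto
  qed (use z slice_weak_gradient tor in auto)
  then have "AE t in lborel. \<forall>i j N. t \<in> {0<..<T} \<longrightarrow> (\<forall>x. (LBINT y. U i (y, t) * pd j (\<lambda>y. ker N (x - y)) y) = - (LBINT y. DU i j (y, t) * ker N (x - y)))"
    unfolding AE_all_countable by blast
  with slice_Lp2 int show ?thesis
  proof eventually_elim
    case (elim t)
    show ?case
    proof
      assume t: "t \<in> {0<..<T}"
      have L: "Lp 2 lborel (\<lambda>x. U i (x, t))" "Lp 2 lborel (\<lambda>x. DU i j (x, t))"
        and I: "integrable lborel (\<lambda>x. U i (x, t))" for i j using elim t by auto
      have D: "pd j (Aop N (\<lambda>x. U i (x, t))) x = Aop N (\<lambda>x. DU i j (x, t)) x" for i j N x
        by (rule Aop_weak_derivative[OF I z(1)]) (use elim(3) t in auto)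
      show "H1_slice t"
        unfolding H1_slice_def
      proof (intro exI[of _ "\<lambda>k i. Aop k (\<lambda>x. U i (x, t))"] allI conjI)
        show "test_S st (Aop k (\<lambda>x. U i (x, t)))" for k i by (rule tt[OF Aop_test(1)[OF I z(1)]])
        show "Lpconv 2 lborel sequentially (\<lambda>k x. indicator X x * Aop k (\<lambda>x. U i (x, t)) x) (\<lambda>x. U i (x, t))" for i
          unfolding X by (rule Aop_converges[OF L(1) z(1)])
        show "Lpconv 2 lborel sequentially (\<lambda>k x. indicator X x * pd j (Aop k (\<lambda>x. U i (x, t))) x) (\<lambda>x. DU i j (x, t))" for i j
          unfolding X D by (rule Aop_converges[OF L(2) z(2)])
      qed
    qed
  qed
qed

lemma AE_H1_slice: "AE t\<in>{0<..<T} in lborel. H1_slice t"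
  using H1_slice_torus H1_slice_domain by (cases st) auto

lemma AE_H1_approx: "AE t\<in>{0<..<T} in lborel. H1_approx st (\<lambda>i x. U i (x, t)) (\<lambda>i j x. DU i j (x, t))"
proof -
  obtain C where C: "0 \<le> C"
    "\<And>\<phi>. test_S st \<phi> \<Longrightarrow> (LBINT x. indicator X x * (\<phi> x) ^ 4) \<le> C * (LBINT x. indicator X x * gsq \<phi> x)^2"
  proof (rule Sobolev_test[OF st dim])
    fix C :: real
    assume C: "0 \<le> C" "\<And>\<phi>. test_S st \<phi> \<Longrightarrow> (LBINT x. indicator X x * (\<phi> x) ^ 4) \<le> C * (LBINT x. indicator X x * gsq \<phi> x)^2"
    show thesis by (rule that[OF C])
  qed
  show ?thesis using AE_H1_slice
  proof eventually_elim
    case (elim t)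
    show ?case
    proof
      assume "t \<in> {0<..<T}"
      with elim have "H1_slice t" by simp
      then obtain \<phi> where "\<forall>i. (\<forall>k. test_S st (\<phi> k i)) \<and>
          Lpconv 2 lborel sequentially (\<lambda>k x. indicator X x * \<phi> k i x) (\<lambda>x. U i (x, t)) \<and>
          (\<forall>j. Lpconv 2 lborel sequentially (\<lambda>k x. indicator X x * pd j (\<phi> k i) x) (\<lambda>x. DU i j (x, t)))"
        unfolding H1_slice_def by (rule exE)
      then have \<phi>: "test_S st (\<phi> k i)"
        "Lpconv 2 lborel sequentially (\<lambda>k x. indicator X x * \<phi> k i x) (\<lambda>x. U i (x, t))"
        "Lpconv 2 lborel sequentially (\<lambda>k x. indicator X x * pd j (\<phi> k i) x) (\<lambda>x. DU i j (x, t))" for i j k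
        by simp_all
      have "H1_seq st \<phi> (\<lambda>i x. U i (x, t)) (\<lambda>i j x. DU i j (x, t))"
        unfolding H1_seq_def using \<phi> tests_L4[OF st C \<phi>(1) \<phi>(2) \<phi>(3)] by simp
      then show "H1_approx st (\<lambda>i x. U i (x, t)) (\<lambda>i j x. DU i j (x, t))" by (auto simp: H1_approx_def)
    qed
  qed
qed

text \<open>Integrate the planar Ladyzhenskaya inequality in time: the L^2 norm of a slice is
  bounded uniformly in time, and its squared H^1 norm is integrable in time. Nonnegative integrals
  are used because finiteness is the point to be proved.\<close>

lemma U_Lp4_2D:
  assumes card: "CARD('n) = 2"
  shows "Lp 4 lborel (U i)"
proof -
  obtain C where C: "0 \<le> C"
    "\<And>\<phi>. CARD('n) = 2 \<Longrightarrow> test_S st \<phi> \<Longrightarrow> (LBINT x. indicator X x * (\<phi> x) ^ 4) \<le>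
       C * ((LBINT x. indicator X x * (\<phi> x)^2) * (LBINT x. indicator X x * gsq \<phi> x))"
  proof (rule Sobolev_test[OF st dim])
    fix C :: real
    assume C: "0 \<le> C" "\<And>\<phi>. CARD('n) = 2 \<Longrightarrow> test_S st \<phi> \<Longrightarrow> (LBINT x. indicator X x * (\<phi> x) ^ 4) \<le>
       C * ((LBINT x. indicator X x * (\<phi> x)^2) * (LBINT x. indicator X x * gsq \<phi> x))"
    show thesis by (rule that[OF C])
  qed
  obtain K where K: "AE t\<in>{0<..<T} in lborel.
        set_integrable lebesgue X (\<lambda>x. (norm (u (x, t)))^2) \<and> (LINT x:X|lebesgue. (norm (u (x, t)))^2) \<le> K"
    using u_LinfL2 by blast
  define g where "g = (\<lambda>z. (U i z)^2 + (\<Sum>j\<in>UNIV. (DU i j z)^2))"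
  have g0: "0 \<le> g z" for z by (auto simp: g_def intro!: add_nonneg_nonneg sum_nonneg)
  have gi: "integrable lborel g"
    unfolding g_def using U_Lp2[THEN Lp_integrable] DU_Lp2[THEN Lp_integrable]
    by (intro integrable_add integrable_sum) auto
  have [measurable]: "g \<in> borel_measurable borel" using gi by auto
  have "AE t in lborel. (\<integral>\<^sup>+x. ennreal (\<bar>U i (x, t)\<bar> ^ 4) \<partial>lborel) \<le> ennreal (C * K) * (\<integral>\<^sup>+x. ennreal (g (x, t)) \<partial>lborel)"
    using AE_H1_approx K AE_eqs_slice slice_Lp2
  proof eventually_elim
    case (elim t)
    show ?case
    proof (cases "t \<in> {0<..<T}")
      case False
      then show ?thesis by (simp add: zero)
    next
      case t: True
      have L: "Lp 2 lborel (\<lambda>x. U i (x, t))" "Lp 2 lborel (\<lambda>x. DU i j (x, t))" for i j using elim t by auto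
      have sq: "integrable lborel (\<lambda>x. (U i (x, t))^2)" "integrable lborel (\<lambda>x. (DU i j (x, t))^2)" for i j
        using L[THEN Lp_integrable] by auto
      have gt: "integrable lborel (\<lambda>x. g (x, t))"
        unfolding g_def by (intro integrable_add integrable_sum sq)
      have K': "(LBINT x. (U i (x, t))^2) \<le> K"
      proof -
        have m: "(\<lambda>x. \<Sum>i\<in>UNIV. (U i (x, t))^2) \<in> borel_measurable borel" by measurable
        have "(LINT x:X|lebesgue. (norm (u (x, t)))^2) = (LBINT x. (\<Sum>i\<in>UNIV. (U i (x, t))^2))"
        proof (rule set_lebesgue_Borel(1)[OF m])
          show "AE x\<in>X in lborel. (norm (u (x, t)))^2 = (\<Sum>i\<in>UNIV. (U i (x, t))^2)"
            using elim(3)[rule_format, OF t] by eventually_elim (simp add: eqs_def power2_norm_vec)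
        qed (simp add: zero)
        moreover have "(LBINT x. (U i (x, t))^2) \<le> (LBINT x. (\<Sum>i\<in>UNIV. (U i (x, t))^2))"
          by (intro integral_mono sq integrable_sum square_le_sum[of "\<lambda>i. U i _"])
        ultimately show ?thesis using elim(2) t by auto
      qed
      obtain \<phi> where "H1_seq st \<phi> (\<lambda>i x. U i (x, t)) (\<lambda>i j x. DU i j (x, t))" using elim(1) t by (auto simp: H1_approx_def)
      note \<phi> = H1_seqD[OF this]
      have gl: "(LBINT x. g (x, t)) = (LBINT x. (U i (x, t))^2) + (\<Sum>j\<in>UNIV. LBINT x. (DU i j (x, t))^2)"
        unfolding g_def using sq by simp
      have gn: "0 \<le> (LBINT x. g (x, t))" using g0 by simp
      have "(LBINT x. (U i (x, t)) ^ 4) \<le> C * ((LBINT x. (U i (x, t))^2) * (LBINT x. g (x, t)))"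
        unfolding gl by (rule tests_L4_bound[OF st C(2)[OF card] \<phi>(1-4)])
      also have "\<dots> \<le> C * (K * (LBINT x. g (x, t)))"
        by (intro mult_left_mono mult_right_mono K' gn C)
      finally have b: "(LBINT x. \<bar>U i (x, t)\<bar> ^ 4) \<le> C * K * (LBINT x. g (x, t))" by (simp add: mult.assoc)
      have i4: "integrable lborel (\<lambda>x. \<bar>U i (x, t)\<bar> ^ 4)" using LpconvD(2)[OF \<phi>(3)] by (rule Lp_integrable)
      have "0 \<le> K" by (rule order_trans[OF _ K']) simp
      then have CK: "0 \<le> C * K" using C(1) by simp
      have "(\<integral>\<^sup>+x. ennreal (\<bar>U i (x, t)\<bar> ^ 4) \<partial>lborel) = ennreal (LBINT x. \<bar>U i (x, t)\<bar> ^ 4)"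
        by (rule nn_integral_eq_integral[OF i4]) simp
      also have "\<dots> \<le> ennreal (C * K * (LBINT x. g (x, t)))" using b by (rule ennreal_leI)
      also have "\<dots> = ennreal (C * K) * (\<integral>\<^sup>+x. ennreal (g (x, t)) \<partial>lborel)"
        using nn_integral_eq_integral[OF gt] g0 CK gn by (simp add: ennreal_mult)
      finally show ?thesis .
    qed
  qed
  then have "(\<integral>\<^sup>+t. \<integral>\<^sup>+x. ennreal (\<bar>U i (x, t)\<bar> ^ 4) \<partial>lborel \<partial>lborel) \<le> (\<integral>\<^sup>+t. ennreal (C * K) * (\<integral>\<^sup>+x. ennreal (g (x, t)) \<partial>lborel) \<partial>lborel)"
    by (rule nn_integral_mono_AE)
  also have "\<dots> = ennreal (C * K) * (\<integral>\<^sup>+z. ennreal (g z) \<partial>lborel)"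
    by (subst nn_integral_lborel_snd, measurable) (rule nn_integral_cmult, measurable)
  also have "\<dots> < \<infinity>"
    using nn_integral_eq_integral[OF gi] g0 by (simp add: ennreal_mult_less_top)
  finally show ?thesis
    unfolding Lp_iff_nn by (subst nn_integral_lborel_snd) auto
qed

lemma U_Lp4: "Lp 4 lborel (U i)"
  using U_Lp4_2D U_Lp4_3D dim by blast

section \<open>The balance laws for the Borel data\<close>

lemma integrable_products:
  "integrable lborel R" "integrable lborel (\<lambda>z. R z * U i z)" "integrable lborel (\<lambda>z. R z * U i z * U j z)"
  "integrable lborel Pr" "integrable lborel (V i j)"
proof -
  have RU: "Lp 2 lborel (\<lambda>z. R z * U i z)" by (rule Lp_bounded_mult[OF U_Lp2, where B=c2]) (use R_bounds in auto)
  have "Lp 2 lborel R" unfolding Lp_def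
  proof
    have "integrable lborel (\<lambda>z. indicator Q z * c2\<^sup>2)" using Q_finite by (intro integrable_mult_left integrable_real_indicator) auto
    then show "integrable lborel (\<lambda>z. \<bar>R z\<bar>^2)"
    proof (rule integrable_bound)
      have "\<bar>R z\<bar>^2 \<le> indicator Q z * c2\<^sup>2" for z
        using power_mono[OF R_bounds(3) abs_ge_zero, of z 2] zero(1)[of z] by (cases "z \<in> Q") auto
      then show "AE z in lborel. norm (\<bar>R z\<bar>^2) \<le> norm (indicator Q z * c2\<^sup>2)" by (intro AE_I2) simp
    qed simp
  qed simp
  from Lp2_integrable[OF this Q_sets Q_finite zero(1)] show "integrable lborel R" .
  show "integrable lborel (\<lambda>z. R z * U i z)" by (rule Lp2_integrable[OF RU Q_sets Q_finite]) (simp add: zero)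
  show "integrable lborel (\<lambda>z. R z * U i z * U j z)" by (rule Lp2_mult[OF RU U_Lp2])
  show "integrable lborel Pr" by (rule Lp2_integrable[OF Pr_Lp2 Q_sets Q_finite zero(4)])
  show "integrable lborel (V i j)" by (rule Lp2_integrable[OF V_Lp2 Q_sets Q_finite zero(5)])
qed

lemma loc_int_R0: "loc_int_S st R0" and loc_int_M0: "loc_int_S st (M0 i)"
proof -
  have l: "loc_int_S st \<rho>0" "loc_int_S st (\<lambda>x. \<rho>0 x *\<^sub>R u0 x)" using ws unfolding weak_solution_def by blast+
  show "loc_int_S st R0"
    by (rule loc_int_S_Borel[OF st l(1)]) (use AE_init in auto)
  show "loc_int_S st (M0 i)"
    by (rule loc_int_S_Borel[OF st loc_int_S_component[OF l(2), of i]]) (use AE_init in \<open>auto simp: M0_def elim: eventually_mono\<close>)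
qed

lemma product_measurable:
  assumes "smooth_fun \<phi>" "smooth_fun \<theta>"
  shows "(\<lambda>z::(real^'n) \<times> real. \<phi> (fst z)) \<in> borel_measurable borel" "(\<lambda>z::(real^'n) \<times> real. \<theta> (snd z)) \<in> borel_measurable borel"
proof -
  have [measurable]: "\<phi> \<in> borel_measurable borel" "\<theta> \<in> borel_measurable borel" using assms smooth_borel by auto
  show "(\<lambda>z::(real^'n) \<times> real. \<phi> (fst z)) \<in> borel_measurable borel" "(\<lambda>z::(real^'n) \<times> real. \<theta> (snd z)) \<in> borel_measurable borel"
    by measurable
qed

text \<open>The initial condition concerns the pairing with the given \<open>\<rho>\<close> at each
  time, whereas \<open>R\<close> agrees with it only at almost every time; this is why the former is
  passed on as \<open>gs\<close>.\<close>

lemma mass_slices: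
  "AE t\<in>{0<..<T} in lborel. integrable lborel (\<lambda>x. R (x, t)) \<and> (\<forall>\<phi>. test_S st \<phi> \<longrightarrow>
      (LBINT x. R (x, t) * \<phi> x) = (LBINT x. R0 x * \<phi> x) +
        flux {0<..<t} (\<lambda>j z. R z * U j z) \<phi>)"
proof (rule conservation_law_slices[OF st T integrable_products(1) zero(1) integrable_products(2), where gs="\<lambda>\<phi> t. LINT x:X|lebesgue. \<rho> (x, t) * \<phi> x"])
  fix \<phi> \<theta> a b assume \<phi>: "test_S st \<phi>" and th: "smooth_fun \<theta>" "0 < a" "b < T" "\<And>t. t \<notin> {a..b} \<Longrightarrow> \<theta> t = 0"
  have s: "smooth_fun \<phi>" by (rule test_S_smooth[OF \<phi>])
  note [measurable] = product_measurable[OF s th(1)] product_measurable[OF smooth_pd[OF s] smooth_dderiv[OF th(1)]]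
  have "(LINT z:Q|lebesgue. \<rho> z * dt (\<lambda>z. \<phi> (fst z) * \<theta> (snd z)) z + \<rho> z * (u z \<bullet> grad_x (\<lambda>z. \<phi> (fst z) * \<theta> (snd z)) z)) = 0"
    using ws test_ST_product[OF \<phi> th] unfolding weak_solution_def by blast
  also have "(LINT z:Q|lebesgue. \<rho> z * dt (\<lambda>z. \<phi> (fst z) * \<theta> (snd z)) z + \<rho> z * (u z \<bullet> grad_x (\<lambda>z. \<phi> (fst z) * \<theta> (snd z)) z)) =
    (LBINT z. R z * (\<phi> (fst z) * dderiv 1 \<theta> (snd z)) + (\<Sum>j\<in>UNIV. R z * U j z * (pd j \<phi> (fst z) * \<theta> (snd z))))"
  proof (rule LINT_Q(1))
    fix z assume "eqs z"
    then show "\<rho> z * dt (\<lambda>z. \<phi> (fst z) * \<theta> (snd z)) z + \<rho> z * (u z \<bullet> grad_x (\<lambda>z. \<phi> (fst z) * \<theta> (snd z)) z) =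
       R z * (\<phi> (fst z) * dderiv 1 \<theta> (snd z)) + (\<Sum>j\<in>UNIV. R z * U j z * (pd j \<phi> (fst z) * \<theta> (snd z)))"
      by (cases z) (simp add: eqs_def dt_def grad_x_def dx_def inner_vec_def dderiv_product_x[OF s th(1)] sum_distrib_left mult.assoc)
  qed (simp_all add: zero)
  finally show "(LBINT z. R z * (\<phi> (fst z) * dderiv 1 \<theta> (snd z)) + (\<Sum>j\<in>UNIV. R z * U j z * (pd j \<phi> (fst z) * \<theta> (snd z)))) = 0" .
next
  fix \<phi> assume \<phi>: "test_S st \<phi>"
  have [measurable]: "\<phi> \<in> borel_measurable borel" by (rule smooth_borel[OF test_S_smooth[OF \<phi>]])
  show "AE t\<in>{0<..<T} in lborel. (LBINT x. R (x, t) * \<phi> x) = (LINT x:X|lebesgue. \<rho> (x, t) * \<phi> x)"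
    using AE_eqs_slice
  proof eventually_elim
    case (elim t)
    show ?case
    proof
      assume "t \<in> {0<..<T}"
      with elim have e: "AE x\<in>X in lborel. eqs (x, t)" by simp
      have "(LINT x:X|lebesgue. \<rho> (x, t) * \<phi> x) = (LBINT x. R (x, t) * \<phi> x)"
      proof (rule set_lebesgue_Borel(1))
        show "AE x\<in>X in lborel. \<rho> (x, t) * \<phi> x = R (x, t) * \<phi> x" using e by eventually_elim (simp add: eqs_def)
      qed (simp_all add: zero)
      then show "(LBINT x. R (x, t) * \<phi> x) = (LINT x:X|lebesgue. \<rho> (x, t) * \<phi> x)" by simp
    qed
  qed
  have "(LINT x:X|lebesgue. \<rho>0 x * \<phi> x) = (LBINT x. R0 x * \<phi> x)"
  proof (rule set_lebesgue_Borel(1))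
    show "AE x\<in>X in lborel. \<rho>0 x * \<phi> x = R0 x * \<phi> x" using AE_init by eventually_elim simp
  qed (simp_all add: zero)
  moreover have "((\<lambda>t. LINT x:X|lebesgue. \<rho> (x, t) * \<phi> x) \<longlongrightarrow> (LINT x:X|lebesgue. \<rho>0 x * \<phi> x)) (at_right 0)"
    using ws \<phi> unfolding weak_solution_def by blast
  ultimately show "((\<lambda>t. LINT x:X|lebesgue. \<rho> (x, t) * \<phi> x) \<longlongrightarrow> (LBINT x. R0 x * \<phi> x)) (at_right 0)" by simp
qed (simp_all add: zero loc_int_R0)

text \<open>A vector field with a single nonzero component. Testing the momentum equation with such
  fields splits it into scalar balance laws.\<close>

definition unit_field :: "'n \<Rightarrow> ('a \<Rightarrow> real) \<Rightarrow> 'a \<Rightarrow> real^'n" where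
  "unit_field i f z = (\<chi> k. if k = i then f z else 0)"

lemma unit_field_component: "(\<lambda>z. unit_field i f z $ k) = (if k = i then f else (\<lambda>z. 0))"
  by (auto simp: unit_field_def)

lemma dderiv_zero: "dderiv e (\<lambda>z. 0) x = 0"
  by (rule dderiv_eq[where D="\<lambda>h. 0"]) auto

lemma unit_field_derivatives:
  fixes f :: "(real^'n) \<times> real \<Rightarrow> real"
  shows "a \<bullet> dt_v (unit_field i f) z = a $ i * dt f z"
    and "A ::: jac_x (unit_field i f) z = (\<Sum>j\<in>UNIV. A $ i $ j * dx j f z)"
    and "div_x (unit_field i f) z = dx i f z"
proof -
  have 1: "dt (\<lambda>w. unit_field i f w $ k) z = (if k = i then dt f z else 0)" for k
    by (simp add: unit_field_component dt_def dderiv_zero)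
  have 2: "dx j (\<lambda>w. unit_field i f w $ k) z = (if k = i then dx j f z else 0)" for j k
    by (simp add: unit_field_component dx_def dderiv_zero)
  show "a \<bullet> dt_v (unit_field i f) z = a $ i * dt f z"
    by (simp add: inner_vec_def dt_v_def 1 if_distrib[of "(*) _"] cong: if_cong)
  have "A ::: jac_x (unit_field i f) z = (\<Sum>k\<in>UNIV. if k = i then (\<Sum>j\<in>UNIV. A $ k $ j * dx j f z) else 0)"
    unfolding frob_def jac_x_def 2 by (intro sum.cong) (simp_all add: 2)
  then show "A ::: jac_x (unit_field i f) z = (\<Sum>j\<in>UNIV. A $ i $ j * dx j f z)" by simp
  show "div_x (unit_field i f) z = dx i f z" by (simp add: div_x_def 2)
qed

lemma momentum_slices:
  "AE t\<in>{0<..<T} in lborel. integrable lborel (\<lambda>x. R (x, t) * U i (x, t)) \<and> (\<forall>\<phi>. test_S st \<phi> \<longrightarrow>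
      (LBINT x. (R (x, t) * U i (x, t)) * \<phi> x) = (LBINT x. M0 i x * \<phi> x) +
        flux {0<..<t} (\<lambda>j z. R z * U i z * U j z + (if i = j then Pr z else 0) - V i j z) \<phi>)"
proof (rule conservation_law_slices[OF st T integrable_products(2), where gs="\<lambda>\<phi> t. LINT x:X|lebesgue. (\<rho> (x, t) *\<^sub>R u (x, t)) \<bullet> unit_field i \<phi> x"])
  show "integrable lborel (\<lambda>z. R z * U i z * U j z + (if i = j then Pr z else 0) - V i j z)" for j
    using integrable_products by (cases "i = j") (auto intro!: integrable_add integrable_diff)
  fix \<phi> \<theta> a b assume \<phi>: "test_S st \<phi>" and th: "smooth_fun \<theta>" "0 < a" "b < T" "\<And>t. t \<notin> {a..b} \<Longrightarrow> \<theta> t = 0"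
  have s: "smooth_fun \<phi>" by (rule test_S_smooth[OF \<phi>])
  note [measurable] = product_measurable[OF s th(1)] product_measurable[OF smooth_pd[OF s] smooth_dderiv[OF th(1)]]
  let ?f = "\<lambda>z. \<phi> (fst z) * \<theta> (snd z)"
  let ?F = "\<lambda>z. (\<rho> z *\<^sub>R u z) \<bullet> dt_v (unit_field i ?f) z + (\<rho> z *\<^sub>R otimes (u z) (u z)) ::: jac_x (unit_field i ?f) z
            + P z * div_x (unit_field i ?f) z - (\<nu> (\<rho> z) *\<^sub>R symgrad (G z)) ::: jac_x (unit_field i ?f) z"
  let ?g = "\<lambda>z. R z * U i z * (\<phi> (fst z) * dderiv 1 \<theta> (snd z)) +
      (\<Sum>j\<in>UNIV. (R z * U i z * U j z + (if i = j then Pr z else 0) - V i j z) * (pd j \<phi> (fst z) * \<theta> (snd z)))"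
  have "test_ST st T (\<lambda>z. 0 * \<theta> (snd z))" by (rule test_ST_product[OF test_S_zero th])
  then have "testv_ST st T (unit_field i ?f)"
    unfolding testv_ST_def unit_field_component using test_ST_product[OF \<phi> th] by simp
  then have "(LINT z:Q|lebesgue. ?F z) = 0" using ws unfolding weak_solution_def by blast
  also have "(LINT z:Q|lebesgue. ?F z) = (LBINT z. ?g z)"
  proof (rule LINT_Q(1))
    fix z assume e: "eqs z"
    obtain x t where z: "z = (x, t)" by (cases z)
    have d: "dt ?f z = \<phi> x * dderiv 1 \<theta> t" "dx j ?f z = pd j \<phi> x * \<theta> t" for j
      by (simp_all add: z dt_def dx_def dderiv_product_x[OF s th(1)])
    have e': "\<rho> z = R z" "u z $ k = U k z" "P z = Pr z" "\<nu> (\<rho> z) * symgrad (G z) $ i $ j = V i j z" for j k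
      using e by (auto simp only: eqs_def)
    have c: "(\<rho> z *\<^sub>R u z) $ i = R z * U i z" "(\<rho> z *\<^sub>R otimes (u z) (u z)) $ i $ j = R z * U i z * U j z"
      "P z = Pr z" "(\<nu> (\<rho> z) *\<^sub>R symgrad (G z)) $ i $ j = V i j z" for j
      by (simp_all only: vector_scaleR_component real_scaleR_def otimes_def vec_lambda_beta e'(4)) (simp_all add: e'(1-3))
    have "?F z = R z * U i z * (\<phi> x * dderiv 1 \<theta> t) + (\<Sum>j\<in>UNIV. R z * U i z * U j z * (pd j \<phi> x * \<theta> t))
       + Pr z * (pd i \<phi> x * \<theta> t) - (\<Sum>j\<in>UNIV. V i j z * (pd j \<phi> x * \<theta> t))"
      unfolding unit_field_derivatives d c ..
    also have "Pr z * (pd i \<phi> x * \<theta> t) = (\<Sum>j\<in>UNIV. (if i = j then Pr z else 0) * (pd j \<phi> x * \<theta> t))"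
      by (simp add: if_distrib[of "\<lambda>a. a * _"] cong: if_cong)
    finally show "?F z = ?g z" by (simp add: z sum.distrib sum_subtractf distrib_right left_diff_distrib)
  qed (simp_all add: zero cong: if_cong)
  finally show "(LBINT z. ?g z) = 0" .
next
  fix \<phi> assume \<phi>: "test_S st \<phi>"
  have [measurable]: "\<phi> \<in> borel_measurable borel" by (rule smooth_borel[OF test_S_smooth[OF \<phi>]])
  have inner: "a \<bullet> unit_field i \<phi> x = a $ i * \<phi> x" for a x
    by (simp add: unit_field_def inner_vec_def if_distrib[of "(*) _"] cong: if_cong)
  show "AE t\<in>{0<..<T} in lborel. (LBINT x. R (x, t) * U i (x, t) * \<phi> x) = (LINT x:X|lebesgue. (\<rho> (x, t) *\<^sub>R u (x, t)) \<bullet> unit_field i \<phi> x)"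
    using AE_eqs_slice
  proof eventually_elim
    case (elim t)
    show ?case
    proof
      assume "t \<in> {0<..<T}"
      with elim have e: "AE x\<in>X in lborel. eqs (x, t)" by simp
      have "(LINT x:X|lebesgue. (\<rho> (x, t) *\<^sub>R u (x, t)) \<bullet> unit_field i \<phi> x) = (LBINT x. R (x, t) * U i (x, t) * \<phi> x)"
      proof (rule set_lebesgue_Borel(1))
        show "AE x\<in>X in lborel. (\<rho> (x, t) *\<^sub>R u (x, t)) \<bullet> unit_field i \<phi> x = R (x, t) * U i (x, t) * \<phi> x"
          unfolding inner using e by eventually_elim (simp add: eqs_def)
      qed (simp_all add: zero)
      then show "(LBINT x. R (x, t) * U i (x, t) * \<phi> x) = (LINT x:X|lebesgue. (\<rho> (x, t) *\<^sub>R u (x, t)) \<bullet> unit_field i \<phi> x)" by simp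
    qed
  qed
  have "(LINT x:X|lebesgue. (\<rho>0 x *\<^sub>R u0 x) \<bullet> unit_field i \<phi> x) = (LBINT x. M0 i x * \<phi> x)"
  proof (rule set_lebesgue_Borel(1))
    show "AE x\<in>X in lborel. (\<rho>0 x *\<^sub>R u0 x) \<bullet> unit_field i \<phi> x = M0 i x * \<phi> x"
      unfolding inner using AE_init by eventually_elim (simp add: M0_def)
  qed (simp_all add: zero)
  moreover have "testv_S st (unit_field i \<phi>)"
    unfolding testv_S_def unit_field_component using \<phi> by (simp add: test_S_zero)
  then have "((\<lambda>t. LINT x:X|lebesgue. (\<rho> (x, t) *\<^sub>R u (x, t)) \<bullet> unit_field i \<phi> x) \<longlongrightarrow> (LINT x:X|lebesgue. (\<rho>0 x *\<^sub>R u0 x) \<bullet> unit_field i \<phi> x)) (at_right 0)"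
    using ws unfolding weak_solution_def by blast
  ultimately show "((\<lambda>t. LINT x:X|lebesgue. (\<rho> (x, t) *\<^sub>R u (x, t)) \<bullet> unit_field i \<phi> x) \<longlongrightarrow> (LBINT x. M0 i x * \<phi> x)) (at_right 0)" by simp
qed (simp_all add: zero loc_int_M0)

lemma AE_divergence_free: "AE t\<in>{0<..<T} in lborel. (AE x in lborel. (\<Sum>i\<in>UNIV. DU i i (x, t)) = 0)"
proof -
  have "AE z\<in>Q in lborel. (\<Sum>i\<in>UNIV. G z $ i $ i) = 0"
    using ws unfolding weak_solution_def AE_completion_iff by blast
  with AE_eqs have "AE z in lborel. (\<Sum>i\<in>UNIV. DU i i z) = 0"
  proof eventually_elim
    case (elim z)
    then show ?case by (cases "z \<in> Q") (simp_all add: eqs_def zero)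
  qed
  from lborel_AE_pair[OF this] show ?thesis by eventually_elim simp
qed

lemma bounded_approx:
  fixes K :: "(real^'n) set"
  assumes "compact K" "K \<subseteq> X" "f \<in> borel_measurable borel" "\<And>x. \<bar>f x\<bar> \<le> B" "\<And>x. x \<notin> K \<Longrightarrow> f x = 0"
  shows "bounded_test_approx st f"
proof (cases st)
  case Torus
  have "f x = 0" if "x \<notin> cbox 0 One" for x using assms(2,5) that Torus by auto
  then show ?thesis unfolding Torus by (rule torus_bounded_approx[OF assms(3,4)])
next
  case (Domain \<Omega>)
  then have "open \<Omega>" "bounded \<Omega>" using st by (auto simp: valid_setting_def)
  then show ?thesis unfolding Domain using assms Domain by (intro domain_bounded_approx[where K=K and B=B]) auto
qed

text \<open>The stress is symmetric in its indices, so its contraction with the gradient equals its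
  contraction with the symmetric part.\<close>

lemma dissipation_identity: "(\<Sum>i\<in>UNIV. \<Sum>j\<in>UNIV. V i j z * DU i j z) = nu z * (\<Sum>i\<in>UNIV. \<Sum>j\<in>UNIV. ((DU i j z + DU j i z) / 2)^2)"
proof -
  define S where "S = (\<lambda>i j. (DU i j z + DU j i z) / 2)"
  have S: "S i j = S j i" for i j by (simp add: S_def add.commute)
  have "(\<Sum>i\<in>UNIV. \<Sum>j\<in>UNIV. S i j * DU j i z) = (\<Sum>i\<in>UNIV. \<Sum>j\<in>UNIV. S i j * DU i j z)"
    by (subst sum.swap) (simp add: S[of _ "_"])
  moreover have "(\<Sum>i\<in>UNIV. \<Sum>j\<in>UNIV. (S i j)^2) = ((\<Sum>i\<in>UNIV. \<Sum>j\<in>UNIV. S i j * DU i j z) + (\<Sum>i\<in>UNIV. \<Sum>j\<in>UNIV. S i j * DU j i z)) / 2"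
    unfolding sum.distrib[symmetric] sum_divide_distrib by (intro sum.cong refl) (simp add: S_def power2_eq_square field_simps)
  ultimately have "(\<Sum>i\<in>UNIV. \<Sum>j\<in>UNIV. S i j * DU i j z) = (\<Sum>i\<in>UNIV. \<Sum>j\<in>UNIV. (S i j)^2)" by simp
  moreover have "V i j z = nu z * S i j" for i j by (simp add: V_def S_def)
  moreover have "(DU i j z + DU j i z) / 2 = S i j" for i j by (simp add: S_def)
  ultimately show ?thesis by (simp add: mult.assoc sum_distrib_left[symmetric])
qed

theorem energy_equality:
  "AE t\<in>{0<..<T} in lborel.
     (1/2) * (LINT x:X|lebesgue. \<rho> (x, t) * (norm (u (x, t)))^2)
     + (LINT z:X \<times> {0<..<t}|lebesgue. \<nu> (\<rho> z) * (symgrad (G z) ::: symgrad (G z)))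
     = (1/2) * (LINT x:X|lebesgue. \<rho>0 x * (norm (u0 x))^2)"
proof -
  obtain K where K: "\<And>k. compact (K k)" "\<And>k. K k \<subseteq> X" "\<And>k. K k \<subseteq> K (Suc k)" "(\<Union>k. K k) = X"
    using region_exhaustion[OF st] by metis
  interpret E: energy_data_init st T c1 c2 R U DU V Pr R0 M0 "\<lambda>i. u0b i" K
  proof unfold_locales
    show "AE t\<in>{0<..<T} in lborel. (\<forall>\<phi>. test_S st \<phi> \<longrightarrow>
      (LBINT x. R (x, t) * \<phi> x) = (LBINT x. R0 x * \<phi> x) +
        flux {0<..<t} (\<lambda>j z. R z * U j z) \<phi>)"
      using mass_slices by eventually_elim blast
    show "AE t\<in>{0<..<T} in lborel. (\<forall>\<phi>. test_S st \<phi> \<longrightarrow>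
      (LBINT x. (R (x, t) * U i (x, t)) * \<phi> x) = (LBINT x. M0 i x * \<phi> x) +
        flux {0<..<t} (\<lambda>j z. R z * U i z * U j z + (if i = j then Pr z else 0) - V i j z) \<phi>)" for i
      using momentum_slices[of i] by eventually_elim blast
    show "bounded_test_approx st f" if "f \<in> borel_measurable borel" "\<And>x. \<bar>f x\<bar> \<le> B" "\<And>x. x \<notin> K k \<Longrightarrow> f x = 0" for f B k
      by (rule bounded_approx[OF K(1,2) that])
    show "K k \<in> sets borel" for k using K(1) by (simp add: borel_compact)
    show "K k \<subseteq> K (Suc k)" for k by (rule K(3))
  qed (use st T c zero R_bounds U_Lp2 U_Lp4 DU_Lp2 V_Lp2 Pr_Lp2 AE_divergence_free AE_H1_approx loc_int_R0 loc_int_M0 K(4) in \<open>simp_all add: M0_def\<close>)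
  have init: "(LINT x:X|lebesgue. \<rho>0 x * (norm (u0 x))^2) = (LBINT x. E.w0 x)"
  proof (rule set_lebesgue_Borel(1))
    show "AE x\<in>X in lborel. \<rho>0 x * (norm (u0 x))^2 = E.w0 x"
      using AE_init by eventually_elim (simp add: E.w0_def power2_norm_vec sum_distrib_left)
  qed (simp_all add: E.w0_def zero)
  define D where "D = (\<lambda>z. \<Sum>i\<in>UNIV. \<Sum>j\<in>UNIV. V i j z * DU i j z)"
  have Di: "integrable lborel D"
    unfolding D_def by (intro integrable_sum Lp2_mult V_Lp2 DU_Lp2)
  show ?thesis using E.energy_equality AE_eqs_slice
  proof eventually_elim
    case (elim t)
    show ?case
    proof
      assume t: "t \<in> {0<..<T}"
      with elim have e: "AE x\<in>X in lborel. eqs (x, t)" by simp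
      have kin: "(LINT x:X|lebesgue. \<rho> (x, t) * (norm (u (x, t)))^2) = (LBINT x. (\<Sum>i\<in>UNIV. E.M i (x, t) * U i (x, t)))"
      proof (rule set_lebesgue_Borel(1))
        show "AE x\<in>X in lborel. \<rho> (x, t) * (norm (u (x, t)))^2 = (\<Sum>i\<in>UNIV. E.M i (x, t) * U i (x, t))"
          unfolding power2_norm_vec using e by eventually_elim (simp add: eqs_def E.M_def sum_distrib_left power2_eq_square mult.assoc)
      qed (simp_all add: E.M_def zero)
      have It: "integrable lborel (\<lambda>z. D z * indicator {0<..<t} (snd z))"
        by (rule integrable_bounded_mult[OF Di, where B=1]) (use Di in \<open>auto simp: indicator_def\<close>)
      have "(LBINT s. indicator {0<..<t} s * E.Diss s) = (LBINT s. LBINT x. D (x, s) * indicator {0<..<t} (snd (x, s)))"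
        by (simp add: E.Diss_def D_def mult.commute)
      also have "\<dots> = (LBINT z. D z * indicator {0<..<t} (snd z))" by (rule lborel_integral_snd[OF It, symmetric])
      also have "\<dots> = (LINT z:X \<times> {0<..<t}|lebesgue. \<nu> (\<rho> z) * (symgrad (G z) ::: symgrad (G z)))"
      proof (rule set_lebesgue_Borel(1)[symmetric])
        show "(\<lambda>z. D z * indicator {0<..<t} (snd z)) \<in> borel_measurable borel" using It by simp
        show "AE z in lborel. z \<in> X \<times> {0<..<t} \<longrightarrow> \<nu> (\<rho> z) * (symgrad (G z) ::: symgrad (G z)) = D z * indicator {0<..<t} (snd z)"
          using AE_eqs
        proof eventually_elim
          case (elim z)
          show ?case
          proof
            assume z: "z \<in> X \<times> {0<..<t}"
            then have "eqs z" using elim t by auto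
            then show "\<nu> (\<rho> z) * (symgrad (G z) ::: symgrad (G z)) = D z * indicator {0<..<t} (snd z)"
              using z by (auto simp: D_def dissipation_identity eqs_def frob_def symgrad_def transpose_def power2_eq_square)
          qed
        qed
        show "D z * indicator {0<..<t} (snd z) = 0" if "z \<notin> X \<times> {0<..<t}" for z
        proof (cases "snd z \<in> {0<..<t}")
          case True
          then have "z \<notin> Q" using that by (cases z) auto
          then show ?thesis by (simp add: D_def zero)
        qed simp
      qed
      finally have diss: "(LBINT s. indicator {0<..<t} s * E.Diss s) = (LINT z:X \<times> {0<..<t}|lebesgue. \<nu> (\<rho> z) * (symgrad (G z) ::: symgrad (G z)))" .
      show "(1/2) * (LINT x:X|lebesgue. \<rho> (x, t) * (norm (u (x, t)))^2)
         + (LINT z:X \<times> {0<..<t}|lebesgue. \<nu> (\<rho> z) * (symgrad (G z) ::: symgrad (G z)))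
         = (1/2) * (LINT x:X|lebesgue. \<rho>0 x * (norm (u0 x))^2)"
        using elim(1) t by (simp add: E.En_def kin diss init)
    qed
  qed
qed

end

lemma real_Borel_version:
  assumes "(f :: 'a::euclidean_space \<Rightarrow> real) \<in> borel_measurable lebesgue"
  shows "\<exists>g. g \<in> borel_measurable borel \<and> (AE x in lborel. f x = g x)"
  using completion_ex_borel_measurable_real[OF assms] by auto

theorem theorem3:
  fixes st :: "('n::finite) setting" and T c1 c2 :: real and \<nu> :: "real \<Rightarrow> real"
    and \<rho> :: "(real^'n) \<times> real \<Rightarrow> real" and u :: "(real^'n) \<times> real \<Rightarrow> real^'n"
    and G :: "(real^'n) \<times> real \<Rightarrow> real^'n^'n" and P :: "(real^'n) \<times> real \<Rightarrow> real"
    and \<rho>0 :: "real^'n \<Rightarrow> real" and u0 :: "real^'n \<Rightarrow> real^'n"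
  assumes dim: "CARD('n) = 2 \<or> CARD('n) = 3"
    and T: "T > 0"
    and nu_cont: "continuous_on {0<..} \<nu>" and nu_nonneg: "\<forall>s>0. \<nu> s \<ge> 0"
    and setting: "st = Torus \<or> (\<exists>\<Omega>. st = Domain \<Omega> \<and> bounded_C2_domain \<Omega>)"
    and ws: "weak_solution st T \<nu> \<rho> u G P \<rho>0 u0"
    and dirichlet: "\<forall>\<Omega>. st = Domain \<Omega> \<longrightarrow>
        (AE t in lborel. t \<in> {0<..<T} \<longrightarrow> H10 \<Omega> (\<lambda>x. u (x, t)) (\<lambda>x. G (x, t)))"
    and c: "0 < c1" "c1 \<le> c2"
    and rho_bd: "AE z in lebesgue. z \<in> region st \<times> {0<..<T} \<longrightarrow> c1 \<le> \<rho> z \<and> \<rho> z \<le> c2"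
    and u_LinfL2: "\<exists>C. AE t in lborel. t \<in> {0<..<T} \<longrightarrow>
        set_integrable lebesgue (region st) (\<lambda>x. (norm (u (x, t)))\<^sup>2) \<and>
        (LINT x:region st|lebesgue. (norm (u (x, t)))\<^sup>2) \<le> C"
    and u_L2H1: "set_integrable lebesgue (region st \<times> {0<..<T}) (\<lambda>z. (norm (u z))\<^sup>2)"
      "set_integrable lebesgue (region st \<times> {0<..<T}) (\<lambda>z. (norm (G z))\<^sup>2)"
    and P_L2: "set_integrable lebesgue (region st \<times> {0<..<T}) (\<lambda>z. (P z)\<^sup>2)"
    and u_L4: "CARD('n) = 3 \<longrightarrow>
        set_integrable lebesgue (region st \<times> {0<..<T}) (\<lambda>z. (norm (u z)) ^ 4)"
  shows "AE t in lborel. t \<in> {0<..<T} \<longrightarrow>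
     (1/2) * (LINT x:region st|lebesgue. \<rho> (x, t) * (norm (u (x, t)))\<^sup>2)
     + (LINT z:region st \<times> {0<..<t}|lebesgue. \<nu> (\<rho> z) * (symgrad (G z) ::: symgrad (G z)))
     = (1/2) * (LINT x:region st|lebesgue. \<rho>0 x * (norm (u0 x))\<^sup>2)"
proof -
  have m: "\<rho> \<in> borel_measurable lebesgue" "u \<in> borel_measurable lebesgue" "G \<in> borel_measurable lebesgue" "P \<in> borel_measurable lebesgue"
    "\<rho>0 \<in> borel_measurable lebesgue" "u0 \<in> borel_measurable lebesgue"
    using ws unfolding weak_solution_def weak_grad_x_def by blast+
  have nth: "(\<lambda>v::'b::real_normed_vector^'n. v $ i) \<in> borel_measurable borel" for i
    by (intro borel_measurable_continuous_onI continuous_intros)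
  have mc: "(\<lambda>z. u z $ i) \<in> borel_measurable lebesgue" "(\<lambda>z. G z $ i $ j) \<in> borel_measurable lebesgue" "(\<lambda>x. u0 x $ i) \<in> borel_measurable lebesgue" for i j
    using measurable_compose[OF m(2) nth] measurable_compose[OF measurable_compose[OF m(3) nth] nth] measurable_compose[OF m(6) nth] by auto
  obtain \<rho>b where \<rho>b: "\<rho>b \<in> borel_measurable borel" "AE z in lborel. \<rho> z = \<rho>b z" using real_Borel_version[OF m(1)] by blast
  obtain Pb where Pb: "Pb \<in> borel_measurable borel" "AE z in lborel. P z = Pb z" using real_Borel_version[OF m(4)] by blast
  obtain \<rho>0b where \<rho>0b: "\<rho>0b \<in> borel_measurable borel" "AE x in lborel. \<rho>0 x = \<rho>0b x" using real_Borel_version[OF m(5)] by blast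
  \<comment> \<open>The locale takes whole families of Borel representatives as parameters, so one
    is chosen for each component.\<close>
  define ub where "ub = (\<lambda>i. SOME g. g \<in> borel_measurable borel \<and> (AE z in lborel. u z $ i = g z))"
  define Gb where "Gb = (\<lambda>i j. SOME g. g \<in> borel_measurable borel \<and> (AE z in lborel. G z $ i $ j = g z))"
  define u0b where "u0b = (\<lambda>i. SOME g. g \<in> borel_measurable borel \<and> (AE x in lborel. u0 x $ i = g x))"
  have ub: "ub i \<in> borel_measurable borel" "AE z in lborel. u z $ i = ub i z" for i
    using someI_ex[OF real_Borel_version[OF mc(1)], of i] by (simp_all add: ub_def)
  have Gb: "Gb i j \<in> borel_measurable borel" "AE z in lborel. G z $ i $ j = Gb i j z" for i j
    using someI_ex[OF real_Borel_version[OF mc(2)], of i j] by (simp_all add: Gb_def)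
  have u0b: "u0b i \<in> borel_measurable borel" "AE x in lborel. u0 x $ i = u0b i x" for i
    using someI_ex[OF real_Borel_version[OF mc(3)], of i] by (simp_all add: u0b_def)
  have "valid_setting st" using setting by (auto simp: valid_setting_def bounded_C2_domain_def)
  then interpret weak_solution_data st T c1 c2 \<nu> \<rho> u G P \<rho>0 u0 \<rho>b ub Gb Pb \<rho>0b u0b
    by (rule weak_solution_data.intro[OF dim T nu_cont _ ws dirichlet[rule_format] c rho_bd u_LinfL2 u_L2H1 P_L2 u_L4[rule_format]
      \<rho>b(1) ub(1) Gb(1) Pb(1) \<rho>0b(1) u0b(1) \<rho>b(2) ub(2) Gb(2) Pb(2) \<rho>0b(2) u0b(2)])
  show ?thesis by (rule energy_equality)
qed

end
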